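(* For every integer $k \geq 3$ there exist a smooth complex projective curve $C$ of gonality $k$ and genus $g = k(k-1)/2$, and a very ample divisor $L$ on $C$ of degree $2g + k - 1$, such that $$K_{h^0(C,L) - k,\, 1}(C,L) \neq 0.$$ In particular, the bound $\deg L \geq 2g + k - 1$ is not sufficient for the vanishing criterion of the gonality conjecture to apply: for every integer $k \geq 3$, it is not true that for all smooth complex projective curves $C$ of genus $g \geq 1$ and gonality $k$, and all globally generated divisors $L$ on $C$ with $\deg L \geq 2g + k - 1$, one has for all integers $i$ $$K_{i,1}(C,L) \neq 0 \quad \Longleftrightarrow \quad 1 \leq i \leq h^0(C,L) - k - 1.$$
   Context: Curves are smooth, projective and irreducible over $\mathbf{C}$. The gonality of a curve $C$ is the minimal degree of a non-constant morphism $C \to \mathbf{P}^1$. For a divisor $L$ on $C$, write $h^0(C,L) = \dim_{\mathbf{C}} H^0(C,L)$, where $H^0(C,L) = H^0(C,\mathcal{O}_C(L))$. Koszul cohomology: let $V = H^0(C,L)$. For integers $p,q$, the space $K_{p,q}(C,L)$ is the cohomology at the middle term of the Koszul complex $$\textstyle\bigwedge^{p+1} V \otimes H^0(C,(q-1)L) \longrightarrow \bigwedge^{p} V \otimes H^0(C,qL) \longrightarrow \bigwedge^{p-1} V \otimes H^0(C,(q+1)L),$$ with differentials $$v_1\wedge\cdots\wedge v_m\otimes s \;\mapsto\; \sum_{j=1}^m (-1)^{j}\, v_1\wedge\cdots\wedge\widehat{v_j}\wedge\cdots\wedge v_m\otimes (v_j s),$$ where exterior powers of negative degree are zero. *)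

theory Defs
  imports
    Complex_Main
    "HOL-Algebra.Embedded_Algebras"
    "HOL-Library.Function_Algebras"
    "HOL-Library.Poly_Mapping"
begin

section \<open>Projective varieties over the complex numbers\<close>

text \<open>
  A point of a projective space is the set of all its homogeneous coordinate vectors. Coordinate
  vectors of points of \<open>P\<^sup>n\<close> are extended by zero to functions on all of \<open>nat\<close>, so that
  \<open>P\<^sup>0 \<subseteq> P\<^sup>1 \<subseteq> P\<^sup>2 \<subseteq> \<dots>\<close>, each closed in the next. Polynomials may accordingly use any of the
  variables \<open>x\<^sub>0, x\<^sub>1, \<dots>\<close>: the variables \<open>x\<^sub>i\<close> with \<open>i > n\<close> vanish on \<open>P\<^sup>n\<close>.
\<close>

type_synonym point = "(nat \<Rightarrow> complex) set"

type_synonym mpoly = "(nat \<Rightarrow>\<^sub>0 nat) \<Rightarrow>\<^sub>0 complex"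

definition proj_point :: "(nat \<Rightarrow> complex) \<Rightarrow> point" where
  "proj_point v = {\<lambda>i. c * v i | c. c \<noteq> 0}"

definition proj_space :: "nat \<Rightarrow> point set" where
  "proj_space n = {proj_point v | v. (\<exists>i. v i \<noteq> 0) \<and> (\<forall>i>n. v i = 0)}"

definition rep :: "'a set \<Rightarrow> 'a" where
  "rep A = (SOME a. a \<in> A)"

definition peval :: "mpoly \<Rightarrow> (nat \<Rightarrow> complex) \<Rightarrow> complex" where
  "peval F v = (\<Sum>m\<in>Poly_Mapping.keys F. Poly_Mapping.lookup F m * (\<Prod>i\<in>Poly_Mapping.keys m. v i ^ Poly_Mapping.lookup m i))"

definition homogeneous :: "nat \<Rightarrow> mpoly \<Rightarrow> bool" where
  "homogeneous d F \<longleftrightarrow> (\<forall>m\<in>Poly_Mapping.keys F. (\<Sum>i\<in>Poly_Mapping.keys m. Poly_Mapping.lookup m i) = d)"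

definition partial_deriv :: "nat \<Rightarrow> mpoly \<Rightarrow> mpoly" where
  "partial_deriv i F =
     (\<Sum>m\<in>Poly_Mapping.keys F. Poly_Mapping.single (m - Poly_Mapping.single i 1) (of_nat (Poly_Mapping.lookup m i) * Poly_Mapping.lookup F m))"

definition vanishes :: "mpoly \<Rightarrow> point \<Rightarrow> bool" where
  "vanishes F p \<longleftrightarrow> peval F (rep p) = 0"

definition zariski_closed :: "point set \<Rightarrow> bool" where
  "zariski_closed Z \<longleftrightarrow>
     (\<exists>n S. (\<forall>F\<in>S. \<exists>d. homogeneous d F) \<and> Z = {p \<in> proj_space n. \<forall>F\<in>S. vanishes F p})"

definition irreducible_closed :: "point set \<Rightarrow> bool" where
  "irreducible_closed Z \<longleftrightarrow> zariski_closed Z \<and> Z \<noteq> {} \<and>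
     (\<forall>A B. zariski_closed A \<longrightarrow> zariski_closed B \<longrightarrow> Z \<subseteq> A \<union> B \<longrightarrow> Z \<subseteq> A \<or> Z \<subseteq> B)"

definition variety_dim :: "point set \<Rightarrow> nat" where
  "variety_dim X = (GREATEST m. \<exists>Z :: nat \<Rightarrow> point set.
     (\<forall>i\<le>m. irreducible_closed (Z i) \<and> Z i \<subseteq> X) \<and> (\<forall>i<m. Z i \<subset> Z (Suc i)))"

definition jacobian_rank :: "nat \<Rightarrow> point set \<Rightarrow> point \<Rightarrow> nat" where
  "jacobian_rank n X p = vector_space.dim (\<lambda>(c :: complex) (w :: nat \<Rightarrow> complex) i. c * w i)
     {\<lambda>i. if i \<le> n then peval (partial_deriv i F) (rep p) else 0 | F.
        (\<exists>d. homogeneous d F) \<and> (\<forall>x\<in>X. vanishes F x)}"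

definition smooth_projective_curve :: "point set \<Rightarrow> bool" where
  "smooth_projective_curve X \<longleftrightarrow> irreducible_closed X \<and> variety_dim X = 1 \<and>
     (\<exists>n. X \<subseteq> proj_space n \<and> (\<forall>p\<in>X. jacobian_rank n X p + variety_dim X = n))"


section \<open>Morphisms\<close>

definition morphism :: "point set \<Rightarrow> point set \<Rightarrow> (point \<Rightarrow> point) \<Rightarrow> bool" where
  "morphism X Y \<phi> \<longleftrightarrow> \<phi> ` X \<subseteq> Y \<and>
     (\<forall>x\<in>X. \<exists>d (F :: nat \<Rightarrow> mpoly). (\<forall>i. homogeneous d (F i)) \<and> (\<exists>i. \<not> vanishes (F i) x) \<and>
        (\<forall>y\<in>X. (\<exists>i. \<not> vanishes (F i) y) \<longrightarrow> \<phi> y = proj_point (\<lambda>i. peval (F i) (rep y))))"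

definition closed_embedding :: "point set \<Rightarrow> nat \<Rightarrow> (point \<Rightarrow> point) \<Rightarrow> bool" where
  "closed_embedding X N \<phi> \<longleftrightarrow> \<phi> ` X \<subseteq> proj_space N \<and> zariski_closed (\<phi> ` X) \<and>
     morphism X (\<phi> ` X) \<phi> \<and> (\<exists>\<psi>. morphism (\<phi> ` X) X \<psi> \<and> (\<forall>x\<in>X. \<psi> (\<phi> x) = x))"


section \<open>The function field\<close>

text \<open>
  A rational function on \<open>X\<close> is an equivalence class of complex-valued functions, two functions
  being equivalent if they agree on a nonempty Zariski open subset of \<open>X\<close>.
\<close>

type_synonym ratfun = "(point \<Rightarrow> complex) set"

definition germ :: "point set \<Rightarrow> (point \<Rightarrow> complex) \<Rightarrow> ratfun" where
  "germ X f = {g. \<exists>Z. zariski_closed Z \<and> \<not> X \<subseteq> Z \<and> (\<forall>x\<in>X - Z. g x = f x)}"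

definition quotient_germ :: "point set \<Rightarrow> mpoly \<Rightarrow> mpoly \<Rightarrow> ratfun" where
  "quotient_germ X F G = germ X (\<lambda>x. peval F (rep x) / peval G (rep x))"

definition function_field :: "point set \<Rightarrow> ratfun ring" where
  "function_field X =
     \<lparr> carrier = {quotient_germ X F G | F G d. homogeneous d F \<and> homogeneous d G \<and>
                                                (\<exists>x\<in>X. \<not> vanishes G x)},
       monoid.mult = (\<lambda>A B. germ X (\<lambda>x. rep A x * rep B x)),
       one = germ X (\<lambda>_. 1),
       zero = germ X (\<lambda>_. 0),
       add = (\<lambda>A B. germ X (\<lambda>x. rep A x + rep B x)) \<rparr>"

definition const_fun :: "point set \<Rightarrow> complex \<Rightarrow> ratfun" where
  "const_fun X c = germ X (\<lambda>_. c)"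

definition morphism_degree :: "point set \<Rightarrow> point set \<Rightarrow> (point \<Rightarrow> point) \<Rightarrow> nat" where
  "morphism_degree X Y \<phi> =
     ring.dim (function_field X)
       {germ X (rep A \<circ> \<phi>) | A. A \<in> carrier (function_field Y)}
       (carrier (function_field X))"

definition gonality :: "point set \<Rightarrow> nat" where
  "gonality X = (LEAST d. \<exists>\<phi>. morphism X (proj_space 1) \<phi> \<and> \<not> (\<exists>c. \<forall>x\<in>X. \<phi> x = c) \<and>
     d = morphism_degree X (proj_space 1) \<phi>)"


section \<open>Local rings and orders of vanishing\<close>

definition local_ring :: "point set \<Rightarrow> point \<Rightarrow> ratfun set" where
  "local_ring X p =
     {quotient_germ X F G | F G d. homogeneous d F \<and> homogeneous d G \<and> \<not> vanishes G p}"

definition max_ideal :: "point set \<Rightarrow> point \<Rightarrow> ratfun set" where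
  "max_ideal X p =
     {quotient_germ X F G | F G d. homogeneous d F \<and> homogeneous d G \<and>
                                   vanishes F p \<and> \<not> vanishes G p}"

definition value_at :: "point set \<Rightarrow> point \<Rightarrow> ratfun \<Rightarrow> complex" where
  "value_at X p f = (THE c. f \<ominus>\<^bsub>function_field X\<^esub> const_fun X c \<in> max_ideal X p)"

definition uniformizer :: "point set \<Rightarrow> point \<Rightarrow> ratfun \<Rightarrow> bool" where
  "uniformizer X p t \<longleftrightarrow> t \<in> max_ideal X p \<and>
     max_ideal X p = {t \<otimes>\<^bsub>function_field X\<^esub> u | u. u \<in> local_ring X p}"

definition order_at :: "point set \<Rightarrow> point \<Rightarrow> ratfun \<Rightarrow> int" where
  "order_at X p f = (THE k. \<exists>t u. uniformizer X p t \<and> u \<in> local_ring X p - max_ideal X p \<and>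
     f = t [^]\<^bsub>function_field X\<^esub> k \<otimes>\<^bsub>function_field X\<^esub> u)"


section \<open>Divisors and their global sections\<close>

definition divisor :: "point set \<Rightarrow> (point \<Rightarrow> int) \<Rightarrow> bool" where
  "divisor X D \<longleftrightarrow> finite {p. D p \<noteq> 0} \<and> {p. D p \<noteq> 0} \<subseteq> X"

definition divisor_degree :: "(point \<Rightarrow> int) \<Rightarrow> int" where
  "divisor_degree D = (\<Sum>p | D p \<noteq> 0. D p)"

definition sections :: "point set \<Rightarrow> (point \<Rightarrow> int) \<Rightarrow> ratfun set" where
  "sections X D = {f \<in> carrier (function_field X).
     f = \<zero>\<^bsub>function_field X\<^esub> \<or> (\<forall>p\<in>X. order_at X p f + D p \<ge> 0)}"

definition h0 :: "point set \<Rightarrow> (point \<Rightarrow> int) \<Rightarrow> nat" where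
  "h0 X D = ring.dim (function_field X) (range (const_fun X)) (sections X D)"

text \<open>The stalk of \<open>\<O>(L)\<close> at \<open>p\<close> is generated by any rational function of order \<open>- L p\<close>.\<close>

definition globally_generated :: "point set \<Rightarrow> (point \<Rightarrow> int) \<Rightarrow> bool" where
  "globally_generated X L \<longleftrightarrow>
     (\<forall>p\<in>X. \<exists>s\<in>sections X L. s \<noteq> \<zero>\<^bsub>function_field X\<^esub> \<and> order_at X p s = - L p)"

text \<open>
  \<open>L\<close> is very ample if \<open>\<O>(L)\<close> is the pullback of \<open>\<O>(1)\<close> under a closed embedding \<open>\<phi>\<close> into some
  \<open>P\<^sup>N\<close>. The isomorphism of line bundles is expressed by the pullbacks \<open>s\<^sub>i\<close> of the coordinates:
  they are sections of \<open>\<O>(L)\<close> with \<open>\<phi> = [s\<^sub>0 : \<dots> : s\<^sub>N]\<close>, where the \<open>s\<^sub>i\<close> are evaluated at \<open>p\<close>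
  in the trivialization of \<open>\<O>(L)\<close> near \<open>p\<close> given by multiplication with \<open>t\<^bsup>L p\<^esup>\<close>. As \<open>\<phi> p\<close> is a
  point of \<open>P\<^sup>N\<close>, not all of these values vanish.
\<close>

definition very_ample :: "point set \<Rightarrow> (point \<Rightarrow> int) \<Rightarrow> bool" where
  "very_ample X L \<longleftrightarrow>
     (\<exists>N \<phi> s. closed_embedding X N \<phi> \<and> (\<forall>i\<le>N. s i \<in> sections X L) \<and>
        (\<forall>p\<in>X. \<exists>t. uniformizer X p t \<and>
           \<phi> p = proj_point (\<lambda>i. if i \<le> N
             then value_at X p (s i \<otimes>\<^bsub>function_field X\<^esub> t [^]\<^bsub>function_field X\<^esub> L p) else 0)))"


section \<open>Differentials and the genus\<close>

definition derivation :: "point set \<Rightarrow> (ratfun \<Rightarrow> ratfun) \<Rightarrow> bool" where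
  "derivation X \<delta> \<longleftrightarrow>
     (\<forall>f\<in>carrier (function_field X). \<delta> f \<in> carrier (function_field X)) \<and>
     (\<forall>f\<in>carrier (function_field X). \<forall>g\<in>carrier (function_field X).
        \<delta> (f \<oplus>\<^bsub>function_field X\<^esub> g) = \<delta> f \<oplus>\<^bsub>function_field X\<^esub> \<delta> g \<and>
        \<delta> (f \<otimes>\<^bsub>function_field X\<^esub> g) =
          (f \<otimes>\<^bsub>function_field X\<^esub> \<delta> g) \<oplus>\<^bsub>function_field X\<^esub> (g \<otimes>\<^bsub>function_field X\<^esub> \<delta> f)) \<and>
     (\<forall>c. \<delta> (const_fun X c) = \<zero>\<^bsub>function_field X\<^esub>)"

text \<open>
  Canonical divisors are the divisors of the nonzero rational differentials \<open>h df\<close>. If \<open>t\<close> is a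
  uniformizer at \<open>p\<close> and \<open>\<delta> = d/dt\<close> is the derivation with \<open>\<delta> t = 1\<close>, then \<open>h df = h (\<delta> f) dt\<close>.
\<close>

definition canonical_divisor :: "point set \<Rightarrow> (point \<Rightarrow> int) \<Rightarrow> bool" where
  "canonical_divisor X W \<longleftrightarrow> divisor X W \<and>
     (\<exists>h\<in>carrier (function_field X) - {\<zero>\<^bsub>function_field X\<^esub>}.
      \<exists>f\<in>carrier (function_field X) - range (const_fun X).
        \<forall>p\<in>X. \<exists>t \<delta>. uniformizer X p t \<and> derivation X \<delta> \<and> \<delta> t = \<one>\<^bsub>function_field X\<^esub> \<and>
          W p = order_at X p (h \<otimes>\<^bsub>function_field X\<^esub> \<delta> f))"

definition genus :: "point set \<Rightarrow> nat" where
  "genus X = h0 X (SOME W. canonical_divisor X W)"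


section \<open>Koszul cohomology\<close>

text \<open>
  With \<open>V = H\<^sup>0(X, L)\<close>, the space \<open>\<Lambda>\<^sup>p V \<otimes> H\<^sup>0(X, qL)\<close> is presented as the quotient of the free
  vector space on the symbols \<open>(vs, s)\<close>, standing for \<open>v\<^sub>1 \<and> \<dots> \<and> v\<^sub>p \<otimes> s\<close>, by the subspace spanned by
  the relations that make the symbol multilinear, and alternating in \<open>vs\<close>. For \<open>p < 0\<close> there are
  no symbols.
\<close>

type_synonym koszul_chain = "(ratfun list \<times> ratfun) \<Rightarrow>\<^sub>0 complex"

definition symbols :: "point set \<Rightarrow> (point \<Rightarrow> int) \<Rightarrow> int \<Rightarrow> int \<Rightarrow> (ratfun list \<times> ratfun) set" where
  "symbols X L p q =
     {(vs, s). set vs \<subseteq> sections X L \<and> int (length vs) = p \<and> s \<in> sections X (\<lambda>x. q * L x)}"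

definition free_space :: "point set \<Rightarrow> (point \<Rightarrow> int) \<Rightarrow> int \<Rightarrow> int \<Rightarrow> koszul_chain set" where
  "free_space X L p q = {z. Poly_Mapping.keys z \<subseteq> symbols X L p q}"

abbreviation chain_scale :: "complex \<Rightarrow> koszul_chain \<Rightarrow> koszul_chain" where
  "chain_scale c \<equiv> Poly_Mapping.map ((*) c)"

abbreviation symbol :: "ratfun list \<Rightarrow> ratfun \<Rightarrow> koszul_chain" where
  "symbol vs s \<equiv> Poly_Mapping.single (vs, s) 1"

definition relators :: "point set \<Rightarrow> (point \<Rightarrow> int) \<Rightarrow> int \<Rightarrow> int \<Rightarrow> koszul_chain set" where
  "relators X L p q =
     {symbol (vs[i := v \<oplus>\<^bsub>function_field X\<^esub> w]) s - symbol (vs[i := v]) s - symbol (vs[i := w]) s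
        | vs s i v w. (vs, s) \<in> symbols X L p q \<and> i < length vs \<and>
                      v \<in> sections X L \<and> w \<in> sections X L} \<union>
     {symbol (vs[i := const_fun X c \<otimes>\<^bsub>function_field X\<^esub> v]) s - chain_scale c (symbol (vs[i := v]) s)
        | vs s i v c. (vs, s) \<in> symbols X L p q \<and> i < length vs \<and> v \<in> sections X L} \<union>
     {symbol vs (s \<oplus>\<^bsub>function_field X\<^esub> s') - symbol vs s - symbol vs s'
        | vs s s'. (vs, s) \<in> symbols X L p q \<and> (vs, s') \<in> symbols X L p q} \<union>
     {symbol vs (const_fun X c \<otimes>\<^bsub>function_field X\<^esub> s) - chain_scale c (symbol vs s)
        | vs s c. (vs, s) \<in> symbols X L p q} \<union>
     {symbol vs s
        | vs s i j. (vs, s) \<in> symbols X L p q \<and> i < j \<and> j < length vs \<and> vs ! i = vs ! j}"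

definition relations :: "point set \<Rightarrow> (point \<Rightarrow> int) \<Rightarrow> int \<Rightarrow> int \<Rightarrow> koszul_chain set" where
  "relations X L p q = Modules.module.span chain_scale (relators X L p q)"

text \<open>List positions are counted from \<open>0\<close>, whence the exponent \<open>Suc j\<close>.\<close>

definition koszul_symbol_diff :: "point set \<Rightarrow> ratfun list \<times> ratfun \<Rightarrow> koszul_chain" where
  "koszul_symbol_diff X = (\<lambda>(vs, s). \<Sum>j<length vs. chain_scale ((- 1) ^ Suc j)
     (symbol (take j vs @ drop (Suc j) vs) (vs ! j \<otimes>\<^bsub>function_field X\<^esub> s)))"

definition koszul_diff :: "point set \<Rightarrow> koszul_chain \<Rightarrow> koszul_chain" where
  "koszul_diff X z = (\<Sum>g\<in>Poly_Mapping.keys z. chain_scale (Poly_Mapping.lookup z g) (koszul_symbol_diff X g))"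

text \<open>
  Cycles and boundaries are taken as preimages in the free vector space: \<open>koszul_boundaries\<close>
  contains \<open>relations\<close>, so the quotient of cycles by boundaries is the middle cohomology of the
  complex of the quotients \<open>\<Lambda>\<^sup>p V \<otimes> H\<^sup>0(X, qL)\<close>.
\<close>

definition koszul_cycles :: "point set \<Rightarrow> (point \<Rightarrow> int) \<Rightarrow> int \<Rightarrow> int \<Rightarrow> koszul_chain set" where
  "koszul_cycles X L p q =
     {z \<in> free_space X L p q. koszul_diff X z \<in> relations X L (p - 1) (q + 1)}"

definition koszul_boundaries :: "point set \<Rightarrow> (point \<Rightarrow> int) \<Rightarrow> int \<Rightarrow> int \<Rightarrow> koszul_chain set" where
  "koszul_boundaries X L p q =
     {koszul_diff X y + r | y r. y \<in> free_space X L (p + 1) (q - 1) \<and> r \<in> relations X L p q}"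

definition koszul_cohomology ::
    "point set \<Rightarrow> (point \<Rightarrow> int) \<Rightarrow> int \<Rightarrow> int \<Rightarrow> koszul_chain set set" where
  "koszul_cohomology X L p q =
     {{z + b | b. b \<in> koszul_boundaries X L p q} | z. z \<in> koszul_cycles X L p q}"

definition koszul_nonzero :: "point set \<Rightarrow> (point \<Rightarrow> int) \<Rightarrow> int \<Rightarrow> int \<Rightarrow> bool" where
  "koszul_nonzero X L p q \<longleftrightarrow> koszul_cohomology X L p q \<noteq> {koszul_boundaries X L p q}"

end

theory Submission
  imports Defs
    "HOL-Computational_Algebra.Computational_Algebra"
begin

text \<open>
  Let \<open>C\<close> be a smooth plane curve of degree \<open>d = k + 1\<close>; its genus is \<open>k (k - 1)/2\<close> and its gonality \<open>d - 1 = k\<close>.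
  Take \<open>L = (d - 2) H\<close> for the hyperplane class \<open>H\<close>. The curve chosen here meets the line at infinity in one
  point only, so that \<open>H\<^sup>0(nH)\<close> consists of the polynomials of degree at most \<open>n\<close> in the affine coordinates
  \<open>x\<close>, \<open>y\<close> for \<open>n < d\<close>, and \<open>deg L = (k - 1)(k + 1) = 2g + k - 1\<close>, \<open>h\<^sup>0(L) - k = g\<close>.

  Write \<open>m = d - 2\<close>. The \<open>g + 2\<close> monomials consisting of the \<open>g\<close> monomials \<open>\<beta>\<close> of degree less than \<open>m\<close> and of
  \<open>x\<^sup>m\<close>, \<open>x\<^bsup>m-1\<^esup> y\<close> give the Koszul cycle \<open>\<Sum> \<plusminus> (\<omega> - {\<alpha>, \<beta>}) \<otimes> \<alpha> \<beta> / x\<^bsup>m-1\<^esup>\<close>, where \<open>\<alpha>\<close> runs through the last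
  two and \<open>\<omega>\<close> is the wedge product of all of them: it is the boundary of a chain with non-regular coefficients.
  It is not the boundary of a chain with constant coefficients, because a linear functional \<open>det R \<otimes> r\<close> with
  \<open>r\<close> among the rows \<open>R\<close> vanishes on those but not on the cycle.
\<close>

text \<open>By adjunction K = (d - 3) H, so L = K + H, and the cycle is the Green-Lazarsfeld class
  of this decomposition: bundles with r + 1 and s + 1 sections give a class in K_(r+s-1,1) of their
  sum. Here r = g - 1 and s = 2, so the index is g. A pencil of degree k, with s = 1, only reaches g
  - 1 = h0(L) - k - 1, the last index that the criterion allows; the excess comes from H having
  three sections. The affine coordinates x and y have pole orders d and d - 1 at the point at
  infinity. These are coprime, so the monomials x^i y^j with j < d have distinct pole orders and
  cannot cancel; this argument replaces Riemann-Roch in every count of sections. The main obstacle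
  is the lower bound for the gonality, which is a degree of function fields here: for every
  non-constant h the function field must have degree at least d - 1 over C(h).\<close>

section \<open>Evaluation of polynomials\<close>

definition rhom :: "('a::comm_ring_1 \<Rightarrow> 'b::comm_ring_1) \<Rightarrow> bool" where
  "rhom c \<longleftrightarrow> c 1 = 1 \<and> (\<forall>a b. c (a + b) = c a + c b) \<and> (\<forall>a b. c (a * b) = c a * c b)"

lemma rhom_simps:
  assumes "rhom c"
  shows "c 0 = 0" "c 1 = 1" "c (a + b) = c a + c b" "c (a * b) = c a * c b" "c (- a) = - c a"
    "c (a - b) = c a - c b" "c (a ^ n) = c a ^ n" "c (of_nat n) = of_nat n"
    "c (sum f A) = (\<Sum>x\<in>A. c (f x))" "c (prod f A) = (\<Prod>x\<in>A. c (f x))"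
proof -
  show a: "c (a + b) = c a + c b" for a b using assms by (auto simp: rhom_def)
  show m: "c (a * b) = c a * c b" for a b using assms by (auto simp: rhom_def)
  show o: "c 1 = 1" using assms by (auto simp: rhom_def)
  show z: "c 0 = 0" using a[of 0 0] by simp
  show u: "c (- a) = - c a" for a
    using a[of a "- a"] z by (simp add: eq_neg_iff_add_eq_0 add.commute)
  show "c (a - b) = c a - c b" using a[of a "- b"] u[of b] by simp
  show "c (a ^ n) = c a ^ n" by (induction n) (auto simp: m o)
  show "c (of_nat n) = of_nat n" by (induction n) (auto simp: a o z)
  show "c (sum f A) = (\<Sum>x\<in>A. c (f x))" by (induction A rule: infinite_finite_induct) (auto simp: a z)
  show "c (prod f A) = (\<Prod>x\<in>A. c (f x))" by (induction A rule: infinite_finite_induct) (auto simp: m o)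
qed

lemma rhom_id: "rhom (\<lambda>x. x)"
  by (simp add: rhom_def)

definition mon_eval :: "(nat \<Rightarrow> 'a::comm_semiring_1) \<Rightarrow> (nat \<Rightarrow>\<^sub>0 nat) \<Rightarrow> 'a" where
  "mon_eval v m = (\<Prod>i\<in>Poly_Mapping.keys m. v i ^ Poly_Mapping.lookup m i)"

text \<open>The coefficients pass through \<open>c\<close>, so that one polynomial can be evaluated
  at complex vectors, power series, Laurent series and polynomials; by \<open>gev_hom\<close> these
  values are compatible with homomorphisms.\<close>

definition gev :: "(complex \<Rightarrow> 'a::comm_ring_1) \<Rightarrow> mpoly \<Rightarrow> (nat \<Rightarrow> 'a) \<Rightarrow> 'a" where
  "gev c F v = (\<Sum>m\<in>Poly_Mapping.keys F. c (Poly_Mapping.lookup F m) * mon_eval v m)"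

lemma peval_gev: "peval F v = gev (\<lambda>x. x) F v"
  by (simp add: peval_def gev_def mon_eval_def)

lemma mon_eval_superset:
  assumes "finite S" "Poly_Mapping.keys m \<subseteq> S"
  shows "mon_eval v m = (\<Prod>i\<in>S. v i ^ Poly_Mapping.lookup m i)"
  unfolding mon_eval_def using assms
  by (intro prod.mono_neutral_left) (auto simp: in_keys_iff)

lemma mon_eval_zero [simp]: "mon_eval v 0 = 1"
  by (simp add: mon_eval_def)

lemma mon_eval_add: "mon_eval v (m + n) = mon_eval v m * mon_eval v n"
proof -
  let ?S = "Poly_Mapping.keys m \<union> Poly_Mapping.keys n"
  have "Poly_Mapping.keys (m + n) \<subseteq> ?S" by (rule Poly_Mapping.keys_add)
  then show ?thesis
    by (simp add: mon_eval_superset[of ?S] lookup_add power_add prod.distrib)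
qed

lemma mon_eval_single [simp]: "mon_eval v (Poly_Mapping.single i k) = v i ^ k"
  by (cases "k = 0") (auto simp: mon_eval_def)

lemma gev_superset:
  assumes "rhom c" "finite S" "Poly_Mapping.keys F \<subseteq> S"
  shows "gev c F v = (\<Sum>m\<in>S. c (Poly_Mapping.lookup F m) * mon_eval v m)"
  unfolding gev_def using assms
  by (intro sum.mono_neutral_left) (auto simp: in_keys_iff rhom_simps)

lemma gev_zero [simp]: "gev c 0 v = 0"
  by (simp add: gev_def)

lemma gev_add:
  assumes "rhom c"
  shows "gev c (F + G) v = gev c F v + gev c G v"
proof -
  let ?S = "Poly_Mapping.keys F \<union> Poly_Mapping.keys G"
  have "Poly_Mapping.keys (F + G) \<subseteq> ?S" by (rule Poly_Mapping.keys_add)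
  then show ?thesis
    by (simp add: gev_superset[OF assms, of ?S] lookup_add rhom_simps[OF assms] distrib_right sum.distrib)
qed

lemma gev_sum:
  assumes "rhom c"
  shows "gev c (\<Sum>x\<in>A. f x) v = (\<Sum>x\<in>A. gev c (f x) v)"
  by (induction A rule: infinite_finite_induct) (auto simp: gev_add[OF assms])

lemma gev_single:
  assumes "rhom c"
  shows "gev c (Poly_Mapping.single m a) v = c a * mon_eval v m"
  by (cases "a = 0") (auto simp: gev_def rhom_simps[OF assms])

lemma mpoly_decomp: "F = (\<Sum>m\<in>Poly_Mapping.keys F. Poly_Mapping.single m (Poly_Mapping.lookup F m))"
  by (rule poly_mapping_eqI) (auto simp: lookup_sum lookup_single when_def in_keys_iff)

lemma gev_mult:
  assumes "rhom c"
  shows "gev c (F * G) v = gev c F v * gev c G v"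
proof -
  have "F * G = (\<Sum>m\<in>Poly_Mapping.keys F. \<Sum>n\<in>Poly_Mapping.keys G.
      Poly_Mapping.single (m + n) (Poly_Mapping.lookup F m * Poly_Mapping.lookup G n))"
    by (subst mpoly_decomp[of F], subst mpoly_decomp[of G]) (simp add: sum_product mult_single)
  then show ?thesis
    by (simp add: gev_sum[OF assms] gev_single[OF assms] rhom_simps[OF assms] mon_eval_add)
       (simp add: gev_def sum_product mult_ac)
qed

lemma gev_one [simp]: "rhom c \<Longrightarrow> gev c 1 v = 1"
  using gev_single[of c 0 1 v] by (simp add: rhom_simps)

lemma gev_rhom:
  assumes "rhom c" shows "rhom (\<lambda>F. gev c F v)"
  using assms by (simp add: rhom_def gev_add gev_mult)

abbreviation mconst :: "complex \<Rightarrow> mpoly" where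
  "mconst a \<equiv> Poly_Mapping.single 0 a"

abbreviation mvar :: "nat \<Rightarrow> mpoly" where
  "mvar i \<equiv> Poly_Mapping.single (Poly_Mapping.single i (Suc 0)) 1"

lemma gev_const: "rhom c \<Longrightarrow> gev c (mconst a) v = c a"
  by (simp add: gev_single)

lemma gev_var: "rhom c \<Longrightarrow> gev c (mvar i) v = v i"
  by (simp add: gev_single rhom_simps)

lemmas gev_simps = gev_add gev_mult gev_const gev_var rhom_simps[OF gev_rhom]

lemma mon_eval_hom: "rhom h \<Longrightarrow> h (mon_eval v m) = mon_eval (\<lambda>i. h (v i)) m"
  by (simp add: mon_eval_def rhom_simps)

lemma gev_hom:
  assumes "rhom h"
  shows "h (gev c F v) = gev (\<lambda>a. h (c a)) F (\<lambda>i. h (v i))"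
  by (simp add: gev_def rhom_simps[OF assms] mon_eval_hom[OF assms])

definition mdeg :: "(nat \<Rightarrow>\<^sub>0 nat) \<Rightarrow> nat" where
  "mdeg m = (\<Sum>i\<in>Poly_Mapping.keys m. Poly_Mapping.lookup m i)"

lemma mdeg_add: "mdeg (m + n) = mdeg m + mdeg n"
proof -
  let ?S = "Poly_Mapping.keys m \<union> Poly_Mapping.keys n"
  have s: "mdeg k = (\<Sum>i\<in>?S. Poly_Mapping.lookup k i)" if "Poly_Mapping.keys k \<subseteq> ?S" for k
    unfolding mdeg_def using that by (intro sum.mono_neutral_left) (auto simp: in_keys_iff)
  have "Poly_Mapping.keys (m + n) \<subseteq> ?S" by (rule Poly_Mapping.keys_add)
  then show ?thesis by (simp add: s lookup_add sum.distrib)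
qed

lemma mdeg_single [simp]: "mdeg (Poly_Mapping.single i k) = k"
  by (cases "k = 0") (auto simp: mdeg_def)

lemma homogeneous_mdeg: "homogeneous d F \<longleftrightarrow> (\<forall>m\<in>Poly_Mapping.keys F. mdeg m = d)"
  by (simp add: homogeneous_def mdeg_def)

lemma homogeneous_zero [simp]: "homogeneous d 0"
  by (simp add: homogeneous_def)

lemma homogeneous_add: "homogeneous d F \<Longrightarrow> homogeneous d G \<Longrightarrow> homogeneous d (F + G)"
  using Poly_Mapping.keys_add[of F G] by (fastforce simp: homogeneous_def)

lemma homogeneous_sum: "(\<And>x. x \<in> A \<Longrightarrow> homogeneous d (f x)) \<Longrightarrow> homogeneous d (\<Sum>x\<in>A. f x)"
  by (induction A rule: infinite_finite_induct) (auto intro: homogeneous_add)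

lemma homogeneous_uminus: "homogeneous d F \<Longrightarrow> homogeneous d (- F)"
  by (simp add: homogeneous_def)

lemma homogeneous_diff: "homogeneous d F \<Longrightarrow> homogeneous d G \<Longrightarrow> homogeneous d (F - G)"
  using homogeneous_add[of d F "- G"] homogeneous_uminus by simp

lemma homogeneous_mult: "homogeneous d F \<Longrightarrow> homogeneous e G \<Longrightarrow> homogeneous (d + e) (F * G)"
  using Poly_Mapping.keys_mult[of F G] by (fastforce simp: homogeneous_mdeg mdeg_add)

lemma homogeneous_single: "homogeneous (mdeg m) (Poly_Mapping.single m a)"
  by (simp add: homogeneous_mdeg)

lemma homogeneous_const: "homogeneous 0 (mconst a)"
  using homogeneous_single[of 0 a] by (simp add: mdeg_def)

lemma homogeneous_var: "homogeneous 1 (mvar i)"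
  using homogeneous_single[of "Poly_Mapping.single i 1" 1] by simp

lemma homogeneous_one: "homogeneous 0 1"
  using homogeneous_const[of 1] by simp

lemma homogeneous_power: "homogeneous d F \<Longrightarrow> homogeneous (n * d) (F ^ n)"
  by (induction n) (auto simp: homogeneous_one intro: homogeneous_mult)

lemma homogeneous_var_power: "homogeneous n (mvar i ^ n)"
  using homogeneous_power[OF homogeneous_var, of n i] by simp

lemma homogeneous_cmult: "homogeneous d F \<Longrightarrow> homogeneous d (mconst a * F)"
  using homogeneous_mult[OF homogeneous_const] by simp

lemma homogeneous_prod:
  "(\<And>x. x \<in> A \<Longrightarrow> homogeneous 1 (f x)) \<Longrightarrow> homogeneous (card A) (\<Prod>x\<in>A. f x)"
proof (induction A rule: infinite_finite_induct)
  case (insert x A)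
  then show ?case using homogeneous_mult[of 1 "f x" "card A" "prod f A"] by simp
qed (auto simp: homogeneous_one)

lemma mon_eval_scale: "mon_eval (\<lambda>i. a * v i) m = a ^ mdeg m * mon_eval v m"
  by (simp add: mon_eval_def mdeg_def power_mult_distrib prod.distrib power_sum)

lemma gev_scale:
  assumes "homogeneous n F"
  shows "gev c F (\<lambda>i. a * v i) = a ^ n * gev c F v"
  unfolding gev_def sum_distrib_left using assms
  by (intro sum.cong) (auto simp: homogeneous_mdeg mon_eval_scale mult_ac)


lemma prod_split_power:
  assumes "finite S" "i \<in> S"
  shows "(\<Prod>j\<in>S. v j ^ Poly_Mapping.lookup (m - Poly_Mapping.single i 1) j)
    = (v i :: 'a::comm_semiring_1) ^ (Poly_Mapping.lookup m i - 1) * (\<Prod>j\<in>S - {i}. v j ^ Poly_Mapping.lookup m j)"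
proof -
  have "(\<Prod>j\<in>S - {i}. v j ^ Poly_Mapping.lookup (m - Poly_Mapping.single i 1) j)
      = (\<Prod>j\<in>S - {i}. v j ^ Poly_Mapping.lookup m j)"
    by (rule prod.cong) (auto simp: lookup_minus lookup_single when_def)
  then show ?thesis
    using assms by (subst prod.remove[of S i]) (auto simp: lookup_minus)
qed

text \<open>Iterated product rule. Where \<open>k i = 0\<close> the truncated exponent
  \<open>k i - 1\<close> does no harm, because the factor \<open>of_nat (k i)\<close>
  vanishes.\<close>

lemma derivation_prod:
  fixes D :: "'a::comm_ring_1 \<Rightarrow> 'a"
  assumes "\<And>a b. D (a * b) = a * D b + b * D a" "finite S"
  shows "D (\<Prod>i\<in>S. v i ^ k i) = (\<Sum>i\<in>S. of_nat (k i) * v i ^ (k i - 1) * D (v i) * (\<Prod>j\<in>S-{i}. v j ^ k j))"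
proof -
  have D1: "D 1 = 0" using assms(1)[of 1 1] by simp
  have pw: "D (x ^ n) = of_nat n * x ^ (n - 1) * D x" for x n
  proof (induction n)
    case (Suc n)
    then show ?case
      by (cases n) (auto simp: assms(1) D1 algebra_simps)
  qed (simp add: D1)
  show ?thesis using assms(2)
  proof (induction S)
    case (insert x S)
    have "(\<Sum>i\<in>S. of_nat (k i) * v i ^ (k i - 1) * D (v i) * (\<Prod>j\<in>insert x S-{i}. v j ^ k j))
       = v x ^ k x * (\<Sum>i\<in>S. of_nat (k i) * v i ^ (k i - 1) * D (v i) * (\<Prod>j\<in>S-{i}. v j ^ k j))"
      unfolding sum_distrib_left
    proof (rule sum.cong)
      fix i assume i: "i \<in> S"
      then have "insert x S - {i} = insert x (S - {i})" using insert by auto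
      then show "of_nat (k i) * v i ^ (k i - 1) * D (v i) * (\<Prod>j\<in>insert x S-{i}. v j ^ k j)
        = v x ^ k x * (of_nat (k i) * v i ^ (k i - 1) * D (v i) * (\<Prod>j\<in>S-{i}. v j ^ k j))"
        using insert i by (simp add: mult_ac)
    qed simp
    then show ?case using insert by (simp add: assms(1) pw mult_ac add.commute)
  qed (simp add: D1)
qed

lemma gev_partial_deriv:
  assumes "rhom c"
  shows "gev c (partial_deriv i F) v = (\<Sum>m\<in>Poly_Mapping.keys F.
    of_nat (Poly_Mapping.lookup m i) * c (Poly_Mapping.lookup F m) * mon_eval v (m - Poly_Mapping.single i 1))"
  unfolding partial_deriv_def
  by (simp add: gev_sum[OF assms] gev_single[OF assms] rhom_simps[OF assms])

text \<open>Both sides are additive over the monomials, and each monomial obeys the product rule.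
  Applied below with \<open>pderiv\<close>, with the derivative of Laurent series and with
  differentiation along a uniformizer; the finite set \<open>I\<close> keeps the sum over the
  infinitely many variables finite.\<close>

lemma gev_chain_rule:
  fixes D :: "'a::comm_ring_1 \<Rightarrow> 'a"
  assumes c: "rhom c" and D: "\<And>a b. D (a + b) = D a + D b" "\<And>a b. D (a * b) = a * D b + b * D a"
    and Dc: "\<And>a. D (c a) = 0" and I: "finite I" "\<And>i. i \<notin> I \<Longrightarrow> v i = 0"
  shows "D (gev c F v) = (\<Sum>i\<in>I. gev c (partial_deriv i F) v * D (v i))"
proof -
  have D0: "D 0 = 0" using D(1)[of 0 0] by simp
  have Dsum: "D (sum f A) = (\<Sum>x\<in>A. D (f x))" for f :: "'b \<Rightarrow> 'a" and A
    by (induction A rule: infinite_finite_induct) (auto simp: D D0)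
  have mon: "D (mon_eval v m) = (\<Sum>i\<in>I. of_nat (Poly_Mapping.lookup m i) * mon_eval v (m - Poly_Mapping.single i 1) * D (v i))" for m
  proof -
    let ?S = "Poly_Mapping.keys m \<union> I"
    have S: "finite ?S" using I by simp
    have ks: "Poly_Mapping.keys (m - Poly_Mapping.single i 1) \<subseteq> ?S" for i
      by (auto simp: in_keys_iff lookup_minus)
    have "D (mon_eval v m) = (\<Sum>i\<in>?S. of_nat (Poly_Mapping.lookup m i) * mon_eval v (m - Poly_Mapping.single i 1) * D (v i))"
      apply (subst mon_eval_superset[OF S]) apply simp
      apply (subst derivation_prod[OF D(2) S])
      apply (rule sum.cong[OF refl])
      apply (subst mon_eval_superset[OF S ks])
      apply (subst prod_split_power[OF S]) apply simp
      by (simp add: mult_ac)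
    also have "\<dots> = (\<Sum>i\<in>I. of_nat (Poly_Mapping.lookup m i) * mon_eval v (m - Poly_Mapping.single i 1) * D (v i))"
      using S I by (intro sum.mono_neutral_right) (auto simp: D0)
    finally show ?thesis .
  qed
  have "D (gev c F v) = (\<Sum>m\<in>Poly_Mapping.keys F. c (Poly_Mapping.lookup F m) * D (mon_eval v m))"
    by (simp add: gev_def Dsum D(2) Dc)
  also have "\<dots> = (\<Sum>i\<in>I. gev c (partial_deriv i F) v * D (v i))"
    unfolding mon gev_partial_deriv[OF c] sum_distrib_left sum_distrib_right
    by (subst sum.swap) (simp add: mult_ac)
  finally show ?thesis .
qed

lemma gev_euler:
  assumes c: "rhom c" and I: "finite I" "\<And>i. i \<notin> I \<Longrightarrow> v i = 0" and F: "homogeneous n F"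
  shows "(\<Sum>i\<in>I. v i * gev c (partial_deriv i F) v) = of_nat n * gev c F v"
proof -
  have mon: "(\<Sum>i\<in>I. v i * (of_nat (Poly_Mapping.lookup m i) * mon_eval v (m - Poly_Mapping.single i 1)))
      = of_nat (mdeg m) * mon_eval v m" for m
  proof -
    have e: "v i * (of_nat (Poly_Mapping.lookup m i) * mon_eval v (m - Poly_Mapping.single i 1))
        = of_nat (Poly_Mapping.lookup m i) * mon_eval v m" for i
    proof (cases "Poly_Mapping.lookup m i = 0")
      case False
      \<comment> \<open>As the exponent of \<open>i\<close> is positive, the truncated subtraction
        loses nothing.\<close>
      then have "m = (m - Poly_Mapping.single i 1) + Poly_Mapping.single i 1"
        by (intro poly_mapping_eqI) (auto simp: lookup_add lookup_minus lookup_single when_def)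
      then have "mon_eval v m = mon_eval v (m - Poly_Mapping.single i 1) * v i"
        by (metis mon_eval_add mon_eval_single power_one_right)
      then show ?thesis by (simp add: mult_ac)
    qed simp
    have "(\<Sum>i\<in>I. of_nat (Poly_Mapping.lookup m i) * mon_eval v m) = (\<Sum>i\<in>I \<union> Poly_Mapping.keys m. of_nat (Poly_Mapping.lookup m i) * mon_eval v m)"
    proof (rule sum.mono_neutral_left)
      show "finite (I \<union> Poly_Mapping.keys m)" "I \<subseteq> I \<union> Poly_Mapping.keys m" using I by auto
      show "\<forall>i\<in>I \<union> Poly_Mapping.keys m - I. of_nat (Poly_Mapping.lookup m i) * mon_eval v m = 0"
      proof
      fix i assume i: "i \<in> I \<union> Poly_Mapping.keys m - I"
      then have "v i ^ Poly_Mapping.lookup m i = 0" using I(2)[of i] by (auto simp: in_keys_iff zero_power)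
      then have "mon_eval v m = 0"
        unfolding mon_eval_def using i by (subst prod.remove[of _ i]) auto
      then show "of_nat (Poly_Mapping.lookup m i) * mon_eval v m = 0" by simp
      qed
    qed
    also have "\<dots> = (\<Sum>i\<in>Poly_Mapping.keys m. of_nat (Poly_Mapping.lookup m i) * mon_eval v m)"
      using I by (intro sum.mono_neutral_right) (auto simp: in_keys_iff)
    also have "\<dots> = of_nat (mdeg m) * mon_eval v m" by (simp add: mdeg_def sum_distrib_right)
    finally show ?thesis unfolding e .
  qed
  have "(\<Sum>i\<in>I. v i * gev c (partial_deriv i F) v)
     = (\<Sum>m\<in>Poly_Mapping.keys F. c (Poly_Mapping.lookup F m) * (\<Sum>i\<in>I. v i * (of_nat (Poly_Mapping.lookup m i) * mon_eval v (m - Poly_Mapping.single i 1))))"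
    unfolding gev_partial_deriv[OF c] sum_distrib_left
    by (subst sum.swap) (simp add: mult_ac)
  also have "\<dots> = of_nat n * gev c F v"
    unfolding mon gev_def sum_distrib_left using F
    by (intro sum.cong) (auto simp: homogeneous_mdeg mult_ac)
  finally show ?thesis .
qed

section \<open>Points of projective space\<close>

lemma rep_in: "A \<noteq> {} \<Longrightarrow> rep A \<in> A"
  unfolding rep_def by (rule someI_ex) auto

lemma rep_proj_point: "\<exists>c. c \<noteq> 0 \<and> rep (proj_point v) = (\<lambda>i. c * v i)"
proof -
  have "v \<in> proj_point v" unfolding proj_point_def by (intro CollectI exI[of _ 1]) auto
  then have "rep (proj_point v) \<in> proj_point v" by (intro rep_in) auto
  then show ?thesis unfolding proj_point_def by auto
qed

lemma proj_point_eq_iff: "proj_point v = proj_point w \<longleftrightarrow> (\<exists>c. c \<noteq> 0 \<and> w = (\<lambda>i. c * v i))"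
proof
  assume "proj_point v = proj_point w"
  moreover have "w \<in> proj_point w" unfolding proj_point_def by (intro CollectI exI[of _ 1]) auto
  ultimately show "\<exists>c. c \<noteq> 0 \<and> w = (\<lambda>i. c * v i)" unfolding proj_point_def by auto
next
  assume "\<exists>c. c \<noteq> 0 \<and> w = (\<lambda>i. c * v i)"
  then obtain c where c: "c \<noteq> 0" "w = (\<lambda>i. c * v i)" by blast
  show "proj_point v = proj_point w"
  proof (intro equalityI subsetI)
    fix u assume "u \<in> proj_point v"
    then obtain a where a: "a \<noteq> 0" "u = (\<lambda>i. a * v i)" by (auto simp: proj_point_def)
    then have "u = (\<lambda>i. (a / c) * w i)" using c by auto
    moreover have "a / c \<noteq> 0" using a c by simp
    ultimately show "u \<in> proj_point w" unfolding proj_point_def by blast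
  next
    fix u assume "u \<in> proj_point w"
    then obtain a where a: "a \<noteq> 0" "u = (\<lambda>i. a * w i)" by (auto simp: proj_point_def)
    then have "u = (\<lambda>i. (a * c) * v i)" using c by auto
    moreover have "a * c \<noteq> 0" using a c by simp
    ultimately show "u \<in> proj_point v" unfolding proj_point_def by blast
  qed
qed

lemma proj_point_eqI: "c \<noteq> 0 \<Longrightarrow> (\<And>i. w i = c * v i) \<Longrightarrow> proj_point v = proj_point w"
  unfolding proj_point_eq_iff by (rule exI[of _ c]) auto

lemma proj_space_rep:
  assumes "p \<in> proj_space n"
  shows "proj_point (rep p) = p" "\<exists>i. rep p i \<noteq> 0" "\<And>i. i > n \<Longrightarrow> rep p i = 0"
proof -
  obtain v where v: "p = proj_point v" "\<exists>i. v i \<noteq> 0" "\<forall>i>n. v i = 0"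
    using assms by (auto simp: proj_space_def)
  obtain c where c: "c \<noteq> 0" "rep p = (\<lambda>i. c * v i)" using rep_proj_point v by blast
  show "proj_point (rep p) = p" using v c by (metis proj_point_eq_iff)
  show "\<exists>i. rep p i \<noteq> 0" "\<And>i. i > n \<Longrightarrow> rep p i = 0" using v c by auto
qed


lemma proj_point_in_space: "v i \<noteq> 0 \<Longrightarrow> (\<And>i. i > n \<Longrightarrow> v i = 0) \<Longrightarrow> proj_point v \<in> proj_space n"
  unfolding proj_space_def by blast

lemma vanishes_proj_point:
  assumes "homogeneous n F"
  shows "vanishes F (proj_point v) \<longleftrightarrow> peval F v = 0"
proof -
  obtain c where c: "c \<noteq> 0" "rep (proj_point v) = (\<lambda>i. c * v i)" using rep_proj_point by blast
  show ?thesis unfolding vanishes_def c(2) peval_gev gev_scale[OF assms] using c by simp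
qed

lemma peval_quotient_proj_point:
  assumes "homogeneous n F" "homogeneous n G"
  shows "peval F (rep (proj_point v)) / peval G (rep (proj_point v)) = peval F v / peval G v"
proof -
  obtain c where c: "c \<noteq> 0" "rep (proj_point v) = (\<lambda>i. c * v i)" using rep_proj_point by blast
  show ?thesis unfolding c(2) peval_gev gev_scale[OF assms(1)] gev_scale[OF assms(2)] using c by simp
qed

text \<open>Coordinates beyond \<open>n\<close> are themselves equations, so the ambient space plays no role.\<close>

lemma zariski_closed_separate:
  assumes "zariski_closed Z" "p \<notin> Z" "p \<in> proj_space m"
  obtains F n where "homogeneous n F" "\<not> vanishes F p" "\<forall>q\<in>Z. vanishes F q"
proof -
  obtain n S where S: "\<forall>F\<in>S. \<exists>d. homogeneous d F" "Z = {p \<in> proj_space n. \<forall>F\<in>S. vanishes F p}"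
    using assms(1) unfolding zariski_closed_def by blast
  show thesis
  proof (cases "p \<in> proj_space n")
    case True
    then obtain F where "F \<in> S" "\<not> vanishes F p" using S assms(2) by auto
    then show thesis using S that by blast
  next
    case False
    obtain i where i: "i > n" "rep p i \<noteq> 0"
    proof -
      have "proj_point (rep p) = p" "\<exists>i. rep p i \<noteq> 0" using proj_space_rep[OF assms(3)] by auto
      then show thesis using False that proj_point_in_space[of "rep p" _ n] by (metis)
    qed
    show thesis
    proof (rule that)
      show "homogeneous 1 (mvar i)" by (rule homogeneous_var)
      show "\<not> vanishes (mvar i) p" using i by (simp add: vanishes_def peval_gev gev_var rhom_id)
      show "\<forall>q\<in>Z. vanishes (mvar i) q"
        using i proj_space_rep(3)[of _ n] S by (auto simp: vanishes_def peval_gev gev_var rhom_id)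
    qed
  qed
qed

lemma vanishes_mult: "vanishes (F * G) p \<longleftrightarrow> vanishes F p \<or> vanishes G p"
  by (simp add: vanishes_def peval_gev gev_mult[OF rhom_id])


lemma vanishes_prod: "finite A \<Longrightarrow> vanishes (\<Prod>x\<in>A. f x) p \<longleftrightarrow> (\<exists>x\<in>A. vanishes (f x) p)"
  by (simp add: vanishes_def peval_gev rhom_simps(10)[OF gev_rhom[OF rhom_id]])

text \<open>The equations are the 2 by 2 minors of the matrix with rows p and q; their vanishing
  means that the rows are proportional.\<close>

lemma zariski_closed_point:
  assumes "p \<in> proj_space n"
  shows "zariski_closed {p}"
proof -
  let ?l = "\<lambda>i j. mconst (rep p i) * mvar j - mconst (rep p j) * mvar i"
  let ?S = "{?l i j | i j. True}"
  have ev: "vanishes (?l i j) q \<longleftrightarrow> rep p i * rep q j = rep p j * rep q i" for i j q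
    by (simp add: vanishes_def peval_gev gev_simps rhom_id)
  have "\<forall>F\<in>?S. \<exists>d. homogeneous d F"
    using homogeneous_diff[OF homogeneous_cmult[OF homogeneous_var] homogeneous_cmult[OF homogeneous_var]] by blast
  moreover have "{p} = {q \<in> proj_space n. \<forall>F\<in>?S. vanishes F q}"
  proof (intro equalityI subsetI)
    fix q assume "q \<in> {p}"
    then show "q \<in> {q \<in> proj_space n. \<forall>F\<in>?S. vanishes F q}" using assms ev by auto
  next
    fix q assume "q \<in> {q \<in> proj_space n. \<forall>F\<in>?S. vanishes F q}"
    then have q: "q \<in> proj_space n" and e: "\<And>i j. rep p i * rep q j = rep p j * rep q i" using ev by blast+
    obtain i where i: "rep q i \<noteq> 0" using proj_space_rep[OF q] by auto
    obtain j where j: "rep p j \<noteq> 0" using proj_space_rep[OF assms] by auto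
    have pi: "rep p i \<noteq> 0" using e[of i j] e[of j i] i j by auto
    have "proj_point (rep p) = proj_point (rep q)"
      by (rule proj_point_eqI[of "rep q i / rep p i"]) (use i pi e[of i] in \<open>auto simp: field_simps\<close>)
    then show "q \<in> {p}" using proj_space_rep(1)[OF q] proj_space_rep(1)[OF assms] by simp
  qed
  ultimately show ?thesis unfolding zariski_closed_def by blast
qed

lemma separating_linear_form:
  assumes "p \<in> proj_space n" "q \<in> proj_space n" "p \<noteq> q"
  obtains l where "homogeneous 1 l" "vanishes l p" "\<not> vanishes l q"
proof -
  have "zariski_closed {p}" by (rule zariski_closed_point[OF assms(1)])
  let ?l = "\<lambda>i j. mconst (rep p i) * mvar j - mconst (rep p j) * mvar i"
  have ev: "vanishes (?l i j) q \<longleftrightarrow> rep p i * rep q j = rep p j * rep q i" for i j q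
    by (simp add: vanishes_def peval_gev gev_simps rhom_id)
  have "\<exists>i j. rep p i * rep q j \<noteq> rep p j * rep q i"
  proof (rule ccontr)
    assume "\<not> ?thesis"
    then have e: "\<And>i j. rep p i * rep q j = rep p j * rep q i" by blast
    obtain i where i: "rep q i \<noteq> 0" using proj_space_rep[OF assms(2)] by auto
    obtain j where j: "rep p j \<noteq> 0" using proj_space_rep[OF assms(1)] by auto
    have pi: "rep p i \<noteq> 0" using e[of i j] e[of j i] i j by auto
    have "proj_point (rep p) = proj_point (rep q)"
      by (rule proj_point_eqI[of "rep q i / rep p i"]) (use i pi e[of i] in \<open>auto simp: field_simps\<close>)
    then show False using proj_space_rep(1)[OF assms(1)] proj_space_rep(1)[OF assms(2)] assms(3) by simp
  qed
  then obtain i j where ij: "rep p i * rep q j \<noteq> rep p j * rep q i" by blast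
  show thesis
    by (rule that[of "?l i j"], unfold ev)
       (use ij in \<open>auto intro!: homogeneous_diff homogeneous_cmult homogeneous_var[unfolded One_nat_def]\<close>)
qed

text \<open>Finite sets of points are cut out, away from any further point, by a product of linear forms.\<close>

lemma separating_form:
  assumes "finite A" "A \<subseteq> proj_space n" "q \<in> proj_space n" "q \<notin> A"
  obtains G where "homogeneous (card A) G" "\<forall>p\<in>A. vanishes G p" "\<not> vanishes G q"
proof -
  have "\<forall>p\<in>A. \<exists>l. homogeneous 1 l \<and> vanishes l p \<and> \<not> vanishes l q"
    using assms by (metis separating_linear_form subsetD)
  then obtain l where l: "\<And>p. p \<in> A \<Longrightarrow> homogeneous 1 (l p) \<and> vanishes (l p) p \<and> \<not> vanishes (l p) q"
    by metis
  show thesis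
  proof (rule that[of "\<Prod>p\<in>A. l p"])
    show "homogeneous (card A) (\<Prod>p\<in>A. l p)" using l by (intro homogeneous_prod) auto
    show "\<forall>p\<in>A. vanishes (\<Prod>p\<in>A. l p) p" using l assms(1) by (auto simp: vanishes_prod)
    show "\<not> vanishes (\<Prod>p\<in>A. l p) q" using l assms(1) by (auto simp: vanishes_prod)
  qed
qed

declare One_nat_def [simp del]

section \<open>Laurent series\<close>

lemma rhom_fls_const: "rhom (fls_const :: 'a::comm_ring_1 \<Rightarrow> 'a fls)"
  by (simp add: rhom_def fls_plus_const)


lemma rhom_fps_to_fls: "rhom (fps_to_fls :: 'a::comm_ring_1 fps \<Rightarrow> 'a fls)"
  by (simp add: rhom_def fls_times_fps_to_fls)

lemma rhom_fps_nth_0: "rhom (\<lambda>f::'a::comm_ring_1 fps. f $ 0)"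
  by (simp add: rhom_def)

definition PE :: "complex fls \<Rightarrow> complex poly \<Rightarrow> complex fls" where
  "PE e q = poly (map_poly fls_const q) e"

lemma PE_pCons: "PE e (pCons a q) = fls_const a + e * PE e q"
  by (simp add: PE_def map_poly_pCons)

lemma PE_0 [simp]: "PE e 0 = 0"
  by (simp add: PE_def)

lemma PE_add: "PE e (p + q) = PE e p + PE e q"
proof (induction p q rule: poly_induct2)
  case (pCons a p b q)
  then show ?case by (simp add: PE_pCons algebra_simps flip: fls_plus_const)
qed simp

lemma PE_smult: "PE e (smult c p) = fls_const c * PE e p"
  by (induction p) (simp_all add: PE_pCons algebra_simps flip: fls_const_mult_const)

lemma PE_mult: "PE e (p * q) = PE e p * PE e q"
  by (induction p) (simp_all add: PE_pCons PE_add PE_smult algebra_simps)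

lemma PE_const [simp]: "PE e [:c:] = fls_const c"
  by (simp add: PE_pCons)

lemma rhom_PE: "rhom (PE e)"
  unfolding rhom_def by (auto simp: PE_add PE_mult one_pCons)

lemmas PE_simps = rhom_simps[OF rhom_PE]

lemma PE_linear: "PE e [:- c, 1:] = e - fls_const c"
  by (simp add: PE_pCons)

lemma PE_altdef: "PE e q = (\<Sum>i\<le>degree q. fls_const (coeff q i) * e ^ i)"
  by (simp add: PE_def poly_altdef degree_map_poly coeff_map_poly)


text \<open>In Horner's scheme each step adds a constant to a multiple of e of negative order, so
  the leading term decides.\<close>

lemma PE_subdegree:
  assumes "fls_subdegree e < 0" "q \<noteq> 0"
  shows "PE e q \<noteq> 0 \<and> fls_subdegree (PE e q) = int (degree q) * fls_subdegree e"
  using assms(2)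
proof (induction q)
  case (pCons a q)
  have e0: "e \<noteq> 0" using assms(1) by auto
  show ?case
  proof (cases "q = 0")
    case False
    then have IH: "PE e q \<noteq> 0" "fls_subdegree (PE e q) = int (degree q) * fls_subdegree e"
      using pCons by auto
    have s: "fls_subdegree (e * PE e q) = int (Suc (degree q)) * fls_subdegree e"
      using IH e0 by (simp add: algebra_simps)
    have "\<dots> < 0" using assms(1) by (intro mult_pos_neg) auto
    then have lt: "fls_subdegree (e * PE e q) < fls_subdegree (fls_const a)" using s by simp
    have "fls_subdegree (e * PE e q + fls_const a) = fls_subdegree (e * PE e q)"
      by (rule fls_subdegree_add_eq1[OF _ lt]) (use IH e0 in simp)
    then show ?thesis using s False lt by (auto simp: PE_pCons add.commute)
  qed (use pCons in \<open>simp add: PE_pCons\<close>)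
qed simp


text \<open>The ultrametric inequality is an equality for summands of distinct orders. That the
  order is attained by some summand is carried along in the induction, since it separates the next
  summand from the partial sum.\<close>

lemma fls_sum_subdegree:
  fixes f :: "'b \<Rightarrow> complex fls"
  assumes "finite S" "S \<noteq> {}" "\<And>i. i \<in> S \<Longrightarrow> f i \<noteq> 0" "inj_on (\<lambda>i. fls_subdegree (f i)) S"
  shows "sum f S \<noteq> 0 \<and> (\<forall>j\<in>S. fls_subdegree (sum f S) \<le> fls_subdegree (f j))
    \<and> (\<exists>i\<in>S. fls_subdegree (sum f S) = fls_subdegree (f i))"
  using assms
proof (induction S rule: finite_ne_induct)
  case (insert x S)
  have IH: "sum f S \<noteq> 0" "\<forall>j\<in>S. fls_subdegree (sum f S) \<le> fls_subdegree (f j)"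
      "\<exists>i\<in>S. fls_subdegree (sum f S) = fls_subdegree (f i)"
    using insert by (auto simp: inj_on_insert)
  have fx: "f x \<noteq> 0" using insert by auto
  have ne: "fls_subdegree (f x) \<noteq> fls_subdegree (sum f S)"
    using IH(3) insert.prems(2) insert.hyps by (force simp: inj_on_def)
  have s: "sum f (insert x S) = f x + sum f S" using insert by simp
  consider "fls_subdegree (f x) < fls_subdegree (sum f S)" | "fls_subdegree (sum f S) < fls_subdegree (f x)"
    using ne by linarith
  then show ?case
  proof cases
    case 1
    then have e: "fls_subdegree (f x + sum f S) = fls_subdegree (f x)"
      using fls_subdegree_add_eq1 fx by blast
    have "f x + sum f S \<noteq> 0" using 1 by (metis add.inverse_inverse add_eq_0_iff fls_uminus_subdegree less_irrefl)
    then show ?thesis unfolding s e using 1 IH by force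
  next
    case 2
    then have e: "fls_subdegree (f x + sum f S) = fls_subdegree (sum f S)"
      using fls_subdegree_add_eq2 IH(1) by blast
    have "f x + sum f S \<noteq> 0" using 2 by (metis add.inverse_inverse add_eq_0_iff fls_uminus_subdegree less_irrefl)
    then show ?thesis unfolding s e using 2 IH by force
  qed
qed simp

definition vec3 :: "'a::zero \<Rightarrow> 'a \<Rightarrow> 'a \<Rightarrow> nat \<Rightarrow> 'a" where
  "vec3 a b c = (\<lambda>i. if i = 0 then a else if i = 1 then b else if i = 2 then c else 0)"

lemma vec3_simps [simp]: "vec3 a b c 0 = a" "vec3 a b c 1 = b" "vec3 a b c (Suc 0) = b" "vec3 a b c 2 = c"
    "i > 2 \<Longrightarrow> vec3 a b c i = 0"
  by (auto simp: vec3_def)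

lemma vec3_map: "h 0 = 0 \<Longrightarrow> (\<lambda>i. h (vec3 a b c i)) = vec3 (h a) (h b) (h c)"
  by (auto simp: vec3_def)

lemma vec3_scale: "(\<lambda>i. (t::'a::mult_zero) * vec3 a b c i) = vec3 (t * a) (t * b) (t * c)"
  by (auto simp: vec3_def)

lemma vec3_eq_iff: "vec3 a b c = vec3 a' b' c' \<longleftrightarrow> a = a' \<and> b = b' \<and> c = c'"
  by (metis vec3_simps(1,2,4))

section \<open>The curve\<close>

text \<open>
  \<open>C\<^sub>d\<close> is the plane curve \<open>x\<^sub>1\<^sup>d = (x\<^sub>0\<^bsup>d-1\<^esup> - x\<^sub>2\<^bsup>d-1\<^esup>) x\<^sub>2\<close>, with a single point \<open>[1:0:0]\<close> at infinity.
  Its function field is realised as the field generated by the Laurent expansions \<open>xs\<close>, \<open>ys\<close>, at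
  infinity, of the affine coordinates; the local parameter is chosen with \<open>ys = X\<^bsup>-(d-1)\<^esup>\<close>.
\<close>

locale plane_curve =
  fixes d :: nat
  assumes d4: "d \<ge> 4"
begin

text \<open>With y = X^(-(d-1)) the equation x^(d-1) = y^d + 1 asks for x = X^(-d) rho with
  rho^(d-1) = 1 + X^(d(d-1)). The function passed to \<open>fps_radical\<close> selects 1 as the
  root of the constant term.\<close>

definition rho :: "complex fps" where
  "rho = fps_radical (\<lambda>_ _. 1) (d - 1) (1 + fps_X ^ (d * (d - 1)))"

lemma rho_power: "rho ^ (d - 1) = 1 + fps_X ^ (d * (d - 1))"
proof -
  obtain k where k: "d - 1 = Suc k" using d4 by (cases "d - 1") auto
  have "(1 + fps_X ^ (d * (d - 1)) :: complex fps) $ 0 = 1" using d4 by simp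
  then show ?thesis unfolding rho_def k by (subst power_radical[symmetric]) (simp_all add: k)
qed

lemma rho_0 [simp]: "rho $ 0 = 1"
  using d4 by (simp add: rho_def)

lemma rho_nz [simp]: "rho \<noteq> 0"
  using rho_0 by (metis fps_zero_nth zero_neq_one)

lemma subdegree_rho [simp]: "subdegree rho = 0"
  by (rule subdegree_eq_0) simp

text \<open>\<open>rho - 1\<close> divides \<open>rho\<^bsup>d-1\<^esup> - 1 = X\<^bsup>d(d-1)\<^esup>\<close> with a cofactor that is a unit.\<close>

lemma rho_expansion: "\<exists>\<theta>. rho = 1 + fps_X ^ (d * (d - 1)) * \<theta>"
proof -
  let ?s = "\<Sum>i<d - 1. rho ^ i"
  have "(rho - 1) * ?s = rho ^ (d - 1) - 1"
    by (rule power_diff_1_eq[symmetric])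
  then have a: "(rho - 1) * ?s = fps_X ^ (d * (d - 1))" by (simp add: rho_power del: One_nat_def)
  have "?s $ 0 = of_nat (d - 1)" by (simp add: fps_sum_nth fps_nth_power_0)
  then have "?s $ 0 \<noteq> 0" using d4 by simp
  then have i: "?s * inverse ?s = 1" using inverse_mult_eq_1[of ?s] by (simp add: mult.commute)
  have "(rho - 1) * (?s * inverse ?s) = fps_X ^ (d * (d - 1)) * inverse ?s"
    unfolding mult.assoc[symmetric] a ..
  then have "rho = 1 + fps_X ^ (d * (d - 1)) * inverse ?s"
    unfolding i by (simp add: algebra_simps)
  then show ?thesis by blast
qed

lemma rho_power_expansion: "\<exists>\<theta>. rho ^ i = 1 + fps_X ^ (d * (d - 1)) * \<theta>"
proof (induction i)
  case (Suc i)
  obtain \<theta> where t: "rho = 1 + fps_X ^ (d * (d - 1)) * \<theta>" using rho_expansion by blast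
  obtain \<theta>' where t': "rho ^ i = 1 + fps_X ^ (d * (d - 1)) * \<theta>'" using Suc by blast
  have "rho ^ Suc i = rho * rho ^ i" by simp
  also have "\<dots> = (1 + fps_X ^ (d * (d - 1)) * \<theta>) * (1 + fps_X ^ (d * (d - 1)) * \<theta>')"
    using t t' by simp
  also have "\<dots> = 1 + fps_X ^ (d * (d - 1)) * (\<theta> + \<theta>' + fps_X ^ (d * (d - 1)) * \<theta> * \<theta>')"
    by (simp add: algebra_simps)
  finally show ?case by blast
qed (auto intro: exI[of _ 0])

definition xs :: "complex fls" where "xs = fls_X_inv ^ d * fps_to_fls rho"

definition ys :: "complex fls" where "ys = fls_X_inv ^ (d - 1)"

lemma xs_nz [simp]: "xs \<noteq> 0"
  by (simp add: xs_def)

lemma ys_nz [simp]: "ys \<noteq> 0"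
  by (simp add: ys_def)

lemma subdegree_xs: "fls_subdegree xs = - int d"
  by (simp add: xs_def fls_subdegree_fls_to_fps)

lemma subdegree_ys: "fls_subdegree ys = - int (d - 1)"
  by (simp add: ys_def)

lemma X_inv_mult_X: "fls_X_inv ^ n * fls_X ^ n = (1 :: complex fls)"
  by (simp add: flip: power_mult_distrib fls_inverse_X)

lemma xs_power_eq: "xs ^ (d - 1) = ys ^ d + 1"
proof -
  have "xs ^ (d - 1) = fls_X_inv ^ (d * (d - 1)) * fps_to_fls (rho ^ (d - 1))"
    by (simp add: xs_def power_mult_distrib fps_to_fls_power power_mult)
  also have "fps_to_fls (rho ^ (d - 1)) = 1 + fls_X ^ (d * (d - 1))"
    by (simp add: rho_power fps_to_fls_power)
  finally have "xs ^ (d - 1) = fls_X_inv ^ (d * (d - 1)) + fls_X_inv ^ (d * (d - 1)) * fls_X ^ (d * (d - 1))"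
    by (simp add: algebra_simps)
  then show ?thesis by (simp only: X_inv_mult_X) (simp add: ys_def mult.commute flip: power_mult)
qed

text \<open>Expansions of y/x and 1/x, the coordinates of the chart around the point at infinity;
  \<open>us\<close> has order 1 and \<open>ws\<close> has order d.\<close>

definition us :: "complex fps" where "us = fps_X * inverse rho"

definition ws :: "complex fps" where "ws = fps_X ^ d * inverse rho"

lemma inv_rho: "fps_to_fls (inverse rho) * fps_to_fls rho = 1"
  by (simp add: inverse_mult_eq_1 flip: fls_times_fps_to_fls)

lemma ws_eq: "fps_to_fls ws = inverse xs"
proof -
  have "fps_to_fls ws * xs = (fls_X_inv ^ d * fls_X ^ d) * (fps_to_fls (inverse rho) * fps_to_fls rho)"
    by (simp add: ws_def xs_def fls_times_fps_to_fls fps_to_fls_power mult_ac)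
  also have "\<dots> = 1" by (simp only: X_inv_mult_X inv_rho mult_1)
  finally show ?thesis by (simp add: field_simps)
qed

lemma us_eq: "fps_to_fls us = ys / xs"
proof -
  have "d = Suc (d - 1)" using d4 by simp
  then have p: "(fls_X_inv ^ d :: complex fls) = fls_X_inv * fls_X_inv ^ (d - 1)" by (metis power_Suc)
  have one: "(fls_X * fls_X_inv :: complex fls) = 1" using X_inv_mult_X[of 1] by (simp add: mult.commute)
  have "fps_to_fls us * xs = ((fls_X * fls_X_inv) * fls_X_inv ^ (d - 1)) * (fps_to_fls (inverse rho) * fps_to_fls rho)"
    by (simp add: us_def xs_def fls_times_fps_to_fls mult_ac p)
  also have "\<dots> = ys" by (simp only: one inv_rho mult_1 mult_1_right ys_def)
  finally show ?thesis by (simp add: field_simps)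
qed

lemma us_0 [simp]: "us $ 0 = 0" and ws_0 [simp]: "ws $ 0 = 0"
  using d4 by (auto simp: us_def ws_def)

lemma us_1 [simp]: "us $ 1 = 1" and ws_1 [simp]: "ws $ 1 = 0"
  using d4 by (auto simp: us_def ws_def fps_X_power_mult_nth)

text \<open>Normal forms modulo the curve equation, which is monic of degree d in y: the expansion
  at infinity and, in \<open>nfv\<close>, the value at an affine point, for the same family of
  coefficients.\<close>

definition nf :: "(nat \<Rightarrow> complex poly) \<Rightarrow> complex fls" where
  "nf p = (\<Sum>j<d. PE xs (p j) * ys ^ j)"

definition nfv :: "(nat \<Rightarrow> complex poly) \<Rightarrow> complex \<Rightarrow> complex \<Rightarrow> complex" where
  "nfv p a b = (\<Sum>j<d. poly (p j) a * b ^ j)"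

lemma PE_xs_subdegree:
  "q \<noteq> 0 \<Longrightarrow> PE xs q \<noteq> 0 \<and> fls_subdegree (PE xs q) = - int (d * degree q)"
  using PE_subdegree[of xs q] d4 by (simp add: subdegree_xs mult.commute)

lemma nf_term_subdegree:
  assumes "q \<noteq> 0"
  shows "PE xs q * ys ^ j \<noteq> 0" "fls_subdegree (PE xs q * ys ^ j) = - int (d * degree q + (d - 1) * j)"
  using PE_xs_subdegree[OF assms] by (simp_all add: fls_subdegree_pow subdegree_ys mult.commute)

text \<open>Modulo d the weight is -j, which determines j below d, and then i.\<close>

lemma weight_inj:
  assumes "j < d" "j' < d" "d * i + (d - 1) * j = d * i' + (d - 1) * j'"
  shows "i = i' \<and> j = j'"
proof -
  have e: "int d * int i + (int d - 1) * int j = int d * int i' + (int d - 1) * int j'"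
    using arg_cong[OF assms(3), of int] d4 by (simp add: of_nat_diff)
  then have "int j' - int j = int d * (int i' + int j' - int i - int j)" by (simp add: algebra_simps)
  then have "int d dvd (int j' - int j)" by simp
  then have "int j' - int j = 0" using assms(1,2) dvd_imp_le_int[of "int j' - int j" "int d"] by linarith
  then have j: "j = j'" by simp
  then show ?thesis using assms(3) d4 by simp
qed

text \<open>By \<open>weight_inj\<close> the terms have distinct pole orders, so none of them can be
  cancelled. In particular normal forms are unique.\<close>

lemma nf_subdegree:
  assumes "j < d" "p j \<noteq> 0"
  shows "nf p \<noteq> 0 \<and> fls_subdegree (nf p) \<le> - int (d * degree (p j) + (d - 1) * j)"
proof -
  let ?S = "{j. j < d \<and> p j \<noteq> 0}"
  let ?f = "\<lambda>j. PE xs (p j) * ys ^ j"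
  have e: "nf p = sum ?f ?S"
    unfolding nf_def by (rule sum.mono_neutral_right) auto
  have "inj_on (\<lambda>j. fls_subdegree (?f j)) ?S"
  proof (rule inj_onI)
    fix i j assume "i \<in> ?S" "j \<in> ?S" "fls_subdegree (?f i) = fls_subdegree (?f j)"
    then show "i = j" using nf_term_subdegree[of "p i" i] nf_term_subdegree[of "p j" j]
      weight_inj[of i j "degree (p i)" "degree (p j)"] by (simp del: of_nat_add of_nat_mult)
  qed
  then have "sum ?f ?S \<noteq> 0 \<and> (\<forall>j\<in>?S. fls_subdegree (sum ?f ?S) \<le> fls_subdegree (?f j))"
    using fls_sum_subdegree[of ?S ?f] assms nf_term_subdegree(1) by auto
  then show ?thesis using assms nf_term_subdegree(2)[of "p j" j] unfolding e by force
qed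

lemma nf_eq_0: "nf p = 0 \<Longrightarrow> j < d \<Longrightarrow> p j = 0"
  using nf_subdegree by blast

lemma nf_add: "nf p + nf q = nf (\<lambda>j. p j + q j)" "nfv p a b + nfv q a b = nfv (\<lambda>j. p j + q j) a b"
  by (simp_all add: nf_def nfv_def PE_add algebra_simps sum.distrib)

lemma nf_PE_mult: "PE xs c * nf p = nf (\<lambda>j. c * p j)" "poly c a * nfv p a b = nfv (\<lambda>j. c * p j) a b"
  by (simp_all add: nf_def nfv_def PE_mult sum_distrib_left mult_ac)

lemma PE_xs_pole: "PE xs [:0, 1:] = xs"
  by (simp add: PE_pCons)

definition Aff :: "(complex \<times> complex) set" where
  "Aff = {(a, b). b ^ d = a ^ (d - 1) - 1}"

definition curve_poly :: "complex poly" where "curve_poly = monom 1 (d - 1) - 1"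

lemma PE_monom: "PE e (monom 1 n) = e ^ n"
proof (induction n)
  case (Suc n)
  then show ?case by (simp add: monom_Suc PE_pCons)
qed (simp add: monom_0)

lemma curve_poly_eval: "PE xs curve_poly = ys ^ d" "poly curve_poly a = a ^ (d - 1) - 1"
  by (simp_all add: curve_poly_def PE_simps PE_monom xs_power_eq poly_monom)

definition shift_y :: "(nat \<Rightarrow> complex poly) \<Rightarrow> nat \<Rightarrow> complex poly" where
  "shift_y p = (\<lambda>j. if j = 0 then curve_poly * p (d - 1) else p (j - 1))"

lemma nf_mult_y: "ys * nf p = nf (shift_y p)"
    "(a, b) \<in> Aff \<Longrightarrow> b * nfv p a b = nfv (shift_y p) a b"
proof -
  obtain n where n: "d = Suc n" using d4 by (cases d) auto
  have r: "{..<d} = {..<Suc n}" "d - 1 = n" using n by auto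
  have "nf (shift_y p) = PE xs curve_poly * PE xs (p n) + (\<Sum>j<n. PE xs (p j) * ys ^ Suc j)"
    unfolding nf_def r(1) sum.lessThan_Suc_shift by (simp add: shift_y_def r(2) PE_mult)
  moreover have "ys * nf p = (\<Sum>j<n. PE xs (p j) * ys ^ Suc j) + ys ^ Suc n * PE xs (p n)"
    unfolding nf_def r(1) sum.lessThan_Suc by (simp add: algebra_simps sum_distrib_left)
  ultimately show "ys * nf p = nf (shift_y p)"
    by (simp add: curve_poly_eval(1) n[symmetric])
  assume "(a, b) \<in> Aff"
  then have c: "poly curve_poly a = b ^ d" by (simp add: curve_poly_eval Aff_def)
  have "nfv (shift_y p) a b = poly curve_poly a * poly (p n) a + (\<Sum>j<n. poly (p j) a * b ^ Suc j)"
    unfolding nfv_def r(1) sum.lessThan_Suc_shift by (simp add: shift_y_def r(2))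
  moreover have "b * nfv p a b = (\<Sum>j<n. poly (p j) a * b ^ Suc j) + b ^ Suc n * poly (p n) a"
    unfolding nfv_def r(1) sum.lessThan_Suc by (simp add: algebra_simps sum_distrib_left)
  ultimately show "b * nfv p a b = nfv (shift_y p) a b"
    by (simp add: c n[symmetric])
qed

text \<open>
  Simultaneous reduction modulo the curve equation of an element of the function field and of the
  function it defines on the affine part of the curve.
\<close>

definition reduces :: "complex fls \<Rightarrow> (complex \<Rightarrow> complex \<Rightarrow> complex) \<Rightarrow> bool" where
  "reduces e f \<longleftrightarrow> (\<exists>p. e = nf p \<and> (\<forall>(a, b)\<in>Aff. f a b = nfv p a b))"

lemma reducesI: "e = nf p \<Longrightarrow> (\<And>a b. (a, b) \<in> Aff \<Longrightarrow> f a b = nfv p a b) \<Longrightarrow> reduces e f"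
  unfolding reduces_def by blast

lemma reducesE:
  assumes "reduces e f"
  obtains p where "e = nf p" "\<And>a b. (a, b) \<in> Aff \<Longrightarrow> f a b = nfv p a b"
  using assms unfolding reduces_def by blast

lemma reduces_add:
  assumes "reduces e f" "reduces e' f'"
  shows "reduces (e + e') (\<lambda>a b. f a b + f' a b)"
proof -
  obtain p where p: "e = nf p" "\<And>a b. (a, b) \<in> Aff \<Longrightarrow> f a b = nfv p a b" using assms(1) by (rule reducesE) blast
  obtain q where q: "e' = nf q" "\<And>a b. (a, b) \<in> Aff \<Longrightarrow> f' a b = nfv q a b" using assms(2) by (rule reducesE) blast
  show ?thesis by (rule reducesI[of _ "\<lambda>j. p j + q j"]) (simp_all add: p q nf_add)
qed

lemma reduces_PE: "reduces e f \<Longrightarrow> reduces (PE xs c * e) (\<lambda>a b. poly c a * f a b)"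
  by (erule reducesE, rule reducesI[OF arg_cong[where f = "(*) (PE xs c)", THEN trans, OF _ nf_PE_mult(1)]])
     (simp_all add: nf_PE_mult)

lemma reduces_cmult: "reduces e f \<Longrightarrow> reduces (fls_const c * e) (\<lambda>a b. c * f a b)"
  using reduces_PE[of e f "[:c:]"] by simp

lemma reduces_x: "reduces e f \<Longrightarrow> reduces (xs * e) (\<lambda>a b. a * f a b)"
  using reduces_PE[of e f "[:0,1:]"] by (simp add: PE_xs_pole)

lemma reduces_y: "reduces e f \<Longrightarrow> reduces (ys * e) (\<lambda>a b. b * f a b)"
  by (erule reducesE, rule reducesI[OF arg_cong[where f = "(*) ys", THEN trans, OF _ nf_mult_y(1)]])
     (simp_all add: nf_mult_y)

lemma reduces_0: "reduces 0 (\<lambda>a b. 0)"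
  unfolding reduces_def by (rule exI[of _ "\<lambda>_. 0"]) (auto simp: nf_def nfv_def)

lemma reduces_1: "reduces 1 (\<lambda>a b. 1)"
proof -
  have "nf (\<lambda>j. if j = 0 then 1 else 0) = (\<Sum>j<d. if j = 0 then 1 else 0)"
    unfolding nf_def by (rule sum.cong) (auto simp: PE_simps)
  moreover have "nfv (\<lambda>j. if j = 0 then 1 else 0) a b = (\<Sum>j<d. if j = 0 then 1 else 0)" for a b
    unfolding nfv_def by (rule sum.cong) auto
  ultimately show ?thesis
    unfolding reduces_def using d4 by (intro exI[of _ "\<lambda>j. if j = 0 then 1 else 0"]) auto
qed

lemma reduces_xy: "reduces (xs ^ i * ys ^ j) (\<lambda>a b. a ^ i * b ^ j)"
proof (induction i)
  case 0
  show ?case by (induction j) (auto simp: reduces_1 dest: reduces_y)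
next
  case (Suc i)
  then show ?case using reduces_x by (fastforce simp: mult.assoc)
qed

lemma reduces_sum:
  "(\<And>x. x \<in> A \<Longrightarrow> reduces (e x) (f x)) \<Longrightarrow> reduces (\<Sum>x\<in>A. e x) (\<lambda>a b. \<Sum>x\<in>A. f x a b)"
  by (induction A rule: infinite_finite_induct) (auto simp: reduces_0 intro: reduces_add)

lemma mon_eval_vec3:
  fixes a b c :: "'a::comm_ring_1"
  shows "mon_eval (vec3 a b c) m = (if Poly_Mapping.keys m \<subseteq> {..2} then
     a ^ Poly_Mapping.lookup m 0 * b ^ Poly_Mapping.lookup m 1 * c ^ Poly_Mapping.lookup m 2 else 0)"
proof (cases "Poly_Mapping.keys m \<subseteq> {..2}")
  case True
  have "{..2::nat} = {0,1,2}" by auto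
  then show ?thesis using True by (simp add: mon_eval_superset[of "{..2}"] mult.assoc)
next
  case False
  then obtain i where i: "i \<in> Poly_Mapping.keys m" "i > 2" by (meson atMost_iff not_le subsetI)
  then have "vec3 a b c i ^ Poly_Mapping.lookup m i = 0" by (simp add: in_keys_iff zero_power)
  then have "mon_eval (vec3 a b c) m = 0" unfolding mon_eval_def using i by (subst prod.remove[of _ i]) auto
  then show ?thesis using False by simp
qed

definition ev :: "mpoly \<Rightarrow> complex fls" where
  "ev F = gev fls_const F (vec3 xs ys 1)"

lemma rhom_ev: "rhom ev"
  unfolding ev_def by (rule gev_rhom[OF rhom_fls_const])

lemmas ev_simps = rhom_simps[OF rhom_ev]

lemma ev_var [simp]: "ev (mvar 0) = xs" "ev (mvar 1) = ys" "ev (mvar 2) = 1"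
  by (simp_all add: ev_def gev_var[OF rhom_fls_const])

lemma ev_const [simp]: "ev (mconst c) = fls_const c"
  by (simp add: ev_def gev_const[OF rhom_fls_const])

lemma reduces_ev: "reduces (ev F) (\<lambda>a b. peval F (vec3 a b 1))"
  unfolding ev_def peval_gev gev_def
proof (rule reduces_sum)
  fix m
  show "reduces (fls_const (Poly_Mapping.lookup F m) * mon_eval (vec3 xs ys 1) m)
     (\<lambda>a b. Poly_Mapping.lookup F m * mon_eval (vec3 a b 1) m)"
    by (rule reduces_cmult) (auto simp: mon_eval_vec3 reduces_0 reduces_xy)
qed

lemma finite_fibre: "finite {b::complex. b ^ d = c}"
proof -
  have "{b::complex. b ^ d = c} \<subseteq> {b. poly (monom 1 d - [:c:]) b = 0}" by (auto simp: poly_monom)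
  moreover have "monom 1 d - [:c:] \<noteq> (0 :: complex poly)"
  proof
    assume "monom 1 d - [:c:] = 0"
    then have "coeff (monom 1 d - [:c:]) d = 0" by simp
    then show False using d4 by (cases d) auto
  qed
  ultimately show ?thesis using poly_roots_finite finite_subset by blast
qed

text \<open>The fibre over such an a has d points, while \<open>nfv p a\<close> is a polynomial of
  degree less than d in b.\<close>

lemma nfv_zero_fibre:
  assumes "a ^ (d - 1) \<noteq> 1" "\<And>b. (a, b) \<in> Aff \<Longrightarrow> nfv p a b = 0" "j < d"
  shows "poly (p j) a = 0"
proof -
  let ?P = "\<Sum>j<d. monom (poly (p j) a) j"
  have P: "poly ?P b = nfv p a b" for b by (simp add: poly_sum poly_monom nfv_def)
  have co: "coeff ?P j = (if j < d then poly (p j) a else 0)" for j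
    by (simp add: coeff_sum)
  have "?P = 0"
  proof (rule ccontr)
    assume nz: "?P \<noteq> 0"
    have "degree ?P < d"
    proof (rule ccontr)
      assume "\<not> degree ?P < d"
      then have "coeff ?P (degree ?P) = 0" using co by simp
      then show False using nz by simp
    qed
    moreover have "card {b. b ^ d = a ^ (d - 1) - 1} = d"
      using card_nth_roots[of "a ^ (d - 1) - 1" d] assms(1) d4 by simp
    moreover have "card {b. b ^ d = a ^ (d - 1) - 1} \<le> card {b. poly ?P b = 0}"
      using assms(2) nz by (intro card_mono poly_roots_finite) (auto simp: P Aff_def)
    moreover have "card {b. poly ?P b = 0} \<le> degree ?P" by (rule card_poly_roots_bound[OF nz])
    ultimately show False by simp
  qed
  then show ?thesis using co[of j] assms(3) by simp
qed

lemma finite_roots_of_unity: "finite {a::complex. a ^ (d - 1) = 1}"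
proof -
  have "{a::complex. a ^ (d - 1) = 1} \<subseteq> {a. poly curve_poly a = 0}" by (auto simp: curve_poly_eval)
  moreover have "curve_poly \<noteq> 0" using curve_poly_eval(1) by (metis PE_0 power_not_zero ys_nz)
  ultimately show ?thesis using poly_roots_finite finite_subset by blast
qed

text \<open>All fibres but finitely many are unramified and avoid the exceptional points, so each
  coefficient has infinitely many roots.\<close>

lemma nfv_zero_cofinite:
  assumes "finite {(a, b) \<in> Aff. nfv p a b \<noteq> 0}" "j < d"
  shows "p j = 0"
proof (rule ccontr)
  assume nz: "p j \<noteq> 0"
  let ?E = "fst ` {(a, b) \<in> Aff. nfv p a b \<noteq> 0} \<union> {a. a ^ (d - 1) = 1}"
  have "a \<in> ?E \<or> poly (p j) a = 0" for a
    using nfv_zero_fibre[of a p j] assms(2) by force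
  then have "UNIV \<subseteq> ?E \<union> {a. poly (p j) a = 0}" by blast
  moreover have "finite (?E \<union> {a. poly (p j) a = 0})"
    using assms(1) finite_roots_of_unity poly_roots_finite[OF nz] by simp
  ultimately have "finite (UNIV :: complex set)" using finite_subset by blast
  then show False using infinite_UNIV_char_0 by blast
qed

text \<open>Bridge between the two models: by uniqueness of normal forms an expansion is zero
  exactly when all coefficients are, and the coefficients are also zero as soon as the function
  vanishes off a finite set.\<close>

lemma reduces_zero_iff:
  assumes "reduces e f"
  shows "finite {(a, b) \<in> Aff. f a b \<noteq> 0} \<Longrightarrow> e = 0" "e = 0 \<Longrightarrow> (a, b) \<in> Aff \<Longrightarrow> f a b = 0"
proof -
  obtain p where p: "e = nf p" "\<And>a b. (a, b) \<in> Aff \<Longrightarrow> f a b = nfv p a b"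
    using assms unfolding reduces_def by auto
  have "{(a, b) \<in> Aff. f a b \<noteq> 0} = {(a, b) \<in> Aff. nfv p a b \<noteq> 0}" using p by auto
  then show "e = 0" if "finite {(a, b) \<in> Aff. f a b \<noteq> 0}"
    using nfv_zero_cofinite[of p] that by (simp add: p nf_def)
  show "f a b = 0" if "e = 0" "(a, b) \<in> Aff"
    using nf_eq_0[of p] that p by (simp add: nfv_def)
qed

end

unbundle fps_syntax

section \<open>Norms\<close>

context plane_curve
begin

section \<open>Automorphisms of the cyclic covering given by x\<close>

definition sg :: "complex \<Rightarrow> complex fls \<Rightarrow> complex fls" where
  "sg \<eta> e = fls_compose_fps e (fps_const \<eta> * fps_X)"

lemma sg_nth: "\<eta> \<noteq> 0 \<Longrightarrow> sg \<eta> e $$ n = e $$ n * \<eta> powi n"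
  unfolding sg_def by (rule fls_nth_fls_compose_fps_linear)

lemma sg_const [simp]: "\<eta> \<noteq> 0 \<Longrightarrow> sg \<eta> (fls_const c) = fls_const c"
  by (rule fls_eqI) (simp add: sg_nth)

lemma rhom_sg:
  assumes "\<eta> \<noteq> 0"
  shows "rhom (sg \<eta>)"
proof -
  have nz: "fps_const \<eta> * fps_X \<noteq> 0" "(fps_const \<eta> * fps_X) $ 0 = 0" using assms by auto
  have "sg \<eta> 1 = 1" using sg_const[OF assms, of 1] by simp
  then show ?thesis unfolding rhom_def
    by (simp add: sg_def fls_compose_fps_mult[OF nz] fls_compose_fps_add[OF nz])
qed

lemma sg_eq_0_iff: "\<eta> \<noteq> 0 \<Longrightarrow> sg \<eta> e = 0 \<longleftrightarrow> e = 0"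
  by (auto simp: fls_eq_iff sg_nth)

lemma sg_sg: "\<eta> \<noteq> 0 \<Longrightarrow> \<zeta> \<noteq> 0 \<Longrightarrow> sg \<zeta> (sg \<eta> e) = sg (\<zeta> * \<eta>) e"
  by (rule fls_eqI) (simp add: sg_nth power_int_mult_distrib mult_ac)

lemma sg_one [simp]: "sg 1 e = e"
  by (rule fls_eqI) (simp add: sg_nth)

definition Rts :: "complex set" where "Rts = {\<eta>. \<eta> ^ d = 1}"

lemma Rts_nz: "\<eta> \<in> Rts \<Longrightarrow> \<eta> \<noteq> 0"
  using d4 by (auto simp: Rts_def power_0_left)

lemma finite_Rts: "finite Rts"
  unfolding Rts_def by (rule finite_fibre)

lemma card_Rts: "card Rts = d"
  using card_nth_roots[of 1 d] d4 by (simp add: Rts_def)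

lemma Rts_mult: "\<eta> \<in> Rts \<Longrightarrow> \<zeta> \<in> Rts \<Longrightarrow> \<eta> * \<zeta> \<in> Rts"
  by (simp add: Rts_def power_mult_distrib)

lemma sg_ys:
  assumes "\<eta> \<in> Rts"
  shows "sg \<eta> ys = fls_const \<eta> * ys"
proof (rule fls_eqI)
  fix n
  have "\<eta> * \<eta> ^ (d - 1) = 1" using assms d4 by (simp add: Rts_def flip: power_Suc)
  then have "\<eta> = inverse (\<eta> ^ (d - 1))" by (metis inverse_unique mult.commute)
  then have "\<eta> powi (- int (d - 1)) = \<eta>" by (simp add: power_int_minus)
  then show "sg \<eta> ys $$ n = (fls_const \<eta> * ys) $$ n"
    by (simp add: sg_nth[OF Rts_nz[OF assms]] ys_def)
qed

text \<open>Both sides are (d-1)-th roots, with constant term 1, of 1 + X^(d(d-1)), which is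
  invariant under X -> \<eta> X; such a root is unique.\<close>

lemma rho_compose:
  assumes "\<eta> \<in> Rts"
  shows "fps_compose rho (fps_const \<eta> * fps_X) = rho"
proof -
  let ?c = "fps_const \<eta> * fps_X"
  let ?b = "1 + fps_X ^ (d * (d - 1)) :: complex fps"
  have d1: "d - 1 = Suc (d - 2)" using d4 by simp
  have c0: "?c $ 0 = 0" by simp
  have "fps_compose rho ?c ^ (d - 1) = fps_compose (rho ^ (d - 1)) ?c"
    by (rule fps_compose_power[OF c0])
  also have "\<dots> = 1 + ?c ^ (d * (d - 1))"
    unfolding rho_power by (simp add: fps_compose_add_distrib fps_X_power_compose)
  also have "?c ^ (d * (d - 1)) = fps_X ^ (d * (d - 1))"
    using assms by (simp add: power_mult_distrib fps_const_power Rts_def power_mult)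
  finally have "fps_compose rho ?c ^ Suc (d - 2) = ?b" using d1 by simp
  moreover have "?b $ 0 = 1" using d4 by simp
  ultimately have "fps_compose rho ?c = fps_radical (\<lambda>_ _. 1) (Suc (d - 2)) ?b"
    by (subst radical_unique[symmetric]) auto
  then show ?thesis unfolding rho_def d1 .
qed

lemma sg_xs:
  assumes "\<eta> \<in> Rts"
  shows "sg \<eta> xs = xs"
proof -
  note nz = Rts_nz[OF assms]
  have "sg \<eta> (fls_X_inv ^ d) = fls_X_inv ^ d"
    using assms by (intro fls_eqI) (auto simp: sg_nth[OF nz] Rts_def power_int_minus)
  moreover have "sg \<eta> (fps_to_fls rho) = fps_to_fls rho"
    unfolding sg_def using nz by (subst fls_compose_fps_to_fls) (auto simp: rho_compose[OF assms])
  ultimately show ?thesis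
    by (simp add: xs_def rhom_simps[OF rhom_sg[OF nz]])
qed

lemma sg_PE: "\<eta> \<in> Rts \<Longrightarrow> sg \<eta> (PE xs q) = PE xs q"
  by (induction q) (simp_all add: PE_pCons rhom_simps[OF rhom_sg] Rts_nz sg_xs)

lemma sg_nf:
  assumes "\<eta> \<in> Rts"
  shows "sg \<eta> (nf p) = nf (\<lambda>j. smult (\<eta> ^ j) (p j))"
proof -
  have "fls_const \<eta> ^ j = fls_const (\<eta> ^ j)" for j
    by (simp add: rhom_simps[OF rhom_fls_const])
  then show ?thesis
    by (simp add: nf_def rhom_simps[OF rhom_sg[OF Rts_nz[OF assms]]] sg_PE[OF assms] sg_ys[OF assms]
        power_mult_distrib PE_smult mult_ac)
qed

definition Acoord :: "complex fls set" where "Acoord = range nf"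

lemma Acoord_reduces: "e \<in> Acoord \<longleftrightarrow> (\<exists>f. reduces e f)"
  unfolding Acoord_def reduces_def by auto

lemma reduces_mult:
  assumes "reduces e f" "reduces e' f'"
  shows "reduces (e * e') (\<lambda>a b. f a b * f' a b)"
proof -
  obtain p where p: "e = nf p" "\<And>a b. (a, b) \<in> Aff \<Longrightarrow> f a b = nfv p a b" using assms(1) by (rule reducesE) blast
  have y: "reduces (ys ^ j * e') (\<lambda>a b. b ^ j * f' a b)" for j
  proof (induction j)
    case (Suc j)
    show ?case using reduces_y[OF Suc] by (simp add: mult.assoc)
  qed (use assms in simp)
  have "reduces (\<Sum>j<d. PE xs (p j) * (ys ^ j * e')) (\<lambda>a b. \<Sum>j<d. poly (p j) a * (b ^ j * f' a b))"
    by (intro reduces_sum reduces_PE y)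
  also have "(\<Sum>j<d. PE xs (p j) * (ys ^ j * e')) = e * e'"
    by (simp add: p nf_def sum_distrib_right mult.assoc)
  finally obtain q where q: "e * e' = nf q"
      "\<And>a b. (a, b) \<in> Aff \<Longrightarrow> (\<Sum>j<d. poly (p j) a * (b ^ j * f' a b)) = nfv q a b"
    by (rule reducesE) blast
  show ?thesis
  proof (rule reducesI[OF q(1)])
    fix a b assume ab: "(a, b) \<in> Aff"
    show "f a b * f' a b = nfv q a b"
      unfolding q(2)[OF ab, symmetric] unfolding p(2)[OF ab] nfv_def sum_distrib_right by (simp add: mult.assoc)
  qed
qed

lemma reduces_PE_const: "reduces (PE xs c) (\<lambda>a b. poly c a)"
  using reduces_PE[OF reduces_1, of c] by simp

lemma reduces_const: "reduces (fls_const c) (\<lambda>a b. c)"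
  using reduces_PE_const[of "[:c:]"] by simp

lemma reduces_xs: "reduces xs (\<lambda>a b. a)" and reduces_ys: "reduces ys (\<lambda>a b. b)"
  using reduces_x[OF reduces_1] reduces_y[OF reduces_1] by simp_all

lemma reduces_uminus: "reduces e f \<Longrightarrow> reduces (- e) (\<lambda>a b. - f a b)"
  using reduces_cmult[of e f "-1"] by (simp add: fls_const_uminus)

lemma reduces_diff: "reduces e f \<Longrightarrow> reduces e' f' \<Longrightarrow> reduces (e - e') (\<lambda>a b. f a b - f' a b)"
  using reduces_add[OF _ reduces_uminus, of e f e' f'] by simp

lemma reduces_power: "reduces e f \<Longrightarrow> reduces (e ^ n) (\<lambda>a b. f a b ^ n)"
  by (induction n) (auto simp: reduces_1 intro: reduces_mult)

lemma Acoord_closed: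
  "e \<in> Acoord \<Longrightarrow> e' \<in> Acoord \<Longrightarrow> e + e' \<in> Acoord"
  "e \<in> Acoord \<Longrightarrow> e' \<in> Acoord \<Longrightarrow> e * e' \<in> Acoord"
  "e \<in> Acoord \<Longrightarrow> e' \<in> Acoord \<Longrightarrow> e - e' \<in> Acoord"
  "e \<in> Acoord \<Longrightarrow> - e \<in> Acoord"
  "e \<in> Acoord \<Longrightarrow> e ^ n \<in> Acoord"
  "fls_const c \<in> Acoord" "PE xs q \<in> Acoord" "xs \<in> Acoord" "ys \<in> Acoord" "1 \<in> Acoord" "0 \<in> Acoord"
proof -
  have I: "\<And>e f. reduces e f \<Longrightarrow> e \<in> Acoord" using Acoord_reduces by blast
  show "fls_const c \<in> Acoord" "PE xs q \<in> Acoord" "xs \<in> Acoord" "ys \<in> Acoord" "1 \<in> Acoord" "0 \<in> Acoord"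
    using I[OF reduces_const] I[OF reduces_PE_const] I[OF reduces_xs] I[OF reduces_ys] I[OF reduces_1] I[OF reduces_0]
    by simp_all
  show "- e \<in> Acoord" "e ^ n \<in> Acoord" if "e \<in> Acoord"
    using that I[OF reduces_uminus] I[OF reduces_power] Acoord_reduces by metis+
  show "e + e' \<in> Acoord" "e * e' \<in> Acoord" "e - e' \<in> Acoord" if "e \<in> Acoord" "e' \<in> Acoord"
    using that I[OF reduces_add] I[OF reduces_mult] I[OF reduces_diff] Acoord_reduces by metis+
qed

lemma Acoord_sum: "(\<And>x. x \<in> S \<Longrightarrow> f x \<in> Acoord) \<Longrightarrow> sum f S \<in> Acoord"
  by (induction S rule: infinite_finite_induct) (auto intro: Acoord_closed)

lemma Acoord_prod: "(\<And>x. x \<in> S \<Longrightarrow> f x \<in> Acoord) \<Longrightarrow> prod f S \<in> Acoord"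
  by (induction S rule: infinite_finite_induct) (auto intro: Acoord_closed)

lemma Acoord_sg: "\<eta> \<in> Rts \<Longrightarrow> e \<in> Acoord \<Longrightarrow> sg \<eta> e \<in> Acoord"
  unfolding Acoord_def using sg_nf by auto

text \<open>
  The automorphisms \<open>X \<mapsto> \<eta> X\<close> with \<open>\<eta>\<^sup>d = 1\<close> fix \<open>xs\<close> and multiply \<open>ys\<close> by \<open>\<eta>\<close>, so
  the product of the conjugates of an element of the coordinate ring is a polynomial in \<open>xs\<close>.
\<close>

lemma norm_exists:
  assumes "e \<in> Acoord" "e \<noteq> 0"
  obtains e' c where "e' \<in> Acoord" "c \<noteq> 0" "e * e' = PE xs c"
proof -
  let ?N = "\<Prod>\<eta>\<in>Rts. sg \<eta> e"
  have one: "1 \<in> Rts" by (simp add: Rts_def)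
  have N: "?N = e * (\<Prod>\<eta>\<in>Rts - {1}. sg \<eta> e)"
    using prod.remove[OF finite_Rts one, of "\<lambda>\<eta>. sg \<eta> e"] by simp
  have NA: "?N \<in> Acoord" by (intro Acoord_prod Acoord_sg assms)
  have Nnz: "?N \<noteq> 0" using assms(2) finite_Rts by (simp add: sg_eq_0_iff Rts_nz)
  obtain p where p: "?N = nf p" using NA by (auto simp: Acoord_def)
  have inv: "sg \<zeta> ?N = ?N" if z: "\<zeta> \<in> Rts" for \<zeta>
  proof -
    have "sg \<zeta> ?N = (\<Prod>\<eta>\<in>Rts. sg \<zeta> (sg \<eta> e))" by (rule rhom_simps(10)[OF rhom_sg[OF Rts_nz[OF z]]])
    also have "\<dots> = (\<Prod>\<eta>\<in>Rts. sg (\<zeta> * \<eta>) e)"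
      by (intro prod.cong refl sg_sg Rts_nz z)
    also have "\<dots> = (\<Prod>\<eta>\<in>Rts. sg \<eta> e)"
    proof (rule prod.reindex_bij_betw[of "\<lambda>\<eta>. \<zeta> * \<eta>" Rts Rts "\<lambda>\<eta>. sg \<eta> e"])
      have inj: "inj_on (\<lambda>\<eta>. \<zeta> * \<eta>) Rts" using Rts_nz[OF z] by (auto simp: inj_on_def)
      have "(\<lambda>\<eta>. \<zeta> * \<eta>) ` Rts \<subseteq> Rts" using z Rts_mult by blast
      then show "bij_betw (\<lambda>\<eta>. \<zeta> * \<eta>) Rts Rts"
        unfolding bij_betw_def using inj endo_inj_surj[OF finite_Rts] by blast
    qed
    finally show ?thesis .
  qed
  \<comment> \<open>Invariance says that \<open>p j\<close> equals \<zeta>^j \<open>p j\<close> for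
    all d-th roots of unity \<zeta>; if \<zeta>^j were always 1, the equation z^j = 1 with j < d
    would have d roots.\<close>
  have pj: "p j = 0" if j: "0 < j" "j < d" for j
  proof -
    have "\<exists>\<zeta>\<in>Rts. \<zeta> ^ j \<noteq> 1"
    proof (rule ccontr)
      assume "\<not> ?thesis"
      then have "Rts \<subseteq> {z. z ^ j = 1}" by auto
      moreover have "card {z::complex. z ^ j = 1} = j" "finite {z::complex. z ^ j = 1}"
        using card_nth_roots[of 1 j] j(1) card_ge_0_finite[of "{z::complex. z ^ j = 1}"] by simp_all
      ultimately have "card Rts \<le> j" by (metis card_mono)
      then show False using j card_Rts by simp
    qed
    then obtain \<zeta> where z: "\<zeta> \<in> Rts" "\<zeta> ^ j \<noteq> 1" by blast
    have "nf (\<lambda>j. smult (\<zeta> ^ j) (p j)) = nf p" using inv[OF z(1)] p sg_nf[OF z(1)] by simp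
    then have "nf (\<lambda>j. smult (\<zeta> ^ j) (p j)) + nf (\<lambda>j. smult (-1) (p j)) = 0"
      by (simp add: nf_def sum_negf PE_simps)
    then have "smult (\<zeta> ^ j) (p j) + smult (-1) (p j) = 0"
      unfolding nf_add using nf_eq_0 j(2) by blast
    then have "smult (\<zeta> ^ j - 1) (p j) = 0" by (simp add: smult_diff_left)
    then show ?thesis using z(2) by simp
  qed
  have "nf p = (\<Sum>j<d. if j = 0 then PE xs (p 0) else 0)"
    unfolding nf_def using pj by (intro sum.cong) auto
  then have NP: "?N = PE xs (p 0)" using d4 p by simp
  show thesis
  proof (rule that)
    show "(\<Prod>\<eta>\<in>Rts - {1}. sg \<eta> e) \<in> Acoord" by (intro Acoord_prod Acoord_sg assms) auto
    show "e * (\<Prod>\<eta>\<in>Rts - {1}. sg \<eta> e) = PE xs (p 0)" using N NP by simp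
    show "p 0 \<noteq> 0" using Nnz NP by auto
  qed
qed

lemma finite_Aff_over: "finite A \<Longrightarrow> finite {(a, b) \<in> Aff. a \<in> A}"
proof -
  assume "finite A"
  then have "finite (\<Union>a\<in>A. (\<lambda>b. (a, b)) ` {b. b ^ d = a ^ (d - 1) - 1})" using finite_fibre by blast
  then show ?thesis by (rule finite_subset[rotated]) (auto simp: Aff_def)
qed

text \<open>Multiplying by the conjugates gives a nonzero polynomial in x, and the zeros of f lie
  over its finitely many roots.\<close>

lemma reduces_finite_zeros:
  assumes "reduces e f" "e \<noteq> 0"
  shows "finite {(a, b) \<in> Aff. f a b = 0}"
proof -
  have "e \<in> Acoord" using assms Acoord_reduces by blast
  then obtain e' c where c: "e' \<in> Acoord" "c \<noteq> 0" "e * e' = PE xs c"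
    using norm_exists[OF _ assms(2)] by blast
  obtain f' where f': "reduces e' f'" using c(1) Acoord_reduces by blast
  have r: "reduces (e * e' - PE xs c) (\<lambda>a b. f a b * f' a b - poly c a)"
    by (intro reduces_diff reduces_mult assms f' reduces_PE_const)
  have "poly c a = 0" if "(a, b) \<in> Aff" "f a b = 0" for a b
    using reduces_zero_iff(2)[OF r _ that(1)] c(3) that(2) by simp
  then have "{(a, b) \<in> Aff. f a b = 0} \<subseteq> {(a, b) \<in> Aff. a \<in> {a. poly c a = 0}}" by auto
  moreover have "finite \<dots>" by (intro finite_Aff_over poly_roots_finite c)
  ultimately show ?thesis by (rule finite_subset)
qed

lemma infinite_Aff: "infinite Aff"
proof
  assume "finite Aff"
  then have "finite {(a, b) \<in> Aff. (1::complex) \<noteq> 0}" by (simp add: case_prod_beta')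
  then show False using reduces_zero_iff(1)[OF reduces_1] by simp
qed

section \<open>Points of the curve and vanishing of forms\<close>

definition pt :: "complex \<Rightarrow> complex \<Rightarrow> point" where "pt a b = proj_point (vec3 a b 1)"

definition infp :: point where "infp = proj_point (vec3 1 0 0)"

definition curve :: "point set" where "curve = insert infp {pt a b | a b. (a, b) \<in> Aff}"

lemma pt_eq_iff [simp]: "pt a b = pt a' b' \<longleftrightarrow> a = a' \<and> b = b'"
  unfolding pt_def proj_point_eq_iff vec3_scale vec3_eq_iff by auto

lemma infp_neq [simp]: "infp \<noteq> pt a b" "pt a b \<noteq> infp"
  unfolding pt_def infp_def proj_point_eq_iff vec3_scale vec3_eq_iff by auto

lemma infp_curve [simp]: "infp \<in> curve"
  by (simp add: curve_def)

lemma pt_curve [simp]: "pt a b \<in> curve \<longleftrightarrow> (a, b) \<in> Aff"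
  by (auto simp: curve_def)

lemma curve_cases:
  assumes "p \<in> curve"
  obtains "p = infp" | a b where "p = pt a b" "(a, b) \<in> Aff"
  using assms by (auto simp: curve_def)

lemma curve_space: "curve \<subseteq> proj_space 2"
proof
  fix p assume "p \<in> curve"
  then show "p \<in> proj_space 2"
  proof (cases rule: curve_cases)
    case 1
    show ?thesis unfolding 1 infp_def by (rule proj_point_in_space[of _ 0]) auto
  next
    case (2 a b)
    show ?thesis unfolding 2 pt_def by (rule proj_point_in_space[of _ 2]) auto
  qed
qed

lemma finite_curve_iff:
  assumes "S \<subseteq> curve"
  shows "finite S \<longleftrightarrow> finite {(a, b) \<in> Aff. pt a b \<in> S}"
proof
  have i: "inj_on (\<lambda>(a, b). pt a b) T" for T by (auto simp: inj_on_def)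
  assume "finite S"
  then have "finite ((\<lambda>(a, b). pt a b) ` {(a, b) \<in> Aff. pt a b \<in> S})"
    by (rule finite_subset[rotated]) auto
  then show "finite {(a, b) \<in> Aff. pt a b \<in> S}" using finite_imageD i by blast
next
  assume f: "finite {(a, b) \<in> Aff. pt a b \<in> S}"
  have "S \<subseteq> insert infp ((\<lambda>(a, b). pt a b) ` {(a, b) \<in> Aff. pt a b \<in> S})"
    using assms by (force elim!: curve_cases)
  then show "finite S" using f finite_subset by blast
qed

lemma infinite_curve: "infinite curve"
proof -
  have "{(a, b) \<in> Aff. pt a b \<in> curve} = Aff" by auto
  then show ?thesis using finite_curve_iff[of curve] infinite_Aff by simp
qed

lemma vanishes_pt: "homogeneous n F \<Longrightarrow> vanishes F (pt a b) \<longleftrightarrow> peval F (vec3 a b 1) = 0"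
  unfolding pt_def by (rule vanishes_proj_point)

lemma vanishes_infp: "homogeneous n F \<Longrightarrow> vanishes F infp \<longleftrightarrow> peval F (vec3 1 0 0) = 0"
  unfolding infp_def by (rule vanishes_proj_point)

text \<open>Value in the chart around the point at infinity. It is a power series, whose constant
  coefficient is the value of the form at \<open>infp\<close> (\<open>evi_0\<close>).\<close>

definition evi :: "mpoly \<Rightarrow> complex fps" where "evi F = gev fps_const F (vec3 1 us ws)"

lemma ev_evi:
  assumes "homogeneous n F"
  shows "ev F = xs ^ n * fps_to_fls (evi F)"
proof -
  have "fps_to_fls (evi F) = gev fls_const F (\<lambda>i. fps_to_fls (vec3 1 us ws i))"
    unfolding evi_def gev_hom[OF rhom_fps_to_fls] by simp
  also have "(\<lambda>i. fps_to_fls (vec3 1 us ws i)) = vec3 1 (ys / xs) (inverse xs)"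
    by (subst vec3_map) (simp_all add: us_eq ws_eq)
  finally have "xs ^ n * fps_to_fls (evi F) = gev fls_const F (\<lambda>i. xs * vec3 1 (ys / xs) (inverse xs) i)"
    using gev_scale[OF assms] by metis
  also have "(\<lambda>i. xs * vec3 1 (ys / xs) (inverse xs) i) = vec3 xs ys 1"
    unfolding vec3_scale by simp
  finally show ?thesis by (simp add: ev_def)
qed

lemma evi_0: "evi F $ 0 = peval F (vec3 1 0 0)"
proof -
  have "evi F $ 0 = gev (\<lambda>a. a) F (\<lambda>i. vec3 1 us ws i $ 0)"
    unfolding evi_def using gev_hom[OF rhom_fps_nth_0, of fps_const F "vec3 1 us ws"] by simp
  also have "(\<lambda>i. vec3 1 us ws i $ 0) = vec3 1 0 0" by (subst vec3_map) simp_all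
  finally show ?thesis by (simp add: peval_gev)
qed

lemma ev_zero_vanishes:
  assumes "homogeneous n F" "ev F = 0" "p \<in> curve"
  shows "vanishes F p"
  using assms(3)
proof (cases rule: curve_cases)
  case 1
  then show ?thesis using ev_evi[OF assms(1)] assms(2) evi_0[of F] by (simp add: vanishes_infp[OF assms(1)])
next
  case (2 a b)
  then show ?thesis using reduces_zero_iff(2)[OF reduces_ev assms(2)] by (simp add: vanishes_pt[OF assms(1)])
qed

lemma ev_zero_cofinite:
  assumes "homogeneous n F" "finite {p \<in> curve. \<not> vanishes F p}"
  shows "ev F = 0"
proof -
  have "finite {(a, b) \<in> Aff. pt a b \<in> {p \<in> curve. \<not> vanishes F p}}"
    using finite_curve_iff[of "{p \<in> curve. \<not> vanishes F p}"] assms(2) by simp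
  then have "finite {(a, b) \<in> Aff. peval F (vec3 a b 1) \<noteq> 0}"
    by (rule finite_subset[rotated]) (auto simp: vanishes_pt[OF assms(1)])
  then show ?thesis by (rule reduces_zero_iff(1)[OF reduces_ev])
qed

lemma ev_finite_zeros:
  assumes "homogeneous n F" "ev F \<noteq> 0"
  shows "finite {p \<in> curve. vanishes F p}"
proof -
  have "finite {(a, b) \<in> Aff. pt a b \<in> {p \<in> curve. vanishes F p}}"
    by (rule finite_subset[OF _ reduces_finite_zeros[OF reduces_ev assms(2)]])
       (auto simp: vanishes_pt[OF assms(1)])
  then show ?thesis using finite_curve_iff[of "{p \<in> curve. vanishes F p}"] by simp
qed

lemma ev_nonzero_iff: "homogeneous n F \<Longrightarrow> ev F \<noteq> 0 \<longleftrightarrow> (\<exists>p\<in>curve. \<not> vanishes F p)"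
  using ev_zero_vanishes ev_zero_cofinite[of n F] by (metis (mono_tags, lifting) Collect_empty_eq finite.emptyI)

end

section \<open>Germs\<close>

text \<open>Proper closed subsets are finite, as on any irreducible curve. Stated for a set X
  because it serves the plane curve and the projective line alike, and reduces equality of germs to
  finite exceptional sets.\<close>

definition cofinite_space :: "point set \<Rightarrow> bool" where
  "cofinite_space X \<longleftrightarrow> infinite X \<and> (\<exists>n. X \<subseteq> proj_space n) \<and>
     (\<forall>Z. zariski_closed Z \<longrightarrow> \<not> X \<subseteq> Z \<longrightarrow> finite (X \<inter> Z))"

lemma finite_in_closed:
  assumes "cofinite_space X" "finite T" "T \<subseteq> X"
  obtains Z where "zariski_closed Z" "T \<subseteq> Z" "\<not> X \<subseteq> Z"
proof -
  obtain n where n: "X \<subseteq> proj_space n" using assms by (auto simp: cofinite_space_def)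
  obtain q where q: "q \<in> X" "q \<notin> T" using assms unfolding cofinite_space_def
    by (metis finite_subset subsetI)
  obtain G where G: "homogeneous (card T) G" "\<forall>p\<in>T. vanishes G p" "\<not> vanishes G q"
    using separating_form[of T n q] assms n q by auto
  show thesis
  proof (rule that)
    show "zariski_closed {p \<in> proj_space n. \<forall>F\<in>{G}. vanishes F p}"
      unfolding zariski_closed_def using G(1) by blast
  qed (use assms n q G in auto)
qed

lemma germ_mem_iff:
  assumes "cofinite_space X"
  shows "g \<in> germ X f \<longleftrightarrow> finite {x \<in> X. g x \<noteq> f x}"
proof
  assume "g \<in> germ X f"
  then obtain Z where Z: "zariski_closed Z" "\<not> X \<subseteq> Z" "\<forall>x\<in>X - Z. g x = f x"
    by (auto simp: germ_def)
  then have "{x \<in> X. g x \<noteq> f x} \<subseteq> X \<inter> Z" by auto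
  then show "finite {x \<in> X. g x \<noteq> f x}" using Z assms finite_subset unfolding cofinite_space_def by blast
next
  assume "finite {x \<in> X. g x \<noteq> f x}"
  then obtain Z where "zariski_closed Z" "{x \<in> X. g x \<noteq> f x} \<subseteq> Z" "\<not> X \<subseteq> Z"
    using finite_in_closed[OF assms] by (metis (no_types, lifting) mem_Collect_eq subsetI)
  then show "g \<in> germ X f" unfolding germ_def by blast
qed

lemma germ_eq_iff:
  assumes "cofinite_space X"
  shows "germ X f = germ X g \<longleftrightarrow> finite {x \<in> X. f x \<noteq> g x}"
proof
  assume "germ X f = germ X g"
  moreover have "f \<in> germ X f" by (simp add: germ_mem_iff[OF assms])
  ultimately have "f \<in> germ X g" by simp
  then show "finite {x \<in> X. f x \<noteq> g x}" by (simp add: germ_mem_iff[OF assms])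
next
  assume f: "finite {x \<in> X. f x \<noteq> g x}"
  show "germ X f = germ X g"
  proof (rule Set.set_eqI)
    fix h
    have "finite {x \<in> X. h x \<noteq> g x}" if "finite {x \<in> X. h x \<noteq> f x}"
      by (rule finite_subset[of _ "{x \<in> X. h x \<noteq> f x} \<union> {x \<in> X. f x \<noteq> g x}"]) (use that f in auto)
    moreover have "finite {x \<in> X. h x \<noteq> f x}" if "finite {x \<in> X. h x \<noteq> g x}"
      by (rule finite_subset[of _ "{x \<in> X. h x \<noteq> g x} \<union> {x \<in> X. f x \<noteq> g x}"]) (use that f in auto)
    ultimately show "h \<in> germ X f \<longleftrightarrow> h \<in> germ X g" by (auto simp: germ_mem_iff[OF assms])
  qed
qed

lemma rep_germ:
  assumes "cofinite_space X"
  shows "finite {x \<in> X. rep (germ X f) x \<noteq> f x}"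
proof -
  have "f \<in> germ X f" by (simp add: germ_mem_iff[OF assms])
  then have "rep (germ X f) \<in> germ X f" by (intro rep_in) auto
  then show ?thesis by (simp add: germ_mem_iff[OF assms])
qed

lemma germ_rep_op:
  assumes "cofinite_space X"
  shows "germ X (\<lambda>x. h (rep (germ X f) x) (rep (germ X g) x)) = germ X (\<lambda>x. h (f x) (g x))"
  unfolding germ_eq_iff[OF assms]
  by (rule finite_subset[OF _ finite_UnI[OF rep_germ[OF assms, of f] rep_germ[OF assms, of g]]]) auto

lemma function_field_simps:
  "cofinite_space X \<Longrightarrow> germ X f \<otimes>\<^bsub>function_field X\<^esub> germ X g = germ X (\<lambda>x. f x * g x)"
  "cofinite_space X \<Longrightarrow> germ X f \<oplus>\<^bsub>function_field X\<^esub> germ X g = germ X (\<lambda>x. f x + g x)"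
  "\<one>\<^bsub>function_field X\<^esub> = germ X (\<lambda>_. 1)" "\<zero>\<^bsub>function_field X\<^esub> = germ X (\<lambda>_. 0)"
  by (simp_all add: function_field_def germ_rep_op[of X "(*)"] germ_rep_op[of X "(+)"])

section \<open>The function field\<close>

context plane_curve
begin

lemma cofinite_curve: "cofinite_space curve"
  unfolding cofinite_space_def
proof (intro conjI allI impI)
  show "infinite curve" by (rule infinite_curve)
  show "\<exists>n. curve \<subseteq> proj_space n" using curve_space by blast
  fix Z assume Z: "zariski_closed Z" "\<not> curve \<subseteq> Z"
  then obtain q where q: "q \<in> curve" "q \<notin> Z" by blast
  then obtain F n where F: "homogeneous n F" "\<not> vanishes F q" "\<forall>p\<in>Z. vanishes F p"
    using zariski_closed_separate[OF Z(1), of q 2] curve_space by (metis subsetD)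
  have "ev F \<noteq> 0" using F q ev_nonzero_iff by blast
  then have "finite {p \<in> curve. vanishes F p}" using ev_finite_zeros F by blast
  then show "finite (curve \<inter> Z)" by (rule finite_subset[rotated]) (use F in auto)
qed

abbreviation FF :: "ratfun ring" where "FF \<equiv> function_field curve"

definition is_frac :: "mpoly \<Rightarrow> mpoly \<Rightarrow> nat \<Rightarrow> complex fls \<Rightarrow> bool" where
  "is_frac F G n e \<longleftrightarrow> homogeneous n F \<and> homogeneous n G \<and> ev G \<noteq> 0 \<and> e = ev F / ev G"

definition KK :: "complex fls set" where "KK = {e. \<exists>F G n. is_frac F G n e}"

text \<open>The isomorphism from the subfield \<open>KK\<close> of Laurent series onto the function
  field. By \<open>quotient_germ_eq_iff\<close> the germ does not depend on the fraction
  chosen.\<close>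

definition gm :: "complex fls \<Rightarrow> ratfun" where
  "gm e = (SOME A. \<exists>F G n. is_frac F G n e \<and> A = quotient_germ curve F G)"

text \<open>Either equality says that the form F G' - F' G is zero on the curve: for germs off a
  finite set, for expansions under \<open>ev\<close>.\<close>

lemma quotient_germ_eq_iff:
  assumes "is_frac F G n e" "is_frac F' G' n' e'"
  shows "quotient_germ curve F G = quotient_germ curve F' G' \<longleftrightarrow> e = e'"
proof -
  let ?H = "F * G' - F' * G"
  have hom: "homogeneous (n + n') ?H"
    using assms homogeneous_mult[of n F n' G'] homogeneous_mult[of n' F' n G]
    by (intro homogeneous_diff) (auto simp: is_frac_def add.commute)
  have fin: "finite {p \<in> curve. vanishes G p}" "finite {p \<in> curve. vanishes G' p}"
    using assms ev_finite_zeros unfolding is_frac_def by blast+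
  have H0: "ev ?H = 0 \<longleftrightarrow> e = e'"
    using assms by (auto simp: is_frac_def ev_simps field_simps)
  have val: "vanishes ?H p \<longleftrightarrow> peval F (rep p) / peval G (rep p) = peval F' (rep p) / peval G' (rep p)"
    if "\<not> vanishes G p" "\<not> vanishes G' p" for p
    using that by (auto simp: vanishes_def peval_gev gev_simps[OF rhom_id] field_simps)
  show ?thesis
  proof
    assume "quotient_germ curve F G = quotient_germ curve F' G'"
    then have f: "finite {p \<in> curve. peval F (rep p) / peval G (rep p) \<noteq> peval F' (rep p) / peval G' (rep p)}"
      unfolding quotient_germ_def germ_eq_iff[OF cofinite_curve] .
    have "finite {p \<in> curve. \<not> vanishes ?H p}"
      by (rule finite_subset[OF _ finite_UnI[OF f finite_UnI[OF fin]]]) (use val in auto)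
    then show "e = e'" using ev_zero_cofinite[OF hom] H0 by blast
  next
    assume "e = e'"
    then have "\<forall>p\<in>curve. vanishes ?H p" using ev_zero_vanishes[OF hom] H0 by blast
    then show "quotient_germ curve F G = quotient_germ curve F' G'"
      unfolding quotient_germ_def germ_eq_iff[OF cofinite_curve]
      by (intro finite_subset[OF _ finite_UnI[OF fin]]) (use val in auto)
  qed
qed

lemma gm_frac:
  assumes "is_frac F G n e"
  shows "gm e = quotient_germ curve F G"
proof -
  have "\<exists>A. \<exists>F G n. is_frac F G n e \<and> A = quotient_germ curve F G" using assms by blast
  then have "\<exists>F G n. is_frac F G n e \<and> gm e = quotient_germ curve F G" unfolding gm_def by (rule someI_ex)
  then obtain F' G' n' where "is_frac F' G' n' e" "gm e = quotient_germ curve F' G'" by blast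
  then show ?thesis using quotient_germ_eq_iff[OF assms, of F' G' n' e] by simp
qed

lemma KK_E:
  assumes "e \<in> KK"
  obtains F G n where "is_frac F G n e" "gm e = quotient_germ curve F G"
  using assms gm_frac unfolding KK_def by blast

lemma inj_gm: "inj_on gm KK"
proof (rule inj_onI)
  fix e e' assume "e \<in> KK" "e' \<in> KK" and eq: "gm e = gm e'"
  then obtain F G n F' G' n' where "is_frac F G n e" "gm e = quotient_germ curve F G"
    "is_frac F' G' n' e'" "gm e' = quotient_germ curve F' G'" by (metis KK_E)
  then show "e = e'" using quotient_germ_eq_iff eq by metis
qed

lemma gm_eq_iff: "e \<in> KK \<Longrightarrow> e' \<in> KK \<Longrightarrow> gm e = gm e' \<longleftrightarrow> e = e'"
  using inj_gm by (auto simp: inj_on_def)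

lemma carrier_FF: "carrier FF = gm ` KK"
proof -
  have "carrier FF = {quotient_germ curve F G | F G d. homogeneous d F \<and> homogeneous d G \<and> (\<exists>x\<in>curve. \<not> vanishes G x)}"
    by (simp add: function_field_def)
  also have "\<dots> = {quotient_germ curve F G | F G n. is_frac F G n (ev F / ev G)}"
    unfolding is_frac_def using ev_nonzero_iff by blast
  also have "\<dots> = gm ` KK"
  proof (intro equalityI subsetI)
    fix A assume "A \<in> {quotient_germ curve F G | F G n. is_frac F G n (ev F / ev G)}"
    then obtain F G n where "is_frac F G n (ev F / ev G)" "A = quotient_germ curve F G" by blast
    then show "A \<in> gm ` KK" using gm_frac unfolding KK_def by blast
  next
    fix A assume "A \<in> gm ` KK"
    then obtain e where "e \<in> KK" "A = gm e" by blast
    then obtain F G n where "is_frac F G n e" "A = quotient_germ curve F G" by (metis KK_E)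
    moreover from this have "is_frac F G n (ev F / ev G)" by (simp add: is_frac_def)
    ultimately show "A \<in> {quotient_germ curve F G | F G n. is_frac F G n (ev F / ev G)}" by blast
  qed
  finally show ?thesis .
qed

lemma is_frac_add: "is_frac F G n e \<Longrightarrow> is_frac F' G' n' e' \<Longrightarrow> is_frac (F * G' + F' * G) (G * G') (n + n') (e + e')"
  using homogeneous_mult[of n F n' G'] homogeneous_mult[of n' F' n G] homogeneous_mult[of n G n' G']
  by (auto simp: is_frac_def ev_simps field_simps add.commute[of n' n] intro: homogeneous_add)

lemma is_frac_mult: "is_frac F G n e \<Longrightarrow> is_frac F' G' n' e' \<Longrightarrow> is_frac (F * F') (G * G') (n + n') (e * e')"
  by (auto simp: is_frac_def ev_simps intro: homogeneous_mult)

lemma is_frac_const: "is_frac (mconst c) 1 0 (fls_const c)"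
  by (simp add: is_frac_def homogeneous_const homogeneous_one ev_simps)

lemma is_frac_inverse: "is_frac F G n e \<Longrightarrow> e \<noteq> 0 \<Longrightarrow> is_frac G F n (inverse e)"
  by (auto simp: is_frac_def)

lemma is_frac_xs: "is_frac (mvar 0) (mvar 2) 1 xs" and is_frac_ys: "is_frac (mvar 1) (mvar 2) 1 ys"
  by (simp_all add: is_frac_def homogeneous_var)

lemma KK_add: "e \<in> KK \<Longrightarrow> e' \<in> KK \<Longrightarrow> e + e' \<in> KK"
  and KK_mult: "e \<in> KK \<Longrightarrow> e' \<in> KK \<Longrightarrow> e * e' \<in> KK"
  and KK_const: "fls_const c \<in> KK" and KK_xs: "xs \<in> KK" and KK_ys: "ys \<in> KK"
  unfolding KK_def using is_frac_add is_frac_mult is_frac_const is_frac_xs is_frac_ys by fast+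

lemma KK_0: "0 \<in> KK" and KK_1: "1 \<in> KK"
  using KK_const[of 0] KK_const[of 1] by simp_all

lemma KK_inverse: "e \<in> KK \<Longrightarrow> inverse e \<in> KK"
  using is_frac_inverse KK_0 unfolding KK_def by (cases "e = 0") fastforce+

lemma KK_uminus: "e \<in> KK \<Longrightarrow> - e \<in> KK"
  using KK_mult[OF KK_const[of "-1"]] by (simp add: fls_const_uminus)

lemma KK_diff: "e \<in> KK \<Longrightarrow> e' \<in> KK \<Longrightarrow> e - e' \<in> KK"
  using KK_add[OF _ KK_uminus] by fastforce

lemma KK_divide: "e \<in> KK \<Longrightarrow> e' \<in> KK \<Longrightarrow> e / e' \<in> KK"
  by (simp add: field_class.field_divide_inverse KK_mult KK_inverse)

lemma KK_power: "e \<in> KK \<Longrightarrow> e ^ n \<in> KK"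
  by (induction n) (auto intro: KK_mult KK_1)

lemma KK_powi: "e \<in> KK \<Longrightarrow> e powi n \<in> KK"
  by (auto simp: power_int_def intro: KK_power KK_inverse)

lemma KK_sum: "(\<And>x. x \<in> S \<Longrightarrow> f x \<in> KK) \<Longrightarrow> sum f S \<in> KK"
  by (induction S rule: infinite_finite_induct) (auto intro: KK_add KK_0)

lemma KK_prod: "(\<And>x. x \<in> S \<Longrightarrow> f x \<in> KK) \<Longrightarrow> prod f S \<in> KK"
  by (induction S rule: infinite_finite_induct) (auto intro: KK_mult KK_1)

lemma KK_PE: "e \<in> KK \<Longrightarrow> PE e q \<in> KK"
  unfolding PE_altdef by (intro KK_sum KK_mult KK_const KK_power)

lemma Acoord_KK: "e \<in> Acoord \<Longrightarrow> e \<in> KK"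
  unfolding Acoord_def nf_def by (auto intro!: KK_sum KK_mult KK_PE KK_xs KK_power KK_ys)

lemmas KK_closed = KK_add KK_mult KK_const KK_xs KK_ys KK_0 KK_1 KK_inverse KK_uminus KK_diff KK_divide
  KK_power KK_powi KK_sum KK_prod KK_PE

lemma ev_Acoord: "ev F \<in> Acoord"
  using reduces_ev Acoord_reduces by blast

text \<open>Multiplying the denominator by its conjugates turns it into a polynomial in x.\<close>

lemma KK_denominator:
  assumes "e \<in> KK"
  obtains c where "c \<noteq> 0" "e * PE xs c \<in> Acoord"
proof -
  obtain F G n where FG: "is_frac F G n e" using assms by (rule KK_E)
  then have G: "ev G \<noteq> 0" "e = ev F / ev G" by (auto simp: is_frac_def)
  obtain g c where g: "g \<in> Acoord" "c \<noteq> 0" "ev G * g = PE xs c"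
    using norm_exists[OF ev_Acoord G(1)] by blast
  have "e * PE xs c = ev F * g" using G g(3)[symmetric] by simp
  then show thesis using that[OF g(2)] g(1) ev_Acoord Acoord_closed(2) by simp
qed

lemma is_frac_germ_eqI:
  assumes "is_frac F G n e" "\<And>p. p \<in> curve \<Longrightarrow> \<not> vanishes G p \<Longrightarrow> f p = peval F (rep p) / peval G (rep p)"
  shows "gm e = germ curve f"
proof -
  have "{p \<in> curve. peval F (rep p) / peval G (rep p) \<noteq> f p} \<subseteq> {p \<in> curve. vanishes G p}"
  proof
    fix x assume "x \<in> {p \<in> curve. peval F (rep p) / peval G (rep p) \<noteq> f p}"
    then show "x \<in> {p \<in> curve. vanishes G p}" using assms(2)[of x] by (cases "vanishes G x") auto
  qed
  moreover have "finite {p \<in> curve. vanishes G p}"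
    using ev_finite_zeros[of n G] assms(1) by (simp add: is_frac_def)
  ultimately show ?thesis
    unfolding gm_frac[OF assms(1)] quotient_germ_def germ_eq_iff[OF cofinite_curve] by (rule finite_subset)
qed

lemma gm_add: "e \<in> KK \<Longrightarrow> e' \<in> KK \<Longrightarrow> gm (e + e') = gm e \<oplus>\<^bsub>FF\<^esub> gm e'"
  and gm_mult: "e \<in> KK \<Longrightarrow> e' \<in> KK \<Longrightarrow> gm (e * e') = gm e \<otimes>\<^bsub>FF\<^esub> gm e'"
proof -
  assume "e \<in> KK" "e' \<in> KK"
  then obtain F G n F' G' n' where f: "is_frac F G n e" "gm e = quotient_germ curve F G"
    "is_frac F' G' n' e'" "gm e' = quotient_germ curve F' G'" by (metis KK_E)
  show "gm (e + e') = gm e \<oplus>\<^bsub>FF\<^esub> gm e'"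
    unfolding f(2,4) quotient_germ_def function_field_simps(2)[OF cofinite_curve]
    by (rule is_frac_germ_eqI[OF is_frac_add[OF f(1,3)]], unfold vanishes_mult)
       (auto simp: vanishes_def peval_gev gev_simps[OF rhom_id] field_simps)
  show "gm (e * e') = gm e \<otimes>\<^bsub>FF\<^esub> gm e'"
    unfolding f(2,4) quotient_germ_def function_field_simps(1)[OF cofinite_curve]
    by (rule is_frac_germ_eqI[OF is_frac_mult[OF f(1,3)]], unfold vanishes_mult)
       (auto simp: vanishes_def peval_gev gev_simps[OF rhom_id] field_simps)
qed

lemma gm_const: "gm (fls_const c) = const_fun curve c"
  unfolding const_fun_def
  by (rule is_frac_germ_eqI[OF is_frac_const]) (simp add: peval_gev rhom_simps[OF gev_rhom[OF rhom_id]] gev_const[OF rhom_id])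

lemma gm_0: "gm 0 = \<zero>\<^bsub>FF\<^esub>" and gm_1: "gm 1 = \<one>\<^bsub>FF\<^esub>"
  using gm_const[of 0] gm_const[of 1] by (simp_all add: const_fun_def function_field_simps)

lemma field_FF: "field FF"
proof -
  have ag: "abelian_group FF"
  proof (rule abelian_groupI; unfold carrier_FF gm_0[symmetric])
    fix x assume "x \<in> gm ` KK"
    then obtain e where e: "e \<in> KK" "x = gm e" by blast
    have "gm (- e) \<oplus>\<^bsub>FF\<^esub> x = gm 0" using gm_add[OF KK_uminus e(1), OF e(1)] e by simp
    then show "\<exists>y\<in>gm ` KK. y \<oplus>\<^bsub>FF\<^esub> x = gm 0" using KK_uminus e by blast
  qed (auto simp: KK_closed add_ac simp flip: gm_add)
  have cm: "comm_monoid FF"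
    by (rule comm_monoidI; unfold carrier_FF gm_1[symmetric]) (auto simp: KK_closed mult_ac simp flip: gm_mult)
  have cr: "cring FF"
    by (rule cringI[OF ag cm]; unfold carrier_FF)
       (auto simp: KK_closed distrib_right simp flip: gm_mult gm_add)
  show "field FF"
  proof (rule cring.cring_fieldI2[OF cr]; unfold carrier_FF gm_1[symmetric] gm_0[symmetric])
    show "gm 0 \<noteq> gm 1" using gm_eq_iff[OF KK_0 KK_1] by simp
    fix a assume "a \<in> gm ` KK" "a \<noteq> gm 0"
    then obtain e where e: "e \<in> KK" "a = gm e" "e \<noteq> 0" by blast
    then have "a \<otimes>\<^bsub>FF\<^esub> gm (inverse e) = gm 1" using gm_mult[OF e(1) KK_inverse[OF e(1)]] by simp
    then show "\<exists>b\<in>gm ` KK. a \<otimes>\<^bsub>FF\<^esub> b = gm 1" using KK_inverse e by blast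
  qed
qed

lemma ring_FF: "ring FF"
  using field_FF by (simp add: field.is_ring)

lemma gm_carrier: "e \<in> KK \<Longrightarrow> gm e \<in> carrier FF"
  by (simp add: carrier_FF)

lemma gm_uminus: "e \<in> KK \<Longrightarrow> gm (- e) = \<ominus>\<^bsub>FF\<^esub> gm e"
proof -
  interpret field FF by (rule field_FF)
  assume e: "e \<in> KK"
  have "gm (- e) \<oplus>\<^bsub>FF\<^esub> gm e = \<zero>\<^bsub>FF\<^esub>" using gm_add[OF KK_uminus[OF e] e] gm_0 by simp
  then show ?thesis using minus_equality gm_carrier e KK_uminus by metis
qed

lemma gm_diff: "e \<in> KK \<Longrightarrow> e' \<in> KK \<Longrightarrow> gm (e - e') = gm e \<ominus>\<^bsub>FF\<^esub> gm e'"
  using gm_add[OF _ KK_uminus, of e e'] gm_uminus by (simp add: a_minus_def)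

lemma gm_inverse:
  assumes "e \<in> KK" "e \<noteq> 0"
  shows "gm (inverse e) = inv\<^bsub>FF\<^esub> gm e"
proof -
  interpret field FF by (rule field_FF)
  have "gm (inverse e) \<otimes>\<^bsub>FF\<^esub> gm e = \<one>\<^bsub>FF\<^esub>"
    using gm_mult[OF KK_inverse[OF assms(1)] assms(1)] assms gm_1 by simp
  then show ?thesis by (metis KK_inverse assms(1) comm_inv_char gm_carrier m_comm)
qed

lemma gm_power: "e \<in> KK \<Longrightarrow> gm (e ^ n) = gm e [^]\<^bsub>FF\<^esub> (n::nat)"
proof (induction n)
  case (Suc n)
  interpret field FF by (rule field_FF)
  show ?case using Suc gm_mult[OF KK_power[of e n], of e] by (simp add: mult.commute[of e])
qed (simp add: gm_1)

lemma gm_powi: "e \<in> KK \<Longrightarrow> e \<noteq> 0 \<Longrightarrow> gm (e powi n) = gm e [^]\<^bsub>FF\<^esub> (n::int)"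
proof (cases "n < 0")
  assume e: "e \<in> KK" "e \<noteq> 0"
  case True
  have "e powi n = inverse (e ^ nat (- n))"
    using True unfolding power_int_def power_inverse by simp
  then have "gm (e powi n) = inv\<^bsub>FF\<^esub> (gm e [^]\<^bsub>FF\<^esub> nat (- n))"
    using gm_inverse[OF KK_power[OF e(1), of "nat (- n)"]] e gm_power[OF e(1)] by simp
  then show ?thesis unfolding int_pow_def2 using True by simp
next
  assume e: "e \<in> KK" "e \<noteq> 0"
  case False
  then have "e powi n = e ^ nat n" unfolding power_int_def by simp
  then show ?thesis unfolding int_pow_def2 using False gm_power[OF e(1)] by simp
qed

section \<open>Local rings\<close>

text \<open>\<open>e\<close> is regular at \<open>p\<close> with value \<open>c\<close>. As a
  relation it describes the local ring (some \<open>c\<close>) and the maximal ideal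
  (\<open>c = 0\<close>) at once.\<close>

definition rv :: "point \<Rightarrow> complex fls \<Rightarrow> complex \<Rightarrow> bool" where
  "rv p e c \<longleftrightarrow> p \<in> curve \<and>
     (\<exists>F G n. is_frac F G n e \<and> \<not> vanishes G p \<and> c = peval F (rep p) / peval G (rep p))"

lemma rvI: "p \<in> curve \<Longrightarrow> is_frac F G n e \<Longrightarrow> \<not> vanishes G p \<Longrightarrow> rv p e (peval F (rep p) / peval G (rep p))"
  unfolding rv_def by blast

lemma rv_KK: "rv p e c \<Longrightarrow> e \<in> KK"
  unfolding rv_def KK_def by blast

lemma rv_curve: "rv p e c \<Longrightarrow> p \<in> curve"
  unfolding rv_def by blast

lemma rv_unique:
  assumes "rv p e c" "rv p e c'"
  shows "c = c'"
proof -
  obtain F G n F' G' n' where f: "is_frac F G n e" "\<not> vanishes G p" "c = peval F (rep p) / peval G (rep p)"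
    "is_frac F' G' n' e" "\<not> vanishes G' p" "c' = peval F' (rep p) / peval G' (rep p)"
    using assms unfolding rv_def by blast
  let ?H = "F * G' - F' * G"
  have hom: "homogeneous (n + n') ?H"
    using f(1,4) homogeneous_mult[of n F n' G'] homogeneous_mult[of n' F' n G]
    by (intro homogeneous_diff) (auto simp: is_frac_def add.commute)
  have "ev ?H = 0" using f(1,4) by (auto simp: is_frac_def ev_simps field_simps)
  then have "vanishes ?H p" using ev_zero_vanishes[OF hom] rv_curve[OF assms(1)] by blast
  then show ?thesis
    unfolding f(3,6) using f(2,5) by (auto simp: vanishes_def peval_gev gev_simps[OF rhom_id] field_simps)
qed

lemma rv_add:
  assumes "rv p e c" "rv p e' c'"
  shows "rv p (e + e') (c + c')"
proof -
  obtain F G n F' G' n' where f: "is_frac F G n e" "\<not> vanishes G p" "c = peval F (rep p) / peval G (rep p)"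
    "is_frac F' G' n' e'" "\<not> vanishes G' p" "c' = peval F' (rep p) / peval G' (rep p)"
    using assms unfolding rv_def by blast
  have "\<not> vanishes (G * G') p" using f by (simp add: vanishes_mult)
  moreover have "c + c' = peval (F * G' + F' * G) (rep p) / peval (G * G') (rep p)"
    unfolding f(3,6) using f(2,5) by (auto simp: vanishes_def peval_gev gev_simps[OF rhom_id] field_simps)
  ultimately show ?thesis using rvI[OF rv_curve[OF assms(1)] is_frac_add[OF f(1,4)]] by simp
qed

lemma rv_mult:
  assumes "rv p e c" "rv p e' c'"
  shows "rv p (e * e') (c * c')"
proof -
  obtain F G n F' G' n' where f: "is_frac F G n e" "\<not> vanishes G p" "c = peval F (rep p) / peval G (rep p)"
    "is_frac F' G' n' e'" "\<not> vanishes G' p" "c' = peval F' (rep p) / peval G' (rep p)"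
    using assms unfolding rv_def by blast
  have "\<not> vanishes (G * G') p" using f by (simp add: vanishes_mult)
  moreover have "c * c' = peval (F * F') (rep p) / peval (G * G') (rep p)"
    unfolding f(3,6) using f(2,5) by (auto simp: vanishes_def peval_gev gev_simps[OF rhom_id] field_simps)
  ultimately show ?thesis using rvI[OF rv_curve[OF assms(1)] is_frac_mult[OF f(1,4)]] by simp
qed

lemma rv_const: "p \<in> curve \<Longrightarrow> rv p (fls_const c) c"
  using rvI[OF _ is_frac_const, of p c]
  by (simp add: vanishes_def peval_gev gev_const[OF rhom_id] rhom_simps[OF gev_rhom[OF rhom_id]])

lemma rv_0: "p \<in> curve \<Longrightarrow> rv p 0 0" and rv_1: "p \<in> curve \<Longrightarrow> rv p 1 1"
  using rv_const[of p 0] rv_const[of p 1] by simp_all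

lemma rv_inverse:
  assumes "rv p e c" "c \<noteq> 0"
  shows "rv p (inverse e) (inverse c)"
proof -
  obtain F G n where f: "is_frac F G n e" "\<not> vanishes G p" "c = peval F (rep p) / peval G (rep p)"
    using assms unfolding rv_def by blast
  have "e \<noteq> 0" using rv_unique[OF assms(1), of 0] rv_0[OF rv_curve[OF assms(1)]] assms(2) by blast
  moreover have "\<not> vanishes F p" using f assms by (auto simp: vanishes_def)
  ultimately show ?thesis
    using rvI[OF rv_curve[OF assms(1)] is_frac_inverse[OF f(1)]] f(3) by simp
qed

lemma rv_nonzero: "rv p e c \<Longrightarrow> c \<noteq> 0 \<Longrightarrow> e \<noteq> 0"
  using rv_unique[of p e c 0] rv_0[OF rv_curve] by blast

lemma rv_divide: "rv p e c \<Longrightarrow> rv p e' c' \<Longrightarrow> c' \<noteq> 0 \<Longrightarrow> rv p (e / e') (c / c')"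
  using rv_mult[OF _ rv_inverse, of p e c e' c'] by (simp add: field_class.field_divide_inverse)

lemma rv_uminus: "rv p e c \<Longrightarrow> rv p (- e) (- c)"
  using rv_mult[OF rv_const[OF rv_curve, of p e c "-1"], of e c] by (simp add: fls_const_uminus)

lemma rv_diff: "rv p e c \<Longrightarrow> rv p e' c' \<Longrightarrow> rv p (e - e') (c - c')"
  using rv_add[OF _ rv_uminus, of p e c e' c'] by simp

lemma rv_power: "rv p e c \<Longrightarrow> rv p (e ^ n) (c ^ n)"
  by (induction n) (auto intro: rv_mult rv_1 rv_curve)

lemma rv_sum: "p \<in> curve \<Longrightarrow> (\<And>x. x \<in> S \<Longrightarrow> rv p (f x) (g x)) \<Longrightarrow> rv p (sum f S) (sum g S)"
  by (induction S rule: infinite_finite_induct) (auto intro: rv_add rv_0)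

lemma rv_PE: "rv p e c \<Longrightarrow> rv p (PE e q) (poly q c)"
  by (induction q) (auto simp: PE_pCons intro: rv_0 rv_add rv_mult rv_const dest: rv_curve)

lemma rv_pt:
  assumes "(a, b) \<in> Aff" "is_frac F G n e" "peval G (vec3 a b 1) \<noteq> 0"
  shows "rv (pt a b) e (peval F (vec3 a b 1) / peval G (vec3 a b 1))"
proof -
  have h: "homogeneous n F" "homogeneous n G" using assms by (auto simp: is_frac_def)
  show ?thesis
    using rvI[OF _ assms(2), of "pt a b"] assms
    by (simp add: vanishes_pt[OF h(2)] peval_quotient_proj_point[OF h, of "vec3 a b 1", folded pt_def])
qed

lemma rv_xs: "(a, b) \<in> Aff \<Longrightarrow> rv (pt a b) xs a" and rv_ys: "(a, b) \<in> Aff \<Longrightarrow> rv (pt a b) ys b"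
  using rv_pt[OF _ is_frac_xs, of a b] rv_pt[OF _ is_frac_ys, of a b]
  by (simp_all add: peval_gev gev_var[OF rhom_id])

lemma rv_infp:
  assumes "is_frac F G n e" "peval G (vec3 1 0 0) \<noteq> 0"
  shows "rv infp e (peval F (vec3 1 0 0) / peval G (vec3 1 0 0))"
proof -
  have h: "homogeneous n F" "homogeneous n G" using assms by (auto simp: is_frac_def)
  show ?thesis
    using rvI[OF infp_curve assms(1)] assms(2)
    by (simp add: vanishes_infp[OF h(2)] peval_quotient_proj_point[OF h, of "vec3 1 0 0", folded infp_def])
qed

lemma rv_infp_inv_xs: "rv infp (inverse xs) 0" and rv_infp_ys_xs: "rv infp (ys / xs) 0"
proof -
  have f: "is_frac (mvar 2) (mvar 0) 1 (inverse xs)" "is_frac (mvar 1) (mvar 0) 1 (ys / xs)"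
    by (simp_all add: is_frac_def homogeneous_var field_simps)
  show "rv infp (inverse xs) 0" "rv infp (ys / xs) 0"
    using rv_infp[OF f(1)] rv_infp[OF f(2)] by (simp_all add: peval_gev gev_var[OF rhom_id])
qed

lemma rv_reduces:
  assumes "reduces e f" "(a, b) \<in> Aff"
  shows "rv (pt a b) e (f a b)"
proof -
  obtain p where p: "e = nf p" "\<And>a b. (a, b) \<in> Aff \<Longrightarrow> f a b = nfv p a b" using assms(1) by (rule reducesE) blast
  show ?thesis unfolding p(1) p(2)[OF assms(2)] nf_def nfv_def
    using assms(2) by (intro rv_sum rv_mult rv_PE rv_power rv_xs rv_ys) auto
qed

lemma rv_Acoord: "e \<in> Acoord \<Longrightarrow> (a, b) \<in> Aff \<Longrightarrow> \<exists>c. rv (pt a b) e c"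
  using rv_reduces Acoord_reduces by blast

lemma local_ring_eq:
  assumes "p \<in> curve"
  shows "local_ring curve p = gm ` {e. \<exists>c. rv p e c}" "max_ideal curve p = gm ` {e. rv p e 0}"
proof -
  have nz: "ev G \<noteq> 0" if "homogeneous n G" "\<not> vanishes G p" for G n
    using ev_nonzero_iff that assms by blast
  show "local_ring curve p = gm ` {e. \<exists>c. rv p e c}"
  proof (intro equalityI subsetI)
    fix A assume "A \<in> local_ring curve p"
    then obtain F G n where f: "homogeneous n F" "homogeneous n G" "\<not> vanishes G p" "A = quotient_germ curve F G"
      by (auto simp: local_ring_def)
    then have fr: "is_frac F G n (ev F / ev G)" using nz by (auto simp: is_frac_def)
    then show "A \<in> gm ` {e. \<exists>c. rv p e c}" using rvI[OF assms fr f(3)] gm_frac[OF fr] f by blast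
  next
    fix A assume "A \<in> gm ` {e. \<exists>c. rv p e c}"
    then obtain F G n e where "is_frac F G n e" "\<not> vanishes G p" "A = gm e" by (auto simp: rv_def)
    then show "A \<in> local_ring curve p" using gm_frac unfolding local_ring_def is_frac_def by blast
  qed
  show "max_ideal curve p = gm ` {e. rv p e 0}"
  proof (intro equalityI subsetI)
    fix A assume "A \<in> max_ideal curve p"
    then obtain F G n where f: "homogeneous n F" "homogeneous n G" "\<not> vanishes G p" "vanishes F p" "A = quotient_germ curve F G"
      by (auto simp: max_ideal_def)
    then have fr: "is_frac F G n (ev F / ev G)" using nz by (auto simp: is_frac_def)
    have "rv p (ev F / ev G) 0" using rvI[OF assms fr f(3)] f(4) by (simp add: vanishes_def)
    then show "A \<in> gm ` {e. rv p e 0}" using gm_frac[OF fr] f by blast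
  next
    fix A assume "A \<in> gm ` {e. rv p e 0}"
    then obtain F G n e where "is_frac F G n e" "\<not> vanishes G p" "A = gm e" "peval F (rep p) = 0"
      by (auto simp: rv_def vanishes_def)
    then show "A \<in> max_ideal curve p" using gm_frac unfolding max_ideal_def is_frac_def vanishes_def by blast
  qed
qed

lemma gm_local_ring_iff: "e \<in> KK \<Longrightarrow> p \<in> curve \<Longrightarrow> gm e \<in> local_ring curve p \<longleftrightarrow> (\<exists>c. rv p e c)"
  and gm_max_ideal_iff: "e \<in> KK \<Longrightarrow> p \<in> curve \<Longrightarrow> gm e \<in> max_ideal curve p \<longleftrightarrow> rv p e 0"
  unfolding local_ring_eq using gm_eq_iff rv_KK by auto

lemma value_at_gm:
  assumes "rv p e c"
  shows "value_at curve p (gm e) = c"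
  unfolding value_at_def
proof (rule the_equality; unfold gm_const[symmetric] gm_diff[OF rv_KK[OF assms] KK_const, symmetric]
    gm_max_ideal_iff[OF KK_diff[OF rv_KK[OF assms] KK_const] rv_curve[OF assms]])
  show "rv p (e - fls_const c) 0" using rv_diff[OF assms rv_const[OF rv_curve[OF assms]], of c] by simp
  fix c' assume "rv p (e - fls_const c') 0"
  moreover have "rv p (e - fls_const c') (c - c')" by (intro rv_diff assms rv_const rv_curve[OF assms])
  ultimately show "c' = c" using rv_unique by fastforce
qed

end

section \<open>Orders of vanishing\<close>

text \<open>A relation that respects sums and products passes from coefficients and coordinates to
  values of polynomials. Instances are congruence modulo a local parameter, \<open>rv p\<close> and
  closure under the ring operations.\<close>

lemma gev_rel:
  assumes "\<And>a. R (c1 a) (c2 a)" "\<And>i. R (v i) (w i)" "R 0 0" "R 1 1"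
    "\<And>x y x' y'. R x y \<Longrightarrow> R x' y' \<Longrightarrow> R (x + x') (y + y')"
    "\<And>x y x' y'. R x y \<Longrightarrow> R x' y' \<Longrightarrow> R (x * x') (y * y')"
  shows "R (gev c1 F v) (gev c2 F w)"
proof -
  have s: "R (sum f A) (sum g A)" if "\<And>x. x \<in> A \<Longrightarrow> R (f x) (g x)" for A :: "(nat \<Rightarrow>\<^sub>0 nat) set" and f g
    using that by (induction A rule: infinite_finite_induct) (auto intro: assms)
  have p: "R (prod f A) (prod g A)" if "\<And>x. x \<in> A \<Longrightarrow> R (f x) (g x)" for A :: "nat set" and f g
    using that by (induction A rule: infinite_finite_induct) (auto intro: assms)
  have pw: "R (x ^ n) (y ^ n)" if "R x y" for x y n
    using that by (induction n) (auto intro: assms)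
  show ?thesis unfolding gev_def mon_eval_def
    by (intro s assms(6) p pw assms(1,2))
qed

context plane_curve
begin

definition lunif :: "point \<Rightarrow> complex fls \<Rightarrow> bool" where
  "lunif p t \<longleftrightarrow> t \<noteq> 0 \<and> rv p t 0 \<and> (\<forall>e. rv p e 0 \<longrightarrow> (\<exists>u c. rv p u c \<and> e = t * u))"

text \<open>If each coordinate is congruent modulo t to its value at p, so is each form; a numerator
  vanishing at p is then t times a regular function. The factor s rescales the chosen chart to (x,
  y, 1).\<close>

lemma lunif_criterion:
  assumes p: "p \<in> curve" and t: "t \<noteq> 0" "rv p t 0" and s: "s \<noteq> 0"
    and v: "\<And>i. \<exists>u x. rv p u x \<and> v i = fls_const (w i) + t * u"
    and ev: "\<And>F n. homogeneous n F \<Longrightarrow> ev F = s ^ n * gev fls_const F v"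
    and van: "\<And>F n. homogeneous n F \<Longrightarrow> vanishes F p \<longleftrightarrow> gev (\<lambda>x. x) F w = 0"
  shows "lunif p t"
proof -
  define R where "R e c \<longleftrightarrow> (\<exists>u x. rv p u x \<and> e = fls_const c + t * u)" for e c
  have R: "R (gev fls_const F v) (gev (\<lambda>x. x) F w)" for F
  proof (rule gev_rel)
    have z: "R (fls_const a) a" for a unfolding R_def using rv_0[OF p] by (metis add.right_neutral mult_zero_right)
    show "R (fls_const a) a" for a by (rule z)
    show "R 0 0" "R 1 1" using z[of 0] z[of 1] by simp_all
    show "R (v i) (w i)" for i using v by (simp add: R_def)
    fix x y x' y' assume "R x y" "R x' y'"
    then obtain u a u' a' where u: "rv p u a" "x = fls_const y + t * u" "rv p u' a'" "x' = fls_const y' + t * u'"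
      unfolding R_def by blast
    show "R (x + x') (y + y')" unfolding R_def
      by (rule exI[of _ "u + u'"], rule exI[of _ "a + a'"])
         (use u rv_add in \<open>auto simp: algebra_simps simp flip: fls_plus_const\<close>)
    have "rv p (u * fls_const y' + (fls_const y * u' + t * (u * u'))) (a * y' + (y * a' + 0 * (a * a')))"
      by (intro rv_add rv_mult rv_const p t u)
    moreover have "x * x' = fls_const (y * y') + t * (u * fls_const y' + (fls_const y * u' + t * (u * u')))"
      using u by (simp add: algebra_simps flip: fls_const_mult_const)
    ultimately show "R (x * x') (y * y')" unfolding R_def by blast
  qed
  have Rrv: "rv p e c" if r: "R e c" for e c
  proof -
    obtain u x where u: "rv p u x" "e = fls_const c + t * u" using r unfolding R_def by blast
    have "rv p (fls_const c + t * u) (c + 0 * x)" by (intro rv_add rv_mult rv_const p t u)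
    then show ?thesis using u by simp
  qed
  have "\<exists>u c. rv p u c \<and> e = t * u" if e: "rv p e 0" for e
  proof -
    obtain F G n where f: "is_frac F G n e" "\<not> vanishes G p" "peval F (rep p) = 0"
      using e unfolding rv_def by (auto simp: vanishes_def)
    have h: "homogeneous n F" "homogeneous n G" "e = ev F / ev G" using f by (auto simp: is_frac_def)
    have F0: "gev (\<lambda>x. x) F w = 0" using van[OF h(1)] f(3) by (simp add: vanishes_def)
    have G0: "gev (\<lambda>x. x) G w \<noteq> 0" using van[OF h(2)] f(2) by simp
    obtain u x where u: "rv p u x" "gev fls_const F v = t * u"
      using R[of F] unfolding R_def F0 by auto
    have g: "rv p (gev fls_const G v) (gev (\<lambda>x. x) G w)" by (rule Rrv[OF R])
    have "e = t * (u / gev fls_const G v)"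
      unfolding h(3) ev[OF h(1)] ev[OF h(2)] u(2) using s by simp
    then show ?thesis using rv_divide[OF u(1) g G0] by blast
  qed
  then show ?thesis unfolding lunif_def using t by blast
qed

text \<open>The sum is the cofactor of e - c in e^n - c^n; its value at p is the derivative n
  c^(n-1).\<close>

lemma geometric_rv:
  assumes "rv p e c" "n > 0"
  shows "rv p (\<Sum>i<n. fls_const c ^ (n - Suc i) * e ^ i) (of_nat n * c ^ (n - 1))"
proof -
  have "rv p (\<Sum>i<n. fls_const c ^ (n - Suc i) * e ^ i) (\<Sum>i<n. c ^ (n - Suc i) * c ^ i)"
    by (intro rv_sum rv_mult rv_power rv_const rv_curve[OF assms(1)] assms)
  also have "(\<Sum>i<n. c ^ (n - Suc i) * c ^ i) = (\<Sum>i<n. c ^ (n - 1))"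
    by (rule sum.cong) (auto simp: One_nat_def simp flip: power_add)
  finally show ?thesis by simp
qed

text \<open>At an affine point, \<open>(ys - b) S\<^sub>y = (xs - a) S\<^sub>x\<close> where \<open>S\<^sub>y\<close>, \<open>S\<^sub>x\<close> take the values of the partial derivatives.\<close>

lemma local_relation:
  assumes "(a, b) \<in> Aff"
  obtains Sx Sy where "rv (pt a b) Sx (of_nat (d - 1) * a ^ (d - 2))" "rv (pt a b) Sy (of_nat d * b ^ (d - 1))"
    "(ys - fls_const b) * Sy = (xs - fls_const a) * Sx"
proof -
  let ?Sy = "\<Sum>i<d. fls_const b ^ (d - Suc i) * ys ^ i"
  let ?Sx = "\<Sum>i<d-1. fls_const a ^ (d - 1 - Suc i) * xs ^ i"
  have cp: "fls_const c ^ n = fls_const (c ^ n)" for c :: complex and n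
    by (simp add: rhom_simps[OF rhom_fls_const])
  have ab: "b ^ d = a ^ (d - 1) - 1" using assms by (simp add: Aff_def)
  have "ys ^ d - fls_const b ^ d = xs ^ (d - 1) - fls_const a ^ (d - 1)"
    unfolding cp ab xs_power_eq by (simp flip: fls_minus_const)
  then have e: "(ys - fls_const b) * ?Sy = (xs - fls_const a) * ?Sx"
    by (simp only: power_diff_sumr2)
  have "rv (pt a b) ?Sx (of_nat (d - 1) * a ^ (d - 1 - 1))" "rv (pt a b) ?Sy (of_nat d * b ^ (d - 1))"
    using geometric_rv[OF rv_xs[OF assms], of "d - 1"] geometric_rv[OF rv_ys[OF assms], of d] d4 by auto
  moreover have "d - 1 - 1 = d - 2" by simp
  ultimately show thesis using that e by metis
qed

lemma lunif_affine:
  assumes ab: "(a, b) \<in> Aff" and t: "t \<noteq> 0" "rv (pt a b) t 0"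
    and x: "\<exists>u x. rv (pt a b) u x \<and> xs - fls_const a = t * u"
    and y: "\<exists>u x. rv (pt a b) u x \<and> ys - fls_const b = t * u"
  shows "lunif (pt a b) t"
proof (rule lunif_criterion[where s = 1 and v = "vec3 xs ys 1" and w = "vec3 a b 1"])
  show "pt a b \<in> curve" using ab by simp
  show "t \<noteq> 0" "rv (pt a b) t 0" by fact+
  fix i :: nat
  have z: "rv (pt a b) 0 0" using ab by (simp add: rv_0)
  obtain u1 x1 u2 x2 where u: "rv (pt a b) u1 x1" "xs - fls_const a = t * u1"
    "rv (pt a b) u2 x2" "ys - fls_const b = t * u2" using x y by blast
  have "xs = fls_const a + t * u1" "ys = fls_const b + t * u2" using u by (metis add.commute diff_add_cancel)+
  then consider "i = 0" | "i = 1" | "i \<noteq> 0" "i \<noteq> 1" by blast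
  then show "\<exists>u x. rv (pt a b) u x \<and> vec3 xs ys 1 i = fls_const (vec3 a b 1 i) + t * u"
  proof cases
    case 1
    show ?thesis by (rule exI[of _ u1], rule exI[of _ x1]) (use u(1) \<open>xs = _\<close> 1 in simp)
  next
    case 2
    show ?thesis by (rule exI[of _ u2], rule exI[of _ x2]) (use u(3) \<open>ys = _\<close> 2 in simp)
  next
    case 3
    show ?thesis by (rule exI[of _ 0], rule exI[of _ 0]) (use z 3 in \<open>simp add: vec3_def\<close>)
  qed
qed (auto simp: ev_def vanishes_pt peval_gev)

text \<open>Where b is nonzero, the \<open>Sy\<close> of \<open>local_relation\<close> is a unit, so
  y - b is a multiple of x - a.\<close>

lemma lunif_xs:
  assumes "(a, b) \<in> Aff" "b \<noteq> 0"
  shows "lunif (pt a b) (xs - fls_const a)"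
proof (rule lunif_affine[OF assms(1)])
  obtain Sx Sy where S: "rv (pt a b) Sx (of_nat (d - 1) * a ^ (d - 2))" "rv (pt a b) Sy (of_nat d * b ^ (d - 1))"
    "(ys - fls_const b) * Sy = (xs - fls_const a) * Sx" using local_relation[OF assms(1)] by blast
  have nz: "of_nat d * b ^ (d - 1) \<noteq> 0" using assms d4 by simp
  show "xs - fls_const a \<noteq> 0"
  proof
    assume "xs - fls_const a = 0"
    then have "fls_subdegree xs = fls_subdegree (fls_const a)" by simp
    then show False using subdegree_xs d4 by simp
  qed
  show "rv (pt a b) (xs - fls_const a) 0"
    using rv_diff[OF rv_xs[OF assms(1)] rv_const, of a] assms by simp
  show "\<exists>u x. rv (pt a b) u x \<and> xs - fls_const a = (xs - fls_const a) * u"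
    using rv_1[of "pt a b"] assms by (metis mult.right_neutral pt_curve)
  have "ys - fls_const b = (xs - fls_const a) * (Sx / Sy)"
    using S(3) rv_nonzero[OF S(2) nz] by (simp add: field_simps)
  then show "\<exists>u x. rv (pt a b) u x \<and> ys - fls_const b = (xs - fls_const a) * u"
    using rv_divide[OF S(1,2) nz] by blast
qed

lemma Aff_zero: "(a, 0) \<in> Aff \<Longrightarrow> a ^ (d - 1) = 1" "(a, 0) \<in> Aff \<Longrightarrow> a \<noteq> 0"
  using d4 by (auto simp: Aff_def power_0_left)

text \<open>Here y^d = x^(d-1) - a^(d-1), and the cofactor of x - a has the nonzero value (d-1)
  a^(d-2): the covering by x is totally ramified at the points with y = 0.\<close>

lemma xs_at_branch_point:
  assumes "(a, 0) \<in> Aff"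
  obtains u c where "rv (pt a 0) u c" "c \<noteq> 0" "xs - fls_const a = ys ^ d * u"
proof -
  have a: "a ^ (d - 1) = 1" "a \<noteq> 0" using Aff_zero assms by auto
  let ?S = "\<Sum>i<d-1. fls_const a ^ (d - 1 - Suc i) * xs ^ i"
  have "rv (pt a 0) ?S (of_nat (d - 1) * a ^ (d - 1 - 1))"
    using geometric_rv[OF rv_xs[OF assms], of "d - 1"] d4 by simp
  moreover have nz: "of_nat (d - 1) * a ^ (d - 1 - 1) \<noteq> 0" using a d4 by simp
  moreover have "ys ^ d = (xs - fls_const a) * ?S"
  proof -
    have "xs ^ (d - 1) - fls_const a ^ (d - 1) = ys ^ d"
      using a by (simp add: xs_power_eq flip: rhom_simps(7)[OF rhom_fls_const])
    then show ?thesis by (simp only: power_diff_sumr2)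
  qed
  ultimately have "rv (pt a 0) (inverse ?S) (inverse (of_nat (d - 1) * a ^ (d - 1 - 1)))"
    "xs - fls_const a = ys ^ d * inverse ?S"
    using rv_inverse rv_nonzero[OF _ nz] by (auto simp: field_simps)
  then show thesis using that nz by (metis inverse_nonzero_iff_nonzero)
qed

lemma lunif_ys:
  assumes "(a, 0) \<in> Aff"
  shows "lunif (pt a 0) ys"
proof (rule lunif_affine[OF assms])
  obtain u c where u: "rv (pt a 0) u c" "xs - fls_const a = ys ^ d * u" using xs_at_branch_point[OF assms] by blast
  show "ys \<noteq> 0" "rv (pt a 0) ys 0" using rv_ys[OF assms] by auto
  have "rv (pt a 0) (ys ^ (d - 1) * u) (0 ^ (d - 1) * c)" by (intro rv_mult rv_power u rv_ys assms)
  moreover have "xs - fls_const a = ys * (ys ^ (d - 1) * u)"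
    using u(2) d4 by (simp add: mult.assoc[symmetric] flip: power_Suc)
  ultimately show "\<exists>u x. rv (pt a 0) u x \<and> xs - fls_const a = ys * u" by blast
  show "\<exists>u x. rv (pt a 0) u x \<and> ys - fls_const 0 = ys * u"
    using rv_1[of "pt a 0"] assms by (intro exI[of _ 1]) auto
qed

lemma ev_infp:
  assumes "homogeneous n F"
  shows "ev F = xs ^ n * gev fls_const F (vec3 1 (ys / xs) (inverse xs))"
proof -
  have "xs ^ n * gev fls_const F (vec3 1 (ys / xs) (inverse xs)) = gev fls_const F (\<lambda>i. xs * vec3 1 (ys / xs) (inverse xs) i)"
    using gev_scale[OF assms] by metis
  also have "(\<lambda>i. xs * vec3 1 (ys / xs) (inverse xs) i) = vec3 xs ys 1"
    unfolding vec3_scale by simp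
  finally show ?thesis by (simp add: ev_def)
qed

text \<open>With t = y/x and w = 1/x the equation of the curve becomes w (1 - w^(d-1)) = t^d, and
  the bracket is a unit at infinity, so w is a multiple of t.\<close>

lemma lunif_infp: "lunif infp (ys / xs)"
proof (rule lunif_criterion[where s = xs and v = "vec3 1 (ys / xs) (inverse xs)" and w = "vec3 1 0 0"])
  let ?t = "ys / xs" and ?w = "inverse xs"
  show "rv infp ?t 0" by (rule rv_infp_ys_xs)
  have u: "rv infp (1 - ?w ^ (d - 1)) (1 - 0 ^ (d - 1))"
    by (intro rv_diff rv_1 rv_power rv_infp_inv_xs infp_curve)
  have one: "1 - 0 ^ (d - 1) = (1::complex)" using d4 by (simp add: power_0_left)
  have nz: "1 - ?w ^ (d - 1) \<noteq> 0" using rv_nonzero[OF u] one by simp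
  have v: "rv infp (?t ^ (d - 1) / (1 - ?w ^ (d - 1))) (0 ^ (d - 1) / (1 - 0 ^ (d - 1)))"
    by (intro rv_divide u rv_power rv_infp_ys_xs) (simp add: one)
  have dp: "z ^ d = z * z ^ (d - 1)" for z :: "complex fls" using d4 by (simp flip: power_Suc)
  have c: "ys ^ d = xs ^ (d - 1) - 1" using xs_power_eq by simp
  have "?t ^ d = ?w * (1 - ?w ^ (d - 1))"
    unfolding power_divide c dp[of xs] by (simp add: field_simps)
  then have "?w = ?t ^ d / (1 - ?w ^ (d - 1))" using nz by (simp only: nonzero_mult_div_cancel_right simp_thms)
  then have "?w = ?t * (?t ^ (d - 1) / (1 - ?w ^ (d - 1)))"
    unfolding dp[of ?t] by (simp only: times_divide_eq_right)
  then have w: "\<exists>u x. rv infp u x \<and> ?w = ?t * u" using v by blast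
  have t: "\<exists>u x. rv infp u x \<and> ?t = ?t * u" using rv_1[OF infp_curve] by (metis mult.right_neutral)
  fix i :: nat
  show "\<exists>u x. rv infp u x \<and> vec3 1 ?t ?w i = fls_const (vec3 1 0 0 i) + ?t * u"
    using w t rv_0[OF infp_curve] unfolding vec3_def
    by (cases "i = 0"; cases "i = 1"; cases "i = 2") (auto intro!: exI[of _ 0])
qed (auto simp: ev_infp vanishes_infp peval_gev)

lemma lunif_exists:
  assumes "p \<in> curve"
  obtains t where "lunif p t"
  using assms
proof (cases rule: curve_cases)
  case (2 a b)
  then show ?thesis using that lunif_xs lunif_ys by (cases "b = 0") auto
qed (use that lunif_infp in blast)

lemma lunif_rv: "lunif p t \<Longrightarrow> rv p t 0" and lunif_nz: "lunif p t \<Longrightarrow> t \<noteq> 0"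
  by (auto simp: lunif_def)

lemma lunif_curve: "lunif p t \<Longrightarrow> p \<in> curve"
  using lunif_rv rv_curve by blast

lemma rv_powi: "rv p e c \<Longrightarrow> c \<noteq> 0 \<Longrightarrow> rv p (e powi n) (c powi n)"
  unfolding power_int_def by (auto intro: rv_power rv_inverse)

definition is_ord :: "point \<Rightarrow> int \<Rightarrow> complex fls \<Rightarrow> bool" where
  "is_ord p n e \<longleftrightarrow> (\<exists>t u c. lunif p t \<and> rv p u c \<and> c \<noteq> 0 \<and> e = t powi n * u)"

lemma is_ordI: "lunif p t \<Longrightarrow> rv p u c \<Longrightarrow> c \<noteq> 0 \<Longrightarrow> e = t powi n * u \<Longrightarrow> is_ord p n e"
  unfolding is_ord_def by blast

lemma lunif_associated:
  assumes "lunif p t" "lunif p t'"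
  obtains w c where "rv p w c" "c \<noteq> 0" "t' = t * w"
proof -
  obtain w c where w: "rv p w c" "t' = t * w" using assms unfolding lunif_def by blast
  obtain w' c' where w': "rv p w' c'" "t = t' * w'" using assms unfolding lunif_def by blast
  have "t * (w * w') = t * 1" using w(2) w'(2) by (metis mult.assoc mult.right_neutral)
  then have "w * w' = 1" using lunif_nz[OF assms(1)] by (metis mult_cancel_left)
  then have "c * c' = 1" using rv_unique[OF rv_mult[OF w(1) w'(1)]] rv_1[OF rv_curve[OF w(1)]] by simp
  then have "c \<noteq> 0" by auto
  then show thesis using that w by blast
qed

lemma is_ord_with:
  assumes "is_ord p n e" "lunif p t"
  obtains u c where "rv p u c" "c \<noteq> 0" "e = t powi n * u"
proof -
  obtain t' u c where u: "lunif p t'" "rv p u c" "c \<noteq> 0" "e = t' powi n * u" using assms is_ord_def by blast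
  obtain w b where w: "rv p w b" "b \<noteq> 0" "t' = t * w" using lunif_associated[OF assms(2) u(1)] by blast
  have "rv p (w powi n * u) (b powi n * c)" by (intro rv_mult rv_powi w u)
  moreover have "e = t powi n * (w powi n * u)" using u w by (simp add: power_int_mult_distrib mult_ac)
  ultimately show thesis using that w u by (metis mult_eq_0_iff power_int_not_zero)
qed

lemma is_ord_mult:
  assumes "is_ord p n e" "is_ord p m e'"
  shows "is_ord p (n + m) (e * e')"
proof -
  obtain t where t: "lunif p t" using assms is_ord_def by blast
  obtain u c where u: "rv p u c" "c \<noteq> 0" "e = t powi n * u" using is_ord_with[OF assms(1) t] by blast
  obtain u' c' where u': "rv p u' c'" "c' \<noteq> 0" "e' = t powi m * u'" using is_ord_with[OF assms(2) t] by blast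
  show ?thesis
    by (rule is_ordI[OF t rv_mult[OF u(1) u'(1)]]) (use u u' lunif_nz[OF t] in \<open>auto simp: power_int_add mult_ac\<close>)
qed

lemma is_ord_inverse:
  assumes "is_ord p n e"
  shows "is_ord p (- n) (inverse e)"
proof -
  obtain t u c where u: "lunif p t" "rv p u c" "c \<noteq> 0" "e = t powi n * u" using assms is_ord_def by blast
  show ?thesis by (rule is_ordI[OF u(1) rv_inverse[OF u(2,3)]]) (use u in \<open>auto simp: power_int_minus\<close>)
qed

lemma is_ord_unit: "rv p u c \<Longrightarrow> c \<noteq> 0 \<Longrightarrow> is_ord p 0 u"
  using lunif_exists[OF rv_curve, of p u c] is_ordI[of p _ u c u 0] by auto

lemma is_ord_lunif: "lunif p t \<Longrightarrow> is_ord p 1 t"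
  using is_ordI[OF _ rv_1[OF lunif_curve], of p t t t 1] by simp

lemma is_ord_nonzero: "is_ord p n e \<Longrightarrow> e \<noteq> 0"
  unfolding is_ord_def using rv_nonzero lunif_nz by (metis mult_eq_0_iff power_int_not_zero)

lemma is_ord_rv:
  assumes "is_ord p n e"
  shows "(\<exists>c. rv p e c) \<longleftrightarrow> n \<ge> 0" "rv p e 0 \<longleftrightarrow> n > 0"
proof -
  obtain t u c where u: "lunif p t" "rv p u c" "c \<noteq> 0" "e = t powi n * u" using assms is_ord_def by blast
  have pos: "rv p e (0 ^ nat n * c)" if "n \<ge> 0"
    unfolding u(4) using that rv_mult[OF rv_power[OF lunif_rv[OF u(1)]] u(2)] by (simp add: power_int_def)
  have neg: False if "n < 0" "rv p e x" for x
  proof -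
    have "u = t ^ nat (- n) * e" unfolding u(4) using that lunif_nz[OF u(1)] by (simp add: power_int_def field_simps)
    then have "rv p u (0 ^ nat (- n) * x)" using rv_mult[OF rv_power[OF lunif_rv[OF u(1)]] that(2)] by simp
    then show False using rv_unique[OF u(2)] u(3) that(1) by (simp add: power_0_left)
  qed
  show "(\<exists>c. rv p e c) \<longleftrightarrow> n \<ge> 0" using pos neg by (meson not_le)
  have "rv p e 0" if "n > 0" using pos that by (simp add: power_0_left)
  moreover have "n > 0" if "rv p e 0"
  proof (rule ccontr)
    assume "\<not> n > 0"
    moreover have "n \<ge> 0" using neg that by (meson not_le)
    ultimately have "rv p e c" using pos by simp
    then show False using rv_unique that u(3) by blast
  qed
  ultimately show "rv p e 0 \<longleftrightarrow> n > 0" by blast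
qed

lemma is_ord_unique:
  assumes "is_ord p n e" "is_ord p m e"
  shows "n = m"
proof -
  have "is_ord p (n + - m) (e * inverse e)" by (intro is_ord_mult is_ord_inverse assms)
  then have "is_ord p (n - m) 1" using is_ord_nonzero[OF assms(1)] by simp
  moreover have "p \<in> curve" using assms is_ord_def rv_curve by blast
  then have "rv p 1 1" "\<not> rv p 1 0" using rv_1 rv_unique by fastforce+
  ultimately show ?thesis using is_ord_rv[of p "n - m" 1] by auto
qed

text \<open>Each division of e by a uniformizer lowers the order of the product, which cannot become
  negative while both factors are regular; hence only finitely many divisions are possible.\<close>

lemma is_ord_factor:
  assumes "is_ord p n (e * e')" "rv p e c" "rv p e' c'"
  shows "\<exists>m. is_ord p m e"
  using assms
proof (induction "nat n" arbitrary: n e c rule: less_induct)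
  case less
  obtain t where t: "lunif p t" using less.prems is_ord_def by blast
  show ?case
  proof (cases "c = 0")
    case True
    then obtain u b where u: "rv p u b" "e = t * u" using t less.prems(2) unfolding lunif_def by blast
    have "rv p (e * e') 0" using rv_mult[OF less.prems(2,3)] True by simp
    then have n: "n > 0" using is_ord_rv(2)[OF less.prems(1)] by blast
    have "is_ord p (n + - 1) ((e * e') * inverse t)" by (intro is_ord_mult is_ord_inverse is_ord_lunif t less.prems)
    moreover have "(e * e') * inverse t = u * e'" using u lunif_nz[OF t] by (simp add: field_simps)
    ultimately have "is_ord p (n - 1) (u * e')" by simp
    then obtain m where "is_ord p m u" using less.hyps[of "n - 1" u b] n u less.prems(3) by auto
    then have "is_ord p (1 + m) e" unfolding u(2) by (intro is_ord_mult is_ord_lunif t)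
    then show ?thesis by blast
  qed (use less.prems is_ord_unit in blast)
qed

lemma is_ord_PE_xs:
  assumes "(a, b) \<in> Aff" "q \<noteq> 0"
  shows "\<exists>n. is_ord (pt a b) n (PE xs q)"
  using assms(2)
proof (induction "degree q" arbitrary: q)
  case 0
  then obtain c where "q = [:c:]" "c \<noteq> 0" by (metis degree_eq_zeroE pCons_0_0)
  then show ?case using is_ord_unit[OF rv_const[of "pt a b" c]] assms(1) by auto
next
  case (Suc n)
  then have "\<not> constant (poly q)" by (simp add: constant_degree)
  then obtain z where "poly q z = 0" using fundamental_theorem_of_algebra by blast
  then obtain r where r: "q = [:- z, 1:] * r" by (auto simp: poly_eq_0_iff_dvd)
  then have rn: "r \<noteq> 0" "degree r = n" using Suc by (auto simp: degree_mult_eq simp del: mult_pCons_left)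
  then obtain m where m: "is_ord (pt a b) m (PE xs r)" using Suc by blast
  have "\<exists>m. is_ord (pt a b) m (xs - fls_const z)"
  proof (cases "z = a")
    case False
    then show ?thesis using is_ord_unit[OF rv_diff[OF rv_xs[OF assms(1)] rv_const[of _ z]]] assms by auto
  next
    case True
    show ?thesis
    proof (cases "b = 0")
      case False
      then show ?thesis using lunif_xs[OF assms(1)] is_ord_lunif True by blast
    next
      case b: True
      then obtain u c where "rv (pt a b) u c" "c \<noteq> 0" "xs - fls_const a = ys ^ d * u"
        using xs_at_branch_point assms(1) by metis
      then show ?thesis using is_ordI[of "pt a b" ys u c _ "int d"] lunif_ys assms(1) b True
        by (metis power_int_of_nat)
    qed
  qed
  then obtain m' where m': "is_ord (pt a b) m' (xs - fls_const z)" by blast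
  show ?case unfolding r PE_mult PE_linear using is_ord_mult[OF m' m] by blast
qed

text \<open>For a polynomial in x the order is found factor by factor. An element of the coordinate
  ring divides such a polynomial, its norm, and denominators can be taken to be polynomials in x as
  well.\<close>

lemma is_ord_affine:
  assumes "(a, b) \<in> Aff" "e \<in> KK" "e \<noteq> 0"
  shows "\<exists>n. is_ord (pt a b) n e"
proof -
  have A: "\<exists>n. is_ord (pt a b) n e" if A: "e \<in> Acoord" "e \<noteq> 0" for e
  proof -
    obtain e' c where c: "e' \<in> Acoord" "c \<noteq> 0" "e * e' = PE xs c" using norm_exists[OF A] by blast
    obtain n where "is_ord (pt a b) n (e * e')" using is_ord_PE_xs[OF assms(1) c(2)] c(3) by auto
    then show ?thesis using is_ord_factor rv_Acoord[OF A(1) assms(1)] rv_Acoord[OF c(1) assms(1)] by blast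
  qed
  obtain c where c: "c \<noteq> 0" "e * PE xs c \<in> Acoord" using KK_denominator[OF assms(2)] by blast
  have nz: "PE xs c \<noteq> 0" using PE_xs_subdegree[OF c(1)] by blast
  obtain n where n: "is_ord (pt a b) n (e * PE xs c)" using A[OF c(2)] nz assms(3) by auto
  obtain m where m: "is_ord (pt a b) m (PE xs c)" using is_ord_PE_xs[OF assms(1) c(1)] by blast
  have "is_ord (pt a b) (n + - m) ((e * PE xs c) * inverse (PE xs c))" by (intro is_ord_mult is_ord_inverse n m)
  moreover have "(e * PE xs c) * inverse (PE xs c) = e" using nz by (simp add: mult.assoc)
  ultimately show ?thesis by auto
qed

section \<open>Orders at the point at infinity\<close>

lemma rv_infp_fps:
  assumes "rv infp e c"
  obtains f where "e = fps_to_fls f" "f $ 0 = c"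
proof -
  obtain F G n where f: "is_frac F G n e" "\<not> vanishes G infp" "c = peval F (rep infp) / peval G (rep infp)"
    using assms unfolding rv_def by blast
  have h: "homogeneous n F" "homogeneous n G" "e = ev F / ev G" using f by (auto simp: is_frac_def)
  have G0: "evi G $ 0 \<noteq> 0" using f(2) by (simp add: vanishes_infp[OF h(2)] evi_0)
  have c: "c = evi F $ 0 / evi G $ 0"
    unfolding evi_0 f(3) infp_def by (rule peval_quotient_proj_point[OF h(1,2)])
  have "e = fps_to_fls (evi F) / fps_to_fls (evi G)" unfolding h(3) ev_evi[OF h(1)] ev_evi[OF h(2)] by simp
  also have "\<dots> = fps_to_fls (evi F * inverse (evi G))"
    using G0 by (simp add: field_class.field_divide_inverse fls_inverse_fps_to_fls fls_times_fps_to_fls)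
  finally show thesis using that[of "evi F * inverse (evi G)"] c by (simp add: field_class.field_divide_inverse)
qed

lemma subdegree_unit_infp: "rv infp u c \<Longrightarrow> c \<noteq> 0 \<Longrightarrow> fls_subdegree u = 0"
  by (elim rv_infp_fps) (auto simp: fls_subdegree_fls_to_fps subdegree_eq_0)

lemma subdegree_lunif: "fls_subdegree (ys / xs) = 1"
  using d4 by (simp add: fls_divide_subdegree subdegree_xs subdegree_ys)

lemma is_ord_infp_subdegree:
  assumes "is_ord infp n e"
  shows "fls_subdegree e = n"
proof -
  obtain u c where u: "rv infp u c" "c \<noteq> 0" "e = (ys / xs) powi n * u" using is_ord_with[OF assms lunif_infp] by blast
  have nz: "u \<noteq> 0" "(ys / xs) powi n \<noteq> 0" using u rv_nonzero by auto
  have "fls_subdegree e = fls_subdegree ((ys / xs) powi n)"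
    unfolding u(3) using nz subdegree_unit_infp[OF u(1,2)] by (subst fls_subdegree_mult) auto
  then show ?thesis by (simp add: subdegree_lunif)
qed

text \<open>The order in X bounds the number of divisions by the local parameter y/x, which has
  order 1 in X.\<close>

lemma is_ord_infp_regular:
  assumes "rv infp e c" "e \<noteq> 0"
  shows "\<exists>n. is_ord infp n e"
  using assms
proof (induction "nat (fls_subdegree e)" arbitrary: e c rule: less_induct)
  case less
  show ?case
  proof (cases "c = 0")
    case True
    then obtain u b where u: "rv infp u b" "e = ys / xs * u"
      using lunif_infp less.prems(1) unfolding lunif_def by blast
    have nz: "u \<noteq> 0" "ys / xs \<noteq> 0" using u less.prems(2) by auto
    have "fls_subdegree e = 1 + fls_subdegree u" unfolding u(2) using nz subdegree_lunif by (subst fls_subdegree_mult) auto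
    moreover have "fls_subdegree u \<ge> 0" using u(1) by (elim rv_infp_fps) (auto simp: fls_subdegree_fls_to_fps)
    ultimately obtain m where "is_ord infp m u" using less.hyps[of u b] u nz by auto
    then have "is_ord infp (1 + m) e" unfolding u(2) by (intro is_ord_mult is_ord_lunif lunif_infp)
    then show ?thesis by blast
  qed (use less.prems is_ord_unit in blast)
qed

lemma is_ord_infp:
  assumes "e \<in> KK" "e \<noteq> 0"
  shows "\<exists>n. is_ord infp n e"
proof -
  obtain F G n where f: "is_frac F G n e" using assms(1) by (rule KK_E)
  then have h: "homogeneous n F" "homogeneous n G" "e = ev F / ev G" "ev G \<noteq> 0" by (auto simp: is_frac_def)
  have e1: "ev (mvar 0 ^ n) = xs ^ n" by (simp add: ev_simps)
  have fr: "is_frac F (mvar 0 ^ n) n (ev F / xs ^ n)" "is_frac G (mvar 0 ^ n) n (ev G / xs ^ n)"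
    using h by (simp_all add: is_frac_def e1 homogeneous_var_power)
  have "peval (mvar 0 ^ n) (vec3 1 0 0) \<noteq> 0"
    by (simp add: peval_gev rhom_simps[OF gev_rhom[OF rhom_id]] gev_var[OF rhom_id])
  then have "\<exists>c. rv infp (ev F / xs ^ n) c" "\<exists>c. rv infp (ev G / xs ^ n) c"
    using rv_infp[OF fr(1)] rv_infp[OF fr(2)] by blast+
  then obtain a b where "is_ord infp a (ev F / xs ^ n)" "is_ord infp b (ev G / xs ^ n)"
    using is_ord_infp_regular h assms(2) by fastforce
  then have "is_ord infp (a + - b) (ev F / xs ^ n * inverse (ev G / xs ^ n))" by (intro is_ord_mult is_ord_inverse)
  also have "ev F / xs ^ n * inverse (ev G / xs ^ n) = e" using h by simp
  finally show ?thesis by blast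
qed

definition ord :: "point \<Rightarrow> complex fls \<Rightarrow> int" where "ord p e = (THE n. is_ord p n e)"

lemma ord_eqI: "is_ord p n e \<Longrightarrow> ord p e = n"
  unfolding ord_def using is_ord_unique by blast

lemma is_ord_ord:
  assumes "p \<in> curve" "e \<in> KK" "e \<noteq> 0"
  shows "is_ord p (ord p e) e"
proof -
  have "\<exists>n. is_ord p n e" using assms(1)
    by (cases rule: curve_cases) (use assms is_ord_infp is_ord_affine in auto)
  then show ?thesis using ord_eqI by blast
qed

lemma ord_infp: "e \<in> KK \<Longrightarrow> e \<noteq> 0 \<Longrightarrow> ord infp e = fls_subdegree e"
  using is_ord_infp_subdegree[OF is_ord_ord[OF infp_curve]] by simp

lemma ord_mult: "p \<in> curve \<Longrightarrow> e \<in> KK \<Longrightarrow> e \<noteq> 0 \<Longrightarrow> e' \<in> KK \<Longrightarrow> e' \<noteq> 0 \<Longrightarrow> ord p (e * e') = ord p e + ord p e'"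
  by (intro ord_eqI is_ord_mult is_ord_ord)

lemma ord_inverse: "p \<in> curve \<Longrightarrow> e \<in> KK \<Longrightarrow> e \<noteq> 0 \<Longrightarrow> ord p (inverse e) = - ord p e"
  by (intro ord_eqI is_ord_inverse is_ord_ord)

lemma ord_divide: "p \<in> curve \<Longrightarrow> e \<in> KK \<Longrightarrow> e \<noteq> 0 \<Longrightarrow> e' \<in> KK \<Longrightarrow> e' \<noteq> 0 \<Longrightarrow> ord p (e / e') = ord p e - ord p e'"
  by (simp add: field_class.field_divide_inverse ord_mult ord_inverse KK_inverse)

lemma ord_ge_0_iff: "p \<in> curve \<Longrightarrow> e \<in> KK \<Longrightarrow> e \<noteq> 0 \<Longrightarrow> 0 \<le> ord p e \<longleftrightarrow> (\<exists>c. rv p e c)"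
  using is_ord_rv(1)[OF is_ord_ord] by blast

lemma ord_pos_iff: "p \<in> curve \<Longrightarrow> e \<in> KK \<Longrightarrow> e \<noteq> 0 \<Longrightarrow> 0 < ord p e \<longleftrightarrow> rv p e 0"
  using is_ord_rv(2)[OF is_ord_ord] by blast

lemma ord_unit: "rv p u c \<Longrightarrow> c \<noteq> 0 \<Longrightarrow> ord p u = 0"
  by (intro ord_eqI is_ord_unit)



lemma finite_ord_nonzero:
  assumes "e \<in> KK" "e \<noteq> 0"
  shows "finite {p \<in> curve. ord p e \<noteq> 0}"
proof -
  obtain F G n where f: "is_frac F G n e" using assms(1) by (rule KK_E)
  then have h: "homogeneous n F" "homogeneous n G" "ev F \<noteq> 0" "ev G \<noteq> 0" using assms(2) by (auto simp: is_frac_def)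
  have "ord p e = 0" if "p \<in> curve" "\<not> vanishes F p" "\<not> vanishes G p" for p
    by (rule ord_unit[OF rvI[OF that(1) f that(3)]]) (use that in \<open>simp add: vanishes_def\<close>)
  then have "{p \<in> curve. ord p e \<noteq> 0} \<subseteq> {p \<in> curve. vanishes F p} \<union> {p \<in> curve. vanishes G p}" by blast
  then show ?thesis using ev_finite_zeros h finite_subset by blast
qed

lemma uniformizer_gm:
  assumes "t \<in> KK" "p \<in> curve"
  shows "uniformizer curve p (gm t) \<longleftrightarrow> lunif p t"
proof
  assume u: "uniformizer curve p (gm t)"
  then have t: "rv p t 0" and m: "max_ideal curve p = {gm t \<otimes>\<^bsub>FF\<^esub> u | u. u \<in> local_ring curve p}"
    unfolding uniformizer_def gm_max_ideal_iff[OF assms] by auto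
  have div: "\<exists>u c. rv p u c \<and> e = t * u" if e: "rv p e 0" for e
  proof -
    have "gm e \<in> max_ideal curve p" using gm_max_ideal_iff[OF rv_KK[OF e] assms(2)] e by simp
    then obtain u c where u: "rv p u c" "gm e = gm t \<otimes>\<^bsub>FF\<^esub> gm u" unfolding m local_ring_eq[OF assms(2)] by auto
    then have "gm e = gm (t * u)" using gm_mult[OF assms(1) rv_KK[OF u(1)]] by simp
    then have "e = t * u" using gm_eq_iff rv_KK[OF e] KK_mult[OF assms(1) rv_KK[OF u(1)]] by blast
    then show ?thesis using u by blast
  qed
  obtain s where s: "lunif p s" using lunif_exists[OF assms(2)] by blast
  then have "t \<noteq> 0" using div[OF lunif_rv[OF s]] lunif_nz[OF s] by auto
  then show "lunif p t" unfolding lunif_def using t div by blast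
next
  assume l: "lunif p t"
  have "max_ideal curve p = {gm t \<otimes>\<^bsub>FF\<^esub> u | u. u \<in> local_ring curve p}"
  proof (intro equalityI subsetI)
    fix A assume "A \<in> max_ideal curve p"
    then obtain e where e: "rv p e 0" "A = gm e" unfolding local_ring_eq[OF assms(2)] by auto
    then obtain u c where u: "rv p u c" "e = t * u" using l unfolding lunif_def by blast
    then have "A = gm t \<otimes>\<^bsub>FF\<^esub> gm u" using gm_mult[OF assms(1) rv_KK[OF u(1)]] e by simp
    then show "A \<in> {gm t \<otimes>\<^bsub>FF\<^esub> u | u. u \<in> local_ring curve p}" unfolding local_ring_eq[OF assms(2)] using u by blast
  next
    fix A assume "A \<in> {gm t \<otimes>\<^bsub>FF\<^esub> u | u. u \<in> local_ring curve p}"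
    then obtain u c where u: "rv p u c" "A = gm t \<otimes>\<^bsub>FF\<^esub> gm u" unfolding local_ring_eq[OF assms(2)] by auto
    then have "A = gm (t * u)" using gm_mult[OF assms(1) rv_KK[OF u(1)]] by simp
    moreover have "rv p (t * u) 0" using rv_mult[OF lunif_rv[OF l] u(1)] by simp
    ultimately show "A \<in> max_ideal curve p" unfolding local_ring_eq[OF assms(2)] by blast
  qed
  then show "uniformizer curve p (gm t)"
    unfolding uniformizer_def gm_max_ideal_iff[OF assms] using lunif_rv[OF l] by blast
qed

lemma uniformizer_E:
  assumes "uniformizer curve p T" "p \<in> curve"
  obtains t where "T = gm t" "lunif p t" "t \<in> KK"
proof -
  have "T \<in> max_ideal curve p" using assms(1) unfolding uniformizer_def by blast
  then obtain t where t: "rv p t 0" "T = gm t" unfolding local_ring_eq[OF assms(2)] by auto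
  then show thesis using that uniformizer_gm[OF rv_KK[OF t(1)] assms(2)] assms(1) rv_KK by blast
qed

lemma order_at_gm:
  assumes "p \<in> curve" "e \<in> KK" "e \<noteq> 0"
  shows "order_at curve p (gm e) = ord p e"
  unfolding order_at_def
proof (rule the_equality)
  obtain t where t: "lunif p t" using lunif_exists[OF assms(1)] by blast
  note tK = rv_KK[OF lunif_rv[OF t]]
  obtain u c where u: "rv p u c" "c \<noteq> 0" "e = t powi (ord p e) * u"
    using is_ord_with[OF is_ord_ord[OF assms] t] by blast
  have "gm e = gm t [^]\<^bsub>FF\<^esub> (ord p e) \<otimes>\<^bsub>FF\<^esub> gm u"
    using gm_mult[OF KK_powi[OF tK, of "ord p e"] rv_KK[OF u(1)]] u(3) gm_powi[OF tK lunif_nz[OF t]] by simp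
  moreover have "gm u \<in> local_ring curve p - max_ideal curve p"
    using gm_local_ring_iff gm_max_ideal_iff rv_KK[OF u(1)] assms(1) u rv_unique by blast
  ultimately show "\<exists>t u. uniformizer curve p t \<and> u \<in> local_ring curve p - max_ideal curve p \<and>
     gm e = t [^]\<^bsub>FF\<^esub> (ord p e) \<otimes>\<^bsub>FF\<^esub> u"
    using uniformizer_gm[OF tK assms(1)] t by blast
next
  fix k :: int assume "\<exists>t u. uniformizer curve p t \<and> u \<in> local_ring curve p - max_ideal curve p \<and> gm e = t [^]\<^bsub>FF\<^esub> k \<otimes>\<^bsub>FF\<^esub> u"
  then obtain T U where TU: "uniformizer curve p T" "U \<in> local_ring curve p - max_ideal curve p" "gm e = T [^]\<^bsub>FF\<^esub> k \<otimes>\<^bsub>FF\<^esub> U" by blast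
  obtain t where t: "T = gm t" "lunif p t" "t \<in> KK" using uniformizer_E[OF TU(1) assms(1)] by blast
  obtain u c where u: "rv p u c" "U = gm u" using TU(2) unfolding local_ring_eq[OF assms(1)] by auto
  have c: "c \<noteq> 0" using TU(2) u gm_max_ideal_iff[OF rv_KK[OF u(1)] assms(1)] by auto
  have "gm e = gm (t powi k * u)"
    using TU(3) t u gm_mult[OF KK_powi[OF t(3)] rv_KK[OF u(1)]] gm_powi[OF t(3) lunif_nz[OF t(2)]] by simp
  then have "e = t powi k * u" using gm_eq_iff assms(2) KK_mult[OF KK_powi[OF t(3)] rv_KK[OF u(1)]] by blast
  then show "k = ord p e" using ord_eqI[OF is_ordI[OF t(2) u(1) c]] by simp
qed

end

section \<open>Smoothness\<close>

lemma homogeneous_partial_deriv: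
  assumes "homogeneous n F"
  shows "homogeneous (n - 1) (partial_deriv i F)"
  unfolding partial_deriv_def
proof (rule homogeneous_sum)
  fix m assume m: "m \<in> Poly_Mapping.keys F"
  show "homogeneous (n - 1) (Poly_Mapping.single (m - Poly_Mapping.single i 1)
      (of_nat (Poly_Mapping.lookup m i) * Poly_Mapping.lookup F m))"
  proof (cases "Poly_Mapping.lookup m i = 0")
    case False
    then have "m = (m - Poly_Mapping.single i 1) + Poly_Mapping.single i 1"
      by (intro poly_mapping_eqI) (auto simp: lookup_add lookup_minus lookup_single when_def)
    then have "mdeg m = mdeg (m - Poly_Mapping.single i 1) + 1" by (metis mdeg_add mdeg_single)
    then have "mdeg (m - Poly_Mapping.single i 1) = n - 1" using assms m by (auto simp: homogeneous_mdeg)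
    then show ?thesis using homogeneous_single by metis
  qed simp
qed

text \<open>The partial derivative is the derivative at 0 along the line through r in direction i.
  This yields the gradient of \<open>Fc\<close> from its closed form \<open>gev_Fc\<close> instead
  of from its monomials.\<close>

lemma peval_partial_deriv:
  fixes r :: "nat \<Rightarrow> complex"
  assumes "finite I" "\<And>j. j \<notin> I \<Longrightarrow> r j = 0" "i \<in> I"
  shows "peval (partial_deriv i F) r = poly (pderiv (gev (\<lambda>a. [:a:]) F (\<lambda>j. [:r j, if j = i then 1 else 0:]))) 0"
proof -
  have c: "rhom (\<lambda>a::complex. [:a:])" by (simp add: rhom_def one_pCons)
  have h: "rhom (\<lambda>p::complex poly. poly p 0)" by (simp add: rhom_def)
  let ?v = "\<lambda>j. [:r j, if j = i then 1 else 0:]"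
  have "pderiv (gev (\<lambda>a. [:a:]) F ?v) = (\<Sum>j\<in>I. gev (\<lambda>a. [:a:]) (partial_deriv j F) ?v * pderiv (?v j))"
    using assms by (intro gev_chain_rule[OF c]) (auto simp: pderiv_add pderiv_mult pderiv_pCons algebra_simps)
  also have "\<dots> = (\<Sum>j\<in>I. if j = i then gev (\<lambda>a. [:a:]) (partial_deriv i F) ?v else 0)"
    by (rule sum.cong) (auto simp: pderiv_pCons)
  also have "\<dots> = gev (\<lambda>a. [:a:]) (partial_deriv i F) ?v" using assms by simp
  finally have e: "pderiv (gev (\<lambda>a. [:a:]) F ?v) = gev (\<lambda>a. [:a:]) (partial_deriv i F) ?v" .
  have "poly (gev (\<lambda>a. [:a:]) (partial_deriv i F) ?v) 0 = gev (\<lambda>a. a) (partial_deriv i F) r"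
    using gev_hom[OF h, of "\<lambda>a. [:a:]" "partial_deriv i F" ?v] by simp
  then show ?thesis unfolding e peval_gev by simp
qed

lemma irreducible_closed_point: "p \<in> proj_space n \<Longrightarrow> irreducible_closed {p}"
  by (auto simp: irreducible_closed_def zariski_closed_point)

lemma irreducible_closed_finite:
  assumes "irreducible_closed Z" "finite Z" "Z \<subseteq> proj_space n"
  obtains p where "Z = {p}"
proof -
  obtain p where p: "p \<in> Z" using assms(1) by (auto simp: irreducible_closed_def)
  obtain G where G: "homogeneous (card (Z - {p})) G" "\<forall>q\<in>Z - {p}. vanishes G q" "\<not> vanishes G p"
    using separating_form[of "Z - {p}" n p] assms p by blast
  have "zariski_closed {q \<in> proj_space n. \<forall>F\<in>{G}. vanishes F q}"
    unfolding zariski_closed_def using G(1) by blast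
  moreover have "zariski_closed {p}" using zariski_closed_point p assms(3) by blast
  moreover have "Z \<subseteq> {p} \<union> {q \<in> proj_space n. \<forall>F\<in>{G}. vanishes F q}" using G(2) assms(3) by blast
  ultimately have "Z \<subseteq> {p} \<or> Z \<subseteq> {q \<in> proj_space n. \<forall>F\<in>{G}. vanishes F q}"
    using assms(1) unfolding irreducible_closed_def by blast
  then have "Z = {p}" using p G(3) by auto
  then show thesis using that by blast
qed

lemma cofinite_space_irreducible:
  assumes "cofinite_space X" "zariski_closed X"
  shows "irreducible_closed X"
  unfolding irreducible_closed_def
proof (intro conjI allI impI)
  show "X \<noteq> {}" using assms unfolding cofinite_space_def by auto
  fix A B assume AB: "zariski_closed A" "zariski_closed B" "X \<subseteq> A \<union> B"
  show "X \<subseteq> A \<or> X \<subseteq> B"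
  proof (rule ccontr)
    assume "\<not> ?thesis"
    then have "finite (X \<inter> A)" "finite (X \<inter> B)" using assms AB unfolding cofinite_space_def by blast+
    moreover have "X = (X \<inter> A) \<union> (X \<inter> B)" using AB by blast
    ultimately have "finite X" by (metis finite_UnI)
    then show False using assms unfolding cofinite_space_def by blast
  qed
qed (use assms in auto)

text \<open>A proper irreducible closed subset is finite and therefore a point, and a point has no
  smaller nonempty subset; so a chain has at most two members.\<close>

lemma cofinite_space_dim:
  assumes X: "cofinite_space X" "zariski_closed X"
  shows "variety_dim X = 1"
  unfolding variety_dim_def
proof (rule Greatest_equality)
  obtain n where n: "X \<subseteq> proj_space n" using X by (auto simp: cofinite_space_def)
  have "infinite X" using X unfolding cofinite_space_def by blast
  then have "X \<noteq> {}" by auto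
  then obtain p where p: "p \<in> X" by blast
  have "infinite X" using X unfolding cofinite_space_def by blast
  then have "X \<noteq> {p}" by auto
  then have px: "{p} \<subset> X" using p by blast
  let ?Z = "\<lambda>i::nat. if i = 0 then {p} else X"
  have pc: "irreducible_closed {p}" using irreducible_closed_point n p by blast
  have xc: "irreducible_closed X" by (rule cofinite_space_irreducible[OF X])
  have "irreducible_closed (?Z i) \<and> ?Z i \<subseteq> X" for i using pc xc p by simp
  moreover have "?Z i \<subset> ?Z (Suc i)" if "i < 1" for i using px that by simp
  ultimately show "\<exists>Z. (\<forall>i\<le>1. irreducible_closed (Z i) \<and> Z i \<subseteq> X) \<and> (\<forall>i<1. Z i \<subset> Z (Suc i))"
    by (intro exI[of _ ?Z] conjI allI impI) blast+
  fix m assume "\<exists>Z. (\<forall>i\<le>m. irreducible_closed (Z i) \<and> Z i \<subseteq> X) \<and> (\<forall>i<m. Z i \<subset> Z (Suc i))"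
  then obtain Z where Z: "\<And>i. i \<le> m \<Longrightarrow> irreducible_closed (Z i) \<and> Z i \<subseteq> X" "\<And>i. i < m \<Longrightarrow> Z i \<subset> Z (Suc i)"
    by blast
  show "m \<le> 1"
  proof (rule ccontr)
    assume "\<not> m \<le> 1"
    then have m: "m \<ge> 2" by simp
    have s: "Z 0 \<subset> Z 1" "Z 1 \<subset> Z 2" using Z(2)[of 0] Z(2)[of 1] m by (simp_all add: numeral_2_eq_2 One_nat_def)
    have ir: "irreducible_closed (Z 1)" "irreducible_closed (Z 0)" "Z 1 \<subseteq> X" "Z 2 \<subseteq> X"
      using Z(1)[of 1] Z(1)[of 0] Z(1)[of 2] m by simp_all
    then have "zariski_closed (Z 1)" "Z 0 \<noteq> {}" unfolding irreducible_closed_def by simp_all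
    moreover have "\<not> X \<subseteq> Z 1" using ir s by blast
    ultimately have "finite (X \<inter> Z 1)" using X unfolding cofinite_space_def by blast
    moreover have "X \<inter> Z 1 = Z 1" using ir by blast
    ultimately have "finite (Z 1)" by simp
    moreover have "Z 1 \<subseteq> proj_space n" using ir n by blast
    ultimately obtain q where q: "Z 1 = {q}" by (rule irreducible_closed_finite[OF ir(1)])
    then have "Z 0 \<subset> {q}" using s(1) by simp
    then show False using \<open>Z 0 \<noteq> {}\<close> by (auto simp: psubset_eq dest: subset_singletonD)
  qed
qed

context plane_curve
begin

definition Fc :: mpoly where "Fc = mvar 1 ^ d - mvar 0 ^ (d - 1) * mvar 2 + mvar 2 ^ d"

lemma homogeneous_Fc: "homogeneous d Fc"
proof -
  have "homogeneous (d - 1 + 1) (mvar 0 ^ (d - 1) * mvar 2)"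
    by (intro homogeneous_mult homogeneous_var_power homogeneous_var)
  then have "homogeneous d (mvar 0 ^ (d - 1) * mvar 2)" using d4 by simp
  then show ?thesis unfolding Fc_def by (intro homogeneous_add homogeneous_diff homogeneous_var_power)
qed

lemma gev_Fc: "rhom c \<Longrightarrow> gev c Fc v = v 1 ^ d - v 0 ^ (d - 1) * v 2 + v 2 ^ d"
  by (simp add: Fc_def rhom_simps[OF gev_rhom] gev_var)

lemma in_curve_iff:
  assumes "p \<in> proj_space 2"
  shows "p \<in> curve \<longleftrightarrow> vanishes Fc p"
proof
  assume "p \<in> curve"
  then show "vanishes Fc p"
  proof (cases rule: curve_cases)
    case 1
    then show ?thesis using d4 by (simp add: vanishes_infp[OF homogeneous_Fc] peval_gev gev_Fc rhom_id power_0_left)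
  next
    case (2 a b)
    then show ?thesis by (simp add: vanishes_pt[OF homogeneous_Fc] peval_gev gev_Fc rhom_id Aff_def)
  qed
next
  assume v: "vanishes Fc p"
  let ?r = "rep p"
  have e: "?r 1 ^ d = ?r 0 ^ (d - 1) * ?r 2 - ?r 2 ^ d"
    using v by (simp add: vanishes_def peval_gev gev_Fc rhom_id algebra_simps)
  have p: "proj_point ?r = p" "\<exists>i. ?r i \<noteq> 0" "\<And>i. i > 2 \<Longrightarrow> ?r i = 0" using proj_space_rep[OF assms] by blast+
  have r: "?r = vec3 (?r 0) (?r 1) (?r 2)"
  proof
    fix i :: nat
    consider "i = 0" | "i = 1" | "i = 2" | "i > 2" by linarith
    then show "?r i = vec3 (?r 0) (?r 1) (?r 2) i" by cases (auto simp: p(3))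
  qed
  obtain a b c where rr: "?r = vec3 a b c" using r by blast
  show "p \<in> curve"
  proof (cases "?r 2 = 0")
    case True
    then have "?r 1 = 0" using e d4 by (simp add: power_0_left)
    moreover have "?r 0 \<noteq> 0"
    proof
      assume "?r 0 = 0"
      then have "?r = vec3 0 0 0" using r True \<open>?r 1 = 0\<close> by metis
      then show False using p(2) by (auto simp: vec3_def split: if_splits)
    qed
    ultimately have "proj_point (vec3 1 0 0) = proj_point ?r"
      using True \<open>?r 1 = 0\<close> by (intro proj_point_eqI[of "?r 0"]) (auto simp: rr vec3_def)
    then show ?thesis using p(1) by (simp add: infp_def[symmetric])
  next
    case False
    have "proj_point (vec3 (?r 0 / ?r 2) (?r 1 / ?r 2) 1) = proj_point ?r"
      using False by (intro proj_point_eqI[of "?r 2"]) (auto simp: rr vec3_def)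
    then have pp: "p = pt (?r 0 / ?r 2) (?r 1 / ?r 2)" using p(1) by (simp add: pt_def)
    have "?r 2 ^ d = ?r 2 ^ (d - 1) * ?r 2" using d4 by (simp flip: power_Suc2)
    then have "(?r 0 / ?r 2, ?r 1 / ?r 2) \<in> Aff"
      unfolding Aff_def using e False by (simp add: field_simps)
    then show ?thesis by (subst pp) simp
  qed
qed

lemma closed_curve: "zariski_closed curve"
proof -
  have "curve = {p \<in> proj_space 2. \<forall>F\<in>{Fc}. vanishes F p}" using in_curve_iff curve_space by auto
  then show ?thesis unfolding zariski_closed_def using homogeneous_Fc by blast
qed

section \<open>The Jacobian criterion\<close>

definition grad :: "mpoly \<Rightarrow> point \<Rightarrow> nat \<Rightarrow> complex" where
  "grad F p = (\<lambda>i. if i \<le> 2 then peval (partial_deriv i F) (rep p) else 0)"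

lemma grad_Fc_nonzero:
  assumes "p \<in> curve"
  shows "\<exists>i\<le>2. grad Fc p i \<noteq> 0"
proof (rule ccontr)
  assume neg: "\<not> ?thesis"
  let ?r = "rep p"
  have sp: "p \<in> proj_space 2" using assms curve_space by blast
  have c: "rhom (\<lambda>a::complex. [:a:])" by (simp add: rhom_def one_pCons)
  have I: "finite {..2::nat}" "\<And>j. j \<notin> {..2} \<Longrightarrow> ?r j = 0" using proj_space_rep(3)[OF sp] by auto
  have pp: "pderiv (f ^ n) = smult (of_nat n) (f ^ (n - 1) * pderiv f)" for f :: "complex poly" and n
  proof (cases n)
    case (Suc m)
    then show ?thesis unfolding Suc pderiv_power_Suc by simp
  qed simp
  note P = peval_partial_deriv[OF I, where F = Fc, unfolded gev_Fc[OF c]]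
  have "peval (partial_deriv 0 Fc) ?r = - (of_nat (d - 1) * ?r 0 ^ (d - 2) * ?r 2)"
    using d4 by (subst P) (simp_all add: pderiv_add pderiv_diff pp pderiv_mult pderiv_smult pderiv_pCons power_0_left)
  then have "grad Fc p 0 = - (of_nat (d - 1) * ?r 0 ^ (d - 2) * ?r 2)" by (simp add: grad_def)
  then have g0: "?r 0 = 0 \<or> ?r 2 = 0" using neg d4 by auto
  have "peval (partial_deriv 1 Fc) ?r = of_nat d * ?r 1 ^ (d - 1)"
    using d4 by (subst P) (simp_all add: pderiv_add pderiv_diff pp pderiv_mult pderiv_smult pderiv_pCons power_0_left)
  then have "grad Fc p 1 = of_nat d * ?r 1 ^ (d - 1)" by (simp add: grad_def)
  moreover have "grad Fc p 1 = 0" using neg by auto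
  ultimately have g1: "?r 1 = 0" using d4 by auto
  have "peval (partial_deriv 2 Fc) ?r = - (?r 0 ^ (d - 1)) + of_nat d * ?r 2 ^ (d - 1)"
    using d4 by (subst P) (simp_all add: pderiv_add pderiv_diff pp pderiv_mult pderiv_smult pderiv_pCons power_0_left)
  then have "grad Fc p 2 = - (?r 0 ^ (d - 1)) + of_nat d * ?r 2 ^ (d - 1)" by (simp add: grad_def)
  then have g2: "?r 0 ^ (d - 1) = of_nat d * ?r 2 ^ (d - 1)" using neg by auto
  have "?r 0 = 0 \<and> ?r 2 = 0" using g0 g2 d4 by (auto simp: power_0_left)
  then have "?r i = 0" for i
    using g1 proj_space_rep(3)[OF sp, of i] by (cases "i = 0"; cases "i = 1"; cases "i = 2") auto
  then show False using proj_space_rep(2)[OF sp] by blast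
qed

text \<open>
  Over the function field, the gradients of \<open>F\<close> and of \<open>Fc\<close> are both orthogonal to the vector
  of coordinates (Euler) and to its derivative (chain rule), hence proportional.
\<close>

lemma grad_proportional:
  assumes F: "homogeneous n F" "ev F = 0" and G: "homogeneous m G" "ev G = 0" and p: "p \<in> curve"
    and ij: "i \<le> 2" "j \<le> 2"
  shows "grad F p i * grad G p j = grad F p j * grad G p i"
proof -
  let ?v = "vec3 xs ys 1"
  let ?d = "\<lambda>F i. ev (partial_deriv i F)"
  have I: "finite {..2::nat}" "\<And>j. j \<notin> {..2} \<Longrightarrow> ?v j = 0" by (auto simp: vec3_def)
  have s3: "sum f {..2} = f 0 + f 1 + f 2" for f :: "nat \<Rightarrow> complex fls"
    by (simp add: numeral_2_eq_2 One_nat_def)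
  have ch: "?d F 0 * fls_deriv xs + ?d F 1 * fls_deriv ys = 0" if "ev F = 0" for F
  proof -
    have "fls_deriv (gev fls_const F ?v) = (\<Sum>i\<in>{..2}. gev fls_const (partial_deriv i F) ?v * fls_deriv (?v i))"
      by (rule gev_chain_rule[OF rhom_fls_const _ _ _ I]) (auto simp: algebra_simps)
    then show ?thesis using that unfolding ev_def s3 by simp
  qed
  have eu: "xs * ?d F 0 + ys * ?d F 1 + ?d F 2 = 0" if "homogeneous n F" "ev F = 0" for F n
    using gev_euler[OF rhom_fls_const I(1), of ?v n F] I(2) that unfolding ev_def s3 by simp
  have ynz: "fls_deriv ys \<noteq> 0"
  proof
    assume "fls_deriv ys = 0"
    then have "ys = fls_const (ys $$ 0)" using fls_deriv_eq_0_iff by blast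
    then have "fls_subdegree ys = 0" by (metis fls_const_subdegree)
    then show False using subdegree_ys d4 by simp
  qed
  have d01: "?d F 0 * ?d G 1 = ?d F 1 * ?d G 0"
  proof -
    have a: "?d F 1 * fls_deriv ys = - (?d F 0 * fls_deriv xs)" "?d G 1 * fls_deriv ys = - (?d G 0 * fls_deriv xs)"
      using ch[OF F(2)] ch[OF G(2)] by (simp_all add: eq_neg_iff_add_eq_0 add.commute)
    have "(?d F 0 * ?d G 1) * fls_deriv ys = ?d F 0 * (?d G 1 * fls_deriv ys)" by (rule mult.assoc)
    also have "\<dots> = ?d G 0 * (?d F 1 * fls_deriv ys)" unfolding a by (simp add: mult_ac)
    finally have "(?d F 0 * ?d G 1) * fls_deriv ys = (?d F 1 * ?d G 0) * fls_deriv ys" by (simp add: mult_ac)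
    then show ?thesis using ynz by simp
  qed
  have f2: "?d F 2 = - (xs * ?d F 0 + ys * ?d F 1)" "?d G 2 = - (xs * ?d G 0 + ys * ?d G 1)"
    using minus_unique[OF eu[OF F]] minus_unique[OF eu[OF G]] by simp_all
  have d02: "?d F 0 * ?d G 2 = ?d F 2 * ?d G 0" and d12: "?d F 1 * ?d G 2 = ?d F 2 * ?d G 1"
    unfolding f2 using d01 by (simp_all add: algebra_simps)
  have c: "?d F i * ?d G j = ?d F j * ?d G i"
  proof -
    have "i = 0 \<or> i = 1 \<or> i = 2" "j = 0 \<or> j = 1 \<or> j = 2" using ij by linarith+
    then show ?thesis using d01 d02 d12 by (elim disjE) auto
  qed
  \<comment> \<open>An identity of expansions between forms of equal degree holds at every point of
    the curve; this carries the proportionality from the function field to p.\<close>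
  let ?H = "partial_deriv i F * partial_deriv j G - partial_deriv j F * partial_deriv i G"
  have "homogeneous ((n - 1) + (m - 1)) ?H"
    by (intro homogeneous_diff homogeneous_mult homogeneous_partial_deriv F G)
  moreover have "ev ?H = 0" using c by (simp add: ev_simps)
  ultimately have "vanishes ?H p" using ev_zero_vanishes p by blast
  then show ?thesis using ij by (simp add: vanishes_def grad_def peval_gev gev_simps[OF rhom_id])
qed

lemma ev_Fc: "ev Fc = 0"
  using ev_zero_cofinite[OF homogeneous_Fc] in_curve_iff curve_space
  by (metis (mono_tags, lifting) Collect_empty_eq finite.emptyI subsetD)

interpretation V: vector_space "\<lambda>(c :: complex) (w :: nat \<Rightarrow> complex) i. c * w i"
  by unfold_locales (auto simp: fun_eq_iff algebra_simps)

lemma jacobian_rank_curve: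
  assumes p: "p \<in> curve"
  shows "jacobian_rank 2 curve p = 1"
proof -
  let ?S = "{grad F p | F. (\<exists>d. homogeneous d F) \<and> (\<forall>x\<in>curve. vanishes F x)}"
  have "V.dim ?S = 1"
  proof (rule V.dim_unique[of "{grad Fc p}"])
    have v: "\<forall>x\<in>curve. vanishes Fc x" using in_curve_iff curve_space by blast
    then show "{grad Fc p} \<subseteq> ?S" using homogeneous_Fc by blast
    obtain i where i: "i \<le> 2" "grad Fc p i \<noteq> 0" using grad_Fc_nonzero[OF p] by blast
    show "?S \<subseteq> V.span {grad Fc p}"
    proof
      fix w assume "w \<in> ?S"
      then obtain F n where F: "w = grad F p" "homogeneous n F" "\<forall>x\<in>curve. vanishes F x" by blast
      have F0: "ev F = 0" using ev_nonzero_iff F by blast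
      have "w = (\<lambda>j. (grad F p i / grad Fc p i) * grad Fc p j)"
      proof
        fix j
        show "w j = (grad F p i / grad Fc p i) * grad Fc p j"
        proof (cases "j \<le> 2")
          case True
          show ?thesis using grad_proportional[OF F(2) F0 homogeneous_Fc ev_Fc p i(1) True] i(2)
            by (simp add: F(1) field_simps)
        qed (simp add: F(1) grad_def)
      qed
      then show "w \<in> V.span {grad Fc p}" unfolding V.span_singleton by (rule range_eqI)
    qed
    have "grad Fc p \<noteq> 0" using i(2) by auto
    then show "V.independent {grad Fc p}" by simp
  qed simp
  then show ?thesis unfolding jacobian_rank_def grad_def .
qed

lemma smooth_curve: "smooth_projective_curve curve"
  unfolding smooth_projective_curve_def
  using cofinite_space_irreducible[OF cofinite_curve closed_curve] cofinite_space_dim[OF cofinite_curve closed_curve]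
    jacobian_rank_curve curve_space by (intro conjI exI[of _ 2]) auto

end

section \<open>Dimensions\<close>

context plane_curve
begin

definition subfld :: "complex fls set \<Rightarrow> bool" where
  "subfld K \<longleftrightarrow> K \<subseteq> KK \<and> 1 \<in> K \<and> (\<forall>a\<in>K. \<forall>b\<in>K. a + b \<in> K \<and> a * b \<in> K) \<and> (\<forall>a\<in>K. - a \<in> K \<and> inverse a \<in> K)"

lemma subfldD:
  assumes "subfld K"
  shows "K \<subseteq> KK" "1 \<in> K" "0 \<in> K" "a \<in> K \<Longrightarrow> b \<in> K \<Longrightarrow> a + b \<in> K" "a \<in> K \<Longrightarrow> b \<in> K \<Longrightarrow> a * b \<in> K"
    "a \<in> K \<Longrightarrow> - a \<in> K" "a \<in> K \<Longrightarrow> inverse a \<in> K" "a \<in> K \<Longrightarrow> a \<in> KK"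
    "a \<in> K \<Longrightarrow> b \<in> K \<Longrightarrow> a - b \<in> K" "a \<in> K \<Longrightarrow> b \<in> K \<Longrightarrow> a / b \<in> K" "a \<in> K \<Longrightarrow> a ^ n \<in> K"
proof -
  show *: "K \<subseteq> KK" "1 \<in> K" "\<And>a b. a \<in> K \<Longrightarrow> b \<in> K \<Longrightarrow> a + b \<in> K" "\<And>a b. a \<in> K \<Longrightarrow> b \<in> K \<Longrightarrow> a * b \<in> K"
    "\<And>a. a \<in> K \<Longrightarrow> - a \<in> K" "\<And>a. a \<in> K \<Longrightarrow> inverse a \<in> K"
    using assms by (auto simp: subfld_def)
  show "0 \<in> K" using *(3)[OF *(2) *(5)[OF *(2)]] by simp
  show "a \<in> KK" if "a \<in> K" using that *(1) by blast
  show "a - b \<in> K" if "a \<in> K" "b \<in> K" using *(3)[OF that(1) *(5)[OF that(2)]] by simp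
  show "a / b \<in> K" if "a \<in> K" "b \<in> K" using *(4)[OF that(1) *(6)[OF that(2)]] by (simp add: field_class.field_divide_inverse)
  show "a ^ n \<in> K" if "a \<in> K" using that by (induction n) (auto intro: *(2,4))
qed


lemma subfield_gm:
  assumes "subfld K"
  shows "subfield (gm ` K) FF"
proof (rule field.subfieldI'[OF field_FF])
  note D = subfldD[OF assms]
  show "subring (gm ` K) FF"
  proof (rule ring.subringI[OF ring_FF])
    show "gm ` K \<subseteq> carrier FF" using D(1) carrier_FF by blast
    show "\<one>\<^bsub>FF\<^esub> \<in> gm ` K" using D(2) gm_1 by (metis imageI)
    show "\<ominus>\<^bsub>FF\<^esub> h \<in> gm ` K" if "h \<in> gm ` K" for h
      using that D(6,8) by (auto simp flip: gm_uminus)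
    show "h1 \<otimes>\<^bsub>FF\<^esub> h2 \<in> gm ` K" "h1 \<oplus>\<^bsub>FF\<^esub> h2 \<in> gm ` K" if "h1 \<in> gm ` K" "h2 \<in> gm ` K" for h1 h2
      using that D(4,5,8) by (auto simp flip: gm_mult gm_add)
  qed
  fix k assume "k \<in> gm ` K - {\<zero>\<^bsub>FF\<^esub>}"
  then obtain a where a: "a \<in> K" "k = gm a" "a \<noteq> 0" using gm_0 by auto
  then show "inv\<^bsub>FF\<^esub> k \<in> gm ` K" using gm_inverse[OF D(8)] D(7) by (metis imageI)
qed

definition lincomb :: "complex fls set \<Rightarrow> nat \<Rightarrow> (nat \<Rightarrow> complex fls) \<Rightarrow> complex fls set" where
  "lincomb K n u = {\<Sum>i<n. k i * u i | k. \<forall>i<n. k i \<in> K}"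

lemma combine_gm:
  assumes "\<And>i. i < n \<Longrightarrow> k i \<in> KK" "\<And>i. i < n \<Longrightarrow> u i \<in> KK"
  shows "ring.combine FF (map (\<lambda>i. gm (k i)) [0..<n]) (map (\<lambda>i. gm (u i)) [0..<n]) = gm (\<Sum>i<n. k i * u i)"
proof -
  interpret ring FF by (rule ring_FF)
  have "combine (map (\<lambda>i. gm (k i)) is) (map (\<lambda>i. gm (u i)) is) = gm (\<Sum>i\<leftarrow>is. k i * u i)
      \<and> (\<Sum>i\<leftarrow>is. k i * u i) \<in> KK" if "set is \<subseteq> {..<n}" for "is"
    using that
  proof (induction "is")
    case (Cons a js)
    then have a: "k a \<in> KK" "u a \<in> KK" using assms by auto
    show ?case using Cons a by (simp add: gm_mult gm_add KK_mult KK_add)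
  qed (simp add: gm_0 KK_0)
  from this[of "[0..<n]"] show ?thesis
    by (simp add: interv_sum_list_conv_sum_set_nat atLeast0LessThan)
qed

lemma lift_coefficients:
  assumes "set Ks \<subseteq> gm ` K" "length Ks = n"
  obtains k where "\<And>i. i < n \<Longrightarrow> k i \<in> K" "Ks = map (\<lambda>i. gm (k i)) [0..<n]"
proof -
  have "\<forall>i<n. \<exists>k. k \<in> K \<and> Ks ! i = gm k" using assms by (metis imageE nth_mem subsetD)
  then obtain k where k: "\<And>i. i < n \<Longrightarrow> k i \<in> K \<and> Ks ! i = gm (k i)" by metis
  have "Ks = map (\<lambda>i. gm (k i)) [0..<n]" using assms(2) k by (intro nth_equalityI) auto
  then show thesis using that k by blast
qed

lemma Span_gm:
  assumes K: "subfld K" and u: "\<And>i. i < n \<Longrightarrow> u i \<in> KK"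
  shows "ring.Span FF (gm ` K) (map (\<lambda>i. gm (u i)) [0..<n]) = gm ` lincomb K n u"
proof -
  interpret ring FF by (rule ring_FF)
  let ?U = "map (\<lambda>i. gm (u i)) [0..<n]"
  note D = subfldD[OF K]
  have "set ?U \<subseteq> carrier FF" using u gm_carrier by auto
  then have "Span (gm ` K) ?U = {combine Ks ?U | Ks. length Ks = length ?U \<and> set Ks \<subseteq> gm ` K}"
    by (rule Span_eq_combine_set_length_version[OF subfield_gm[OF K]])
  also have "\<dots> = gm ` lincomb K n u"
  proof (intro equalityI subsetI)
    fix x assume "x \<in> {combine Ks ?U | Ks. length Ks = length ?U \<and> set Ks \<subseteq> gm ` K}"
    then obtain Ks where Ks: "x = combine Ks ?U" "length Ks = n" "set Ks \<subseteq> gm ` K" by auto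
    obtain k where k: "\<And>i. i < n \<Longrightarrow> k i \<in> K" "Ks = map (\<lambda>i. gm (k i)) [0..<n]"
      using lift_coefficients[OF Ks(3,2)] by blast
    have "x = gm (\<Sum>i<n. k i * u i)" unfolding Ks(1) k(2) using k(1) D(8) u by (intro combine_gm) auto
    then show "x \<in> gm ` lincomb K n u" unfolding lincomb_def using k(1) by blast
  next
    fix x assume "x \<in> gm ` lincomb K n u"
    then obtain k where k: "\<forall>i<n. k i \<in> K" "x = gm (\<Sum>i<n. k i * u i)" unfolding lincomb_def by blast
    then have "x = combine (map (\<lambda>i. gm (k i)) [0..<n]) ?U" using combine_gm[of n k u] D(8) u by simp
    moreover have "set (map (\<lambda>i. gm (k i)) [0..<n]) \<subseteq> gm ` K" using k by auto
    moreover have "length (map (\<lambda>i. gm (k i)) [0..<n]) = length ?U" by simp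
    ultimately show "x \<in> {combine Ks ?U | Ks. length Ks = length ?U \<and> set Ks \<subseteq> gm ` K}" by blast
  qed
  finally show ?thesis .
qed

lemma independent_gm:
  assumes K: "subfld K" and u: "\<And>i. i < n \<Longrightarrow> u i \<in> KK"
    and ind: "\<And>k. (\<And>i. i < n \<Longrightarrow> k i \<in> K) \<Longrightarrow> (\<Sum>i<n. k i * u i) = 0 \<Longrightarrow> \<forall>i<n. k i = 0"
  shows "ring.independent FF (gm ` K) (map (\<lambda>i. gm (u i)) [0..<n])"
proof (rule ccontr)
  interpret ring FF by (rule ring_FF)
  let ?U = "map (\<lambda>i. gm (u i)) [0..<n]"
  note D = subfldD[OF K]
  assume dep: "dependent (gm ` K) ?U"
  have cU: "set ?U \<subseteq> carrier FF" using u gm_carrier by auto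
  obtain Ks where Ks: "length Ks = length ?U" "combine Ks ?U = \<zero>\<^bsub>FF\<^esub>" "set Ks \<subseteq> gm ` K" "set Ks \<noteq> {\<zero>\<^bsub>FF\<^esub>}"
    by (rule dependent_imp_non_trivial_combine[OF subfield_gm[OF K] cU dep])
  obtain k where k: "\<And>i. i < n \<Longrightarrow> k i \<in> K" "Ks = map (\<lambda>i. gm (k i)) [0..<n]"
    using lift_coefficients[OF Ks(3), of n] Ks(1) by auto
  have "gm (\<Sum>i<n. k i * u i) = gm 0" using combine_gm[of n k u] k D(8) u Ks(2) gm_0 by simp
  moreover have "(\<Sum>i<n. k i * u i) \<in> KK" by (intro KK_sum KK_mult) (use k(1) D(8) u in auto)
  ultimately have "(\<Sum>i<n. k i * u i) = 0" using gm_eq_iff KK_0 by blast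
  then have z: "\<forall>i<n. k i = 0" using ind k(1) by blast
  show False
  proof (cases "n = 0")
    case True
    then show ?thesis using dep by simp
  next
    case False
    then have "set Ks = {\<zero>\<^bsub>FF\<^esub>}" using z gm_0 unfolding k(2) by auto
    then show ?thesis using Ks(4) by blast
  qed
qed

lemma dimension_basis:
  assumes K: "subfld K" and u: "\<And>i. i < n \<Longrightarrow> u i \<in> KK"
    and ind: "\<And>k. (\<And>i. i < n \<Longrightarrow> k i \<in> K) \<Longrightarrow> (\<Sum>i<n. k i * u i) = 0 \<Longrightarrow> \<forall>i<n. k i = 0"
  shows "ring.dimension FF n (gm ` K) (gm ` lincomb K n u)"
proof -
  interpret ring FF by (rule ring_FF)
  have "independent (gm ` K) (map (\<lambda>i. gm (u i)) [0..<n])" by (rule independent_gm[OF K u ind])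
  moreover have "Span (gm ` K) (map (\<lambda>i. gm (u i)) [0..<n]) = gm ` lincomb K n u" by (rule Span_gm[OF K u])
  ultimately show ?thesis using dimension_independent by fastforce
qed

lemma dimension_spanning:
  assumes K: "subfld K" and u: "\<And>i. i < n \<Longrightarrow> u i \<in> KK"
  shows "\<exists>m\<le>n. ring.dimension FF m (gm ` K) (gm ` lincomb K n u)"
proof -
  interpret ring FF by (rule ring_FF)
  have Us: "\<exists>m\<le>length Us. dimension m (gm ` K) (Span (gm ` K) Us)" if "set Us \<subseteq> carrier FF" for Us
    using that
  proof (induction Us)
    case (Cons u Us)
    then obtain m where m: "m \<le> length Us" "dimension m (gm ` K) (Span (gm ` K) Us)" by auto
    show ?case
    proof (cases "u \<in> Span (gm ` K) Us")
      case True
      then have "Span (gm ` K) (u # Us) = Span (gm ` K) Us"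
        using Span_base_incl[OF subfield_gm[OF K]] mono_Span_subset[OF subfield_gm[OF K]]
        by (metis Cons.prems insert_subset list.simps(15) subset_antisym)
      then show ?thesis using m by (intro exI[of _ m]) auto
    next
      case False
      then have "dimension (Suc m) (gm ` K) (Span (gm ` K) (u # Us))"
        using Suc_dim[OF _ False m(2)] Cons.prems by simp
      then show ?thesis using m(1) by (intro exI[of _ "Suc m"]) auto
    qed
  qed (auto intro: zero_dim)
  have "set (map (\<lambda>i. gm (u i)) [0..<n]) \<subseteq> carrier FF" using u gm_carrier by auto
  from Us[OF this] obtain m where m: "m \<le> n" "dimension m (gm ` K) (Span (gm ` K) (map (\<lambda>i. gm (u i)) [0..<n]))" by (auto simp del: Span.simps)
  moreover have "Span (gm ` K) (map (\<lambda>i. gm (u i)) [0..<n]) = gm ` lincomb K n u" by (rule Span_gm[OF K u])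
  ultimately show ?thesis by metis
qed

lemma dependence:
  assumes K: "subfld K" and dim: "ring.dimension FF m (gm ` K) (gm ` E)" and E: "E \<subseteq> KK"
    and f: "\<And>i. i \<le> m \<Longrightarrow> f i \<in> E"
  obtains k where "\<And>i. i \<le> m \<Longrightarrow> k i \<in> K" "\<exists>i\<le>m. k i \<noteq> 0" "(\<Sum>i\<le>m. k i * f i) = 0"
proof (rule ccontr)
  interpret ring FF by (rule ring_FF)
  assume neg: "\<not> thesis"
  have fK: "f i \<in> KK" if "i < Suc m" for i using f[of i] E that by auto
  have "independent (gm ` K) (map (\<lambda>i. gm (f i)) [0..<Suc m])"
  proof (rule independent_gm[OF K fK])
    fix k assume k: "\<And>i. i < Suc m \<Longrightarrow> k i \<in> K" "(\<Sum>i<Suc m. k i * f i) = 0"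
    then have "(\<Sum>i\<le>m. k i * f i) = 0" by (simp add: lessThan_Suc_atMost)
    then show "\<forall>i<Suc m. k i = 0" using neg that[of k] k(1) by (meson le_imp_less_Suc less_Suc_eq_le)
  qed
  moreover have "set (map (\<lambda>i. gm (f i)) [0..<Suc m]) \<subseteq> gm ` E" using f by (auto simp: less_Suc_eq_le)
  ultimately have "length (map (\<lambda>i. gm (f i)) [0..<Suc m]) \<le> m"
    by (rule independent_length_le_dimension[OF subfield_gm[OF K] dim])
  then show False by simp
qed

lemma dim_eqI:
  assumes "subfld K" "ring.dimension FF n (gm ` K) E"
  shows "ring.dim FF (gm ` K) E = n"
proof -
  interpret ring FF by (rule ring_FF)
  show ?thesis using dimI[OF subfield_gm[OF assms(1)] assms(2)] by (simp add: over_def)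
qed

abbreviation CC :: "complex fls set" where "CC \<equiv> range fls_const"

lemma subfld_CC: "subfld CC"
  unfolding subfld_def using KK_const
  by (auto simp: fls_plus_const fls_inverse_const simp flip: fls_const_uminus)

lemma gm_CC: "gm ` CC = range (const_fun curve)"
  by (auto simp: gm_const image_image)

section \<open>Global sections\<close>

text \<open>Clearing a denominator \<open>xs - z\<close>: the coefficients of a multiple of it vanish at all points over \<open>z\<close>.\<close>

lemma nf_divisible:
  assumes G: "nf p = (xs - fls_const z) * e" and reg: "\<And>b. (z, b) \<in> Aff \<Longrightarrow> \<exists>c. rv (pt z b) e c" and j: "j < d"
  shows "poly (p j) z = 0"
proof (cases "z ^ (d - 1) = 1")
  case False
  show ?thesis
  proof (rule nfv_zero_fibre[OF False _ j])
    fix b assume b: "(z, b) \<in> Aff"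
    obtain c where c: "rv (pt z b) e c" using reg[OF b] by blast
    have "rv (pt z b) (xs - fls_const z) (z - z)" by (intro rv_diff rv_xs rv_const) (use b in auto)
    then have "rv (pt z b) (nf p) 0" unfolding G using rv_mult[OF _ c] by fastforce
    moreover have "rv (pt z b) (nf p) (nfv p z b)" by (rule rv_reduces[OF reducesI b]) auto
    ultimately show "nfv p z b = 0" using rv_unique by blast
  qed
next
  case True
  \<comment> \<open>Branch point: (z, 0) is the only point over z, and x - z has order d there. The
    j-th term of the normal form has an order congruent to j modulo d, so the coefficients are shown
    to vanish at z in increasing order of j. Below, \<open>?R m e\<close> says that y^m divides e
    locally.\<close>
  then have b: "(z, 0) \<in> Aff" using d4 by (simp add: Aff_def power_0_left)
  let ?R = "\<lambda>m e. \<exists>u c. rv (pt z 0) u c \<and> e = ys ^ m * u"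
  have radd: "?R m (e + e')" if R: "?R m e" "?R m e'" for m e e'
    using R rv_add by (metis distrib_left)
  have rneg: "?R m (- e)" if "?R m e" for m e
    using that rv_uminus by (metis mult_minus_right)
  have rsum: "?R m (sum f S)" if "\<And>x. x \<in> S \<Longrightarrow> ?R m (f x)" for m f and S :: "nat set"
    using that
  proof (induction S rule: infinite_finite_induct)
    case (insert x S)
    then show ?case using radd[where m = m and e = "f x" and e' = "sum f S"] by simp
  qed (use rv_0[of "pt z 0"] b in \<open>auto intro!: exI[of _ 0]\<close>)
  have rle: "?R m e" if m: "m \<le> n" and R: "?R n e" for m n e
  proof -
    obtain u c where u: "rv (pt z 0) u c" "e = ys ^ n * u" using R by blast
    have "rv (pt z 0) (ys ^ (n - m) * u) (0 ^ (n - m) * c)" by (intro rv_mult rv_power rv_ys b u)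
    moreover have "e = ys ^ m * (ys ^ (n - m) * u)" using u(2) m by (simp add: mult.assoc[symmetric] flip: power_add)
    ultimately show ?thesis by blast
  qed
  obtain w c where w: "rv (pt z 0) w c" "xs - fls_const z = ys ^ d * w"
    using xs_at_branch_point[OF b] by blast
  have rG: "?R d (nf p)"
  proof -
    obtain c' where "rv (pt z 0) e c'" using reg[OF b] by blast
    then show ?thesis unfolding G w(2) using rv_mult[OF w(1)] by (metis mult.assoc)
  qed
  show ?thesis using j
  proof (induction j rule: less_induct)
    case (less j)
    let ?f = "\<lambda>i. PE xs (p i) * ys ^ i"
    have "?R (Suc j) (?f i)" if i: "i \<in> {..<d} - {j}" for i
    proof (cases "i < j")
      case True
      then have "poly (p i) z = 0" using less by auto
      then obtain r where r: "p i = [:- z, 1:] * r" by (auto simp: poly_eq_0_iff_dvd)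
      have "rv (pt z 0) (w * (PE xs r * ys ^ i)) (c * (poly r z * 0 ^ i))"
        by (intro rv_mult w rv_PE rv_xs b rv_power rv_ys)
      moreover have "?f i = ys ^ d * (w * (PE xs r * ys ^ i))"
        unfolding r PE_mult PE_linear w(2) by (simp add: mult_ac)
      ultimately have "?R d (?f i)" by blast
      then show ?thesis using rle less.prems by (meson Suc_leI)
    next
      case False
      then have "Suc j \<le> i" using i by auto
      moreover have "rv (pt z 0) (PE xs (p i)) (poly (p i) z)" by (intro rv_PE rv_xs b)
      then have "?R i (?f i)" by (metis mult.commute)
      ultimately show ?thesis using rle by blast
    qed
    then have "?R (Suc j) (sum ?f ({..<d} - {j}))" by (intro rsum) auto
    moreover have "?R (Suc j) (nf p)" using rle[of "Suc j" d] rG less.prems by (meson Suc_leI)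
    ultimately have "?R (Suc j) (nf p + - sum ?f ({..<d} - {j}))" by (intro radd rneg)
    moreover have "nf p = ?f j + sum ?f ({..<d} - {j})"
      unfolding nf_def using less.prems by (subst sum.remove[of _ j]) auto
    ultimately obtain u a where u: "rv (pt z 0) u a" "?f j = ys ^ Suc j * u" by auto
    have "ys ^ j * PE xs (p j) = ys ^ j * (ys * u)" using u(2) by (simp add: mult_ac)
    then have "PE xs (p j) = ys * u" by simp
    then have "rv (pt z 0) (PE xs (p j)) (0 * a)" using rv_mult[OF rv_ys[OF b] u(1)] by simp
    moreover have "rv (pt z 0) (PE xs (p j)) (poly (p j) z)" by (intro rv_PE rv_xs b)
    ultimately show ?case using rv_unique by fastforce
  qed
qed

text \<open>A denominator in x splits into linear factors, and by \<open>nf_divisible\<close>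
  regularity over z allows x - z to be divided out of all coefficients at once. This is the
  normality of the affine curve.\<close>

lemma regular_affine_Acoord:
  assumes "e \<in> KK" "\<And>a b. (a, b) \<in> Aff \<Longrightarrow> \<exists>c. rv (pt a b) e c"
  shows "e \<in> Acoord"
proof -
  have main: "e \<in> Acoord" if "c \<noteq> 0" "e * PE xs c \<in> Acoord" for c
    using that
  proof (induction "degree c" arbitrary: c)
    case 0
    then obtain a where a: "c = [:a:]" "a \<noteq> 0" by (metis degree_eq_zeroE pCons_0_0)
    have "e = (e * PE xs c) * fls_const (inverse a)" using a by (simp add: a mult.assoc)
    also have "\<dots> \<in> Acoord" by (intro Acoord_closed 0)
    finally show ?case .
  next
    case (Suc n)
    then have "\<not> constant (poly c)" by (simp add: constant_degree)
    then obtain z where "poly c z = 0" using fundamental_theorem_of_algebra by blast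
    then obtain r where r: "c = [:- z, 1:] * r" by (auto simp: poly_eq_0_iff_dvd)
    then have rn: "r \<noteq> 0" "degree r = n" using Suc by (auto simp: degree_mult_eq simp del: mult_pCons_left)
    obtain p where p: "e * PE xs c = nf p" using Suc.prems by (auto simp: Acoord_def)
    let ?e = "e * PE xs r"
    have G: "nf p = (xs - fls_const z) * ?e"
      unfolding p[symmetric] r PE_mult PE_linear by (simp add: mult_ac)
    have "\<exists>c. rv (pt z b) ?e c" if b: "(z, b) \<in> Aff" for b
      using assms(2)[OF b] rv_mult[OF _ rv_PE[OF rv_xs[OF b]]] by blast
    then have "poly (p j) z = 0" if "j < d" for j by (intro nf_divisible[OF G]) (use that in auto)
    then have "\<forall>j. \<exists>q. j < d \<longrightarrow> p j = [:- z, 1:] * q" by (auto simp: poly_eq_0_iff_dvd dvd_def)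
    then obtain q where q: "\<And>j. j < d \<Longrightarrow> p j = [:- z, 1:] * q j" by metis
    have "nf p = (xs - fls_const z) * nf q"
      unfolding PE_linear[symmetric] nf_PE_mult(1) unfolding nf_def by (rule sum.cong) (auto simp: q)
    moreover have "xs - fls_const z \<noteq> 0"
      unfolding PE_linear[symmetric] using PE_xs_subdegree[of "[:- z, 1:]"] by simp
    ultimately have "?e = nf q" using G by simp
    then have "e * PE xs r \<in> Acoord" by (simp add: Acoord_def)
    then show ?case using Suc.hyps(1)[of r] rn by blast
  qed
  obtain c where "c \<noteq> 0" "e * PE xs c \<in> Acoord" using KK_denominator[OF assms(1)] by blast
  then show ?thesis by (rule main)
qed

text \<open>The pair \<open>(j, i)\<close> stands for the monomial \<open>xs\<^sup>i ys\<^sup>j\<close>, whose pole order at infinity is \<open>wt (j, i)\<close>.\<close>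

definition Tn :: "nat \<Rightarrow> (nat \<times> nat) set" where "Tn n = Sigma {..n} (\<lambda>j. {..n - j})"

definition mn :: "nat \<times> nat \<Rightarrow> complex fls" where "mn = (\<lambda>(j, i). xs ^ i * ys ^ j)"

definition wt :: "nat \<times> nat \<Rightarrow> nat" where "wt = (\<lambda>(j, i). d * i + (d - 1) * j)"

definition Mn :: "nat \<Rightarrow> complex fls set" where
  "Mn n = {\<Sum>x\<in>Tn n. fls_const (c x) * mn x | c. True}"

lemma finite_Tn [simp]: "finite (Tn n)"
  by (simp add: Tn_def)

lemma Tn_iff: "(j, i) \<in> Tn n \<longleftrightarrow> i + j \<le> n"
  by (auto simp: Tn_def)

lemma card_Tn: "card (Tn n) = (n + 1) * (n + 2) div 2"
proof -
  have "card (Tn n) = (\<Sum>j\<le>n. Suc (n - j))" unfolding Tn_def by simp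
  also have "\<dots> = (\<Sum>j\<le>n. Suc j)" by (rule sum.nat_diff_reindex[of Suc "Suc n", unfolded lessThan_Suc_atMost, simplified])
  also have "\<dots> = (n + 1) * (n + 2) div 2"
  proof -
    have "2 * (\<Sum>j\<le>n. Suc j) = (n + 1) * (n + 2)" by (induction n) auto
    then show ?thesis by simp
  qed
  finally show ?thesis .
qed

lemma mn_Acoord: "mn x \<in> Acoord"
  by (auto simp: mn_def split: prod.split intro!: Acoord_closed)

lemma mn_KK: "mn x \<in> KK"
  by (intro Acoord_KK mn_Acoord)

lemma mn_nz [simp]: "mn x \<noteq> 0"
  by (auto simp: mn_def split: prod.split)

lemma subdegree_mn: "fls_subdegree (mn x) = - int (wt x)"
  by (cases x) (simp add: mn_def wt_def fls_subdegree_pow subdegree_xs subdegree_ys mult.commute)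

lemma wt_le: "x \<in> Tn n \<Longrightarrow> wt x \<le> n * d"
proof (cases x)
  case (Pair j i)
  assume "x \<in> Tn n"
  then have "i + j \<le> n" using Pair Tn_iff by simp
  then have "d * (i + j) \<le> d * n" by (rule mult_le_mono2)
  moreover have "wt x \<le> d * (i + j)" unfolding Pair wt_def by (simp add: distrib_left)
  ultimately have "wt x \<le> d * n" by (rule le_trans[rotated])
  then show ?thesis by (simp only: mult.commute)
qed

text \<open>A term of total degree s has pole order d s - j > d (s - 1) because j < d, and by
  \<open>nf_subdegree\<close> no term is cancelled; so a pole of order at most n d leaves only terms
  with s at most n.\<close>

lemma Acoord_Mn:
  assumes "e \<in> Acoord" "- int (n * d) \<le> fls_subdegree e" "n < d"
  shows "e \<in> Mn n"
proof -
  obtain p where p: "e = nf p" using assms(1) by (auto simp: Acoord_def)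
  have deg: "degree (p j) + j \<le> n" if "j < d" "p j \<noteq> 0" for j
  proof -
    have "d * degree (p j) + (d - 1) * j \<le> n * d"
      using nf_subdegree[of j p] that assms(2) unfolding p by linarith
    moreover have "(d - 1) * j + j = d * j" using d4 by (simp add: diff_mult_distrib)
    ultimately have "d * (degree (p j) + j) \<le> n * d + j" by (simp add: distrib_left)
    also have "\<dots> < d * (n + 1)" using that(1) by (simp add: algebra_simps)
    finally show ?thesis by (simp only: mult_less_cancel1) simp
  qed
  have z: "p j = 0" if "j < d" "n < j" for j using deg[OF that(1)] that(2) by fastforce
  have PE: "PE xs (p j) = (\<Sum>i\<le>n - j. fls_const (coeff (p j) i) * xs ^ i)" if "j \<le> n" for j
  proof (cases "p j = 0")
    case False
    then have "degree (p j) \<le> n - j" using deg[of j] that assms(3) by simp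
    then show ?thesis unfolding PE_altdef
      by (intro sum.mono_neutral_left) (auto simp: coeff_eq_0 not_le)
  qed simp
  have "e = (\<Sum>j\<le>n. PE xs (p j) * ys ^ j)"
    unfolding p nf_def using assms(3) z by (intro sum.mono_neutral_right) auto
  also have "\<dots> = (\<Sum>j\<le>n. \<Sum>i\<le>n - j. fls_const (coeff (p j) i) * mn (j, i))"
    by (rule sum.cong) (auto simp: PE mn_def sum_distrib_right mult.assoc)
  also have "\<dots> = (\<Sum>x\<in>Tn n. fls_const (case x of (j, i) \<Rightarrow> coeff (p j) i) * mn x)"
    unfolding Tn_def by (subst sum.Sigma) (auto intro: sum.cong)
  finally show ?thesis unfolding Mn_def by blast
qed

lemma Mn_Acoord: "e \<in> Mn n \<Longrightarrow> e \<in> Acoord"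
  unfolding Mn_def by (auto intro!: Acoord_sum Acoord_closed mn_Acoord)

lemma Mn_subdegree:
  assumes "e \<in> Mn n"
  shows "- int (n * d) \<le> fls_subdegree e"
proof (cases "e = 0")
  case False
  obtain c where c: "e = (\<Sum>x\<in>Tn n. fls_const (c x) * mn x)" using assms by (auto simp: Mn_def)
  show ?thesis
  proof (rule fls_subdegree_geI[OF False])
    fix k assume k: "k < - int (n * d)"
    have "(fls_const (c x) * mn x) $$ k = 0" if "x \<in> Tn n" for x
    proof -
      have "k < fls_subdegree (mn x)" using k wt_le[OF that] by (simp add: subdegree_mn del: of_nat_mult)
      then show ?thesis by simp
    qed
    then show "e $$ k = 0" unfolding c fls_nth_sum by (intro sum.neutral ballI)
  qed
qed simp

text \<open>
  As \<open>xs\<^sup>i = X\<^bsup>-di\<^esup> (1 + O(X\<^bsup>d(d-1)\<^esup>))\<close> and the pole orders involved are less than \<open>d(d-1)\<close>, the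
  coefficients of \<open>X\<^bsup>-wt x\<^esup>\<close> form the dual basis to the monomials.
\<close>

lemma mn_nth:
  assumes "x \<in> Tn (d - 2)" "x' \<in> Tn (d - 2)"
  shows "mn x $$ (- int (wt x')) = (if x = x' then 1 else 0)"
proof -
  obtain j i j' i' where x: "x = (j, i)" "x' = (j', i')" by (cases x, cases x')
  have le: "j < d" "j' < d" using assms x d4 by (auto simp: Tn_iff)
  have "wt x \<le> (d - 2) * d" using assms wt_le by blast
  also have "\<dots> < d * (d - 1)" using d4 by (simp add: mult.commute)
  finally have lt: "wt x < d * (d - 1)" .
  have e: "mn x = fls_X_inv ^ wt x * fps_to_fls (rho ^ i)"
    by (simp add: x mn_def wt_def xs_def ys_def power_mult_distrib power_add fps_to_fls_power mult_ac flip: power_mult)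
  obtain \<theta> where th: "rho ^ i = 1 + fps_X ^ (d * (d - 1)) * \<theta>" using rho_power_expansion by blast
  have r: "rho ^ i $ k = (if k = 0 then 1 else 0)" if "k < d * (d - 1)" for k
    unfolding th using that by (simp add: fps_X_power_mult_nth)
  have "mn x $$ (- int (wt x')) = fps_to_fls (rho ^ i) $$ (int (wt x) - int (wt x'))"
    unfolding e fls_X_inv_power_times_conv_shift by (simp add: algebra_simps)
  also have "\<dots> = (if wt x = wt x' then 1 else 0)"
  proof (cases "int (wt x) - int (wt x') < 0")
    case False
    then have "nat (int (wt x) - int (wt x')) < d * (d - 1)" using lt by linarith
    then show ?thesis using r[of "nat (int (wt x) - int (wt x'))"] False by auto
  qed auto
  also have "wt x = wt x' \<longleftrightarrow> x = x'" using weight_inj[OF le, of i i'] by (auto simp: x wt_def)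
  finally show ?thesis .
qed

lemma coefficient_extraction:
  assumes "n \<le> d - 2" "x' \<in> Tn n"
  shows "(\<Sum>x\<in>Tn n. fls_const (c x) * mn x) $$ (- int (wt x')) = c x'"
proof -
  have sub: "Tn n \<subseteq> Tn (d - 2)" using assms(1) by (auto simp: Tn_def)
  have "(\<Sum>x\<in>Tn n. fls_const (c x) * mn x) $$ (- int (wt x')) = (\<Sum>x\<in>Tn n. if x = x' then c x else 0)"
    unfolding fls_nth_sum using sub assms(2) by (intro sum.cong) (auto simp: mn_nth subsetD[OF sub])
  then show ?thesis using assms(2) by simp
qed

lemma sections_gm:
  "sections curve D = gm ` {e \<in> KK. e = 0 \<or> (\<forall>p\<in>curve. ord p e + D p \<ge> 0)}"
proof -
  have "gm e = \<zero>\<^bsub>FF\<^esub> \<longleftrightarrow> e = 0" if "e \<in> KK" for e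
    using gm_eq_iff[OF that KK_0] gm_0 by simp
  then have "gm e = \<zero>\<^bsub>FF\<^esub> \<or> (\<forall>p\<in>curve. order_at curve p (gm e) + D p \<ge> 0)
      \<longleftrightarrow> e = 0 \<or> (\<forall>p\<in>curve. ord p e + D p \<ge> 0)" if "e \<in> KK" for e
    using order_at_gm[OF _ that] that by (metis (no_types, lifting))
  then show ?thesis unfolding sections_def carrier_FF by blast
qed

definition Linf :: "int \<Rightarrow> point \<Rightarrow> int" where "Linf n = (\<lambda>p. if p = infp then n else 0)"

text \<open>Regularity off infinity puts e in the coordinate ring, and the pole order at infinity
  bounds its degree. The divisor is n times the section of the curve by the line at
  infinity.\<close>

lemma Linf_sections:
  assumes "n < d"
  shows "{e \<in> KK. e = 0 \<or> (\<forall>p\<in>curve. ord p e + Linf (int (n * d)) p \<ge> 0)} = Mn n"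
proof (intro equalityI subsetI)
  fix e assume "e \<in> {e \<in> KK. e = 0 \<or> (\<forall>p\<in>curve. ord p e + Linf (int (n * d)) p \<ge> 0)}"
  then have e: "e \<in> KK" "e = 0 \<or> (\<forall>p\<in>curve. ord p e + Linf (int (n * d)) p \<ge> 0)" by auto
  show "e \<in> Mn n"
  proof (cases "e = 0")
    case True
    then show ?thesis unfolding Mn_def by (intro CollectI exI[of _ "\<lambda>_. 0"]) simp
  next
    case False
    then have o: "\<And>p. p \<in> curve \<Longrightarrow> ord p e + Linf (int (n * d)) p \<ge> 0" using e by blast
    have "e \<in> Acoord"
    proof (rule regular_affine_Acoord[OF e(1)])
      fix a b assume ab: "(a, b) \<in> Aff"
      then have "0 \<le> ord (pt a b) e" using o[of "pt a b"] by (simp add: Linf_def)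
      then show "\<exists>c. rv (pt a b) e c" using ord_ge_0_iff[of "pt a b" e] ab e(1) False by simp
    qed
    moreover have "- int (n * d) \<le> fls_subdegree e"
      using o[OF infp_curve] ord_infp[OF e(1) False] by (simp add: Linf_def del: of_nat_mult)
    ultimately show ?thesis using Acoord_Mn assms by blast
  qed
next
  fix e assume m: "e \<in> Mn n"
  then have A: "e \<in> Acoord" "e \<in> KK" using Mn_Acoord Acoord_KK by blast+
  have "ord p e + Linf (int (n * d)) p \<ge> 0" if p: "p \<in> curve" and e: "e \<noteq> 0" for p
    using p
  proof (cases rule: curve_cases)
    case 1
    then show ?thesis using Mn_subdegree[OF m] ord_infp[OF A(2) e] by (simp add: Linf_def del: of_nat_mult)
  next
    case (2 a b)
    then have "0 \<le> ord p e" using rv_Acoord[OF A(1)] ord_ge_0_iff[OF p A(2) e] by blast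
    then show ?thesis using 2 by (simp add: Linf_def)
  qed
  then show "e \<in> {e \<in> KK. e = 0 \<or> (\<forall>p\<in>curve. ord p e + Linf (int (n * d)) p \<ge> 0)}" using A(2) by blast
qed

text \<open>The factor \<kappa> absorbs a principal divisor, since the sections of linearly
  equivalent divisors differ by multiplication with a fixed function. It is 1 for multiples of the
  line section and general for canonical divisors.\<close>

lemma h0_multiple:
  assumes S: "sections curve D = gm ` ((\<lambda>e. \<kappa> * e) ` Mn n)" and k: "\<kappa> \<in> KK" "\<kappa> \<noteq> 0" and n: "n \<le> d - 2"
  shows "h0 curve D = (n + 1) * (n + 2) div 2"
proof -
  obtain en where en: "bij_betw en {..<card (Tn n)} (Tn n)"
    using ex_bij_betw_nat_finite[OF finite_Tn[of n]] by (auto simp: atLeast0LessThan)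
  let ?u = "\<lambda>i. \<kappa> * mn (en i)"
  have reidx: "(\<Sum>i<card (Tn n). f (en i)) = sum f (Tn n)" for f :: "nat \<times> nat \<Rightarrow> complex fls"
    by (rule sum.reindex_bij_betw[OF en])
  have sums: "(\<Sum>i<card (Tn n). fls_const (c (en i)) * ?u i) = \<kappa> * (\<Sum>x\<in>Tn n. fls_const (c x) * mn x)" for c
    unfolding reidx[of "\<lambda>x. fls_const (c x) * (\<kappa> * mn x)"] sum_distrib_left by (simp add: mult_ac)
  have inv: "\<exists>c. \<forall>i<card (Tn n). k i = fls_const (c (en i))" if k: "\<forall>i<card (Tn n). k i \<in> CC" for k
  proof -
    have "\<forall>i<card (Tn n). k i = fls_const (k (inv_into {..<card (Tn n)} en (en i)) $$ 0)"
    proof (intro allI impI)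
      fix i assume i: "i < card (Tn n)"
      have "inv_into {..<card (Tn n)} en (en i) = i" using en i by (simp add: bij_betw_def inv_into_f_f)
      moreover obtain a where "k i = fls_const a" using k i by blast
      ultimately show "k i = fls_const (k (inv_into {..<card (Tn n)} en (en i)) $$ 0)" by simp
    qed
    then show ?thesis by (intro exI[of _ "\<lambda>x. k (inv_into {..<card (Tn n)} en x) $$ 0"])
  qed
  have lin: "lincomb CC (card (Tn n)) ?u = (\<lambda>e. \<kappa> * e) ` Mn n"
  proof (intro equalityI subsetI)
    fix x assume "x \<in> lincomb CC (card (Tn n)) ?u"
    then obtain k where k: "\<forall>i<card (Tn n). k i \<in> CC" "x = (\<Sum>i<card (Tn n). k i * ?u i)" by (auto simp: lincomb_def)
    obtain c where c: "\<forall>i<card (Tn n). k i = fls_const (c (en i))" using inv[OF k(1)] by blast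
    have "x = (\<Sum>i<card (Tn n). fls_const (c (en i)) * ?u i)" unfolding k(2) using c by (intro sum.cong) auto
    then have "x = \<kappa> * (\<Sum>x\<in>Tn n. fls_const (c x) * mn x)" using sums by simp
    then show "x \<in> (\<lambda>e. \<kappa> * e) ` Mn n" unfolding Mn_def by blast
  next
    fix x assume "x \<in> (\<lambda>e. \<kappa> * e) ` Mn n"
    then obtain c where "x = \<kappa> * (\<Sum>x\<in>Tn n. fls_const (c x) * mn x)" unfolding Mn_def by blast
    then have "x = (\<Sum>i<card (Tn n). fls_const (c (en i)) * ?u i)" using sums by simp
    then show "x \<in> lincomb CC (card (Tn n)) ?u"
      unfolding lincomb_def by (intro CollectI exI[of _ "\<lambda>i. fls_const (c (en i))"]) auto
  qed
  have "ring.dimension FF (card (Tn n)) (gm ` CC) (gm ` lincomb CC (card (Tn n)) ?u)"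
  proof (rule dimension_basis[OF subfld_CC])
    show "?u i \<in> KK" for i using k mn_KK KK_mult by blast
    fix k assume "\<And>i. i < card (Tn n) \<Longrightarrow> k i \<in> CC" and z: "(\<Sum>i<card (Tn n). k i * ?u i) = 0"
    then obtain c where c: "\<forall>i<card (Tn n). k i = fls_const (c (en i))" using inv[of k] by blast
    have "(\<Sum>i<card (Tn n). fls_const (c (en i)) * ?u i) = (\<Sum>i<card (Tn n). k i * ?u i)"
      using c by (intro sum.cong) auto
    then have "(\<Sum>i<card (Tn n). fls_const (c (en i)) * ?u i) = 0" using z by simp
    then have z': "(\<Sum>x\<in>Tn n. fls_const (c x) * mn x) = 0" unfolding sums using \<open>\<kappa> \<noteq> 0\<close> by simp
    have cz: "c x = 0" if "x \<in> Tn n" for x using coefficient_extraction[OF n that, of c] unfolding z' by simp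
    show "\<forall>i<card (Tn n). k i = 0"
    proof (intro allI impI)
      fix i assume i: "i < card (Tn n)"
      then have "en i \<in> Tn n" using bij_betwE[OF en] by auto
      then show "k i = 0" using c i cz by simp
    qed
  qed
  then have "ring.dim FF (gm ` CC) (sections curve D) = card (Tn n)"
    unfolding S lin by (rule dim_eqI[OF subfld_CC])
  then show ?thesis unfolding h0_def gm_CC card_Tn .
qed

lemma sections_Linf: "n < d \<Longrightarrow> sections curve (Linf (int (n * d))) = gm ` Mn n"
  unfolding sections_gm by (simp only: Linf_sections)

lemma h0_Linf: "n \<le> d - 2 \<Longrightarrow> h0 curve (Linf (int (n * d))) = (n + 1) * (n + 2) div 2"
  using h0_multiple[of "Linf (int (n * d))" 1 n] sections_Linf[of n] d4 KK_1 by simp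

end

section \<open>Canonical divisors and the genus\<close>

context plane_curve
begin

lemma gev_closed:
  assumes "\<And>a. P (fls_const a)" "\<And>i. P (v i)" "\<And>x y. P x \<Longrightarrow> P y \<Longrightarrow> P (x + y)" "\<And>x y. P x \<Longrightarrow> P y \<Longrightarrow> P (x * y)"
  shows "P (gev fls_const F v)"
  using gev_rel[of "\<lambda>x (y::complex). P x" fls_const "\<lambda>_. 0" v "\<lambda>_. 0" F] assms assms(1)[of 0] assms(1)[of 1] by simp

lemma vec3_exhaust:
  fixes i :: nat
  assumes "P 0 a" "P 1 b" "P 2 c" "\<And>i. i > 2 \<Longrightarrow> P i 0"
  shows "P i (vec3 a b c i)"
proof -
  consider "i = 0" | "i = 1" | "i = 2" | "i > 2" by linarith
  then show ?thesis by cases (use assms in auto)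
qed

lemma KK_induct:
  assumes "e \<in> KK" and c: "\<And>a. P (fls_const a)" and xy: "P xs" "P ys"
    and a: "\<And>x y. x \<in> KK \<Longrightarrow> y \<in> KK \<Longrightarrow> P x \<Longrightarrow> P y \<Longrightarrow> P (x + y)"
    and m: "\<And>x y. x \<in> KK \<Longrightarrow> y \<in> KK \<Longrightarrow> P x \<Longrightarrow> P y \<Longrightarrow> P (x * y)"
    and i: "\<And>x. x \<in> KK \<Longrightarrow> x \<noteq> 0 \<Longrightarrow> P x \<Longrightarrow> P (inverse x)"
  shows "P e"
proof -
  obtain F G n where "is_frac F G n e" using assms(1) by (rule KK_E)
  then have e: "e = ev F * inverse (ev G)" "ev G \<noteq> 0" by (auto simp: is_frac_def field_class.field_divide_inverse)
  have "vec3 xs ys 1 i \<in> KK \<and> P (vec3 xs ys 1 i)" for i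
    by (rule vec3_exhaust) (use c[of 0] c[of 1] xy KK_0 KK_1 KK_xs KK_ys in auto)
  then have *: "ev F \<in> KK \<and> P (ev F)" for F
    unfolding ev_def by (rule gev_closed[where P = "\<lambda>x. x \<in> KK \<and> P x", rotated]) (simp_all add: c a m KK_const KK_add KK_mult)
  show ?thesis unfolding e(1)
    by (intro m i KK_inverse) (use * e(2) in auto)
qed

text \<open>Differentiation with respect to y on the function field, computed from the derivative of
  expansions in the local parameter at infinity.\<close>

definition Dy :: "complex fls \<Rightarrow> complex fls" where "Dy e = fls_deriv e / fls_deriv ys"

lemma deriv_ys_nz: "fls_deriv ys \<noteq> 0"
proof
  assume "fls_deriv ys = 0"
  then have "ys = fls_const (ys $$ 0)" using fls_deriv_eq_0_iff by blast
  then have "fls_subdegree ys = 0" by (metis fls_const_subdegree)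
  then show False using subdegree_ys d4 by simp
qed

lemma Dy_simps: "Dy (a + b) = Dy a + Dy b" "Dy (a * b) = a * Dy b + b * Dy a" "Dy (fls_const c) = 0" "Dy ys = 1"
  using deriv_ys_nz by (simp_all add: Dy_def field_simps)

lemma Dy_zero_iff: "Dy e = 0 \<longleftrightarrow> e \<in> CC"
  using deriv_ys_nz fls_deriv_eq_0_iff[of e] by (auto simp: Dy_def)

definition drv :: "(complex fls \<Rightarrow> complex fls) \<Rightarrow> bool" where
  "drv D \<longleftrightarrow> (\<forall>a\<in>KK. D a \<in> KK) \<and> (\<forall>a\<in>KK. \<forall>b\<in>KK. D (a + b) = D a + D b \<and> D (a * b) = a * D b + b * D a) \<and> (\<forall>c. D (fls_const c) = 0)"

text \<open>Separated from \<open>drv\<close> so that the power and inverse rules are available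
  before a map is known to preserve \<open>KK\<close>, as in the proof of
  \<open>Dy_KK\<close>.\<close>

definition leibniz :: "(complex fls \<Rightarrow> complex fls) \<Rightarrow> bool" where
  "leibniz D \<longleftrightarrow> D 1 = 0 \<and> (\<forall>a\<in>KK. \<forall>b\<in>KK. D (a + b) = D a + D b \<and> D (a * b) = a * D b + b * D a)"

lemma leibnizD:
  assumes "leibniz D"
  shows "D 1 = 0" "a \<in> KK \<Longrightarrow> b \<in> KK \<Longrightarrow> D (a + b) = D a + D b" "a \<in> KK \<Longrightarrow> b \<in> KK \<Longrightarrow> D (a * b) = a * D b + b * D a"
  using assms by (auto simp: leibniz_def)

lemma drv_power:
  assumes D: "leibniz D" and a: "a \<in> KK"
  shows "D (a ^ n) = of_nat n * a ^ (n - 1) * D a"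
proof (induction n)
  case (Suc n)
  have "D (a ^ Suc n) = a * D (a ^ n) + a ^ n * D a" using leibnizD(3)[OF D a KK_power[OF a]] by simp
  then show ?case unfolding Suc by (cases n) (simp_all add: algebra_simps)
qed (simp add: leibnizD(1)[OF D])

lemma drv_inverse:
  assumes D: "leibniz D" and a: "a \<in> KK" "a \<noteq> 0"
  shows "D (inverse a) = - D a / a ^ 2"
proof -
  have "a * D (inverse a) + inverse a * D a = 0"
    using leibnizD(3)[OF D a(1) KK_inverse[OF a(1)]] a(2) leibnizD(1)[OF D] by simp
  then have "a * D (inverse a) = - (inverse a * D a)" by (simp add: eq_neg_iff_add_eq_0)
  then show ?thesis using a(2) by (simp add: field_simps power2_eq_square)
qed

lemma drv_xs:
  assumes D: "leibniz D"
  shows "of_nat (d - 1) * xs ^ (d - 2) * D xs = of_nat d * ys ^ (d - 1) * D ys"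
proof -
  have "D (xs ^ (d - 1)) = D (ys ^ d)" unfolding xs_power_eq using leibnizD(2)[OF D KK_power[OF KK_ys] KK_1] leibnizD(1)[OF D] by simp
  then show ?thesis unfolding drv_power[OF D KK_xs] drv_power[OF D KK_ys] by simp
qed

lemma Dy_1: "Dy 1 = 0"
  using Dy_simps(3)[of 1] by simp

lemma leibniz_Dy: "leibniz Dy"
  by (simp add: leibniz_def Dy_1 Dy_simps)

lemma Dy_xs: "Dy xs = of_nat d * ys ^ (d - 1) / (of_nat (d - 1) * xs ^ (d - 2))"
  using drv_xs[OF leibniz_Dy] d4 by (simp add: Dy_simps field_simps)

lemma of_nat_KK: "of_nat n \<in> KK"
  using KK_const[of "of_nat n"] by (simp add: fls_of_nat)

lemma Dy_KK:
  assumes "e \<in> KK"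
  shows "Dy e \<in> KK"
  using assms
proof (rule KK_induct[where P = "\<lambda>e. Dy e \<in> KK"])
  show "Dy xs \<in> KK" unfolding Dy_xs by (intro KK_closed of_nat_KK)
  show "Dy (inverse x) \<in> KK" if "x \<in> KK" "x \<noteq> 0" "Dy x \<in> KK" for x
    unfolding drv_inverse[OF leibniz_Dy that(1,2)] by (intro KK_closed that)
qed (auto simp: Dy_simps intro: KK_closed)

text \<open>Derivations form a one-dimensional space: x is algebraic over C(y), so the derivative of
  x follows from that of y by \<open>drv_xs\<close>, and x and y generate the field.\<close>

lemma drv_unique:
  assumes D: "drv D" and e: "e \<in> KK"
  shows "D e = D ys * Dy e"
  using e
proof (rule KK_induct[where P = "\<lambda>e. D e = D ys * Dy e"])
  have "D 1 = 0" using D unfolding drv_def by (metis fls_const_1)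
  then have L: "leibniz D" using D by (simp add: drv_def leibniz_def)
  show "D (fls_const a) = D ys * Dy (fls_const a)" for a using D by (simp add: drv_def Dy_simps)
  show "D ys = D ys * Dy ys" by (simp add: Dy_simps)
  show "D xs = D ys * Dy xs"
    using drv_xs[OF L] d4 by (simp add: Dy_xs field_simps)
  show "D (x + y) = D ys * Dy (x + y)" "D (x * y) = D ys * Dy (x * y)"
    if "x \<in> KK" "y \<in> KK" "D x = D ys * Dy x" "D y = D ys * Dy y" for x y
    using that by (simp_all add: leibnizD[OF L] Dy_simps algebra_simps)
  show "D (inverse x) = D ys * Dy (inverse x)" if "x \<in> KK" "x \<noteq> 0" "D x = D ys * Dy x" for x
    using that by (simp add: drv_inverse[OF L that(1,2)] drv_inverse[OF leibniz_Dy that(1,2)])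
qed

text \<open>The quotient \<open>Dy e / Dy t\<close> is de/dt. The condition says that d/dt preserves
  the local ring, so that orders of differentials may be measured against dt.\<close>

definition good_unif :: "point \<Rightarrow> complex fls \<Rightarrow> bool" where
  "good_unif p t \<longleftrightarrow> lunif p t \<and> Dy t \<noteq> 0 \<and> (\<forall>e c. rv p e c \<longrightarrow> (\<exists>c'. rv p (Dy e / Dy t) c'))"

text \<open>The chain rule reduces regularity of de/dt to the three coordinates, and the quotient
  rule passes from forms to fractions.\<close>

lemma good_unif_criterion:
  assumes p: "p \<in> curve" and t: "lunif p t" "Dy t \<noteq> 0" and s: "s \<noteq> 0"
    and v: "\<And>i. rv p (v i) (w i)" "\<And>i. i > 2 \<Longrightarrow> v i = 0"
    and dv: "\<And>i. \<exists>c. rv p (Dy (v i) / Dy t) c"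
    and ev: "\<And>F n. homogeneous n F \<Longrightarrow> ev F = s ^ n * gev fls_const F v"
    and van: "\<And>F n. homogeneous n F \<Longrightarrow> vanishes F p \<longleftrightarrow> gev (\<lambda>x. x) F w = 0"
  shows "good_unif p t"
  unfolding good_unif_def
proof (intro conjI t allI impI)
  let ?D = "\<lambda>e. Dy e / Dy t"
  have D: "?D (a + b) = ?D a + ?D b" "?D (a * b) = a * ?D b + b * ?D a" "?D (fls_const c) = 0" for a b c
    by (simp_all add: Dy_simps add_divide_distrib)
  have D1: "?D 1 = 0" using D(3)[of 1] by simp
  have L: "leibniz ?D" unfolding leibniz_def using D(1,2) D1 by blast
  have G: "rv p (gev fls_const F v) (gev (\<lambda>x. x) F w)" for F
    by (rule gev_rel[of "rv p"]) (auto intro: v rv_const rv_0 rv_1 p rv_add rv_mult)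
  have DG: "\<exists>c. rv p (?D (gev fls_const F v)) c" for F
  proof -
    have "?D (gev fls_const F v) = (\<Sum>i\<in>{..2}. gev fls_const (partial_deriv i F) v * ?D (v i))"
      by (rule gev_chain_rule[OF rhom_fls_const D]) (use v(2) in auto)
    moreover have "\<exists>c. rv p (\<Sum>i\<in>{..2::nat}. gev fls_const (partial_deriv i F) v * ?D (v i)) c"
    proof -
      obtain g where "\<And>i. rv p (?D (v i)) (g i)" using dv by metis
      then have "rv p (\<Sum>i\<in>{..2::nat}. gev fls_const (partial_deriv i F) v * ?D (v i))
          (\<Sum>i\<in>{..2::nat}. gev (\<lambda>x. x) (partial_deriv i F) w * g i)"
        by (intro rv_sum p rv_mult G)
      then show ?thesis by blast
    qed
    ultimately show ?thesis by simp
  qed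
  fix e c assume "rv p e c"
  then obtain F H n where f: "is_frac F H n e" "\<not> vanishes H p" unfolding rv_def by blast
  then have h: "homogeneous n F" "homogeneous n H" "e = ev F / ev H" by (auto simp: is_frac_def)
  let ?f = "gev fls_const F v" and ?g = "gev fls_const H v"
  have g0: "gev (\<lambda>x. x) H w \<noteq> 0" using van[OF h(2)] f(2) by simp
  then have gnz: "?g \<noteq> 0" using rv_nonzero G by blast
  have gK: "?g \<in> KK" using rv_KK G by blast
  have e: "e = ?f * inverse ?g" unfolding h(3) ev[OF h(1)] ev[OF h(2)] using s by (simp add: field_simps)
  have "?D e = ?f * (- ?D ?g / ?g ^ 2) + inverse ?g * ?D ?f"
    unfolding e D(2) drv_inverse[OF L gK gnz] ..
  moreover obtain a b where ab: "rv p (?D ?f) a" "rv p (?D ?g) b" using DG by blast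
  have "rv p (?f * (- ?D ?g / ?g ^ 2) + inverse ?g * ?D ?f)
    (gev (\<lambda>x. x) F w * (- b / gev (\<lambda>x. x) H w ^ 2) + inverse (gev (\<lambda>x. x) H w) * a)"
    by (intro rv_add rv_mult G rv_inverse g0 ab rv_divide rv_uminus rv_power) (use g0 in simp)
  ultimately show "\<exists>c'. rv p (?D e) c'" by metis
qed

lemma good_unif_affine:
  assumes ab: "(a, b) \<in> Aff" and t: "lunif (pt a b) t" "Dy t \<noteq> 0"
    and dv: "\<exists>c. rv (pt a b) (Dy xs / Dy t) c" "\<exists>c. rv (pt a b) (Dy ys / Dy t) c"
  shows "good_unif (pt a b) t"
proof (rule good_unif_criterion[where s = 1 and v = "vec3 xs ys 1" and w = "vec3 a b 1"])
  have p: "pt a b \<in> curve" using ab by simp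
  show "rv (pt a b) (vec3 xs ys 1 i) (vec3 a b 1 i)" for i
    by (rule vec3_exhaust) (use rv_xs[OF ab] rv_ys[OF ab] rv_1[OF p] rv_0[OF p] in auto)
  show "\<exists>c. rv (pt a b) (Dy (vec3 xs ys 1 i) / Dy t) c" for i
    by (rule vec3_exhaust[where P = "\<lambda>i x. \<exists>c. rv (pt a b) (Dy x / Dy t) c"])
       (use dv rv_0[OF p] Dy_1 Dy_simps(3)[of 0] in auto)
qed (use assms in \<open>auto simp: ev_def vanishes_pt peval_gev\<close>)

lemma xs_Dy_xs: "xs ^ (d - 2) * Dy xs = of_nat d / of_nat (d - 1) * ys ^ (d - 1)"
  using d4 by (simp add: Dy_xs field_simps)

lemma rv_of_nat: "p \<in> curve \<Longrightarrow> rv p (of_nat n) (of_nat n)"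
  using rv_const[of p "of_nat n"] by (simp add: fls_of_nat)

lemma good_unif_xs:
  assumes ab: "(a, b) \<in> Aff" and b: "b \<noteq> 0"
  shows "good_unif (pt a b) (xs - fls_const a)" "ord (pt a b) (xs ^ (d - 2) * Dy (xs - fls_const a)) = 0"
proof -
  let ?t = "xs - fls_const a"
  have p: "pt a b \<in> curve" using ab by simp
  have "Dy (?t + fls_const a) = Dy ?t + Dy (fls_const a)" by (rule Dy_simps(1))
  then have Dt: "Dy ?t = Dy xs" by (simp add: Dy_simps)
  have nz: "Dy xs \<noteq> 0" unfolding Dy_xs using d4 by simp
  have q: "rv (pt a b) (of_nat d * ys ^ (d - 1)) (of_nat d * b ^ (d - 1))"
    by (intro rv_mult rv_of_nat rv_power rv_ys ab p)
  have "rv (pt a b) (of_nat (d - 1) * xs ^ (d - 2) / (of_nat d * ys ^ (d - 1))) (of_nat (d - 1) * a ^ (d - 2) / (of_nat d * b ^ (d - 1)))"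
    by (intro rv_divide q rv_mult rv_of_nat rv_power rv_xs ab p) (use b d4 in simp)
  moreover have "of_nat (d - 1) * xs ^ (d - 2) / (of_nat d * ys ^ (d - 1)) = Dy ys / Dy ?t"
    unfolding Dt Dy_xs by (simp add: Dy_simps)
  ultimately show "good_unif (pt a b) ?t"
    using rv_1[OF p] nz by (intro good_unif_affine ab lunif_xs b) (auto simp: Dt)
  have "rv (pt a b) (of_nat d / of_nat (d - 1) * ys ^ (d - 1)) (of_nat d / of_nat (d - 1) * b ^ (d - 1))"
    by (intro rv_mult rv_divide rv_of_nat rv_power rv_ys ab p) (use d4 in simp)
  then show "ord (pt a b) (xs ^ (d - 2) * Dy ?t) = 0"
    unfolding Dt xs_Dy_xs by (rule ord_unit) (use b d4 in simp)
qed

lemma good_unif_ys: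
  assumes ab: "(a, 0) \<in> Aff"
  shows "good_unif (pt a 0) ys" "ord (pt a 0) (xs ^ (d - 2) * Dy ys) = 0"
proof -
  have p: "pt a 0 \<in> curve" using ab by simp
  have a: "a \<noteq> 0" using Aff_zero ab by blast
  have "rv (pt a 0) (of_nat d * ys ^ (d - 1) / (of_nat (d - 1) * xs ^ (d - 2))) (of_nat d * 0 ^ (d - 1) / (of_nat (d - 1) * a ^ (d - 2)))"
    by (intro rv_divide rv_mult rv_of_nat rv_power rv_ys rv_xs ab p) (use a d4 in simp)
  then show "good_unif (pt a 0) ys"
    using rv_1[OF p] by (intro good_unif_affine ab lunif_ys) (auto simp: Dy_simps Dy_xs)
  have "rv (pt a 0) (xs ^ (d - 2) * Dy ys) (a ^ (d - 2) * 1)"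
    unfolding Dy_simps by (intro rv_mult rv_power rv_xs ab rv_1 p)
  then show "ord (pt a 0) (xs ^ (d - 2) * Dy ys) = 0" by (rule ord_unit) (use a in simp)
qed

lemma deriv_us: "fls_subdegree (fls_deriv (ys / xs)) = 0" "fls_deriv (ys / xs) \<noteq> 0"
proof -
  have e: "fls_deriv (ys / xs) = fps_to_fls (fps_deriv us)" by (simp add: us_eq[symmetric] fls_deriv_fps_to_fls)
  have n: "fps_deriv us $ 0 = 1" by simp
  then have "subdegree (fps_deriv us) = 0" by (intro subdegree_eq_0) simp
  then show "fls_subdegree (fls_deriv (ys / xs)) = 0" unfolding e by (simp add: fls_subdegree_fls_to_fps)
  show "fls_deriv (ys / xs) \<noteq> 0" unfolding e using n by (metis fps_to_fls_eq_0_iff fps_zero_nth zero_neq_one)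
qed

text \<open>Implicit differentiation of w = t^d + w^d, with w = 1/x, gives dw/dt = d t^(d-1) / (1 -
  d w^(d-1)), which is regular at infinity since w vanishes there.\<close>

lemma good_unif_infp:
  shows "good_unif infp (ys / xs)" "ord infp (xs ^ (d - 2) * Dy (ys / xs)) = - int ((d - 3) * d)"
proof -
  let ?t = "ys / xs" and ?w = "inverse xs"
  let ?D = "\<lambda>e. Dy e / Dy ?t"
  have nz: "Dy ?t \<noteq> 0" using deriv_us(2) deriv_ys_nz by (simp add: Dy_def)
  have D: "?D (a + b) = ?D a + ?D b" "?D (a * b) = a * ?D b + b * ?D a" "?D (fls_const c) = 0" for a b c
    by (simp_all add: Dy_simps add_divide_distrib)
  have D1: "?D 1 = 0" using D(3)[of 1] by simp
  have L: "leibniz ?D" unfolding leibniz_def using D(1,2) D1 by blast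
  have tK: "?t \<in> KK" and wK: "?w \<in> KK" using KK_closed by auto
  have dp: "z ^ d = z * z ^ (d - 1)" for z :: "complex fls" using d4 by (simp flip: power_Suc)
  have c: "ys ^ d = xs ^ (d - 1) - 1" using xs_power_eq by simp
  have rel: "?t ^ d + ?w ^ d = ?w"
    unfolding power_divide c power_inverse dp[of xs] by (simp add: field_simps)
  have "?D (?t ^ d) + ?D (?w ^ d) = ?D ?w" using D(1)[of "?t ^ d" "?w ^ d"] unfolding rel by simp
  then have "of_nat d * ?t ^ (d - 1) * ?D ?t + of_nat d * ?w ^ (d - 1) * ?D ?w = ?D ?w"
    unfolding drv_power[OF L tK] drv_power[OF L wK] .
  moreover have "?D ?t = 1" using nz by simp
  ultimately have eq: "of_nat d * ?t ^ (d - 1) + of_nat d * ?w ^ (d - 1) * ?D ?w = ?D ?w" by (simp only: mult_1_right)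
  have solve: "X = (1 - Y) * Z" if "X + Y * Z = Z" for X Y Z :: "complex fls"
    using that by (metis add_diff_cancel_right' left_diff_distrib mult_1)
  note r = solve[OF eq]
  have u: "rv infp (1 - of_nat d * ?w ^ (d - 1)) (1 - of_nat d * 0 ^ (d - 1))"
    by (intro rv_diff rv_mult rv_of_nat rv_1 rv_power rv_infp_inv_xs infp_curve)
  have one: "1 - of_nat d * 0 ^ (d - 1) = (1::complex)" using d4 by (simp add: power_0_left)
  have unz: "1 - of_nat d * ?w ^ (d - 1) \<noteq> 0" using rv_nonzero[OF u] one by simp
  have "?D ?w = of_nat d * ?t ^ (d - 1) / (1 - of_nat d * ?w ^ (d - 1))"
    unfolding r using unz by simp
  moreover have "rv infp (of_nat d * ?t ^ (d - 1) / (1 - of_nat d * ?w ^ (d - 1))) (of_nat d * 0 ^ (d - 1) / (1 - of_nat d * 0 ^ (d - 1)))"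
    by (intro rv_divide rv_mult rv_of_nat u rv_power rv_infp_ys_xs infp_curve) (simp add: one)
  ultimately have dw: "\<exists>c. rv infp (?D ?w) c" by metis
  show "good_unif infp ?t"
  proof (rule good_unif_criterion[where s = xs and v = "vec3 1 ?t ?w" and w = "vec3 1 0 0"])
    show "rv infp (vec3 1 ?t ?w i) (vec3 1 0 0 i)" for i
      by (rule vec3_exhaust) (use rv_infp_ys_xs rv_infp_inv_xs rv_1[OF infp_curve] rv_0[OF infp_curve] in auto)
    show "\<exists>c. rv infp (?D (vec3 1 ?t ?w i)) c" for i
      by (rule vec3_exhaust[where P = "\<lambda>i x. \<exists>c. rv infp (?D x) c"])
         (use dw nz rv_0[OF infp_curve] rv_1[OF infp_curve] D1 D(3)[of 0] in auto)
  qed (use nz lunif_infp in \<open>auto simp: ev_infp vanishes_infp peval_gev\<close>)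
  have K: "xs ^ (d - 2) * Dy ?t \<in> KK" by (intro KK_closed Dy_KK)
  \<comment> \<open>In terms of X, the derivative of y/x has order 0 and that of y has order -d, so
    \<open>Dy ?t\<close> has order d; multiplying with x^(d-2) subtracts (d-2) d.\<close>
  have "of_int (fls_subdegree ys) \<noteq> (0::complex)" using subdegree_ys d4 by simp
  then have dy: "fls_subdegree (fls_deriv ys) = - int (d - 1) - 1"
    using fls_subdegree_deriv[of ys] subdegree_ys by simp
  have "fls_subdegree (Dy ?t) = 0 - (- int (d - 1) - 1)"
    unfolding Dy_def using deriv_us deriv_ys_nz dy by (subst fls_divide_subdegree) auto
  also have "\<dots> = int d" using d4 by simp
  finally have s: "fls_subdegree (Dy ?t) = int d" .
  have "fls_subdegree (xs ^ (d - 2) * Dy ?t) = int (d - 2) * - int d + int d"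
    using nz s by (simp add: fls_subdegree_pow subdegree_xs)
  also have "\<dots> = - int ((d - 3) * d)" using d4 by (simp add: of_nat_diff algebra_simps)
  finally show "ord infp (xs ^ (d - 2) * Dy ?t) = - int ((d - 3) * d)"
    using ord_infp[OF K] nz by simp
qed

text \<open>The differential dy / x^(d-2) equals dt / (x^(d-2) \<open>Dy t\<close>), so these orders
  say that it has neither zeros nor poles on the affine part and a zero of order (d-3) d at
  infinity.\<close>

lemma good_unif_exists:
  assumes "p \<in> curve"
  obtains t where "good_unif p t" "ord p (xs ^ (d - 2) * Dy t) = - Linf (int ((d - 3) * d)) p"
  using assms
proof (cases rule: curve_cases)
  case 1
  then show thesis using that[of "ys / xs"] good_unif_infp by (simp add: Linf_def)
next
  case (2 a b)
  show thesis
  proof (cases "b = 0")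
    case True
    then show ?thesis using that[of ys] good_unif_ys[of a] 2 by (simp add: Linf_def)
  next
    case False
    then show ?thesis using that[of "xs - fls_const a"] good_unif_xs[of a b] 2 by (simp add: Linf_def)
  qed
qed

text \<open>Any other uniformizer is t = t0 w with a unit w, and dt/dt0 = w + t0 dw/dt0 is again a
  unit.\<close>

lemma ord_Dy_lunif:
  assumes "lunif p t"
  shows "Dy t \<noteq> 0" "ord p (xs ^ (d - 2) * Dy t) = - Linf (int ((d - 3) * d)) p"
proof -
  note p = lunif_curve[OF assms]
  obtain t0 where t0: "good_unif p t0" "ord p (xs ^ (d - 2) * Dy t0) = - Linf (int ((d - 3) * d)) p"
    using good_unif_exists[OF p] by blast
  then have l: "lunif p t0" "Dy t0 \<noteq> 0" by (auto simp: good_unif_def)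
  obtain w c where w: "rv p w c" "c \<noteq> 0" "t = t0 * w" using lunif_associated[OF l(1) assms] by blast
  obtain c' where c': "rv p (Dy w / Dy t0) c'" using t0(1) w(1) unfolding good_unif_def by blast
  let ?q = "w + t0 * (Dy w / Dy t0)"
  have e: "Dy t = Dy t0 * ?q" unfolding w(3) Dy_simps using l(2) by (simp add: field_simps)
  have "rv p ?q (c + 0 * c')" by (intro rv_add rv_mult w lunif_rv l c')
  then have q: "rv p ?q c" by simp
  have K: "t0 \<in> KK" "xs ^ (d - 2) * Dy t0 \<in> KK" using rv_KK[OF lunif_rv[OF l(1)]] by (auto intro!: KK_closed Dy_KK)
  show nz: "Dy t \<noteq> 0" unfolding e using l(2) rv_nonzero[OF q w(2)] by simp
  have "ord p (xs ^ (d - 2) * Dy t) = ord p ((xs ^ (d - 2) * Dy t0) * ?q)" unfolding e by (simp add: mult_ac)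
  also have "\<dots> = ord p (xs ^ (d - 2) * Dy t0) + ord p ?q"
    by (intro ord_mult p K rv_KK[OF q] rv_nonzero[OF q w(2)]) (use l in simp)
  finally show "ord p (xs ^ (d - 2) * Dy t) = - Linf (int ((d - 3) * d)) p"
    using t0(2) ord_unit[OF q w(2)] by simp
qed

section \<open>Derivations of the function field and canonical divisors\<close>

lemma derivation_gm:
  assumes "derivation curve \<delta>"
  obtains D where "drv D" "\<And>e. e \<in> KK \<Longrightarrow> \<delta> (gm e) = gm (D e)"
proof -
  have c: "\<And>e. e \<in> KK \<Longrightarrow> \<delta> (gm e) \<in> gm ` KK" using assms carrier_FF by (auto simp: derivation_def)
  then have "\<forall>e. \<exists>y. e \<in> KK \<longrightarrow> y \<in> KK \<and> \<delta> (gm e) = gm y" by blast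
  then obtain D where D: "\<And>e. e \<in> KK \<Longrightarrow> D e \<in> KK \<and> \<delta> (gm e) = gm (D e)" by metis
  have DK: "D e \<in> KK" if "e \<in> KK" for e using D that by blast
  have "drv D" unfolding drv_def
  proof (intro conjI ballI allI)
    show "D a \<in> KK" if "a \<in> KK" for a using D that by blast
    fix a b assume ab: "a \<in> KK" "b \<in> KK"
    have ca: "gm a \<in> carrier FF" "gm b \<in> carrier FF" using ab gm_carrier by auto
    have "gm (D (a + b)) = gm (D a) \<oplus>\<^bsub>FF\<^esub> gm (D b)"
      using assms ca D[OF ab(1)] D[OF ab(2)] D[OF KK_add[OF ab]] gm_add[OF ab] unfolding derivation_def by metis
    then have "gm (D (a + b)) = gm (D a + D b)" using gm_add D ab by simp
    then show "D (a + b) = D a + D b" by (rule inj_onD[OF inj_gm]) (intro KK_add DK ab)+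
    have "gm (D (a * b)) = (gm a \<otimes>\<^bsub>FF\<^esub> gm (D b)) \<oplus>\<^bsub>FF\<^esub> (gm b \<otimes>\<^bsub>FF\<^esub> gm (D a))"
      using assms ca D[OF ab(1)] D[OF ab(2)] D[OF KK_mult[OF ab]] gm_mult[OF ab] unfolding derivation_def by metis
    then have "gm (D (a * b)) = gm (a * D b + b * D a)" using gm_add gm_mult D ab KK_mult by simp
    then show "D (a * b) = a * D b + b * D a" by (rule inj_onD[OF inj_gm]) (intro KK_add KK_mult DK ab)+
  next
    fix c
    have "gm (D (fls_const c)) = gm 0"
      using assms D[OF KK_const, of c] gm_const[of c] gm_0 unfolding derivation_def by metis
    then show "D (fls_const c) = 0" by (rule inj_onD[OF inj_gm]) (intro DK KK_const KK_0)+
  qed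
  then show thesis using that D by blast
qed

lemma derivation_exists:
  assumes "t \<in> KK" "Dy t \<noteq> 0"
  obtains \<delta> where "derivation curve \<delta>" "\<And>e. e \<in> KK \<Longrightarrow> \<delta> (gm e) = gm (Dy e / Dy t)"
proof -
  define \<delta> where "\<delta> A = gm (Dy (the_inv_into KK gm A) / Dy t)" for A
  have d: "\<delta> (gm e) = gm (Dy e / Dy t)" if "e \<in> KK" for e
    unfolding \<delta>_def the_inv_into_f_f[OF inj_gm that] ..
  have K: "Dy e / Dy t \<in> KK" if "e \<in> KK" for e by (intro KK_divide Dy_KK that assms)
  have "derivation curve \<delta>"
    unfolding derivation_def carrier_FF
  proof (intro conjI ballI allI)
    show "\<delta> f \<in> gm ` KK" if "f \<in> gm ` KK" for f using that d K by auto
    fix f g assume "f \<in> gm ` KK" "g \<in> gm ` KK"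
    then obtain a b where ab: "a \<in> KK" "b \<in> KK" "f = gm a" "g = gm b" by blast
    show "\<delta> (f \<oplus>\<^bsub>FF\<^esub> g) = \<delta> f \<oplus>\<^bsub>FF\<^esub> \<delta> g"
      using ab by (simp add: d K KK_add Dy_simps add_divide_distrib flip: gm_add)
    have "\<delta> (f \<otimes>\<^bsub>FF\<^esub> g) = gm (a * (Dy b / Dy t) + b * (Dy a / Dy t))"
      using ab by (simp add: d KK_mult Dy_simps add_divide_distrib flip: gm_mult)
    also have "\<dots> = (gm a \<otimes>\<^bsub>FF\<^esub> gm (Dy b / Dy t)) \<oplus>\<^bsub>FF\<^esub> (gm b \<otimes>\<^bsub>FF\<^esub> gm (Dy a / Dy t))"
      using gm_add[OF KK_mult[OF ab(1) K[OF ab(2)]] KK_mult[OF ab(2) K[OF ab(1)]]]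
        gm_mult[OF ab(1) K[OF ab(2)]] gm_mult[OF ab(2) K[OF ab(1)]] by (simp only:)
    finally show "\<delta> (f \<otimes>\<^bsub>FF\<^esub> g) = (f \<otimes>\<^bsub>FF\<^esub> \<delta> g) \<oplus>\<^bsub>FF\<^esub> (g \<otimes>\<^bsub>FF\<^esub> \<delta> f)"
      unfolding ab(3,4) d[OF ab(1)] d[OF ab(2)] .
  next
    fix c show "\<delta> (const_fun curve c) = \<zero>\<^bsub>FF\<^esub>"
      unfolding gm_const[symmetric] d[OF KK_const] Dy_simps using gm_0 by simp
  qed
  then show thesis using that d by blast
qed

lemma divisor_Linf: "divisor curve (Linf n)"
proof -
  have "{p. Linf n p \<noteq> 0} \<subseteq> {infp}" by (auto simp: Linf_def)
  then show ?thesis unfolding divisor_def using finite_subset by auto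
qed

lemma canonical_divisor_Linf: "canonical_divisor curve (Linf (int ((d - 3) * d)))"
  unfolding canonical_divisor_def
proof (intro conjI divisor_Linf bexI)
  \<comment> \<open>The rational differential used is dy / x^(d-2).\<close>
  let ?h = "inverse (xs ^ (d - 2))"
  have hK: "?h \<in> KK" "?h \<noteq> 0" by (intro KK_inverse KK_power KK_xs) simp
  show "gm ?h \<in> carrier FF - {\<zero>\<^bsub>FF\<^esub>}" using gm_carrier[OF hK(1)] gm_eq_iff[OF hK(1) KK_0] hK(2) unfolding gm_0 by blast
  have "ys \<notin> CC" using Dy_zero_iff[of ys] Dy_simps(4) by simp
  then have "gm ys \<notin> gm ` CC" using inj_on_image_mem_iff[OF inj_gm KK_ys subfldD(1)[OF subfld_CC]] by simp
  then show "gm ys \<in> carrier FF - range (const_fun curve)" using gm_carrier KK_ys gm_CC by simp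
  show "\<forall>p\<in>curve. \<exists>t \<delta>. uniformizer curve p t \<and> derivation curve \<delta> \<and> \<delta> t = \<one>\<^bsub>FF\<^esub> \<and>
      Linf (int ((d - 3) * d)) p = order_at curve p (gm ?h \<otimes>\<^bsub>FF\<^esub> \<delta> (gm ys))"
  proof
    fix p assume p: "p \<in> curve"
    obtain t where t: "lunif p t" using lunif_exists[OF p] by blast
    note tK = rv_KK[OF lunif_rv[OF t]]
    note Dt = ord_Dy_lunif[OF t]
    obtain \<delta> where \<delta>: "derivation curve \<delta>" "\<And>e. e \<in> KK \<Longrightarrow> \<delta> (gm e) = gm (Dy e / Dy t)"
      using derivation_exists[OF tK Dt(1)] by blast
    have DK: "1 / Dy t \<in> KK" by (intro KK_closed Dy_KK tK)
    have "gm ?h \<otimes>\<^bsub>FF\<^esub> \<delta> (gm ys) = gm (?h * (1 / Dy t))"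
      using \<delta>(2)[OF KK_ys] gm_mult[OF hK(1) DK] by (simp add: Dy_simps)
    also have "?h * (1 / Dy t) = inverse (xs ^ (d - 2) * Dy t)" by (simp add: field_simps)
    finally have e: "gm ?h \<otimes>\<^bsub>FF\<^esub> \<delta> (gm ys) = gm (inverse (xs ^ (d - 2) * Dy t))" .
    have K: "xs ^ (d - 2) * Dy t \<in> KK" "xs ^ (d - 2) * Dy t \<noteq> 0" using Dt(1) by (auto intro!: KK_closed Dy_KK tK)
    have "order_at curve p (gm ?h \<otimes>\<^bsub>FF\<^esub> \<delta> (gm ys)) = Linf (int ((d - 3) * d)) p"
      unfolding e using order_at_gm[OF p KK_inverse[OF K(1)]] K(2) ord_inverse[OF p K] Dt(2) by simp
    moreover have "\<delta> (gm t) = \<one>\<^bsub>FF\<^esub>" using \<delta>(2)[OF tK] Dt(1) gm_1 by simp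
    ultimately show "\<exists>t \<delta>. uniformizer curve p t \<and> derivation curve \<delta> \<and> \<delta> t = \<one>\<^bsub>FF\<^esub> \<and>
      Linf (int ((d - 3) * d)) p = order_at curve p (gm ?h \<otimes>\<^bsub>FF\<^esub> \<delta> (gm ys))"
      using uniformizer_gm[OF tK p] t \<delta>(1) by metis
  qed
qed

text \<open>Since \<open>genus\<close> chooses some canonical divisor, all of them have to be
  treated: h dg is k times dy / x^(d-2) with k = h (dg/dy) x^(d-2), so the divisor differs from that
  of \<open>canonical_divisor_Linf\<close> by the divisor of k.\<close>

lemma h0_canonical:
  assumes "canonical_divisor curve W"
  shows "h0 curve W = (d - 2) * (d - 1) div 2"
proof -
  obtain H f where hf: "H \<in> carrier FF - {\<zero>\<^bsub>FF\<^esub>}" "f \<in> carrier FF - range (const_fun curve)"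
    "\<And>p. p \<in> curve \<Longrightarrow> \<exists>t \<delta>. uniformizer curve p t \<and> derivation curve \<delta> \<and> \<delta> t = \<one>\<^bsub>FF\<^esub> \<and>
          W p = order_at curve p (H \<otimes>\<^bsub>FF\<^esub> \<delta> f)"
    using assms unfolding canonical_divisor_def by blast
  have "H \<in> gm ` KK" "H \<noteq> gm 0" "f \<in> gm ` KK" "f \<notin> gm ` CC" using hf(1,2) carrier_FF gm_0 gm_CC by blast+
  then obtain h g where h: "h \<in> KK" "H = gm h" "h \<noteq> 0" and g: "g \<in> KK" "f = gm g" "g \<notin> CC" by blast
  have Dg: "Dy g \<noteq> 0" using g(3) Dy_zero_iff by blast
  let ?k = "h * Dy g * xs ^ (d - 2)"
  have k: "?k \<in> KK" "?k \<noteq> 0" using h g Dg by (auto intro!: KK_closed Dy_KK)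
  have W: "W p = ord p ?k + Linf (int ((d - 3) * d)) p" if p: "p \<in> curve" for p
  proof -
    obtain T \<delta> where T: "uniformizer curve p T" "derivation curve \<delta>" "\<delta> T = \<one>\<^bsub>FF\<^esub>" "W p = order_at curve p (H \<otimes>\<^bsub>FF\<^esub> \<delta> f)"
      using hf(3)[OF p] by blast
    obtain t where t: "T = gm t" "lunif p t" "t \<in> KK" using uniformizer_E[OF T(1) p] by blast
    obtain D where D: "drv D" "\<And>e. e \<in> KK \<Longrightarrow> \<delta> (gm e) = gm (D e)" using derivation_gm[OF T(2)] by blast
    note Dt = ord_Dy_lunif[OF t(2)]
    have "gm (D t) = gm 1" using D(2)[OF t(3)] T(3) t(1) gm_1 by simp
    then have "D t = 1" using gm_eq_iff[OF _ KK_1] D(1) t(3) by (auto simp: drv_def)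
    then have "D ys * Dy t = 1" using drv_unique[OF D(1) t(3)] by simp
    then have Dys: "D ys = inverse (Dy t)" by (metis inverse_unique mult.commute)
    have q: "xs ^ (d - 2) * Dy t \<in> KK" "xs ^ (d - 2) * Dy t \<noteq> 0" using Dt(1) by (auto intro!: KK_closed Dy_KK t)
    have "D g \<in> KK" using D(1) g(1) by (simp add: drv_def)
    then have "H \<otimes>\<^bsub>FF\<^esub> \<delta> f = gm (h * D g)" using D(2)[OF g(1)] g(2) h gm_mult by simp
    also have "h * D g = ?k / (xs ^ (d - 2) * Dy t)"
      unfolding drv_unique[OF D(1) g(1)] Dys using Dt(1) by (simp add: field_simps)
    finally have "W p = ord p (?k / (xs ^ (d - 2) * Dy t))"
      using T(4) order_at_gm[OF p KK_divide[OF k(1) q(1)]] k(2) q(2) by simp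
    also have "\<dots> = ord p ?k - ord p (xs ^ (d - 2) * Dy t)" by (rule ord_divide[OF p k q])
    finally show ?thesis using Dt(2) by simp
  qed
  let ?L = "Linf (int ((d - 3) * d))"
  have "{e \<in> KK. e = 0 \<or> (\<forall>p\<in>curve. ord p e + W p \<ge> 0)} = (\<lambda>e. inverse ?k * e) ` {e \<in> KK. e = 0 \<or> (\<forall>p\<in>curve. ord p e + ?L p \<ge> 0)}"
  proof (intro equalityI subsetI)
    fix e assume e: "e \<in> {e \<in> KK. e = 0 \<or> (\<forall>p\<in>curve. ord p e + W p \<ge> 0)}"
    have "ord p (?k * e) + ?L p \<ge> 0" if "p \<in> curve" "e \<noteq> 0" for p
      using e that W[OF that(1)] ord_mult[OF that(1) k, of e] by auto
    then have "?k * e \<in> {e \<in> KK. e = 0 \<or> (\<forall>p\<in>curve. ord p e + ?L p \<ge> 0)}" using e k(1) KK_mult by auto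
    moreover have "e = inverse ?k * (?k * e)"
      unfolding mult.assoc[of "inverse ?k" ?k e, symmetric] left_inverse[OF k(2)] by simp
    ultimately show "e \<in> (\<lambda>e. inverse ?k * e) ` {e \<in> KK. e = 0 \<or> (\<forall>p\<in>curve. ord p e + ?L p \<ge> 0)}" by blast
  next
    fix x assume "x \<in> (\<lambda>e. inverse ?k * e) ` {e \<in> KK. e = 0 \<or> (\<forall>p\<in>curve. ord p e + ?L p \<ge> 0)}"
    then obtain e where e: "x = inverse ?k * e" "e \<in> KK" "e = 0 \<or> (\<forall>p\<in>curve. ord p e + ?L p \<ge> 0)" by blast
    have kK: "inverse ?k \<in> KK" "inverse ?k \<noteq> 0" using KK_inverse[OF k(1)] k(2) by (auto simp del: inverse_mult_distrib)
    have "ord p x + W p \<ge> 0" if "p \<in> curve" "x \<noteq> 0" for p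
      using e that W[OF that(1)] ord_mult[OF that(1) kK, of e] ord_inverse[OF that(1) k] by (auto simp del: inverse_mult_distrib)
    moreover have "x \<in> KK" unfolding e(1) by (intro KK_mult kK e)
    ultimately show "x \<in> {e \<in> KK. e = 0 \<or> (\<forall>p\<in>curve. ord p e + W p \<ge> 0)}" by blast
  qed
  also have "\<dots> = (\<lambda>e. inverse ?k * e) ` Mn (d - 3)"
    using Linf_sections[of "d - 3"] d4 by simp
  finally have "sections curve W = gm ` ((\<lambda>e. inverse ?k * e) ` Mn (d - 3))" unfolding sections_gm by simp
  then have h: "h0 curve W = (d - 3 + 1) * (d - 3 + 2) div 2"
    by (rule h0_multiple[OF _ KK_inverse[OF k(1)]]) (use k(2) d4 in auto)
  have "d - 3 + 1 = d - 2" "d - 3 + 2 = d - 1" using d4 by auto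
  then show ?thesis using h by (simp only:)
qed

lemma genus_curve: "genus curve = (d - 2) * (d - 1) div 2"
  unfolding genus_def using h0_canonical someI_ex[of "canonical_divisor curve"] canonical_divisor_Linf by blast

end

section \<open>A very ample divisor\<close>

context plane_curve
begin

text \<open>
  Among the forms of degree \<open>m = d - 2\<close> it suffices to use \<open>x\<^sub>0\<^bsup>m-1\<^esup> x\<^sub>i\<close> and \<open>x\<^sub>2\<^bsup>m-1\<^esup> x\<^sub>i\<close>, since
  \<open>x\<^sub>0\<close> and \<open>x\<^sub>2\<close> have no common zero on the curve. The pair \<open>(j, i)\<close> encodes \<open>x\<^sub>0\<^sup>i x\<^sub>1\<^sup>j x\<^sub>2\<^bsup>m-i-j\<^esup>\<close>.
\<close>

definition six :: "(nat \<times> nat) list" where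
  "six = [(0, d - 2), (1, d - 3), (0, d - 3), (0, 1), (1, 0), (0, 0)]"

definition mform :: "nat \<times> nat \<Rightarrow> mpoly" where
  "mform = (\<lambda>(j, i). mvar 0 ^ i * mvar 1 ^ j * mvar 2 ^ (d - 2 - i - j))"

definition vm :: "nat \<times> nat \<Rightarrow> (nat \<Rightarrow> complex) \<Rightarrow> complex" where
  "vm = (\<lambda>(j, i) r. r 0 ^ i * r 1 ^ j * r 2 ^ (d - 2 - i - j))"

definition vmap :: "(nat \<Rightarrow> complex) \<Rightarrow> nat \<Rightarrow> complex" where
  "vmap r = (\<lambda>n. if n \<le> 5 then vm (six ! n) r else 0)"

definition phi :: "point \<Rightarrow> point" where "phi p = proj_point (vmap (rep p))"

lemma le5: "n \<le> (5::nat) \<longleftrightarrow> n = 0 \<or> n = 1 \<or> n = 2 \<or> n = 3 \<or> n = 4 \<or> n = 5"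
  by linarith

lemma six_nth:
  "six ! 0 = (0, d - 2)" "six ! 1 = (1, d - 3)" "six ! 2 = (0, d - 3)" "six ! 3 = (0, 1)" "six ! 4 = (1, 0)" "six ! 5 = (0, 0)"
  by (simp_all add: six_def numeral_eq_Suc One_nat_def)

lemma vmap_simps:
  "vmap r 0 = r 0 ^ (d - 3) * r 0" "vmap r 1 = r 0 ^ (d - 3) * r 1" "vmap r 2 = r 0 ^ (d - 3) * r 2"
  "vmap r 3 = r 2 ^ (d - 3) * r 0" "vmap r 4 = r 2 ^ (d - 3) * r 1" "vmap r 5 = r 2 ^ (d - 3) * r 2"
  "n > 5 \<Longrightarrow> vmap r n = 0"
proof -
  define k where "k = d - 3"
  have e: "d - 2 = Suc k" "d - 3 = k" using d4 by (auto simp: k_def)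
  show "vmap r 0 = r 0 ^ (d - 3) * r 0" "vmap r 1 = r 0 ^ (d - 3) * r 1" "vmap r 2 = r 0 ^ (d - 3) * r 2"
    "vmap r 3 = r 2 ^ (d - 3) * r 0" "vmap r 4 = r 2 ^ (d - 3) * r 1" "vmap r 5 = r 2 ^ (d - 3) * r 2"
    by (simp_all add: vmap_def six_nth vm_def e)
  show "n > 5 \<Longrightarrow> vmap r n = 0" by (simp add: vmap_def)
qed

lemma vmap_scale: "vmap (\<lambda>i. c * r i) n = c ^ (d - 2) * vmap r n"
proof -
  have e: "d - 2 = Suc (d - 3)" using d4 by auto
  consider "n = 0" | "n = 1" | "n = 2" | "n = 3" | "n = 4" | "n = 5" | "n > 5" using le5[of n] by linarith
  then show ?thesis unfolding e
    by cases (auto simp: vmap_simps power_mult_distrib mult_ac)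
qed

lemma phi_proj_point: "phi (proj_point v) = proj_point (vmap v)"
proof -
  obtain c where c: "c \<noteq> 0" "rep (proj_point v) = (\<lambda>i. c * v i)" using rep_proj_point by blast
  show ?thesis unfolding phi_def c(2)
    by (rule proj_point_eqI[of "inverse (c ^ (d - 2))"]) (use c(1) in \<open>simp_all add: vmap_scale\<close>)
qed

lemma rep_phi:
  obtains c where "c \<noteq> 0" "rep (phi p) = (\<lambda>n. c * vmap (rep p) n)"
  using rep_proj_point[of "vmap (rep p)"] unfolding phi_def by blast

lemma curve_rep:
  assumes "p \<in> curve"
  shows "proj_point (rep p) = p" "\<And>i. i > 2 \<Longrightarrow> rep p i = 0" "rep p 0 \<noteq> 0 \<or> rep p 2 \<noteq> 0"
    "rep p 1 ^ d = rep p 0 ^ (d - 1) * rep p 2 - rep p 2 ^ d"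
proof -
  have sp: "p \<in> proj_space 2" using assms curve_space by blast
  show r: "proj_point (rep p) = p" "\<And>i. i > 2 \<Longrightarrow> rep p i = 0" using proj_space_rep[OF sp] by blast+
  show e: "rep p 1 ^ d = rep p 0 ^ (d - 1) * rep p 2 - rep p 2 ^ d"
    using assms in_curve_iff[OF sp] by (simp add: vanishes_def peval_gev gev_Fc rhom_id algebra_simps)
  show "rep p 0 \<noteq> 0 \<or> rep p 2 \<noteq> 0"
  proof (rule ccontr)
    assume "\<not> ?thesis"
    then have z: "rep p 0 = 0" "rep p 2 = 0" by auto
    then have "rep p 1 = 0" using e d4 by (simp add: power_0_left)
    then have "rep p i = 0" for i using z r(2)[of i]
      by (cases "i = 0"; cases "i = 1"; cases "i = 2") auto
    then show False using proj_space_rep(2)[OF sp] by blast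
  qed
qed

lemma vec3_rep:
  assumes "\<And>i. i > 2 \<Longrightarrow> r i = 0"
  shows "(vec3 (r 0) (r 1) (r 2) :: nat \<Rightarrow> complex) = r"
proof
  fix i show "vec3 (r 0) (r 1) (r 2) i = r i"
    by (rule vec3_exhaust[where P = "\<lambda>i x. x = r i"]) (use assms in auto)
qed

lemma curveI:
  assumes "\<exists>i\<le>2. r i \<noteq> 0" "\<And>i. i > 2 \<Longrightarrow> r i = 0" "r 1 ^ d - r 0 ^ (d - 1) * r 2 + r 2 ^ d = 0"
  shows "proj_point r \<in> curve"
proof -
  have "proj_point r \<in> proj_space 2" using assms by (auto intro: proj_point_in_space)
  moreover have "vanishes Fc (proj_point r)"
    using assms(3) by (simp add: vanishes_proj_point[OF homogeneous_Fc] peval_gev gev_Fc rhom_id)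
  ultimately show ?thesis using in_curve_iff by blast
qed

lemma phi_space: "p \<in> curve \<Longrightarrow> phi p \<in> proj_space 5"
proof -
  assume p: "p \<in> curve"
  have "vmap (rep p) 0 \<noteq> 0 \<or> vmap (rep p) 5 \<noteq> 0" using curve_rep(3)[OF p] by (auto simp: vmap_simps)
  then show ?thesis unfolding phi_def using proj_point_in_space[of "vmap (rep p)" _ 5] vmap_simps(7) by metis
qed

text \<open>
  On the image \<open>(u, w)\<close> of the point \<open>[v]\<close>, with \<open>u = v\<^sub>0\<^bsup>m-1\<^esup> v\<close> and \<open>w = v\<^sub>2\<^bsup>m-1\<^esup> v\<close>, the vectors \<open>u\<close>, \<open>w\<close>
  are proportional with ratio \<open>v\<^sub>0\<^bsup>m-1\<^esup> : v\<^sub>2\<^bsup>m-1\<^esup>\<close>, read off from \<open>u\<close> as well as from \<open>w\<close>.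
\<close>

definition image_eqs :: "(nat \<Rightarrow> complex) \<Rightarrow> bool" where
  "image_eqs z \<longleftrightarrow> (\<forall>i\<le>2. \<forall>j\<le>2. z i * z (j + 3) = z j * z (i + 3)) \<and>
     z 1 ^ d - z 0 ^ (d - 1) * z 2 + z 2 ^ d = 0 \<and> z 4 ^ d - z 3 ^ (d - 1) * z 5 + z 5 ^ d = 0 \<and>
     (\<forall>j\<le>2. z j * z 2 ^ (d - 3) = z (j + 3) * z 0 ^ (d - 3) \<and> z j * z 5 ^ (d - 3) = z (j + 3) * z 3 ^ (d - 3))"

definition image_forms :: "mpoly set" where
  "image_forms = {mvar i * mvar (j + 3) - mvar j * mvar (i + 3) | i j. i \<le> 2 \<and> j \<le> 2} \<union>
     {mvar 1 ^ d - mvar 0 ^ (d - 1) * mvar 2 + mvar 2 ^ d, mvar 4 ^ d - mvar 3 ^ (d - 1) * mvar 5 + mvar 5 ^ d} \<union>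
     {mvar j * mvar 2 ^ (d - 3) - mvar (j + 3) * mvar 0 ^ (d - 3) | j. j \<le> 2} \<union>
     {mvar j * mvar 5 ^ (d - 3) - mvar (j + 3) * mvar 3 ^ (d - 3) | j. j \<le> 2}"

lemma image_forms_homogeneous: "F \<in> image_forms \<Longrightarrow> \<exists>n. homogeneous n F"
proof -
  have a: "homogeneous (1 + 1) (mvar i * mvar j - mvar k * mvar l)" for i j k l
    by (intro homogeneous_diff homogeneous_mult homogeneous_var)
  have b: "homogeneous d (mvar i ^ d - mvar j ^ (d - 1) * mvar k + mvar k ^ d)" for i j k
  proof -
    have "homogeneous (d - 1 + 1) (mvar j ^ (d - 1) * mvar k)"
      by (intro homogeneous_mult homogeneous_var_power homogeneous_var)
    then have "homogeneous d (mvar j ^ (d - 1) * mvar k)" using d4 by simp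
    then show ?thesis by (intro homogeneous_add homogeneous_diff homogeneous_var_power)
  qed
  have c: "homogeneous (1 + (d - 3)) (mvar i * mvar j ^ (d - 3) - mvar k * mvar l ^ (d - 3))" for i j k l
    by (intro homogeneous_diff homogeneous_mult homogeneous_var homogeneous_var_power)
  assume "F \<in> image_forms"
  then show ?thesis unfolding image_forms_def using a b c by blast
qed

lemma image_forms_eqs: "(\<forall>F\<in>image_forms. vanishes F q) \<longleftrightarrow> image_eqs (rep q)"
proof -
  note s = vanishes_def peval_gev gev_simps[OF rhom_id] gev_var[OF rhom_id]
  have "(\<forall>F\<in>image_forms. vanishes F q) \<longleftrightarrow>
      (\<forall>i\<le>2. \<forall>j\<le>2. vanishes (mvar i * mvar (j + 3) - mvar j * mvar (i + 3)) q) \<and>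
      vanishes (mvar 1 ^ d - mvar 0 ^ (d - 1) * mvar 2 + mvar 2 ^ d) q \<and>
      vanishes (mvar 4 ^ d - mvar 3 ^ (d - 1) * mvar 5 + mvar 5 ^ d) q \<and>
      (\<forall>j\<le>2. vanishes (mvar j * mvar 2 ^ (d - 3) - mvar (j + 3) * mvar 0 ^ (d - 3)) q \<and>
        vanishes (mvar j * mvar 5 ^ (d - 3) - mvar (j + 3) * mvar 3 ^ (d - 3)) q)"
    unfolding image_forms_def by blast
  then show ?thesis unfolding image_eqs_def s by simp
qed

lemma image_eqs_scale: "c \<noteq> 0 \<Longrightarrow> image_eqs (\<lambda>i. c * z i) \<longleftrightarrow> image_eqs z"
proof -
  assume c: "c \<noteq> 0"
  obtain n where n: "d = Suc n" using d4 by (cases d) auto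
  have e: "(c * a) ^ d - (c * b) ^ (d - 1) * (c * g) + (c * g) ^ d = c ^ d * (a ^ d - b ^ (d - 1) * g + g ^ d)" for a b g
    unfolding n by (simp add: power_mult_distrib algebra_simps)
  show ?thesis unfolding image_eqs_def e using c by (simp add: power_mult_distrib mult_ac)
qed

lemma le2: "(\<forall>j\<le>2::nat. P j) \<longleftrightarrow> P 0 \<and> P 1 \<and> P 2"
proof -
  have "j \<le> 2 \<longleftrightarrow> j = 0 \<or> j = 1 \<or> j = 2" for j :: nat by linarith
  then show ?thesis by auto
qed

lemma image_eqs_phi:
  assumes "p \<in> curve"
  shows "image_eqs (vmap (rep p))"
proof -
  let ?r = "rep p"
  have e: "?r 1 ^ d - ?r 0 ^ (d - 1) * ?r 2 + ?r 2 ^ d = 0" using curve_rep(4)[OF assms] by simp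
  obtain n where n: "d = Suc n" using d4 by (cases d) auto
  have F: "(c * ?r 1) ^ d - (c * ?r 0) ^ (d - 1) * (c * ?r 2) + (c * ?r 2) ^ d = 0" for c
  proof -
    have "(c * ?r 1) ^ d - (c * ?r 0) ^ (d - 1) * (c * ?r 2) + (c * ?r 2) ^ d = c ^ d * (?r 1 ^ d - ?r 0 ^ (d - 1) * ?r 2 + ?r 2 ^ d)"
      unfolding n by (simp add: power_mult_distrib algebra_simps)
    then show ?thesis using e by simp
  qed
  have idx: "(0::nat) + 3 = 3" "(1::nat) + 3 = 4" "(2::nat) + 3 = 5" by auto
  show ?thesis
    unfolding image_eqs_def le2 idx vmap_simps by (intro conjI; (rule F | simp add: power_mult_distrib mult_ac))
qed

lemma image_eqs_solution:
  assumes q: "q \<in> proj_space 5" and e: "image_eqs (rep q)"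
  shows "q \<in> phi ` curve"
proof -
  let ?z = "rep q"
  have idx: "(0::nat) + 3 = 3" "(1::nat) + 3 = 4" "(2::nat) + 3 = 5" by auto
  have zq: "proj_point ?z = q" "\<exists>i. ?z i \<noteq> 0" "\<And>i. i > 5 \<Longrightarrow> ?z i = 0" using proj_space_rep[OF q] by blast+
  have Fu: "?z 1 ^ d - ?z 0 ^ (d - 1) * ?z 2 + ?z 2 ^ d = 0" and Fw: "?z 4 ^ d - ?z 3 ^ (d - 1) * ?z 5 + ?z 5 ^ d = 0"
    and pr: "\<And>i j. i \<le> 2 \<Longrightarrow> j \<le> 2 \<Longrightarrow> ?z i * ?z (j + 3) = ?z j * ?z (i + 3)"
    and ru: "\<And>j. j \<le> 2 \<Longrightarrow> ?z j * ?z 2 ^ (d - 3) = ?z (j + 3) * ?z 0 ^ (d - 3)"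
    and rw: "\<And>j. j \<le> 2 \<Longrightarrow> ?z j * ?z 5 ^ (d - 3) = ?z (j + 3) * ?z 3 ^ (d - 3)"
    using e unfolding image_eqs_def by blast+
  have d0: "(0::complex) ^ (d - 3) = 0" "(0::complex) ^ (d - 1) = 0" "(0::complex) ^ d = 0" using d4 by (auto simp: power_0_left)
  have cover: "proj_point (vmap v) = q" if c: "c \<noteq> 0" "\<And>i. i \<le> 2 \<Longrightarrow> vmap v i = c * ?z i" "\<And>i. i \<le> 2 \<Longrightarrow> vmap v (i + 3) = c * ?z (i + 3)" for v c
  proof -
    have "vmap v i = c * ?z i" for i
    proof -
      consider "i \<le> 2" | "i - 3 \<le> 2 \<and> i = i - 3 + 3" | "i > 5" by linarith
      then show ?thesis
      proof cases
        case 2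
        then show ?thesis using c(3)[of "i - 3"] by simp
      qed (use c zq vmap_simps(7) in auto)
    qed
    then show ?thesis using proj_point_eqI[OF c(1), of "vmap v" ?z] zq(1) by simp
  qed
  show ?thesis
  proof (cases "\<exists>i\<le>2. ?z i \<noteq> 0")
    case True
    let ?v = "\<lambda>i. if i \<le> 2 then ?z i else 0"
    have vC: "proj_point ?v \<in> curve" by (rule curveI) (use True Fu in auto)
    \<comment> \<open>If the first entry of u were 0, the ratio equations would force the third and
      the curve equation the second to vanish, so u would be zero.\<close>
    have z0: "?z 0 \<noteq> 0"
    proof
      assume z0: "?z 0 = 0"
      obtain j where j: "j \<le> 2" "?z j \<noteq> 0" using True by blast
      have "?z 2 = 0" using ru[OF j(1)] j(2) z0 d0 by simp
      moreover from this have "?z 1 = 0" using Fu z0 d0 by simp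
      ultimately show False using j z0 le2[of "\<lambda>j. ?z j = 0"] by auto
    qed
    have w: "?z (i + 3) * ?z 0 ^ (d - 3) = ?z i * ?z 2 ^ (d - 3)" if "i \<le> 2" for i using ru[OF that] by simp
    have "proj_point (vmap ?v) = q"
    proof (rule cover[of "?z 0 ^ (d - 3)"])
      show "?z 0 ^ (d - 3) \<noteq> 0" using z0 by simp
      show "vmap ?v i = ?z 0 ^ (d - 3) * ?z i" if "i \<le> 2" for i
        using that le2[of "\<lambda>i. vmap ?v i = ?z 0 ^ (d - 3) * ?z i"] by (simp add: vmap_simps)
      show "vmap ?v (i + 3) = ?z 0 ^ (d - 3) * ?z (i + 3)" if "i \<le> 2" for i
        using that le2[of "\<lambda>i. vmap ?v (i + 3) = ?z 0 ^ (d - 3) * ?z (i + 3)"] w[of 0] w[of 1] w[of 2]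
        unfolding idx by (simp add: vmap_simps mult.commute)
    qed
    then have "q = phi (proj_point ?v)" unfolding phi_proj_point by (rule sym)
    then show ?thesis using vC by (rule image_eqI)
  next
    case False
    \<comment> \<open>Now u = 0 and the point has to come from w. The ratio equations read off from
      w force its first entry to vanish.\<close>
    then have u: "?z 0 = 0" "?z 1 = 0" "?z 2 = 0" by auto
    obtain i where i: "?z i \<noteq> 0" using zq(2) by blast
    have "i > 2" using i False by (meson not_le)
    moreover have "i \<le> 5" using i zq(3) by (meson not_le)
    ultimately have "i - 3 \<le> 2" "i - 3 + 3 = i" by auto
    then obtain j where j: "j \<le> 2" "?z (j + 3) \<noteq> 0" using i that[of "i - 3"] by simp
    have "?z j = 0" using j(1) False by blast
    then have "?z 3 = 0" using rw[OF j(1)] j(2) by simp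
    have z5: "?z 5 \<noteq> 0"
    proof
      assume "?z 5 = 0"
      moreover from this have "?z 4 = 0" using Fw d0 by simp
      ultimately have "?z (j + 3) = 0" using j(1) \<open>?z 3 = 0\<close> le2[of "\<lambda>j. ?z (j + 3) = 0"] unfolding idx by auto
      then show False using j by blast
    qed
    let ?v = "\<lambda>i. if i \<le> 2 then ?z (i + 3) else 0"
    have v: "?v 0 = 0" "?v 1 = ?z 4" "?v 2 = ?z 5" using \<open>?z 3 = 0\<close> by simp_all
    have "proj_point ?v \<in> curve"
    proof (rule curveI)
      show "\<exists>i\<le>2. ?v i \<noteq> 0" by (intro exI[of _ 2]) (use z5 in simp)
      show "?v 1 ^ d - ?v 0 ^ (d - 1) * ?v 2 + ?v 2 ^ d = 0" unfolding v using Fw \<open>?z 3 = 0\<close> by simp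
    qed simp
    moreover have e: "proj_point (vmap ?v) = q"
    proof (rule cover[of "?z 5 ^ (d - 3)"])
      show "?z 5 ^ (d - 3) \<noteq> 0" using z5 by simp
      show "vmap ?v i = ?z 5 ^ (d - 3) * ?z i" if "i \<le> 2" for i
        using that le2[of "\<lambda>i. vmap ?v i = ?z 5 ^ (d - 3) * ?z i"] unfolding vmap_simps v u by (simp add: d0)
      show "vmap ?v (i + 3) = ?z 5 ^ (d - 3) * ?z (i + 3)" if "i \<le> 2" for i
        using that le2[of "\<lambda>i. vmap ?v (i + 3) = ?z 5 ^ (d - 3) * ?z (i + 3)"] \<open>?z 3 = 0\<close>
        unfolding idx vmap_simps v by simp
    qed
    moreover have "q = phi (proj_point ?v)" unfolding phi_proj_point by (rule e[symmetric])
    ultimately show ?thesis by (intro image_eqI)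
  qed
qed

lemma closed_image: "zariski_closed (phi ` curve)"
proof -
  have "phi ` curve = {q \<in> proj_space 5. \<forall>F\<in>image_forms. vanishes F q}"
  proof (intro equalityI subsetI)
    fix q assume "q \<in> phi ` curve"
    then obtain p where p: "p \<in> curve" "q = phi p" by blast
    obtain c where c: "c \<noteq> 0" "rep q = (\<lambda>n. c * vmap (rep p) n)" using rep_phi[of p] p(2) by metis
    have "image_eqs (rep q)" unfolding c(2) image_eqs_scale[OF c(1)] by (rule image_eqs_phi[OF p(1)])
    then show "q \<in> {q \<in> proj_space 5. \<forall>F\<in>image_forms. vanishes F q}"
      using phi_space[OF p(1)] p(2) image_forms_eqs by simp
  next
    fix q assume "q \<in> {q \<in> proj_space 5. \<forall>F\<in>image_forms. vanishes F q}"
    then show "q \<in> phi ` curve" using image_eqs_solution image_forms_eqs by blast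
  qed
  then show ?thesis unfolding zariski_closed_def
    by (intro exI[of _ 5] exI[of _ image_forms] conjI ballI image_forms_homogeneous)
qed

definition phi_forms :: "nat \<Rightarrow> mpoly" where
  "phi_forms n = (if n \<le> 5 then mform (six ! n) else 0)"

lemma phi_forms_eval: "peval (phi_forms n) r = vmap r n"
  by (cases "six ! n") (simp add: phi_forms_def vmap_def mform_def vm_def peval_gev gev_simps[OF rhom_id] gev_var[OF rhom_id])

lemma phi_forms_homogeneous: "homogeneous (d - 2) (phi_forms n)"
proof (cases "n \<le> 5")
  case True
  obtain j i where ji: "six ! n = (j, i)" by (cases "six ! n")
  have "i + j \<le> d - 2" using True ji d4 unfolding le5 by (auto simp: six_nth)
  then have "i + j + (d - 2 - i - j) = d - 2" by simp
  moreover have "homogeneous (i + j + (d - 2 - i - j)) (mform (j, i))"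
    unfolding mform_def by (auto intro!: homogeneous_mult homogeneous_var_power)
  ultimately have "homogeneous (d - 2) (mform (j, i))" by metis
  then show ?thesis using True ji by (simp add: phi_forms_def)
qed (simp add: phi_forms_def)

lemma morphism_phi: "morphism curve (phi ` curve) phi"
  unfolding morphism_def
proof (intro conjI ballI subset_refl)
  fix p assume p: "p \<in> curve"
  have "\<exists>n. \<not> vanishes (phi_forms n) p"
    using curve_rep(3)[OF p] unfolding vanishes_def phi_forms_eval
    by (elim disjE) (rule exI[of _ 0], simp add: vmap_simps, rule exI[of _ 5], simp add: vmap_simps)
  then show "\<exists>n F. (\<forall>i. homogeneous n (F i)) \<and> (\<exists>i. \<not> vanishes (F i) p) \<and>
      (\<forall>y\<in>curve. (\<exists>i. \<not> vanishes (F i) y) \<longrightarrow> phi y = proj_point (\<lambda>i. peval (F i) (rep y)))"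
    using phi_forms_homogeneous by (intro exI[of _ "d - 2"] exI[of _ phi_forms]) (simp add: phi_forms_eval phi_def)
qed

text \<open>The point is read off from whichever of the two blocks of three coordinates is nonzero;
  by \<open>phi_blocks\<close> they agree where both are.\<close>

definition psi :: "point \<Rightarrow> point" where
  "psi q = (if \<exists>i\<le>2. rep q i \<noteq> 0 then proj_point (vec3 (rep q 0) (rep q 1) (rep q 2))
     else proj_point (vec3 (rep q 3) (rep q 4) (rep q 5)))"

lemma phi_blocks:
  assumes p: "p \<in> curve"
  shows "(\<exists>i\<le>2. rep (phi p) i \<noteq> 0) \<Longrightarrow> proj_point (vec3 (rep (phi p) 0) (rep (phi p) 1) (rep (phi p) 2)) = p"
    "(\<exists>i\<le>2. rep (phi p) (i + 3) \<noteq> 0) \<Longrightarrow> proj_point (vec3 (rep (phi p) 3) (rep (phi p) 4) (rep (phi p) 5)) = p"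
    "(\<exists>i\<le>2. rep (phi p) i \<noteq> 0) \<or> (\<exists>i\<le>2. rep (phi p) (i + 3) \<noteq> 0)"
proof -
  obtain c where c: "c \<noteq> 0" "rep (phi p) = (\<lambda>n. c * vmap (rep p) n)" by (rule rep_phi)
  have idx: "(0::nat) + 3 = 3" "(1::nat) + 3 = 4" "(2::nat) + 3 = 5" by auto
  have ex2: "(\<exists>j\<le>2::nat. P j) \<longleftrightarrow> P 0 \<or> P 1 \<or> P 2" for P using le2[of "\<lambda>j. \<not> P j"] by blast
  have r3: "vec3 (rep p 0) (rep p 1) (rep p 2) = rep p" by (rule vec3_rep) (rule curve_rep(2)[OF p])
  have pp: "proj_point (vec3 (a * rep p 0) (a * rep p 1) (a * rep p 2)) = p" if "a \<noteq> 0" for a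
  proof -
    have "vec3 (a * rep p 0) (a * rep p 1) (a * rep p 2) = (\<lambda>i. a * rep p i)" unfolding vec3_scale[symmetric] r3 ..
    moreover have "proj_point (\<lambda>i. a * rep p i) = proj_point (rep p)"
      by (rule proj_point_eqI[of "inverse a"]) (use that in simp_all)
    ultimately show ?thesis using curve_rep(1)[OF p] by simp
  qed
  show "proj_point (vec3 (rep (phi p) 0) (rep (phi p) 1) (rep (phi p) 2)) = p" if "\<exists>i\<le>2. rep (phi p) i \<noteq> 0"
  proof -
    have "c * rep p 0 ^ (d - 3) \<noteq> 0" using that c unfolding ex2 c(2) vmap_simps by auto
    from pp[OF this] show ?thesis by (simp add: c(2) vmap_simps mult_ac)
  qed
  show "proj_point (vec3 (rep (phi p) 3) (rep (phi p) 4) (rep (phi p) 5)) = p" if "\<exists>i\<le>2. rep (phi p) (i + 3) \<noteq> 0"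
  proof -
    have "c * rep p 2 ^ (d - 3) \<noteq> 0" using that c unfolding ex2 idx c(2) vmap_simps by auto
    from pp[OF this] show ?thesis by (simp add: c(2) vmap_simps mult_ac)
  qed
  show "(\<exists>i\<le>2. rep (phi p) i \<noteq> 0) \<or> (\<exists>i\<le>2. rep (phi p) (i + 3) \<noteq> 0)"
    using curve_rep(3)[OF p] c(1) unfolding ex2 idx c(2) vmap_simps by auto
qed

lemma psi_phi: "p \<in> curve \<Longrightarrow> psi (phi p) = p"
  unfolding psi_def using phi_blocks[of p] by auto

lemma morphism_psi: "morphism (phi ` curve) curve psi"
  unfolding morphism_def
proof (intro conjI ballI)
  show "psi ` phi ` curve \<subseteq> curve" using psi_phi by auto
  fix q assume "q \<in> phi ` curve"
  then obtain p where p: "p \<in> curve" "q = phi p" by blast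
  \<comment> \<open>The charts \<open>F 0\<close> and \<open>F 3\<close> are the projections to the
    first and to the last three coordinates.\<close>
  define F where "F k n = (if n \<le> 2 then mvar (n + k) else 0)" for k n
  have hom: "homogeneous 1 (F k n)" for k n unfolding F_def using homogeneous_var by simp
  have ev: "peval (F k n) r = (if n \<le> 2 then r (n + k) else 0)" for k n r
    by (simp add: F_def peval_gev gev_var[OF rhom_id])
  have v: "(\<lambda>n. peval (F k n) r) = vec3 (r k) (r (1 + k)) (r (2 + k))" for k r
    unfolding ev vec3_def by (auto simp: fun_eq_iff le_Suc_eq numeral_2_eq_2 One_nat_def)
  have nv: "(\<exists>n. \<not> vanishes (F k n) y) \<longleftrightarrow> (\<exists>n\<le>2. rep y (n + k) \<noteq> 0)" for k y
    unfolding vanishes_def ev by auto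
  have chart0: "psi y = proj_point (\<lambda>n. peval (F 0 n) (rep y))" if y: "y \<in> phi ` curve" "\<exists>n. \<not> vanishes (F 0 n) y" for y
  proof -
    obtain p' where p': "p' \<in> curve" "y = phi p'" using y by blast
    have "\<exists>n\<le>2. rep (phi p') n \<noteq> 0" using y(2) nv[of 0 y] p'(2) by simp
    then show ?thesis unfolding v using phi_blocks(1)[OF p'(1)] psi_phi[OF p'(1)] p'(2) by simp
  qed
  have chart3: "psi y = proj_point (\<lambda>n. peval (F 3 n) (rep y))" if y: "y \<in> phi ` curve" "\<exists>n. \<not> vanishes (F 3 n) y" for y
  proof -
    obtain p' where p': "p' \<in> curve" "y = phi p'" using y by blast
    have "\<exists>n\<le>2. rep (phi p') (n + 3) \<noteq> 0" using y(2) nv[of 3 y] p'(2) by simp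
    then show ?thesis unfolding v using phi_blocks(2)[OF p'(1)] psi_phi[OF p'(1)] p'(2) by simp
  qed
  have "(\<exists>n. \<not> vanishes (F 0 n) q) \<or> (\<exists>n. \<not> vanishes (F 3 n) q)"
    using phi_blocks(3)[OF p(1)] unfolding nv p(2) by simp
  then show "\<exists>n G. (\<forall>i. homogeneous n (G i)) \<and> (\<exists>i. \<not> vanishes (G i) q) \<and>
      (\<forall>y\<in>phi ` curve. (\<exists>i. \<not> vanishes (G i) y) \<longrightarrow> psi y = proj_point (\<lambda>i. peval (G i) (rep y)))"
    using hom chart0 chart3 by blast
qed

lemma closed_embedding_phi: "closed_embedding curve 5 phi"
  unfolding closed_embedding_def using phi_space closed_image morphism_phi morphism_psi psi_phi by blast

section \<open>Sections of (d - 2) H and the bundle they generate\<close>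

definition LL :: "point \<Rightarrow> int" where "LL = Linf (int ((d - 2) * d))"

lemma mn_Mn: "x \<in> Tn n \<Longrightarrow> mn x \<in> Mn n"
proof -
  assume x: "x \<in> Tn n"
  have "(\<Sum>y\<in>Tn n. fls_const (if y = x then 1 else 0) * mn y) = (\<Sum>y\<in>Tn n. if y = x then mn y else 0)"
    by (rule sum.cong) auto
  also have "\<dots> = mn x" using x by simp
  finally have e: "mn x = (\<Sum>y\<in>Tn n. fls_const (if y = x then 1 else 0) * mn y)" by (rule sym)
  show ?thesis unfolding Mn_def
    by (rule CollectI, rule exI[of _ "\<lambda>y. if y = x then 1 else 0"], rule conjI[OF e TrueI])
qed

lemma six_Tn: "n \<le> 5 \<Longrightarrow> six ! n \<in> Tn (d - 2)"
  using d4 unfolding le5 by (auto simp: six_nth Tn_iff)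

text \<open>With m = d - 2, t = y/x and w = 1/x, the product x^i y^j t^(m d) is (x t^d)^m t^j
  w^(m-i-j), and x t^d = 1 - w^(d-1) takes the value 1 at infinity; so only i = m survives.\<close>

lemma mn_at_infp:
  assumes "(j, i) \<in> Tn (d - 2)"
  shows "rv infp (mn (j, i) * (ys / xs) ^ ((d - 2) * d)) (if i = d - 2 then 1 else 0)"
proof -
  let ?w = "inverse xs" and ?u = "ys / xs"
  have ij: "i + j \<le> d - 2" using assms Tn_iff by blast
  have dp: "z ^ d = z * z ^ (d - 1)" for z :: "complex fls" using d4 by (simp flip: power_Suc)
  have c: "ys ^ d = xs ^ (d - 1) - 1" using xs_power_eq by simp
  have k: "xs * ?u ^ d = 1 - ?w ^ (d - 1)"
    unfolding power_divide c dp[of xs] by (simp add: field_simps)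
  have m: "xs ^ (d - 2) = xs ^ i * xs ^ j * xs ^ (d - 2 - i - j)" 
  proof -
    have "d - 2 = i + j + (d - 2 - i - j)" using ij by simp
    then show ?thesis by (metis power_add)
  qed
  have "mn (j, i) * ?u ^ ((d - 2) * d) = (xs * ?u ^ d) ^ (d - 2) * (mn (j, i) / xs ^ (d - 2))"
    by (simp add: power_mult_distrib mult.commute[of "d - 2" d] power_mult)
  also have "mn (j, i) / xs ^ (d - 2) = ?u ^ j * ?w ^ (d - 2 - i - j)"
    unfolding m mn_def by (simp add: field_simps)
  finally have e: "mn (j, i) * ?u ^ ((d - 2) * d) = (1 - ?w ^ (d - 1)) ^ (d - 2) * (?u ^ j * ?w ^ (d - 2 - i - j))"
    unfolding k .
  have "rv infp ((1 - ?w ^ (d - 1)) ^ (d - 2) * (?u ^ j * ?w ^ (d - 2 - i - j))) ((1 - 0 ^ (d - 1)) ^ (d - 2) * (0 ^ j * 0 ^ (d - 2 - i - j)))"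
    by (intro rv_mult rv_power rv_diff rv_1 rv_infp_inv_xs rv_infp_ys_xs infp_curve)
  moreover have "(1 - 0 ^ (d - 1)) ^ (d - 2) * (0 ^ j * 0 ^ (d - 2 - i - j)) = (if i = d - 2 then 1 else (0::complex))"
    using ij d4 by (auto simp: power_0_left)
  ultimately show ?thesis unfolding e by simp
qed

lemma very_ample_LL: "very_ample curve LL"
  unfolding very_ample_def
proof (rule exI[of _ 5], rule exI[of _ phi], rule exI[of _ "\<lambda>n. gm (mn (six ! n))"], intro conjI allI impI ballI)
  let ?s = "\<lambda>n. gm (mn (six ! n))"
  show "closed_embedding curve 5 phi" by (rule closed_embedding_phi)
  show "?s n \<in> sections curve LL" if "n \<le> 5" for n
    unfolding LL_def using sections_Linf[of "d - 2"] d4 mn_Mn[OF six_Tn[OF that]] by simp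
  fix p assume p: "p \<in> curve"
  show "\<exists>t. uniformizer curve p t \<and>
     phi p = proj_point (\<lambda>i. if i \<le> 5 then value_at curve p (?s i \<otimes>\<^bsub>FF\<^esub> t [^]\<^bsub>FF\<^esub> LL p) else 0)"
    using p
  proof (cases rule: curve_cases)
    case 1
    have tK: "ys / xs \<in> KK" "ys / xs \<noteq> 0" using KK_divide KK_ys KK_xs by auto
    have six: "(if n \<le> 5 then value_at curve p (?s n \<otimes>\<^bsub>FF\<^esub> gm (ys / xs) [^]\<^bsub>FF\<^esub> LL p) else 0) = vmap (vec3 1 0 0) n" for n
    proof (cases "n \<le> 5")
      case True
      obtain j i where ji: "six ! n = (j, i)" by (cases "six ! n")
      have "?s n \<otimes>\<^bsub>FF\<^esub> gm (ys / xs) [^]\<^bsub>FF\<^esub> LL p = gm (mn (j, i) * (ys / xs) powi LL p)"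
        using gm_powi[OF tK] gm_mult[OF mn_KK KK_powi[OF tK(1)]] ji by simp
      also have "(ys / xs) powi LL p = (ys / xs) ^ ((d - 2) * d)"
        unfolding 1 LL_def Linf_def by (simp only: if_True simp_thms power_int_of_nat)
      finally have "value_at curve p (?s n \<otimes>\<^bsub>FF\<^esub> gm (ys / xs) [^]\<^bsub>FF\<^esub> LL p) = (if i = d - 2 then 1 else 0)"
        using value_at_gm[OF mn_at_infp[of j i]] six_Tn[OF True] ji 1 by simp
      moreover have "vmap (vec3 1 0 0) n = (if i = d - 2 then 1 else 0)"
        using six_Tn[OF True] True ji by (auto simp: vmap_def vm_def Tn_iff power_0_left)
      ultimately show ?thesis using True by simp
    qed (simp add: vmap_def)
    have "phi p = proj_point (vmap (vec3 1 0 0))" unfolding 1 infp_def by (rule phi_proj_point)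
    then show ?thesis using uniformizer_gm[OF tK(1) p] lunif_infp 1 six by (intro exI[of _ "gm (ys / xs)"]) simp
  next
    case (2 a b)
    obtain t where t: "lunif p t" using lunif_exists[OF p] by blast
    note tK = rv_KK[OF lunif_rv[OF t]]
    have L0: "LL p = 0" unfolding 2 LL_def Linf_def by simp
    have six: "(if n \<le> 5 then value_at curve p (?s n \<otimes>\<^bsub>FF\<^esub> gm t [^]\<^bsub>FF\<^esub> LL p) else 0) = vmap (vec3 a b 1) n" for n
    proof (cases "n \<le> 5")
      case True
      obtain j i where ji: "six ! n = (j, i)" by (cases "six ! n")
      have "?s n \<otimes>\<^bsub>FF\<^esub> gm t [^]\<^bsub>FF\<^esub> LL p = gm (mn (j, i) * t powi LL p)"
        using gm_powi[OF tK lunif_nz[OF t]] gm_mult[OF mn_KK KK_powi[OF tK]] ji by simp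
      also have "\<dots> = gm (mn (j, i))" unfolding L0 by simp
      also have "value_at curve p \<dots> = a ^ i * b ^ j"
        unfolding 2(1) mn_def by (rule value_at_gm) (auto intro!: rv_mult rv_power rv_xs rv_ys 2)
      finally show ?thesis using True ji by (simp add: vmap_def vm_def)
    qed (simp add: vmap_def)
    have "phi p = proj_point (vmap (vec3 a b 1))" unfolding 2 pt_def by (rule phi_proj_point)
    then show ?thesis using uniformizer_gm[OF tK p] t six by (intro exI[of _ "gm t"]) simp
  qed
qed

text \<open>The section 1 generates on the affine part, and x^(d-2), with the largest admissible
  pole, at infinity.\<close>

lemma globally_generated_LL: "globally_generated curve LL"
  unfolding globally_generated_def
proof
  fix p assume p: "p \<in> curve"
  have sec: "gm (mn x) \<in> sections curve LL" if "x \<in> Tn (d - 2)" for x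
    unfolding LL_def using sections_Linf[of "d - 2"] d4 mn_Mn[OF that] by simp
  have nz: "gm (mn x) \<noteq> \<zero>\<^bsub>FF\<^esub>" for x using gm_eq_iff[OF mn_KK KK_0] gm_0 by simp
  show "\<exists>s\<in>sections curve LL. s \<noteq> \<zero>\<^bsub>FF\<^esub> \<and> order_at curve p s = - LL p"
    using p
  proof (cases rule: curve_cases)
    case 1
    have "ord infp (mn (0, d - 2)) = - int (wt (0, d - 2))" using ord_infp[OF mn_KK] subdegree_mn by simp
    then have "order_at curve p (gm (mn (0, d - 2))) = - LL p"
      using order_at_gm[OF p mn_KK] 1 by (simp add: LL_def Linf_def wt_def mult.commute)
    moreover have "(0, d - 2) \<in> Tn (d - 2)" by (simp add: Tn_iff)
    ultimately show ?thesis using sec nz by blast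
  next
    case (2 a b)
    have m: "mn (0, 0) = 1" by (simp add: mn_def)
    have "order_at curve p (gm (mn (0, 0))) = - LL p"
      using order_at_gm[OF p KK_1] ord_unit[OF rv_1[OF p]] 2(1) unfolding m by (simp add: LL_def Linf_def)
    moreover have "(0, 0) \<in> Tn (d - 2)" by (simp add: Tn_iff)
    ultimately show ?thesis using sec nz by blast
  qed
qed

lemma divisor_LL: "divisor curve LL" and degree_LL: "divisor_degree LL = int ((d - 2) * d)"
proof -
  show "divisor curve LL" unfolding LL_def by (rule divisor_Linf)
  have "int ((d - 2) * d) \<noteq> 0" using d4 by simp
  then have "{p. LL p \<noteq> 0} = {infp}" unfolding LL_def Linf_def by auto
  then show "divisor_degree LL = int ((d - 2) * d)" unfolding divisor_degree_def by (simp add: LL_def Linf_def)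
qed

lemma h0_LL: "h0 curve LL = (d - 1) * d div 2"
proof -
  have "h0 curve LL = (d - 2 + 1) * (d - 2 + 2) div 2" unfolding LL_def by (rule h0_Linf) simp
  moreover have "d - 2 + 1 = d - 1" "d - 2 + 2 = d" using d4 by auto
  ultimately show ?thesis by (simp only:)
qed

end

section \<open>Finite extensions\<close>

context plane_curve
begin

definition lcs :: "complex fls set \<Rightarrow> 'b set \<Rightarrow> ('b \<Rightarrow> complex fls) \<Rightarrow> complex fls set" where
  "lcs K I u = {\<Sum>b\<in>I. k b * u b | k. \<forall>b\<in>I. k b \<in> K}"

lemma lcsI: "(\<And>b. b \<in> I \<Longrightarrow> k b \<in> K) \<Longrightarrow> (\<Sum>b\<in>I. k b * u b) \<in> lcs K I u"
  unfolding lcs_def by blast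

lemma lcsE:
  assumes "s \<in> lcs K I u"
  obtains k where "\<And>b. b \<in> I \<Longrightarrow> k b \<in> K" "s = (\<Sum>b\<in>I. k b * u b)"
  using assms unfolding lcs_def by blast

lemma lcs_lincomb:
  fixes I :: "'b set" and u :: "'b \<Rightarrow> complex fls"
  assumes "finite I"
  obtains u' where "lcs K I u = lincomb K (card I) u'" "\<And>i. i < card I \<Longrightarrow> u' i \<in> u ` I"
proof -
  obtain en where en: "bij_betw en {..<card I} I"
    using ex_bij_betw_nat_finite[OF assms] by (auto simp: atLeast0LessThan)
  have reidx: "(\<Sum>i<card I. f (en i)) = sum f I" for f :: "'b \<Rightarrow> complex fls"
    by (rule sum.reindex_bij_betw[OF en])
  have enI: "en i \<in> I" if "i < card I" for i using bij_betwE[OF en] that by auto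
  let ?g = "inv_into {..<card I} en"
  have g: "?g (en i) = i" if "i < card I" for i
    using en that by (simp add: bij_betw_def inv_into_f_f)
  show thesis
  proof (rule that)
    show "lcs K I u = lincomb K (card I) (\<lambda>i. u (en i))"
    proof (intro equalityI subsetI)
      fix s assume "s \<in> lcs K I u"
      then obtain k where k: "\<And>b. b \<in> I \<Longrightarrow> k b \<in> K" "s = (\<Sum>b\<in>I. k b * u b)" by (rule lcsE) blast
      have s: "s = (\<Sum>i<card I. k (en i) * u (en i))" unfolding k(2) by (rule reidx[symmetric])
      show "s \<in> lincomb K (card I) (\<lambda>i. u (en i))" unfolding lincomb_def
        by (rule CollectI, rule exI[of _ "\<lambda>i. k (en i)"], rule conjI[OF s]) (use k(1) enI in blast)
    next
      fix s assume "s \<in> lincomb K (card I) (\<lambda>i. u (en i))"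
      then obtain k where k: "\<forall>i<card I. k i \<in> K" "s = (\<Sum>i<card I. k i * u (en i))" unfolding lincomb_def by blast
      have "s = (\<Sum>i<card I. k (?g (en i)) * u (en i))" unfolding k(2) by (rule sum.cong) (auto simp: g)
      also have "\<dots> = (\<Sum>b\<in>I. k (?g b) * u b)" by (rule reidx)
      also have "\<dots> \<in> lcs K I u"
      proof (rule lcsI)
        fix b assume "b \<in> I"
        then obtain i where "i < card I" "b = en i" using en by (auto simp: bij_betw_def)
        then show "k (?g b) \<in> K" using k(1) g by simp
      qed
      finally show "s \<in> lcs K I u" .
    qed
    show "u (en i) \<in> u ` I" if "i < card I" for i using enI[OF that] by blast
  qed
qed

context
  fixes K :: "complex fls set" and I :: "'b set" and u :: "'b \<Rightarrow> complex fls"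
  assumes K: "subfld K" and I: "finite I"
begin

lemma lcs_add: "s \<in> lcs K I u \<Longrightarrow> s' \<in> lcs K I u \<Longrightarrow> s + s' \<in> lcs K I u"
proof -
  assume "s \<in> lcs K I u" "s' \<in> lcs K I u"
  then obtain k k' where k: "\<forall>b\<in>I. k b \<in> K" "s = (\<Sum>b\<in>I. k b * u b)"
    "\<forall>b\<in>I. k' b \<in> K" "s' = (\<Sum>b\<in>I. k' b * u b)" unfolding lcs_def by blast
  have e: "s + s' = (\<Sum>b\<in>I. (k b + k' b) * u b)" unfolding k by (simp add: sum.distrib algebra_simps)
  show ?thesis unfolding e by (rule lcsI) (use k subfldD(4)[OF K] in blast)
qed

lemma lcs_smult: "a \<in> K \<Longrightarrow> s \<in> lcs K I u \<Longrightarrow> a * s \<in> lcs K I u"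
proof -
  assume a: "a \<in> K" and s: "s \<in> lcs K I u"
  from s obtain k where k: "\<And>b. b \<in> I \<Longrightarrow> k b \<in> K" "s = (\<Sum>b\<in>I. k b * u b)" by (rule lcsE) blast
  have e: "a * s = (\<Sum>b\<in>I. (a * k b) * u b)" unfolding k by (simp add: sum_distrib_left mult.assoc)
  show ?thesis unfolding e by (rule lcsI) (use k a subfldD(5)[OF K] in blast)
qed

lemma lcs_0: "0 \<in> lcs K I u"
proof -
  have "(\<Sum>b\<in>I. 0 * u b) \<in> lcs K I u" by (rule lcsI) (rule subfldD(3)[OF K])
  then show ?thesis by simp
qed

lemma lcs_sum: "(\<And>x. x \<in> S \<Longrightarrow> f x \<in> lcs K I u) \<Longrightarrow> sum f S \<in> lcs K I u"
  by (induction S rule: infinite_finite_induct) (auto intro: lcs_0 lcs_add)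

lemma lcs_base: "b \<in> I \<Longrightarrow> u b \<in> lcs K I u"
proof -
  assume b: "b \<in> I"
  have "(\<Sum>x\<in>I. (if x = b then 1 else 0) * u x) \<in> lcs K I u"
    by (rule lcsI) (simp add: subfldD[OF K])
  moreover have "(\<Sum>x\<in>I. (if x = b then 1 else 0) * u x) = (\<Sum>x\<in>I. if x = b then u x else 0)"
    by (rule sum.cong) auto
  ultimately show ?thesis using b I by simp
qed

lemma lcs_mult_closed:
  assumes "\<And>b. b \<in> I \<Longrightarrow> g * u b \<in> lcs K I u" "s \<in> lcs K I u"
  shows "g * s \<in> lcs K I u"
proof -
  obtain k where k: "\<And>b. b \<in> I \<Longrightarrow> k b \<in> K" "s = (\<Sum>b\<in>I. k b * u b)" using assms(2) by (rule lcsE) blast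
  have e: "g * s = (\<Sum>b\<in>I. k b * (g * u b))" unfolding k by (simp add: sum_distrib_left mult_ac)
  show ?thesis unfolding e by (intro lcs_sum lcs_smult k assms(1))
qed

end

text \<open>The span contains 1 and is stable under x and y, hence under the coordinate ring. Powers
  of a nonzero f in that ring are dependent over K, so 1/f is a polynomial in f over K and preserves
  the span as well; as denominators can be cleared, the span is the whole field.\<close>

lemma finite_extension_generators:
  fixes I :: "'b set"
  assumes K: "subfld K" "CC \<subseteq> K" and I: "finite I" and u: "\<And>b. b \<in> I \<Longrightarrow> u b \<in> KK" and one: "1 \<in> lcs K I u"
    and x: "\<And>b. b \<in> I \<Longrightarrow> xs * u b \<in> lcs K I u" and y: "\<And>b. b \<in> I \<Longrightarrow> ys * u b \<in> lcs K I u"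
  shows "\<exists>m\<le>card I. ring.dimension FF m (gm ` K) (gm ` KK)"
proof -
  let ?S = "lcs K I u"
  note sa = lcs_add[OF K(1) I] and sm = lcs_smult[OF K(1) I] and ss = lcs_sum[OF K(1) I]
  have mx: "xs * s \<in> ?S" and my: "ys * s \<in> ?S" if "s \<in> ?S" for s
    using lcs_mult_closed[OF K(1) I _ that] x y by blast+
  have pw: "xs ^ i * ys ^ j * s \<in> ?S" if "s \<in> ?S" for i j s
  proof (induction i)
    case 0
    show ?case by (induction j) (auto simp: that mult.assoc intro: my)
  qed (auto simp: mult.assoc intro: mx)
  have A: "a * s \<in> ?S" if a: "a \<in> Acoord" and s: "s \<in> ?S" for a s
  proof -
    obtain p where p: "a = nf p" using a by (auto simp: Acoord_def)
    have e: "a * s = (\<Sum>j<d. \<Sum>i\<le>degree (p j). fls_const (coeff (p j) i) * (xs ^ i * ys ^ j * s))"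
      unfolding p nf_def PE_altdef sum_distrib_right by (simp add: mult_ac)
    show ?thesis unfolding e by (intro ss sm pw s) (use K(2) in auto)
  qed
  obtain u' where u': "?S = lincomb K (card I) u'" "\<And>i. i < card I \<Longrightarrow> u' i \<in> u ` I"
    by (rule lcs_lincomb[OF I, of K u]) blast
  have u'K: "u' i \<in> KK" if "i < card I" for i using u'(2)[OF that] u by auto
  obtain m where m: "m \<le> card I" "ring.dimension FF m (gm ` K) (gm ` ?S)"
  proof -
    have "\<exists>m\<le>card I. ring.dimension FF m (gm ` K) (gm ` lincomb K (card I) u')"
      by (rule dimension_spanning[OF K(1)]) (rule u'K)
    then show thesis using that unfolding u'(1) by auto
  qed
  have SK: "?S \<subseteq> KK"
  proof
    fix s assume "s \<in> ?S"
    then obtain k where k: "\<And>b. b \<in> I \<Longrightarrow> k b \<in> K" "s = (\<Sum>b\<in>I. k b * u b)" by (rule lcsE) blast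
    show "s \<in> KK" unfolding k(2) by (intro KK_sum KK_mult u) (use k(1) subfldD(1)[OF K(1)] in blast)+
  qed
  have inv: "inverse f * s \<in> ?S" if f: "f \<in> Acoord" "f \<noteq> 0" and s: "s \<in> ?S" for f s
  proof -
    have fS: "f ^ i * s \<in> ?S" if "s \<in> ?S" for i s by (rule A) (use f that Acoord_closed(5) in auto)
    obtain k where k: "\<And>i. i \<le> m \<Longrightarrow> k i \<in> K" "\<exists>i\<le>m. k i \<noteq> 0" "(\<Sum>i\<le>m. k i * (f ^ i * 1)) = 0"
      by (rule dependence[OF K(1) m(2) SK, of "\<lambda>i. f ^ i * 1"]) (use fS[OF one] in simp, blast)
    \<comment> \<open>Dividing the relation by the lowest power of f that occurs leaves a nonzero
      term from K, from which 1/f is solved.\<close>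
    define i0 where "i0 = (LEAST i. i \<le> m \<and> k i \<noteq> 0)"
    have i0: "i0 \<le> m" "k i0 \<noteq> 0" using LeastI_ex[OF k(2)] unfolding i0_def by auto
    have low: "k i = 0" if "i < i0" for i using not_less_Least[of i "\<lambda>i. i \<le> m \<and> k i \<noteq> 0"] that i0(1) unfolding i0_def by auto
    let ?T = "\<Sum>i\<in>{i0<..m}. k i * f ^ (i - Suc i0)"
    have "(\<Sum>i\<le>m. k i * f ^ i) = (\<Sum>i\<in>{i0..m}. k i * f ^ i)"
      by (rule sum.mono_neutral_right) (auto simp: low)
    also have "\<dots> = k i0 * f ^ i0 + (\<Sum>i\<in>{i0<..m}. k i * f ^ i)"
      using i0(1) by (simp add: sum.head)
    also have "(\<Sum>i\<in>{i0<..m}. k i * f ^ i) = f ^ i0 * (f * ?T)"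
      unfolding sum_distrib_left
    proof (rule sum.cong)
      fix i assume "i \<in> {i0<..m}"
      then have "f ^ i = f ^ (i0 + Suc (i - Suc i0))" by simp
      then show "k i * f ^ i = f ^ i0 * (f * (k i * f ^ (i - Suc i0)))" by (simp only: power_add power_Suc) (simp add: mult_ac)
    qed simp
    finally have "f ^ i0 * (k i0 + f * ?T) = 0" using k(3) by (simp add: algebra_simps)
    then have "f * ?T = - k i0" using f(2) by (simp add: eq_neg_iff_add_eq_0 add.commute)
    then have "inverse f = - inverse (k i0) * ?T" using f(2) i0(2) by (simp add: field_simps)
    then have e: "inverse f * s = (\<Sum>i\<in>{i0<..m}. (- inverse (k i0) * k i) * (f ^ (i - Suc i0) * s))"
      by (simp add: sum_distrib_left sum_distrib_right mult_ac)
    show ?thesis unfolding e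
      by (intro ss sm fS s subfldD(5,6,7)[OF K(1)] k(1)) (use i0 in auto)
  qed
  have "KK \<subseteq> ?S"
  proof
    fix e assume "e \<in> KK"
    then obtain c where c: "c \<noteq> 0" "e * PE xs c \<in> Acoord" by (rule KK_denominator)
    have nz: "PE xs c \<noteq> 0" using PE_xs_subdegree[OF c(1)] by blast
    have "inverse (PE xs c) * ((e * PE xs c) * 1) \<in> ?S"
      by (intro inv A c one Acoord_closed nz)
    then show "e \<in> ?S" using nz by (simp add: mult_ac)
  qed
  then have "?S = KK" using SK by blast
  then show ?thesis using m by auto
qed

section \<open>The subfields C(h)\<close>

definition Ch :: "complex fls \<Rightarrow> complex fls set" where
  "Ch h = {PE h P / PE h Q | P Q. PE h Q \<noteq> 0}"

lemma ChI: "PE h Q \<noteq> 0 \<Longrightarrow> PE h P / PE h Q \<in> Ch h"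
  unfolding Ch_def by blast

lemma PE_Ch: "PE h P \<in> Ch h"
  using ChI[of h "[:1:]" P] by simp

lemma subfld_Ch:
  assumes "h \<in> KK"
  shows "subfld (Ch h)" "CC \<subseteq> Ch h" "h \<in> Ch h"
proof -
  show "CC \<subseteq> Ch h" using PE_Ch[of h "[:_:]"] by auto
  show "h \<in> Ch h" using PE_Ch[of h "[:0, 1:]"] by (simp add: PE_pCons)
  show "subfld (Ch h)" unfolding subfld_def
  proof (intro conjI ballI)
    show "Ch h \<subseteq> KK" unfolding Ch_def using KK_divide KK_PE assms by blast
    show "1 \<in> Ch h" using PE_Ch[of h 1] by (simp add: PE_simps)
    fix a assume "a \<in> Ch h"
    then obtain P Q where a: "a = PE h P / PE h Q" "PE h Q \<noteq> 0" unfolding Ch_def by blast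
    show "- a \<in> Ch h" using ChI[OF a(2), of "- P"] by (simp add: a PE_simps)
    show "inverse a \<in> Ch h"
    proof (cases "PE h P = 0")
      case True
      then show ?thesis using PE_Ch[of h 0] by (simp add: a)
    next
      case False
      then show ?thesis using ChI[OF False, of Q] by (simp add: a)
    qed
    fix b assume "b \<in> Ch h"
    then obtain P' Q' where b: "b = PE h P' / PE h Q'" "PE h Q' \<noteq> 0" unfolding Ch_def by blast
    have Q: "PE h (Q * Q') \<noteq> 0" using a b by (simp add: PE_simps)
    show "a + b \<in> Ch h" using ChI[OF Q, of "P * Q' + P' * Q"] a b by (simp add: PE_simps add_frac_eq)
    show "a * b \<in> Ch h" using ChI[OF Q, of "P * P'"] a b by (simp add: PE_simps)
  qed
qed

lemma clear_denominators:
  assumes "\<And>i. i \<le> m \<Longrightarrow> k i \<in> Ch h"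
  obtains P q where "PE h q \<noteq> 0" "\<And>i. i \<le> (m::nat) \<Longrightarrow> k i * PE h q = PE h (P i)"
proof -
  have "\<forall>i. \<exists>P Q. i \<le> m \<longrightarrow> k i = PE h P / PE h Q \<and> PE h Q \<noteq> 0" using assms unfolding Ch_def by blast
  then obtain P Q where PQ: "\<And>i. i \<le> m \<Longrightarrow> k i = PE h (P i) / PE h (Q i) \<and> PE h (Q i) \<noteq> 0" by metis
  show thesis
  proof (rule that)
    show "PE h (\<Prod>i\<le>m. Q i) \<noteq> 0" using PQ by (simp add: PE_simps)
    fix i assume i: "i \<le> m"
    have "(\<Prod>j\<le>m. Q j) = Q i * (\<Prod>j\<in>{..m}-{i}. Q j)" using i by (simp add: prod.remove)
    then show "k i * PE h (\<Prod>i\<le>m. Q i) = PE h (P i * (\<Prod>j\<in>{..m}-{i}. Q j))"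
      using PQ[OF i] by (simp add: PE_simps)
  qed
qed

lemma PE_transcendental:
  assumes "h \<notin> CC" "PE h P = 0"
  shows "P = 0"
  using assms(2)
proof (induction "degree P" arbitrary: P)
  case 0
  then show ?case by (metis PE_const degree_eq_zeroE fls_const_eq_0_iff pCons_0_0)
next
  case (Suc n)
  then have "\<not> constant (poly P)" by (simp add: constant_degree)
  then obtain z where "poly P z = 0" using fundamental_theorem_of_algebra by blast
  then obtain r where r: "P = [:- z, 1:] * r" by (auto simp: poly_eq_0_iff_dvd)
  have "h - fls_const z \<noteq> 0" using assms(1) by auto
  then have "PE h r = 0" using Suc.prems unfolding r PE_mult PE_linear by simp
  moreover have "r \<noteq> 0 \<Longrightarrow> degree r = n" using r Suc.hyps(2) by (auto simp: degree_mult_eq simp del: mult_pCons_left)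
  ultimately have "r = 0" using Suc.hyps(1) by blast
  then show ?case using r by simp
qed

lemma dimension_over_Cx: "\<exists>m. ring.dimension FF m (gm ` Ch xs) (gm ` KK)"
proof -
  note K = subfld_Ch[OF KK_xs]
  let ?S = "lcs (Ch xs) {..<d} (\<lambda>j. ys ^ j)"
  have b: "ys ^ j \<in> ?S" if "j < d" for j using lcs_base[OF K(1), of "{..<d}" j "\<lambda>j. ys ^ j"] that by simp
  have one: "1 \<in> ?S" using b[of 0] d4 by simp
  have "\<exists>m\<le>card {..<d}. ring.dimension FF m (gm ` Ch xs) (gm ` KK)"
  proof (rule finite_extension_generators[OF K(1,2) _ _ one])
    show "ys ^ j \<in> KK" for j by (intro KK_power KK_ys)
    show "xs * ys ^ j \<in> ?S" if "j \<in> {..<d}" for j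
      by (rule lcs_smult[OF K(1)]) (use K(3) b that in auto)
    show "ys * ys ^ j \<in> ?S" if j: "j \<in> {..<d}" for j
    proof (cases "Suc j < d")
      case True
      then show ?thesis using b[of "Suc j"] by simp
    next
      case False
      then have "Suc j = d" using j by auto
      then have "ys * ys ^ j = (xs ^ (d - 1) - 1) * 1" using xs_power_eq by (metis add_diff_cancel_right' mult.right_neutral power_Suc)
      moreover have "xs ^ (d - 1) - 1 \<in> Ch xs" by (intro subfldD(9)[OF K(1)] subfldD(11)[OF K(1)] subfldD(2)[OF K(1)] K(3))
      ultimately show ?thesis using lcs_smult[OF K(1) _ _ one] by simp
    qed
  qed simp
  then show ?thesis by blast
qed

text \<open>The equation x^(d-1) = y^d + 1 makes the powers of x below d - 1 a spanning set.
  Equality follows later from \<open>dimension_lower_bound\<close>.\<close>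

lemma dimension_over_Cy: "\<exists>m\<le>d - 1. ring.dimension FF m (gm ` Ch ys) (gm ` KK)"
proof -
  note K = subfld_Ch[OF KK_ys]
  let ?S = "lcs (Ch ys) {..<d-1} (\<lambda>j. xs ^ j)"
  have b: "xs ^ j \<in> ?S" if "j < d - 1" for j using lcs_base[OF K(1), of "{..<d-1}" j "\<lambda>j. xs ^ j"] that by simp
  have one: "1 \<in> ?S" using b[of 0] d4 by simp
  have "\<exists>m\<le>card {..<d-1}. ring.dimension FF m (gm ` Ch ys) (gm ` KK)"
  proof (rule finite_extension_generators[OF K(1,2) _ _ one])
    show "xs ^ j \<in> KK" for j by (intro KK_power KK_xs)
    show "ys * xs ^ j \<in> ?S" if "j \<in> {..<d-1}" for j
      by (rule lcs_smult[OF K(1)]) (use K(3) b that in auto)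
    show "xs * xs ^ j \<in> ?S" if j: "j \<in> {..<d-1}" for j
    proof (cases "Suc j < d - 1")
      case True
      then show ?thesis using b[of "Suc j"] by simp
    next
      case False
      then have "Suc j = d - 1" using j by auto
      then have "xs * xs ^ j = (ys ^ d + 1) * 1" using xs_power_eq by (metis mult.right_neutral power_Suc)
      moreover have "ys ^ d + 1 \<in> Ch ys" by (intro subfldD(4)[OF K(1)] subfldD(11)[OF K(1)] subfldD(2)[OF K(1)] K(3))
      ultimately show ?thesis using lcs_smult[OF K(1) _ _ one] by simp
    qed
  qed simp
  then show ?thesis by simp
qed

text \<open>A relation between \<open>h\<close> and \<open>xs\<close>, polynomial in both, is read as an equation for \<open>xs\<close> over \<open>Ch h\<close>.\<close>

lemma xs_algebraic:
  assumes h: "h \<in> KK" "h \<notin> CC"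
  obtains n c where "n > 0" "\<And>i. i < n \<Longrightarrow> c i \<in> Ch h" "xs ^ n = (\<Sum>i<n. c i * xs ^ i)"
proof -
  note K = subfld_Ch[OF KK_xs] and Kh = subfld_Ch[OF h(1)]
  obtain m where m: "ring.dimension FF m (gm ` Ch xs) (gm ` KK)" using dimension_over_Cx by blast
  obtain k where k: "\<And>i. i \<le> m \<Longrightarrow> k i \<in> Ch xs" "\<exists>i\<le>m. k i \<noteq> 0" "(\<Sum>i\<le>m. k i * h ^ i) = 0"
    by (rule dependence[OF K(1) m subset_refl, of "\<lambda>i. h ^ i"]) (use KK_power[OF h(1)] in auto)
  obtain P q where P: "PE xs q \<noteq> 0" "\<And>i. i \<le> m \<Longrightarrow> k i * PE xs q = PE xs (P i)"
    by (rule clear_denominators[of m k xs, OF k(1)]) blast+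
  obtain i0 where i0: "i0 \<le> m" "P i0 \<noteq> 0" using k(2) P by (metis PE_0 mult_eq_0_iff)
  have "(\<Sum>i\<le>m. PE xs (P i) * h ^ i) = (\<Sum>i\<le>m. (k i * PE xs q) * h ^ i)" using P(2) by (intro sum.cong) auto
  also have "\<dots> = PE xs q * (\<Sum>i\<le>m. k i * h ^ i)" by (simp add: sum_distrib_left mult_ac)
  finally have rel: "(\<Sum>i\<le>m. PE xs (P i) * h ^ i) = 0" using k(3) by simp
  define N where "N = Max ((\<lambda>i. degree (P i)) ` {..m})"
  have N: "degree (P i) \<le> N" if "i \<le> m" for i unfolding N_def using that by (intro Max_ge) auto
  \<comment> \<open>\<open>R k\<close>, evaluated at h, is the coefficient of x^k when the relation
    is ordered by powers of x.\<close>
  define R where "R k = (\<Sum>i\<le>m. monom (coeff (P i) k) i)" for k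
  have PER: "PE h (R k) = (\<Sum>i\<le>m. fls_const (coeff (P i) k) * h ^ i)" for k
  proof -
    have "PE h (monom a i) = fls_const a * h ^ i" for a i
      using PE_smult[of h a "monom 1 i"] PE_monom[of h i] by (simp add: smult_monom)
    then show ?thesis unfolding R_def by (simp add: PE_simps)
  qed
  have "(\<Sum>k\<le>N. PE h (R k) * xs ^ k) = (\<Sum>i\<le>m. (\<Sum>k\<le>N. fls_const (coeff (P i) k) * xs ^ k) * h ^ i)"
    unfolding PER sum_distrib_right by (subst sum.swap) (simp add: mult_ac)
  also have "\<dots> = (\<Sum>i\<le>m. PE xs (P i) * h ^ i)"
  proof (rule sum.cong)
    fix i assume "i \<in> {..m}"
    then have "PE xs (P i) = (\<Sum>k\<le>N. fls_const (coeff (P i) k) * xs ^ k)"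
      unfolding PE_altdef using N[of i] by (intro sum.mono_neutral_left) (auto simp: coeff_eq_0)
    then show "(\<Sum>k\<le>N. fls_const (coeff (P i) k) * xs ^ k) * h ^ i = PE xs (P i) * h ^ i" by simp
  qed simp
  finally have rel': "(\<Sum>k\<le>N. PE h (R k) * xs ^ k) = 0" using rel by simp
  have coR: "coeff (R k) i = (if i \<le> m then coeff (P i) k else 0)" for k i
    unfolding R_def by (simp add: coeff_sum)
  have exk: "\<exists>k\<le>N. R k \<noteq> 0"
  proof -
    have "coeff (R (degree (P i0))) i0 \<noteq> 0" unfolding coR using i0 by simp
    then show ?thesis using N[OF i0(1)] by (metis coeff_0)
  qed
  define n where "n = Max {k. k \<le> N \<and> R k \<noteq> 0}"
  have fin: "finite {k. k \<le> N \<and> R k \<noteq> 0}" by simp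
  have n: "n \<le> N" "R n \<noteq> 0" using Max_in[OF fin] exk unfolding n_def by auto
  have top: "R k = 0" if "k \<le> N" "n < k" for k
  proof (rule ccontr)
    assume "R k \<noteq> 0"
    then have "k \<le> n" unfolding n_def by (intro Max_ge[OF fin]) (simp add: that)
    then show False using that by simp
  qed
  \<comment> \<open>The leading coefficient is a nonzero polynomial in h, so it is nonzero because h
    is transcendental, and it can be inverted in \<open>Ch h\<close>.\<close>
  have Rn: "PE h (R n) \<noteq> 0" using PE_transcendental[OF h(2)] n(2) by blast
  have "(\<Sum>k\<le>N. PE h (R k) * xs ^ k) = (\<Sum>k<Suc n. PE h (R k) * xs ^ k)"
    using n(1) top by (intro sum.mono_neutral_right) auto
  then have eq: "PE h (R n) * xs ^ n = - (\<Sum>k<n. PE h (R k) * xs ^ k)"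
    using rel' by (simp add: eq_neg_iff_add_eq_0 add.commute)
  show thesis
  proof (rule that)
    show "n > 0"
    proof (rule ccontr)
      assume "\<not> n > 0"
      then show False using eq Rn by simp
    qed
    show "- PE h (R i) / PE h (R n) \<in> Ch h" for i
      by (intro subfldD(10)[OF Kh(1)] subfldD(6)[OF Kh(1)] PE_Ch)
    have "xs ^ n = (PE h (R n) * xs ^ n) / PE h (R n)" using Rn by simp
    then show "xs ^ n = (\<Sum>i<n. - PE h (R i) / PE h (R n) * xs ^ i)"
      unfolding eq by (simp add: sum_divide_distrib sum_negf)
  qed
qed

text \<open>The x^i y^j span, with i below the degree of an equation for x over C(h) and j < d.
  Finiteness makes the \<open>ring.dim\<close> in \<open>morphism_degree\<close> a genuine
  dimension.\<close>

lemma finite_dimension_over_Ch: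
  assumes h: "h \<in> KK" "h \<notin> CC"
  shows "\<exists>m. ring.dimension FF m (gm ` Ch h) (gm ` KK)"
proof -
  note K = subfld_Ch[OF h(1)]
  obtain n c where n: "n > 0" "\<And>i. i < n \<Longrightarrow> c i \<in> Ch h" "xs ^ n = (\<Sum>i<n. c i * xs ^ i)"
    using xs_algebraic[OF h] by blast
  let ?I = "{..<n} \<times> {..<d}" and ?u = "\<lambda>(i, j). xs ^ i * ys ^ j"
  let ?S = "lcs (Ch h) ?I ?u"
  have I: "finite ?I" by simp
  note sm = lcs_smult[OF K(1) I] and ss = lcs_sum[OF K(1) I] and sa = lcs_add[OF K(1) I]
  have b: "xs ^ i * ys ^ j \<in> ?S" if "i < n" "j < d" for i j
    using lcs_base[OF K(1) I, of "(i, j)" ?u] that by simp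
  have x: "xs * ?u t \<in> ?S" if "t \<in> ?I" for t
  proof -
    obtain i j where t: "t = (i, j)" "i < n" "j < d" using \<open>t \<in> ?I\<close> by auto
    show ?thesis
    proof (cases "Suc i < n")
      case True
      then show ?thesis using b[of "Suc i" j] t by (simp add: mult.assoc)
    next
      case False
      then have "Suc i = n" using t by auto
      then have "xs * ?u t = xs ^ n * ys ^ j" using t by (auto simp: mult.assoc)
      also have "\<dots> = (\<Sum>i<n. c i * (xs ^ i * ys ^ j))" unfolding n(3) sum_distrib_right by (simp add: mult.assoc)
      also have "\<dots> \<in> ?S" by (intro ss sm n(2) b t) auto
      finally show ?thesis .
    qed
  qed
  have xp: "xs ^ k * s \<in> ?S" if "s \<in> ?S" for k s
    by (induction k) (auto simp: that mult.assoc intro: lcs_mult_closed[OF K(1) I x])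
  have one: "1 \<in> ?S" using b[of 0 0] n(1) d4 by simp
  have "\<exists>m\<le>card ?I. ring.dimension FF m (gm ` Ch h) (gm ` KK)"
  proof (rule finite_extension_generators[OF K(1,2) I _ one x])
    show "?u t \<in> KK" for t by (cases t) (simp add: KK_mult KK_power KK_xs KK_ys)
    fix t assume "t \<in> ?I"
    then obtain i j where t: "t = (i, j)" "i < n" "j < d" by auto
    show "ys * ?u t \<in> ?S"
    proof (cases "Suc j < d")
      case True
      then show ?thesis using b[of i "Suc j"] t by (simp add: mult_ac)
    next
      case False
      then have "Suc j = d" using t by auto
      then have "ys * ?u t = xs ^ i * ys ^ d" using t by (auto simp: mult_ac)
      also have "\<dots> = xs ^ (d - 1) * (xs ^ i * 1) + fls_const (-1) * (xs ^ i * 1)"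
        using xs_power_eq by (simp add: algebra_simps fls_const_uminus)
      also have "\<dots> \<in> ?S" by (intro sa xp sm one) (rule subsetD[OF K(2)], rule rangeI)
      finally show ?thesis .
    qed
  qed
  then show ?thesis by blast
qed

end

section \<open>The gonality is at least \<open>d - 1\<close>\<close>

lemma rsquarefree_card_roots:
  fixes p :: "complex poly"
  assumes "rsquarefree p"
  shows "card {z. poly p z = 0} = degree p"
proof -
  have p0: "p \<noteq> 0" using assms by (auto simp: rsquarefree_def)
  have "degree p = degree (smult (lead_coeff p) (\<Prod>z | poly p z = 0. [:- z, 1:]))"
    by (simp only: complex_poly_decompose_rsquarefree[OF assms])
  also have "\<dots> = degree (\<Prod>z | poly p z = 0. [:- z, 1:])" using p0 by (simp only: degree_smult_eq) simp
  also have "\<dots> = (\<Sum>z | poly p z = 0. degree [:- z, 1:])" by (rule degree_prod_sum_eq) auto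
  also have "\<dots> = card {z. poly p z = 0}" by simp
  finally show ?thesis by simp
qed

text \<open>With n the least multiplicity of the root l, dividing by the n-th power leaves
  polynomials that do not all vanish at l; this keeps a relation over C[h] nontrivial when h is
  specialised to l.\<close>

lemma common_factor_at:
  fixes P :: "nat \<Rightarrow> complex poly"
  assumes "\<exists>i\<le>e. P i \<noteq> 0"
  obtains P' n where "\<And>i. i \<le> e \<Longrightarrow> P i = [:- l, 1:] ^ n * P' i" "\<exists>i\<le>e. poly (P' i) l \<noteq> 0"
proof -
  define I where "I = {i. i \<le> e \<and> P i \<noteq> 0}"
  define n where "n = Min ((\<lambda>i. order l (P i)) ` I)"
  have I: "finite I" "I \<noteq> {}" using assms by (auto simp: I_def)
  have "n \<in> (\<lambda>i. order l (P i)) ` I" unfolding n_def using I by (intro Min_in) auto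
  then obtain i0 where i0: "i0 \<in> I" "n = order l (P i0)" by auto
  have "[:- l, 1:] ^ n dvd P i" if "i \<le> e" for i
  proof (cases "P i = 0")
    case False
    then have "n \<le> order l (P i)" unfolding n_def using I(1) that by (intro Min_le) (auto simp: I_def)
    then show ?thesis using order_1[of l "P i"] le_imp_power_dvd dvd_trans by blast
  qed simp
  then have "\<forall>i. \<exists>q. i \<le> e \<longrightarrow> P i = [:- l, 1:] ^ n * q" by (metis dvdE)
  then obtain P' where P': "\<And>i. i \<le> e \<Longrightarrow> P i = [:- l, 1:] ^ n * P' i" by metis
  have i0': "i0 \<le> e" "P i0 \<noteq> 0" using i0(1) by (auto simp: I_def)
  obtain q where q: "P i0 = [:- l, 1:] ^ n * q" "\<not> [:- l, 1:] dvd q"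
    using order_decomp[OF i0'(2), of l] i0(2) by auto
  have "q = P' i0" using q(1) P'[OF i0'(1)] by (simp add: mult_left_cancel del: mult_pCons_left)
  then have "poly (P' i0) l \<noteq> 0" using q(2) by (simp add: poly_eq_0_iff_dvd)
  then show thesis using that[of n P'] P' i0'(1) by blast
qed

context plane_curve
begin

section \<open>Lines in general position and cancellation of poles\<close>

definition ell :: "complex \<Rightarrow> complex fls" where "ell \<epsilon> = ys + fls_const \<epsilon> * xs"

lemma ell_Acoord: "ell \<epsilon> \<in> Acoord"
  unfolding ell_def by (intro Acoord_closed)

lemma subdegree_ell:
  assumes "\<epsilon> \<noteq> 0"
  shows "fls_subdegree (ell \<epsilon>) = - int d"
proof -
  have s: "fls_subdegree (fls_const \<epsilon> * xs) = - int d" using assms subdegree_xs by simp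
  have "fls_subdegree (fls_const \<epsilon> * xs) < fls_subdegree ys" unfolding s subdegree_ys using d4 by simp
  then show ?thesis unfolding ell_def using assms s by (subst fls_subdegree_add_eq2) auto
qed

lemma rv_ell: "(a, b) \<in> Aff \<Longrightarrow> rv (pt a b) (ell \<epsilon>) (b + \<epsilon> * a)"
  unfolding ell_def by (intro rv_add rv_mult rv_ys rv_xs rv_const) auto

lemma rv_divide_regular:
  assumes "rv p q c" "rv p e c'" "c' \<noteq> 0" "q = e * g"
  shows "\<exists>c. rv p g c"
proof -
  have "e \<noteq> 0" using rv_nonzero assms by blast
  then have "g = q / e" using assms(4) by simp
  then show ?thesis using rv_divide assms by blast
qed

text \<open>Modulo the curve equation the polar is y^d plus terms with smaller poles, since d y^d -
  (d-1) x^(d-1) = y^d - (d-1); so its coefficient at X^(-d(d-1)) is 1.\<close>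

lemma polar_nonzero:
  "of_nat d * ys ^ (d - 1) * (ys - fls_const b) - of_nat (d - 1) * xs ^ (d - 2) * (xs - fls_const a) \<noteq> 0"
proof
  let ?N = "- int (d * (d - 1))"
  assume z: "of_nat d * ys ^ (d - 1) * (ys - fls_const b) - of_nat (d - 1) * xs ^ (d - 2) * (xs - fls_const a) = 0"
  have s1: "Suc (d - 2) = d - 1" and s2: "Suc (d - 1) = d" using d4 by auto
  have yd: "ys ^ d $$ ?N = 1" unfolding ys_def power_mult[symmetric] by (simp add: mult.commute)
  have c: "fls_const c $$ ?N = 0" for c :: complex using d4 by simp
  have y1: "(fls_const c * ys ^ (d - 1)) $$ ?N = 0" for c
  proof -
    have "?N < fls_subdegree (ys ^ (d - 1))" 
    proof -
      have "int ((d - 1) * (d - 1)) < int (d * (d - 1))" unfolding of_nat_less_iff using d4 by simp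
      then show ?thesis unfolding fls_subdegree_pow subdegree_ys by (simp only: of_nat_mult mult_minus_right neg_less_iff_less)
    qed
    then show ?thesis by simp
  qed
  have x1: "(fls_const c * xs ^ (d - 2)) $$ ?N = 0" for c
  proof -
    have "?N < fls_subdegree (xs ^ (d - 2))" 
    proof -
      have "int ((d - 2) * d) < int (d * (d - 1))" unfolding of_nat_less_iff using d4 by simp
      then show ?thesis unfolding fls_subdegree_pow subdegree_xs by (simp only: of_nat_mult mult_minus_right neg_less_iff_less)
    qed
    then show ?thesis by simp
  qed
  have "xs * xs ^ (d - 2) = xs ^ (d - 1)" "ys * ys ^ (d - 1) = ys ^ d" using power_Suc s1 s2 by metis+
  moreover have of_nat_d: "of_nat (d - 1) = (of_nat d - 1 :: complex fls)" using d4 by (simp add: of_nat_diff)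
  ultimately have "of_nat d * ys ^ (d - 1) * (ys - fls_const b) - of_nat (d - 1) * xs ^ (d - 2) * (xs - fls_const a)
    = (of_nat d * ys ^ d - of_nat (d - 1) * (ys ^ d + 1)) - of_nat d * fls_const b * ys ^ (d - 1)
      + of_nat (d - 1) * fls_const a * xs ^ (d - 2)"
    using xs_power_eq by (simp add: algebra_simps)
  also have "\<dots> = ys ^ d - fls_const (of_nat (d - 1)) - fls_const (of_nat d * b) * ys ^ (d - 1)
      + fls_const (of_nat (d - 1) * a) * xs ^ (d - 2)"
    unfolding fls_const_mult_const[symmetric] fls_of_nat[symmetric] of_nat_d by (simp add: algebra_simps)
  finally have "(ys ^ d - fls_const (of_nat (d - 1)) - fls_const (of_nat d * b) * ys ^ (d - 1)
      + fls_const (of_nat (d - 1) * a) * xs ^ (d - 2)) $$ ?N = 0"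
    using z by simp
  then have "1 - 0 - 0 + 0 = (0 :: complex)" by (simp only: fls_plus_nth fls_minus_nth yd c y1 x1)
  then show False by simp
qed

text \<open>A general line through \<open>(a, b)\<close> meets the affine curve in \<open>d\<close> distinct points: otherwise it passes
  through a further zero of the polar of \<open>(a, b)\<close>, or is tangent at \<open>(a, b)\<close>.\<close>

lemma transversal_slopes:
  assumes ab: "(a, b) \<in> Aff"
  shows "finite {\<epsilon>. \<not> rsquarefree ([:b + \<epsilon> * a, - \<epsilon>:] ^ d - monom 1 (d - 1) + 1)}"
proof -
  let ?w = "\<lambda>x y. of_nat d * y ^ (d - 1) * (y - b) - of_nat (d - 1) * x ^ (d - 2) * (x - a) :: complex"
  let ?Z = "{(x, y) \<in> Aff. ?w x y = 0}"
  have of_nat: "reduces (of_nat n) (\<lambda>a b. of_nat n)" for n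
    using reduces_const[of "of_nat n"] by (simp add: fls_of_nat)
  have "reduces (of_nat d * ys ^ (d - 1) * (ys - fls_const b) - of_nat (d - 1) * xs ^ (d - 2) * (xs - fls_const a)) ?w"
    by (intro reduces_diff reduces_mult reduces_power of_nat reduces_ys reduces_xs reduces_const)
  then have fin: "finite ?Z" using polar_nonzero by (rule reduces_finite_zeros)
  let ?B = "insert (- (of_nat (d - 1) * a ^ (d - 2)) / (of_nat d * b ^ (d - 1))) ((\<lambda>(x, y). - (y - b) / (x - a)) ` ?Z)"
  have "\<epsilon> \<in> ?B" if nsq: "\<not> rsquarefree ([:b + \<epsilon> * a, - \<epsilon>:] ^ d - monom 1 (d - 1) + 1)" for \<epsilon>
  proof -
    obtain x where x: "poly ([:b + \<epsilon> * a, - \<epsilon>:] ^ d - monom 1 (d - 1) + 1) x = 0"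
      "poly (pderiv ([:b + \<epsilon> * a, - \<epsilon>:] ^ d - monom 1 (d - 1) + 1)) x = 0"
      using nsq unfolding rsquarefree_roots by blast
    \<comment> \<open>A multiple root x of the restricted equation gives a point (x, y) of the curve
      at which the line through (a, b) is tangent; the tangency is the equation
      \<open>D\<close>.\<close>
    define y where "y = b + \<epsilon> * a - \<epsilon> * x"
    have A: "(x, y) \<in> Aff" using x(1) by (simp add: Aff_def y_def poly_monom algebra_simps)
    have D: "of_nat d * y ^ (d - 1) * \<epsilon> + of_nat (d - 1) * x ^ (d - 2) = 0"
      using x(2) d4 by (simp add: pderiv_add pderiv_diff pderiv_power pderiv_pCons pderiv_monom poly_monom y_def
        algebra_simps numeral_2_eq_2 eq_neg_iff_add_eq_0)
    have yb: "y - b = - \<epsilon> * (x - a)" by (simp add: y_def algebra_simps)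
    have "?w x y = - (of_nat d * y ^ (d - 1) * \<epsilon> + of_nat (d - 1) * x ^ (d - 2)) * (x - a)"
      unfolding yb by (simp add: algebra_simps)
    then have Z: "(x, y) \<in> ?Z" using A D by simp
    show ?thesis
    proof (cases "x = a")
      case False
      then have "\<epsilon> = - (y - b) / (x - a)" unfolding yb by simp
      then show ?thesis using Z by force
    next
      case True
      then have y: "y = b" using yb by simp
      \<comment> \<open>At a point with b = 0 the tangent is vertical, so no line y + \<epsilon> x =
        c is tangent there.\<close>
      have "b \<noteq> 0"
      proof
        assume "b = 0"
        then have "a ^ (d - 2) = 0" using D True y d4 by (auto simp: zero_power of_nat_eq_0_iff)
        then have "a = 0" by simp
        moreover have "a \<noteq> 0" using Aff_zero(2) ab \<open>b = 0\<close> by blast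
        ultimately show False by blast
      qed
      then have "\<epsilon> = - (of_nat (d - 1) * a ^ (d - 2)) / (of_nat d * b ^ (d - 1))"
        using D True y d4 by (simp add: field_simps eq_neg_iff_add_eq_0)
      then show ?thesis by blast
    qed
  qed
  then have "{\<epsilon>. \<not> rsquarefree ([:b + \<epsilon> * a, - \<epsilon>:] ^ d - monom 1 (d - 1) + 1)} \<subseteq> ?B" by blast
  then show ?thesis by (rule finite_subset) (intro finite.insertI finite_imageI fin)
qed

text \<open>Only finitely many slopes are excluded. By the last condition a line of the chosen
  direction contains at most one point of P, and by the second it meets the affine curve in d
  distinct points when it contains one.\<close>

lemma general_slope:
  assumes "finite P" "P \<subseteq> Aff"
  obtains \<epsilon> where "\<epsilon> \<noteq> 0" "\<And>a b. (a, b) \<in> P \<Longrightarrow> rsquarefree ([:b + \<epsilon> * a, - \<epsilon>:] ^ d - monom 1 (d - 1) + 1)"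
    "\<And>a b x y. (a, b) \<in> P \<Longrightarrow> (x, y) \<in> P \<Longrightarrow> b + \<epsilon> * a = y + \<epsilon> * x \<Longrightarrow> x = a"
proof -
  let ?B = "insert 0 ((\<Union>(a, b)\<in>P. {\<epsilon>. \<not> rsquarefree ([:b + \<epsilon> * a, - \<epsilon>:] ^ d - monom 1 (d - 1) + 1)})
    \<union> (\<lambda>((a, b), (x, y)). (y - b) / (a - x)) ` (P \<times> P))"
  have "finite ?B" using assms transversal_slopes by auto
  then obtain \<epsilon> where e: "\<epsilon> \<notin> ?B" using ex_new_if_finite[OF infinite_UNIV_char_0] by blast
  show thesis
  proof (rule that)
    show "\<epsilon> \<noteq> 0" using e by blast
    show "rsquarefree ([:b + \<epsilon> * a, - \<epsilon>:] ^ d - monom 1 (d - 1) + 1)" if "(a, b) \<in> P" for a b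
      using e that by blast
    show "x = a" if "(a, b) \<in> P" "(x, y) \<in> P" "b + \<epsilon> * a = y + \<epsilon> * x" for a b x y
    proof (rule ccontr)
      assume "x \<noteq> a"
      then have "\<epsilon> = (y - b) / (a - x)" using that(3) by (simp add: field_simps)
      moreover have "(y - b) / (a - x) \<in> (\<lambda>((a, b), (x, y)). (y - b) / (a - x)) ` (P \<times> P)"
        using that(1,2) by force
      ultimately show False using e by blast
    qed
  qed
qed

text \<open>Restricted to the line, q becomes a polynomial of degree at most d - 2 in x with at
  least d - 1 zeros, hence zero. So q equals its difference from its restriction, which is divisible
  by the equation of the line.\<close>

lemma vanishing_on_line:
  assumes q: "q \<in> Mn (d - 2)" and X: "d - 1 \<le> card X"
    and z: "\<And>x. x \<in> X \<Longrightarrow> (x, c - \<epsilon> * x) \<in> Aff \<and> rv (pt x (c - \<epsilon> * x)) q 0"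
  shows "\<exists>r\<in>Acoord. q = (ell \<epsilon> - fls_const c) * r"
proof -
  obtain k where k: "q = (\<Sum>t\<in>Tn (d - 2). fls_const (k t) * mn t)" using q unfolding Mn_def by blast
  let ?lp = "[:c, - \<epsilon>:]" and ?le = "fls_const c - fls_const \<epsilon> * xs"
  define Q where "Q = (\<Sum>(j, i)\<in>Tn (d - 2). smult (k (j, i)) (monom 1 i * ?lp ^ j))"
  have lp: "degree (?lp ^ j) \<le> j" for j
    using degree_power_le[of ?lp j] by (auto intro: order_trans split: if_splits)
  have "degree Q \<le> d - 2" unfolding Q_def
  proof (rule degree_sum_le)
    fix t assume "t \<in> Tn (d - 2)"
    then obtain j i where t: "t = (j, i)" "i + j \<le> d - 2" by (metis Tn_iff surj_pair)
    have "degree (monom 1 i * ?lp ^ j) \<le> i + j"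
      using degree_mult_le[of "monom (1::complex) i" "?lp ^ j"] lp[of j] degree_monom_le[of "1::complex" i] by linarith
    then show "degree (case t of (j, i) \<Rightarrow> smult (k (j, i)) (monom 1 i * ?lp ^ j)) \<le> d - 2"
      using t degree_smult_le[of "k t" "monom 1 i * ?lp ^ j"] by (auto intro: order_trans)
  qed simp
  moreover have "poly Q x = 0" if "x \<in> X" for x
  proof -
    note zx = z[OF that]
    have "rv (pt x (c - \<epsilon> * x)) q (\<Sum>(j, i)\<in>Tn (d - 2). k (j, i) * (x ^ i * (c - \<epsilon> * x) ^ j))"
      unfolding k mn_def case_prod_beta using zx
      by (intro rv_sum rv_mult rv_const rv_power rv_xs rv_ys) (auto simp: rv_const)
    then have "(\<Sum>(j, i)\<in>Tn (d - 2). k (j, i) * (x ^ i * (c - \<epsilon> * x) ^ j)) = 0" using zx rv_unique by blast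
    then show ?thesis unfolding Q_def by (simp add: poly_sum case_prod_beta poly_monom mult_ac)
  qed
  ultimately have Q0: "Q = 0"
  proof -
    assume deg: "degree Q \<le> d - 2" and roots: "\<And>x. x \<in> X \<Longrightarrow> poly Q x = 0"
    show "Q = 0"
    proof (rule ccontr)
      assume "Q \<noteq> 0"
      then have "card X \<le> card {x. poly Q x = 0}" using roots by (intro card_mono poly_roots_finite) auto
      also have "\<dots> \<le> d - 2" using card_poly_roots_bound[OF \<open>Q \<noteq> 0\<close>] deg by simp
      finally show False using X d4 by simp
    qed
  qed
  have leq: "ys - ?le = ell \<epsilon> - fls_const c" by (simp add: ell_def)
  have lpe: "PE xs ?lp = ?le" by (simp add: PE_pCons fls_const_uminus mult.commute)
  have "PE xs Q = (\<Sum>(j, i)\<in>Tn (d - 2). fls_const (k (j, i)) * (xs ^ i * ?le ^ j))"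
    unfolding Q_def by (simp add: PE_simps case_prod_beta PE_smult PE_monom lpe)
  then have "q = q - (\<Sum>(j, i)\<in>Tn (d - 2). fls_const (k (j, i)) * (xs ^ i * ?le ^ j))" using Q0 by simp
  also have "\<dots> = (\<Sum>(j, i)\<in>Tn (d - 2). fls_const (k (j, i)) * xs ^ i * (ys ^ j - ?le ^ j))"
    unfolding k mn_def sum_subtractf[symmetric] by (rule sum.cong) (auto simp: algebra_simps)
  also have "\<dots> = (ell \<epsilon> - fls_const c) *
      (\<Sum>(j, i)\<in>Tn (d - 2). fls_const (k (j, i)) * xs ^ i * (\<Sum>l<j. ?le ^ (j - Suc l) * ys ^ l))"
    by (subst sum_distrib_left, rule sum.cong) (auto simp: power_diff_sumr2 leq mult_ac)
  finally show ?thesis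
    by (rule bexI) (auto simp: case_prod_beta intro!: Acoord_sum Acoord_closed)
qed

text \<open>One factor of s is removed at a time. If the corresponding line misses the poles of h,
  dividing by its equation is harmless; otherwise it contains one pole and d - 1 further points of
  the curve, at which q vanishes, so \<open>vanishing_on_line\<close> applies.\<close>

lemma cancel_linear_factors:
  assumes h: "h \<in> KK" "h \<noteq> 0" "0 \<le> fls_subdegree h" and \<epsilon>: "\<epsilon> \<noteq> 0"
    and P: "P = {(a, b) \<in> Aff. \<not> (\<exists>c. rv (pt a b) h c)}"
    and sq: "\<And>a b. (a, b) \<in> P \<Longrightarrow> rsquarefree ([:b + \<epsilon> * a, - \<epsilon>:] ^ d - monom 1 (d - 1) + 1)"
    and inj: "\<And>a b x y. (a, b) \<in> P \<Longrightarrow> (x, y) \<in> P \<Longrightarrow> b + \<epsilon> * a = y + \<epsilon> * x \<Longrightarrow> x = a"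
  shows "s \<noteq> 0 \<Longrightarrow> degree s \<le> d - 2 \<Longrightarrow> h * PE (ell \<epsilon>) s \<in> Acoord \<Longrightarrow> h \<in> Acoord"
proof (induction "degree s" arbitrary: s)
  case 0
  then obtain c where c: "s = [:c:]" "c \<noteq> 0" by (metis degree_eq_zeroE pCons_0_0)
  then have e: "h = fls_const (inverse c) * (h * PE (ell \<epsilon>) s)"
    by (simp add: mult_ac fls_const_mult_const)
  show ?case by (subst e) (intro Acoord_closed 0)
next
  case (Suc n)
  have ellsub: "fls_subdegree (ell \<epsilon>) < 0" unfolding subdegree_ell[OF \<epsilon>] using d4 by simp
  have "\<not> constant (poly s)" using Suc.hyps(2) by (simp add: constant_degree)
  then obtain c where "poly s c = 0" using fundamental_theorem_of_algebra by blast
  then obtain s' where s: "s = [:- c, 1:] * s'" by (auto simp: poly_eq_0_iff_dvd)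
  have s': "s' \<noteq> 0" "degree s' = n" using s Suc by (auto simp: degree_mult_eq simp del: mult_pCons_left)
  let ?l = "ell \<epsilon> - fls_const c"
  define g where "g = h * PE (ell \<epsilon>) s'"
  define q where "q = h * PE (ell \<epsilon>) s"
  have q: "q = ?l * g" unfolding q_def g_def s PE_mult PE_linear by (simp add: mult_ac)
  have qA: "q \<in> Acoord" unfolding q_def by (rule Suc.prems)
  have gK: "g \<in> KK" unfolding g_def by (intro KK_mult h KK_PE Acoord_KK ell_Acoord)
  have l0: "?l \<noteq> 0"
  proof
    assume "?l = 0"
    then have "fls_subdegree (ell \<epsilon>) = 0" by simp
    then show False using ellsub by simp
  qed
  have rl: "rv (pt x y) ?l (y + \<epsilon> * x - c)" if "(x, y) \<in> Aff" for x y
    using that by (intro rv_diff rv_ell rv_const) auto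
  have greg: "\<exists>v. rv (pt x y) g v" if xy: "(x, y) \<in> Aff" "(x, y) \<notin> P" for x y
  proof -
    obtain v where "rv (pt x y) h v" using xy P by auto
    then show ?thesis unfolding g_def using rv_mult rv_PE[OF rv_ell[OF xy(1)]] by blast
  qed
  have "g \<in> Acoord"
  proof (cases "\<exists>(a, b)\<in>P. b + \<epsilon> * a = c")
    case False
    show ?thesis
    proof (rule regular_affine_Acoord[OF gK])
      fix x y assume xy: "(x, y) \<in> Aff"
      show "\<exists>v. rv (pt x y) g v"
      proof (cases "y + \<epsilon> * x = c")
        case True
        then show ?thesis using greg[OF xy] False by blast
      next
        case n: False
        obtain v where "rv (pt x y) q v" using rv_Acoord[OF qA xy] by blast
        then show ?thesis using rv_divide_regular[OF _ rl[OF xy] _ q] n by auto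
      qed
    qed
  next
    case True
    then obtain a b where ab: "(a, b) \<in> P" "b + \<epsilon> * a = c" by blast
    let ?Phi = "[:c, - \<epsilon>:] ^ d - monom 1 (d - 1) + 1"
    have sqf: "rsquarefree ?Phi" using sq[OF ab(1)] unfolding ab(2) .
    have "degree ?Phi = d"
    proof -
      have "degree ([:c, - \<epsilon>:] ^ d) = d" using \<epsilon> by (subst degree_power_eq) auto
      moreover have "degree (1 - monom 1 (d - 1) :: complex poly) \<le> d - 1"
        by (rule degree_diff_le) (auto simp: degree_monom_le)
      ultimately have "degree ([:c, - \<epsilon>:] ^ d + (1 - monom 1 (d - 1))) = d"
        using d4 by (subst degree_add_eq_left) auto
      then show ?thesis by (simp add: algebra_simps)
    qed
    then have card: "card {x. poly ?Phi x = 0} = d" using rsquarefree_card_roots[OF sqf] by simp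
    have on: "poly ?Phi x = 0 \<longleftrightarrow> (x, c - \<epsilon> * x) \<in> Aff" for x
      by (simp add: Aff_def poly_monom algebra_simps)
    have aA: "(a, b) \<in> Aff" using ab(1) P by blast
    have "b = c - \<epsilon> * a" using ab(2) by (simp add: algebra_simps)
    then have ra: "a \<in> {x. poly ?Phi x = 0}" using aA on by simp
    let ?X = "{x. poly ?Phi x = 0} - {a}"
    have X: "card ?X = d - 1" using ra card by simp
    \<comment> \<open>As h has no pole at infinity, the pole of q there is at most that of a
      polynomial of degree d - 2.\<close>
    have sub: "- int ((d - 2) * d) \<le> fls_subdegree q"
    proof -
      note ps = PE_subdegree[OF ellsub Suc.prems(1)]
      have "fls_subdegree q = fls_subdegree h - int (degree s * d)"
        unfolding q_def using h(2) ps subdegree_ell[OF \<epsilon>] by simp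
      moreover have "int (degree s * d) \<le> int ((d - 2) * d)" by (intro of_nat_mono mult_le_mono1 Suc.prems(2))
      ultimately show ?thesis using h(3) by linarith
    qed
    have "q \<in> Mn (d - 2)" by (rule Acoord_Mn[OF qA sub]) (use d4 in simp)
    then have "\<exists>r\<in>Acoord. q = ?l * r"
    proof (rule vanishing_on_line)
      show "d - 1 \<le> card ?X" using X by simp
      fix x assume x: "x \<in> ?X"
      then have A: "(x, c - \<epsilon> * x) \<in> Aff" using on by blast
      have "(x, c - \<epsilon> * x) \<notin> P" using inj[OF ab(1)] ab(2) x by auto
      then obtain v where "rv (pt x (c - \<epsilon> * x)) g v" using greg[OF A] by blast
      then have "rv (pt x (c - \<epsilon> * x)) q 0" unfolding q using rv_mult[OF rl[OF A]] by fastforce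
      then show "(x, c - \<epsilon> * x) \<in> Aff \<and> rv (pt x (c - \<epsilon> * x)) q 0" using A by blast
    qed
    then show ?thesis using q l0 by auto
  qed
  then show ?case using Suc.hyps(1)[OF s'(2)[symmetric] s'(1)] Suc.prems(2) Suc.hyps(2) s'(2) unfolding g_def by simp
qed

lemma regular_at_infinity_shift:
  assumes "h \<in> KK"
  obtains l c where "rv infp (inverse (h - fls_const l)) c"
proof (cases "\<exists>c. rv infp h c")
  case True
  then obtain c where "rv infp h c" by blast
  then have "rv infp (h - fls_const (c + 1)) (c - (c + 1))" by (intro rv_diff rv_const) auto
  from rv_inverse[OF this] that show thesis by simp
next
  case False
  have h0: "h \<noteq> 0" using False rv_0[OF infp_curve] by metis
  have "ord infp h < 0" using ord_ge_0_iff[OF infp_curve assms h0] False by (metis not_le)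
  then have "0 \<le> ord infp (inverse h)" using ord_inverse[OF infp_curve assms h0] by simp
  then have "\<exists>c. rv infp (inverse h) c" using ord_ge_0_iff[OF infp_curve KK_inverse[OF assms]] h0 by simp
  then show thesis using that[of 0] by auto
qed

lemma regular_inverse_or:
  assumes "p \<in> curve" "h \<in> KK" "h - fls_const l \<noteq> 0" "\<not> (\<exists>c. rv p (inverse (h - fls_const l)) c)"
  shows "\<exists>c. rv p h c"
proof -
  have K: "h - fls_const l \<in> KK" by (intro KK_diff KK_const assms)
  have "ord p (inverse (h - fls_const l)) < 0"
    using ord_ge_0_iff[OF assms(1) KK_inverse[OF K]] assms(3,4) by (simp add: not_le[symmetric])
  then have "0 \<le> ord p (h - fls_const l)" using ord_inverse[OF assms(1) K assms(3)] by simp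
  then obtain c where "rv p (h - fls_const l) c" using ord_ge_0_iff[OF assms(1) K assms(3)] by blast
  from rv_add[OF this rv_const[OF assms(1), of l]] show ?thesis by auto
qed

text \<open>A relation of degree \<open>e \<le> d - 2\<close> for a general linear form \<open>\<ell>\<close> over \<open>\<complex>(h)\<close> bounds the poles of
  \<open>1/(h - \<lambda>)\<close>: they lie on \<open>e\<close> lines \<open>\<ell> = c\<close>, and a line meeting the polar divisor in one point is
  superfluous because a curve of degree at most \<open>d - 2\<close> through its other points contains it.\<close>

lemma dimension_lower_bound:
  assumes h: "h \<in> KK" "h \<notin> CC" and dim: "ring.dimension FF e (gm ` Ch h) (gm ` KK)"
  shows "d - 1 \<le> e"
proof (rule ccontr)
  assume "\<not> d - 1 \<le> e"
  then have e: "e \<le> d - 2" by simp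
  note K = subfld_Ch[OF h(1)]
  \<comment> \<open>Replacing h by 1/(h - l) removes a possible pole at infinity.\<close>
  obtain l c0 where l: "rv infp (inverse (h - fls_const l)) c0" by (rule regular_at_infinity_shift[OF h(1)])
  define h1 where "h1 = inverse (h - fls_const l)"
  have hl: "h - fls_const l \<noteq> 0" using h(2) by auto
  have h1: "h1 \<in> KK" "h1 \<noteq> 0" unfolding h1_def using hl by (auto intro!: KK_inverse KK_diff KK_const h)
  have "0 \<le> ord infp h1" using ord_ge_0_iff[OF infp_curve h1] l unfolding h1_def by blast
  then have h1sub: "0 \<le> fls_subdegree h1" using ord_infp[OF h1] by simp
  define P where "P = {(a, b) \<in> Aff. \<not> (\<exists>c. rv (pt a b) h1 c)}"
  have "finite P"
  proof -
    let ?S = "{p \<in> curve. ord p h1 \<noteq> 0}"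
    have "finite {(a, b) \<in> Aff. pt a b \<in> ?S}"
      using finite_ord_nonzero[OF h1] finite_curve_iff[of ?S] by blast
    moreover have "P \<subseteq> {(a, b) \<in> Aff. pt a b \<in> ?S}"
      unfolding P_def using ord_ge_0_iff[OF _ h1] by force
    ultimately show ?thesis by (rule finite_subset[rotated])
  qed
  moreover have "P \<subseteq> Aff" unfolding P_def by blast
  ultimately obtain \<epsilon> where \<epsilon>: "\<epsilon> \<noteq> 0" "\<And>a b. (a, b) \<in> P \<Longrightarrow> rsquarefree ([:b + \<epsilon> * a, - \<epsilon>:] ^ d - monom 1 (d - 1) + 1)"
    "\<And>a b x y. (a, b) \<in> P \<Longrightarrow> (x, y) \<in> P \<Longrightarrow> b + \<epsilon> * a = y + \<epsilon> * x \<Longrightarrow> x = a"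
    by (rule general_slope) blast
  obtain k where k: "\<And>i. i \<le> e \<Longrightarrow> k i \<in> Ch h" "\<exists>i\<le>e. k i \<noteq> 0" "(\<Sum>i\<le>e. k i * ell \<epsilon> ^ i) = 0"
    by (rule dependence[OF K(1) dim subset_refl, of "\<lambda>i. ell \<epsilon> ^ i"])
      (use KK_power[OF Acoord_KK[OF ell_Acoord]] in simp, blast)
  obtain R w where R: "PE h w \<noteq> 0" "\<And>i. i \<le> e \<Longrightarrow> k i * PE h w = PE h (R i)"
    by (rule clear_denominators[of e k h, OF k(1)]) blast+
  have "\<exists>i\<le>e. R i \<noteq> 0" using k(2) R by (metis PE_0 mult_eq_0_iff)
  then obtain R' n where R': "\<And>i. i \<le> e \<Longrightarrow> R i = [:- l, 1:] ^ n * R' i" "\<exists>i\<le>e. poly (R' i) l \<noteq> 0"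
    by (rule common_factor_at[of e R l]) blast
  have "(h - fls_const l) ^ n * (\<Sum>i\<le>e. PE h (R' i) * ell \<epsilon> ^ i) = (\<Sum>i\<le>e. PE h (R i) * ell \<epsilon> ^ i)"
    unfolding sum_distrib_left by (rule sum.cong) (auto simp: R'(1) PE_mult PE_simps(7) PE_linear mult_ac simp del: mult_pCons_left)
  also have "\<dots> = (\<Sum>i\<le>e. PE h w * (k i * ell \<epsilon> ^ i))"
    by (rule sum.cong) (auto simp: R(2)[symmetric] mult_ac)
  also have "\<dots> = 0" using k(3) by (simp add: sum_distrib_left[symmetric])
  finally have rel: "(\<Sum>i\<le>e. PE h (R' i) * ell \<epsilon> ^ i) = 0" using hl by simp
  \<comment> \<open>Specialisation of the relation at h = l: each coefficient is (h - l) times the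
    value of \<open>S i\<close> plus a constant, and the constants form the polynomial s in the
    linear form. Hence the quotient of its value by h - l is a polynomial in h and the linear form,
    so it is regular at the affine points where h is.\<close>
  define S where "S i = synthetic_div (R' i) l" for i
  define s where "s = (\<Sum>i\<le>e. monom (poly (R' i) l) i)"
  have dec: "PE h (R' i) = (h - fls_const l) * PE h (S i) + fls_const (poly (R' i) l)" for i
    using arg_cong[OF synthetic_div_correct'[of l "R' i"], of "PE h"]
    unfolding S_def PE_simps(3) PE_mult PE_linear by simp
  have mon: "PE (ell \<epsilon>) (monom a i) = fls_const a * ell \<epsilon> ^ i" for a i
    using PE_smult[of "ell \<epsilon>" a "monom 1 i"] PE_monom[of "ell \<epsilon>" i] by (simp add: smult_monom)
  have "PE (ell \<epsilon>) s = (\<Sum>i\<le>e. fls_const (poly (R' i) l) * ell \<epsilon> ^ i)"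
    unfolding s_def PE_simps(9) mon ..
  then have "(h - fls_const l) * (\<Sum>i\<le>e. PE h (S i) * ell \<epsilon> ^ i) + PE (ell \<epsilon>) s = 0"
    using rel unfolding dec by (simp add: sum_distrib_left sum.distrib[symmetric] algebra_simps)
  then have "PE (ell \<epsilon>) s = (h - fls_const l) * - (\<Sum>i\<le>e. PE h (S i) * ell \<epsilon> ^ i)"
    by (simp add: eq_neg_iff_add_eq_0 add.commute)
  then have G: "h1 * PE (ell \<epsilon>) s = - (\<Sum>i\<le>e. PE h (S i) * ell \<epsilon> ^ i)"
    unfolding h1_def using hl by simp
  have s: "s \<noteq> 0" "degree s \<le> d - 2"
  proof -
    obtain i where i: "i \<le> e" "poly (R' i) l \<noteq> 0" using R'(2) by blast
    have "coeff s i = poly (R' i) l" unfolding s_def using i(1) by (simp add: coeff_sum)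
    then show "s \<noteq> 0" using i(2) by (metis coeff_0)
    show "degree s \<le> d - 2" unfolding s_def
    proof (rule degree_sum_le)
      fix i assume "i \<in> {..e}"
      then show "degree (monom (poly (R' i) l) i) \<le> d - 2" using e degree_monom_le[of "poly (R' i) l" i] by simp
    qed simp
  qed
  have lr: "\<exists>c. rv (pt a b) (PE (ell \<epsilon>) s) c" if "(a, b) \<in> Aff" for a b using rv_PE[OF rv_ell[OF that]] by blast
  have "h1 * PE (ell \<epsilon>) s \<in> Acoord"
  proof (rule regular_affine_Acoord)
    show "h1 * PE (ell \<epsilon>) s \<in> KK" by (intro KK_mult h1 KK_PE Acoord_KK ell_Acoord)
    fix a b assume ab: "(a, b) \<in> Aff"
    show "\<exists>c. rv (pt a b) (h1 * PE (ell \<epsilon>) s) c"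
    proof (cases "\<exists>c. rv (pt a b) h1 c")
      case True
      then show ?thesis using rv_mult lr[OF ab] by blast
    next
      case False
      then obtain c where c: "rv (pt a b) h c"
        using regular_inverse_or[OF iffD2[OF pt_curve ab] h(1) hl] unfolding h1_def by blast
      have "rv (pt a b) (- (\<Sum>i\<le>e. PE h (S i) * ell \<epsilon> ^ i)) (- (\<Sum>i\<le>e. poly (S i) c * (b + \<epsilon> * a) ^ i))"
        using ab by (intro rv_uminus rv_sum rv_mult rv_PE rv_power rv_ell c) auto
      then show ?thesis unfolding G by blast
    qed
  qed
  note GA = this
  have "h1 \<in> Acoord"
  proof (rule cancel_linear_factors[OF h1 h1sub \<epsilon>(1) P_def _ _ s GA])
    show "rsquarefree ([:b + \<epsilon> * a, - \<epsilon>:] ^ d - monom 1 (d - 1) + 1)" if "(a, b) \<in> P" for a b by (rule \<epsilon>(2)[OF that])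
    show "x = a" if "(a, b) \<in> P" "(x, y) \<in> P" "b + \<epsilon> * a = y + \<epsilon> * x" for a b x y by (rule \<epsilon>(3)[OF that])
  qed
  \<comment> \<open>Without any poles \<open>h1\<close> is constant, and so is h, contrary to the
    assumption.\<close>
  then have "h1 \<in> Mn 0" by (rule Acoord_Mn) (use h1sub d4 in auto)
  then obtain v where "h1 = (\<Sum>x\<in>Tn 0. fls_const (v x) * mn x)" unfolding Mn_def by blast
  then have v: "h1 = fls_const (v (0, 0))" by (simp add: Tn_def mn_def)
  have "h - fls_const l = inverse h1" unfolding h1_def by simp
  then have "h = fls_const l + fls_const (inverse (v (0, 0)))" unfolding v by (simp add: algebra_simps fls_inverse_const)
  then have "h = fls_const (l + inverse (v (0, 0)))" by (simp add: fls_plus_const)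
  then show False using h(2) by blast
qed

end

section \<open>Points, forms and closed sets on the projective line\<close>

lemma vec3_exhaust_line:
  assumes "\<And>i. i > 1 \<Longrightarrow> v i = 0"
  shows "v = vec3 (v 0) (v 1) 0"
  using assms by (auto simp: vec3_def fun_eq_iff)

lemma line_point_eq_iff:
  fixes a b x y :: complex
  assumes "a \<noteq> 0 \<or> b \<noteq> 0" "x \<noteq> 0 \<or> y \<noteq> 0"
  shows "proj_point (vec3 a b 0) = proj_point (vec3 x y 0) \<longleftrightarrow> a * y = x * b"
proof
  assume "proj_point (vec3 a b 0) = proj_point (vec3 x y 0)"
  then obtain c where "vec3 x y 0 = (\<lambda>i. c * vec3 a b 0 i)" unfolding proj_point_eq_iff by blast
  then have "x = c * a" "y = c * b" unfolding vec3_scale vec3_eq_iff by auto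
  then show "a * y = x * b" by simp
next
  assume e: "a * y = x * b"
  define c where "c = (if a = 0 then y / b else x / a)"
  have "x = c * a" "y = c * b" "c \<noteq> 0" using e assms by (auto simp: c_def field_simps)
  then have "c \<noteq> 0" "vec3 x y 0 i = c * vec3 a b 0 i" for i by (auto simp: vec3_def)
  then show "proj_point (vec3 a b 0) = proj_point (vec3 x y 0)" by (rule proj_point_eqI)
qed

definition dehom :: "mpoly \<Rightarrow> complex poly" where
  "dehom F = gev (\<lambda>c. [:c:]) F (vec3 [:0, 1:] 1 0)"

definition rehom :: "nat \<Rightarrow> complex poly \<Rightarrow> mpoly" where
  "rehom n P = (\<Sum>i\<le>n. mconst (coeff P i) * mvar 0 ^ i * mvar 1 ^ (n - i))"

lemma rhom_poly: "rhom (\<lambda>p. poly p (t :: complex))"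
  by (simp add: rhom_def)

lemma poly_dehom: "poly (dehom F) t = peval F (vec3 t 1 0)"
proof -
  have "(\<lambda>i. poly (vec3 [:0, 1:] 1 0 i) t) = vec3 t 1 0" by (auto simp: vec3_def)
  then show ?thesis unfolding dehom_def peval_gev gev_hom[OF rhom_poly] by simp
qed

lemma homogeneous_rehom: "homogeneous n (rehom n P)"
  unfolding rehom_def
proof (rule homogeneous_sum)
  fix i assume "i \<in> {..n}"
  then show "homogeneous n (mconst (coeff P i) * mvar 0 ^ i * mvar 1 ^ (n - i))"
    using homogeneous_mult[OF homogeneous_cmult[OF homogeneous_var_power[of i 0]] homogeneous_var_power[of "n - i" 1], of "coeff P i"]
    by simp
qed

lemma dehom_rehom:
  assumes "degree P \<le> n"
  shows "dehom (rehom n P) = P"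
proof (rule poly_eq_poly_eq_iff[THEN iffD1], rule ext)
  fix t
  have "poly (dehom (rehom n P)) t = (\<Sum>i\<le>n. coeff P i * t ^ i)"
    unfolding poly_dehom rehom_def peval_gev by (simp add: gev_simps[OF rhom_id] gev_sum[OF rhom_id] gev_var[OF rhom_id] gev_const[OF rhom_id])
  also have "\<dots> = (\<Sum>i\<le>degree P. coeff P i * t ^ i)"
    by (rule sum.mono_neutral_right) (use assms in \<open>auto simp: coeff_eq_0\<close>)
  finally show "poly (dehom (rehom n P)) t = poly P t" by (simp add: poly_altdef)
qed

lemma line_cases:
  assumes "p \<in> proj_space 1"
  obtains "p = proj_point (vec3 1 0 0)" | t where "p = proj_point (vec3 t 1 0)"
proof -
  note p = proj_space_rep[OF assms]
  let ?r = "rep p"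
  have r: "?r = vec3 (?r 0) (?r 1) 0" by (rule vec3_exhaust_line) (rule p(3))
  have nz: "?r 0 \<noteq> 0 \<or> ?r 1 \<noteq> 0" using p(2,3) by (metis One_nat_def less_one linorder_neqE_nat)
  have e: "p = proj_point (vec3 (?r 0) (?r 1) 0)" using p(1) r by simp
  show thesis
  proof (cases "?r 1 = 0")
    case True
    then have "proj_point (vec3 (?r 0) (?r 1) 0) = proj_point (vec3 1 0 0)" using nz by (simp add: line_point_eq_iff)
    then show ?thesis by (intro that(1) trans[OF e])
  next
    case False
    then have "proj_point (vec3 (?r 0) (?r 1) 0) = proj_point (vec3 (?r 0 / ?r 1) 1 0)" by (simp add: line_point_eq_iff)
    then show ?thesis by (intro that(2) trans[OF e])
  qed
qed

lemma dehom_0_vanishes: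
  assumes F: "homogeneous n F" and z: "dehom F = 0" and p: "p \<in> proj_space 1"
  shows "vanishes F p"
  using p
proof (cases rule: line_cases)
  case (2 t)
  then show ?thesis unfolding 2 vanishes_proj_point[OF F] using poly_dehom[of F t] z by simp
next
  case 1
  \<comment> \<open>The point [1:0] lies outside the chart of \<open>dehom\<close>. On the other
    chart the form is a polynomial vanishing at all nonzero s, hence also at 0.\<close>
  define Q where "Q = gev (\<lambda>c. [:c:]) F (vec3 1 [:0, 1:] 0)"
  have Q: "poly Q s = peval F (vec3 1 s 0)" for s :: complex
  proof -
    have "(\<lambda>i. poly (vec3 1 [:0, 1:] 0 i) s) = vec3 1 s 0" by (auto simp: vec3_def)
    then show ?thesis unfolding Q_def peval_gev gev_hom[OF rhom_poly] by simp
  qed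
  have "poly Q s = 0" if "s \<noteq> 0" for s
  proof -
    have "vec3 1 s 0 = (\<lambda>i. s * vec3 (inverse s) 1 0 i)" unfolding vec3_scale using that by simp
    then have "poly Q s = s ^ n * peval F (vec3 (inverse s) 1 0)" unfolding Q peval_gev by (simp add: gev_scale[OF F])
    then show ?thesis using poly_dehom[of F "inverse s"] z by simp
  qed
  then have "UNIV - {0} \<subseteq> {s. poly Q s = 0}" by auto
  moreover have "infinite (UNIV - {0 :: complex})" using infinite_UNIV_char_0 by simp
  ultimately have "infinite {s. poly Q s = 0}" by (metis finite_subset)
  then have "Q = 0" using poly_roots_finite by blast
  then show ?thesis unfolding 1 vanishes_proj_point[OF F] using Q[of 0] by simp
qed

lemma finite_zeros_dehom:
  assumes F: "homogeneous n F" and nz: "dehom F \<noteq> 0"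
  shows "finite {p \<in> proj_space 1. vanishes F p}"
proof (rule finite_subset)
  show "{p \<in> proj_space 1. vanishes F p} \<subseteq>
    insert (proj_point (vec3 1 0 0)) ((\<lambda>t. proj_point (vec3 t 1 0)) ` {t. poly (dehom F) t = 0})"
  proof
    fix p assume p: "p \<in> {p \<in> proj_space 1. vanishes F p}"
    then have "p \<in> proj_space 1" by blast
    then show "p \<in> insert (proj_point (vec3 1 0 0)) ((\<lambda>t. proj_point (vec3 t 1 0)) ` {t. poly (dehom F) t = 0})"
    proof (cases rule: line_cases)
      case (2 t)
      then have "poly (dehom F) t = 0" using p vanishes_proj_point[OF F] unfolding poly_dehom by simp
      then show ?thesis using 2 by blast
    qed blast
  qed
qed (simp add: poly_roots_finite[OF nz])

lemma line_point_in_space: "a \<noteq> 0 \<or> b \<noteq> 0 \<Longrightarrow> proj_point (vec3 a b 0) \<in> proj_space 1"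
  unfolding proj_space_def by (intro CollectI exI[of _ "vec3 a b 0"] conjI) (auto simp: vec3_def intro: exI[of _ 0] exI[of _ 1])

lemma cofinite_line: "cofinite_space (proj_space 1)"
  unfolding cofinite_space_def
proof (intro conjI allI impI)
  have "inj (\<lambda>t :: complex. proj_point (vec3 t 1 0))"
    by (rule injI) (simp add: line_point_eq_iff)
  then have "infinite (range (\<lambda>t :: complex. proj_point (vec3 t 1 0)))"
    using finite_imageD infinite_UNIV_char_0 by blast
  moreover have "range (\<lambda>t :: complex. proj_point (vec3 t 1 0)) \<subseteq> proj_space 1"
    by (auto intro: line_point_in_space)
  ultimately show "infinite (proj_space 1)" by (metis finite_subset)
  show "\<exists>n. proj_space 1 \<subseteq> proj_space n" by blast
  fix Z assume Z: "zariski_closed Z" "\<not> proj_space 1 \<subseteq> Z"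
  then obtain p where p: "p \<in> proj_space 1" "p \<notin> Z" by blast
  obtain F n where F: "homogeneous n F" "\<not> vanishes F p" "\<forall>q\<in>Z. vanishes F q"
    by (rule zariski_closed_separate[OF Z(1) p(2,1)])
  have "dehom F \<noteq> 0" using dehom_0_vanishes[OF F(1) _ p(1)] F(2) by blast
  then have "finite {p \<in> proj_space 1. vanishes F p}" by (rule finite_zeros_dehom[OF F(1)])
  moreover have "proj_space 1 \<inter> Z \<subseteq> {p \<in> proj_space 1. vanishes F p}" using F(3) by blast
  ultimately show "finite (proj_space 1 \<inter> Z)" by (rule finite_subset[rotated])
qed

context plane_curve
begin

section \<open>Morphisms to the projective line as rational functions\<close>

lemma gm_germ_iff:
  assumes "e \<in> KK"
  shows "gm e = germ curve f \<longleftrightarrow> finite {p \<in> curve. \<not> rv p e (f p)}"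
proof -
  obtain F G n where F: "is_frac F G n e" "gm e = quotient_germ curve F G" using assms by (rule KK_E)
  let ?g = "\<lambda>p. peval F (rep p) / peval G (rep p)"
  have G: "homogeneous n G" "ev G \<noteq> 0" using F(1) unfolding is_frac_def by auto
  have fin: "finite {p \<in> curve. vanishes G p}" by (rule ev_finite_zeros[OF G])
  have g: "rv p e (f p) \<longleftrightarrow> ?g p = f p" if "p \<in> curve" "\<not> vanishes G p" for p
    using rvI[OF that(1) F(1) that(2)] rv_unique by metis
  have "gm e = germ curve f \<longleftrightarrow> finite {p \<in> curve. ?g p \<noteq> f p}"
    unfolding F(2) quotient_germ_def by (rule germ_eq_iff[OF cofinite_curve])
  also have "\<dots> \<longleftrightarrow> finite {p \<in> curve. \<not> rv p e (f p)}"
  proof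
    assume "finite {p \<in> curve. ?g p \<noteq> f p}"
    then have "finite ({p \<in> curve. ?g p \<noteq> f p} \<union> {p \<in> curve. vanishes G p})" using fin by blast
    moreover have "{p \<in> curve. \<not> rv p e (f p)} \<subseteq> {p \<in> curve. ?g p \<noteq> f p} \<union> {p \<in> curve. vanishes G p}"
      using g by blast
    ultimately show "finite {p \<in> curve. \<not> rv p e (f p)}" by (rule finite_subset[rotated])
  next
    assume "finite {p \<in> curve. \<not> rv p e (f p)}"
    then have "finite ({p \<in> curve. \<not> rv p e (f p)} \<union> {p \<in> curve. vanishes G p})" using fin by blast
    moreover have "{p \<in> curve. ?g p \<noteq> f p} \<subseteq> {p \<in> curve. \<not> rv p e (f p)} \<union> {p \<in> curve. vanishes G p}"
      using g by blast
    ultimately show "finite {p \<in> curve. ?g p \<noteq> f p}" by (rule finite_subset[rotated])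
  qed
  finally show ?thesis .
qed

lemma finite_rv_zeros:
  assumes "e \<in> KK" "e \<noteq> 0"
  shows "finite {p \<in> curve. rv p e 0}"
proof (rule finite_subset[OF _ finite_ord_nonzero[OF assms]])
  show "{p \<in> curve. rv p e 0} \<subseteq> {p \<in> curve. ord p e \<noteq> 0}"
  proof (intro subsetI CollectI conjI)
    fix p assume p: "p \<in> {p \<in> curve. rv p e 0}"
    then show "p \<in> curve" by blast
    then show "ord p e \<noteq> 0" using ord_pos_iff[OF _ assms, of p] p by simp
  qed
qed

text \<open>Forms with index above 1 vanish wherever the chart applies, since the values of \<phi>
  lie on the line; the first two thus describe \<phi> off a finite set.\<close>

lemma morphism_chart:
  assumes m: "morphism curve (proj_space 1) \<phi>" and x: "x \<in> curve"
  obtains n and F :: "nat \<Rightarrow> mpoly" where "homogeneous n (F 0)" "homogeneous n (F 1)"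
    "\<not> vanishes (F 0) x \<or> \<not> vanishes (F 1) x"
    "\<And>y. y \<in> curve \<Longrightarrow> \<not> vanishes (F 0) y \<or> \<not> vanishes (F 1) y \<Longrightarrow>
       \<phi> y = proj_point (vec3 (peval (F 0) (rep y)) (peval (F 1) (rep y)) 0)"
    "finite {y \<in> curve. vanishes (F 0) y \<and> vanishes (F 1) y}"
proof -
  obtain n F where F: "\<And>i. homogeneous n (F i)" "\<exists>i. \<not> vanishes (F i) x"
    "\<forall>y\<in>curve. (\<exists>i. \<not> vanishes (F i) y) \<longrightarrow> \<phi> y = proj_point (\<lambda>i. peval (F i) (rep y))"
    using m x unfolding morphism_def by metis
  have z: "peval (F i) (rep y) = 0" if y: "y \<in> curve" "\<exists>i. \<not> vanishes (F i) y" "i > 1" for y i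
  proof -
    have "\<phi> ` curve \<subseteq> proj_space 1" using m unfolding morphism_def by (rule conjunct1)
    then have "\<phi> y \<in> proj_space 1" using y(1) by (rule subsetD[OF _ imageI])
    moreover have "\<phi> y = proj_point (\<lambda>i. peval (F i) (rep y))" using F(3) y(1,2) by blast
    ultimately have "rep (proj_point (\<lambda>i. peval (F i) (rep y))) i = 0" using proj_space_rep(3)[OF _ y(3)] by metis
    moreover obtain c where "c \<noteq> 0" "rep (proj_point (\<lambda>i. peval (F i) (rep y))) = (\<lambda>i. c * peval (F i) (rep y))"
      using rep_proj_point by blast
    ultimately show ?thesis by simp
  qed
  have nz: "\<not> vanishes (F 0) y \<or> \<not> vanishes (F 1) y" if y: "y \<in> curve" "\<exists>i. \<not> vanishes (F i) y" for y
  proof -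
    obtain i where i: "\<not> vanishes (F i) y" using y by blast
    then have "\<not> i > 1" using z[OF y] unfolding vanishes_def by blast
    then have "i = 0 \<or> i = 1" by linarith
    then show ?thesis using i by blast
  qed
  show thesis
  proof (rule that[of n F])
    show "\<not> vanishes (F 0) x \<or> \<not> vanishes (F 1) x" by (rule nz[OF x F(2)])
    then obtain j where j: "j = 0 \<or> j = 1" "\<not> vanishes (F j) x" by blast
    then have "ev (F j) \<noteq> 0" using ev_nonzero_iff[OF F(1)] x by blast
    then have "finite {y \<in> curve. vanishes (F j) y}" by (rule ev_finite_zeros[OF F(1)])
    moreover have "{y \<in> curve. vanishes (F 0) y \<and> vanishes (F 1) y} \<subseteq> {y \<in> curve. vanishes (F j) y}" using j(1) by blast
    ultimately show "finite {y \<in> curve. vanishes (F 0) y \<and> vanishes (F 1) y}" by (rule finite_subset[rotated])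
    fix y assume y: "y \<in> curve" "\<not> vanishes (F 0) y \<or> \<not> vanishes (F 1) y"
    then have ex: "\<exists>i. \<not> vanishes (F i) y" by blast
    have "(\<lambda>i. peval (F i) (rep y)) = vec3 (peval (F 0) (rep y)) (peval (F 1) (rep y)) 0"
      by (rule vec3_exhaust_line) (rule z[OF y(1) ex])
    then show "\<phi> y = proj_point (vec3 (peval (F 0) (rep y)) (peval (F 1) (rep y)) 0)" using F(3) y(1) ex by simp
  qed (rule F(1))+
qed

text \<open>In a chart around x the fibre over [a:b] is cut out by the form b \<open>F 0\<close> - a
  \<open>F 1\<close>, which is zero on the curve as soon as it has infinitely many zeros.\<close>

lemma morphism_constant:
  assumes m: "morphism curve (proj_space 1) \<phi>" and inf: "infinite {x \<in> curve. \<phi> x = p}" and x: "x \<in> curve"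
  shows "\<phi> x = p"
proof -
  have "{x \<in> curve. \<phi> x = p} \<noteq> {}" using inf by (rule contrapos_nn) (simp only: finite.emptyI)
  then have "p \<in> proj_space 1" using m unfolding morphism_def by blast
  note pr = proj_space_rep[OF this]
  let ?a = "rep p 0" and ?b = "rep p 1"
  have "rep p = vec3 ?a ?b 0" by (rule vec3_exhaust_line) (rule pr(3))
  then have p: "p = proj_point (vec3 ?a ?b 0)" using pr(1) by metis
  have pnz: "?a \<noteq> 0 \<or> ?b \<noteq> 0" using pr(2,3) by (metis One_nat_def less_one linorder_neqE_nat)
  obtain n and F :: "nat \<Rightarrow> mpoly" where F: "homogeneous n (F 0)" "homogeneous n (F 1)"
    "\<not> vanishes (F 0) x \<or> \<not> vanishes (F 1) x"
    "\<And>y. y \<in> curve \<Longrightarrow> \<not> vanishes (F 0) y \<or> \<not> vanishes (F 1) y \<Longrightarrow>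
       \<phi> y = proj_point (vec3 (peval (F 0) (rep y)) (peval (F 1) (rep y)) 0)"
    "finite {y \<in> curve. vanishes (F 0) y \<and> vanishes (F 1) y}"
    by (rule morphism_chart[OF m x]) blast
  define H where "H = mconst ?b * F 0 - mconst ?a * F 1"
  have H: "homogeneous n H" unfolding H_def by (intro homogeneous_diff homogeneous_cmult F)
  have on: "\<phi> y = p \<longleftrightarrow> vanishes H y" if "y \<in> curve" "\<not> vanishes (F 0) y \<or> \<not> vanishes (F 1) y" for y
  proof -
    have "\<phi> y = p \<longleftrightarrow> \<phi> y = proj_point (vec3 ?a ?b 0)" by (rule arg_cong[OF p])
    also have "\<dots> \<longleftrightarrow> peval (F 0) (rep y) * ?b = ?a * peval (F 1) (rep y)"
      unfolding F(4)[OF that] by (rule line_point_eq_iff) (use that pnz in \<open>auto simp: vanishes_def\<close>)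
    also have "\<dots> \<longleftrightarrow> vanishes H y"
      unfolding vanishes_def H_def peval_gev by (simp add: gev_simps[OF rhom_id] gev_const[OF rhom_id] mult.commute)
    finally show ?thesis .
  qed
  have "infinite ({x \<in> curve. \<phi> x = p} - {y \<in> curve. vanishes (F 0) y \<and> vanishes (F 1) y})"
    by (rule Diff_infinite_finite[OF F(5) inf])
  moreover have "{x \<in> curve. \<phi> x = p} - {y \<in> curve. vanishes (F 0) y \<and> vanishes (F 1) y} \<subseteq> {y \<in> curve. vanishes H y}"
    using on by blast
  ultimately have "infinite {y \<in> curve. vanishes H y}" by (rule infinite_super[rotated])
  then have "ev H = 0" using ev_finite_zeros[OF H] by blast
  then show ?thesis using ev_zero_vanishes[OF H _ x] on[OF x F(3)] by blast
qed

text \<open>The function is the quotient of \<open>F 0\<close> by \<open>F 1\<close> in one chart. A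
  linear relation between these forms on the curve would make \<phi> constant, so the quotient
  exists and is not constant.\<close>

lemma morphism_to_line:
  assumes m: "morphism curve (proj_space 1) \<phi>" and nc: "\<not> (\<exists>c. \<forall>x\<in>curve. \<phi> x = c)"
  obtains h \<eta> where "h \<in> KK" "h \<notin> CC" "finite {y \<in> curve. \<not> (rv y h (\<eta> y) \<and> \<phi> y = proj_point (vec3 (\<eta> y) 1 0))}"
proof -
  obtain n and F :: "nat \<Rightarrow> mpoly" where F: "homogeneous n (F 0)" "homogeneous n (F 1)"
    "\<not> vanishes (F 0) infp \<or> \<not> vanishes (F 1) infp"
    "\<And>y. y \<in> curve \<Longrightarrow> \<not> vanishes (F 0) y \<or> \<not> vanishes (F 1) y \<Longrightarrow>
       \<phi> y = proj_point (vec3 (peval (F 0) (rep y)) (peval (F 1) (rep y)) 0)"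
    "finite {y \<in> curve. vanishes (F 0) y \<and> vanishes (F 1) y}"
    by (rule morphism_chart[OF m infp_curve]) blast
  let ?A = "\<lambda>y. peval (F 0) (rep y)" and ?B = "\<lambda>y. peval (F 1) (rep y)"
  have rat: "\<exists>y\<in>curve. \<not> vanishes (mconst a * F 1 - mconst b * F 0) y" if ab: "a \<noteq> 0 \<or> b \<noteq> 0" for a b
  proof (rule ccontr)
    assume "\<not> (\<exists>y\<in>curve. \<not> vanishes (mconst a * F 1 - mconst b * F 0) y)"
    then have z: "?A y * b = a * ?B y" if "y \<in> curve" for y
      using that unfolding vanishes_def peval_gev by (simp add: gev_simps[OF rhom_id] gev_const[OF rhom_id] mult.commute)
    have "\<phi> y = proj_point (vec3 a b 0)" if "y \<in> curve" "\<not> vanishes (F 0) y \<or> \<not> vanishes (F 1) y" for y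
      unfolding F(4)[OF that] by (subst line_point_eq_iff) (use that ab z in \<open>auto simp: vanishes_def\<close>)
    then have sub: "curve - {y \<in> curve. vanishes (F 0) y \<and> vanishes (F 1) y} \<subseteq> {y \<in> curve. \<phi> y = proj_point (vec3 a b 0)}"
      by blast
    have "infinite (curve - {y \<in> curve. vanishes (F 0) y \<and> vanishes (F 1) y})"
      by (rule Diff_infinite_finite[OF F(5) infinite_curve])
    then have "infinite {y \<in> curve. \<phi> y = proj_point (vec3 a b 0)}" by (rule infinite_super[OF sub])
    then show False using morphism_constant[OF m] nc by blast
  qed
  have H: "homogeneous n (mconst a * F 1 - mconst b * F 0)" for a b
    by (intro homogeneous_diff homogeneous_cmult F)
  have evH: "fls_const a * ev (F 1) \<noteq> fls_const b * ev (F 0)" if "a \<noteq> 0 \<or> b \<noteq> 0" for a b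
  proof -
    have "ev (mconst a * F 1 - mconst b * F 0) \<noteq> 0" using ev_nonzero_iff[OF H] rat[OF that] by blast
    then show ?thesis by (simp add: ev_simps)
  qed
  have F1: "ev (F 1) \<noteq> 0" using evH[of 1 0] by simp
  let ?h = "ev (F 0) / ev (F 1)"
  have fr: "is_frac (F 0) (F 1) n ?h" unfolding is_frac_def using F F1 by blast
  show thesis
  proof (rule that[of ?h "\<lambda>y. ?A y / ?B y"])
    show "?h \<in> KK" unfolding KK_def using fr by blast
    show "?h \<notin> CC"
    proof
      assume "?h \<in> CC"
      then obtain c where "?h = fls_const c" by blast
      then have "fls_const c * ev (F 1) = fls_const 1 * ev (F 0)" using F1 by (simp add: field_simps)
      then show False using evH[of c 1] by simp
    qed
    have "{y \<in> curve. \<not> (rv y ?h (?A y / ?B y) \<and> \<phi> y = proj_point (vec3 (?A y / ?B y) 1 0))} \<subseteq> {y \<in> curve. vanishes (F 1) y}"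
    proof (intro subsetI CollectI conjI)
      fix y assume y: "y \<in> {y \<in> curve. \<not> (rv y ?h (?A y / ?B y) \<and> \<phi> y = proj_point (vec3 (?A y / ?B y) 1 0))}"
      then show "y \<in> curve" by blast
      show "vanishes (F 1) y"
      proof (rule ccontr)
        assume nv: "\<not> vanishes (F 1) y"
        have "rv y ?h (?A y / ?B y)" using y by (intro rvI[OF _ fr nv]) blast
        moreover have "\<phi> y = proj_point (vec3 (?A y / ?B y) 1 0)"
          using y nv by (subst F(4), blast, blast, subst line_point_eq_iff) (auto simp: vanishes_def)
        ultimately show False using y by blast
      qed
    qed
    then show "finite {y \<in> curve. \<not> (rv y ?h (?A y / ?B y) \<and> \<phi> y = proj_point (vec3 (?A y / ?B y) 1 0))}"
      by (rule finite_subset) (rule ev_finite_zeros[OF F(2) F1])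
  qed
qed

text \<open>Representatives of germs are determined only up to finite sets. The preimages of finite
  sets are finite because \<phi> is not constant, so pulling back amounts to evaluation at
  h.\<close>

lemma pullback_field:
  assumes m: "morphism curve (proj_space 1) \<phi>" and nc: "\<not> (\<exists>c. \<forall>x\<in>curve. \<phi> x = c)"
    and h: "h \<in> KK" "h \<notin> CC"
    and \<eta>: "finite {y \<in> curve. \<not> (rv y h (\<eta> y) \<and> \<phi> y = proj_point (vec3 (\<eta> y) 1 0))}"
  shows "{germ curve (rep A \<circ> \<phi>) | A. A \<in> carrier (function_field (proj_space 1))} = gm ` Ch h"
proof -
  have fib: "finite {x \<in> curve. \<phi> x \<in> T}" if "finite T" for T
  proof -
    have "finite {x \<in> curve. \<phi> x = p}" for p
    proof (rule ccontr)
      assume inf: "infinite {x \<in> curve. \<phi> x = p}"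
      have "\<forall>x\<in>curve. \<phi> x = p" by (intro ballI morphism_constant[OF m inf])
      then show False using nc by blast
    qed
    then have "finite (\<Union>p\<in>T. {x \<in> curve. \<phi> x = p})" by (intro finite_UN_I that)
    moreover have "{x \<in> curve. \<phi> x \<in> T} \<subseteq> (\<Union>p\<in>T. {x \<in> curve. \<phi> x = p})" by blast
    ultimately show ?thesis by (rule finite_subset[rotated])
  qed
  have pull: "germ curve (rep (quotient_germ (proj_space 1) F G) \<circ> \<phi>) = gm (PE h (dehom F) / PE h (dehom G))"
    if F: "homogeneous n F" "homogeneous n G" and G: "dehom G \<noteq> 0" for F G n
  proof -
    let ?f = "\<lambda>x. peval F (rep x) / peval G (rep x)"
    let ?A = "quotient_germ (proj_space 1) F G" and ?e = "PE h (dehom F) / PE h (dehom G)"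
    let ?T = "{x \<in> proj_space 1. rep ?A x \<noteq> ?f x}" and ?E = "{y \<in> curve. \<not> (rv y h (\<eta> y) \<and> \<phi> y = proj_point (vec3 (\<eta> y) 1 0))}"
    have T: "finite ?T" unfolding quotient_germ_def by (rule rep_germ[OF cofinite_line])
    have G0: "PE h (dehom G) \<noteq> 0" using PE_transcendental[OF h(2)] G by blast
    have GK: "PE h (dehom G) \<in> KK" by (intro KK_PE h)
    have K: "?e \<in> KK" by (intro KK_divide KK_PE h)
    have "{y \<in> curve. \<not> rv y ?e ((rep ?A \<circ> \<phi>) y)} \<subseteq> {x \<in> curve. \<phi> x \<in> ?T} \<union> ?E \<union> {p \<in> curve. rv p (PE h (dehom G)) 0}"
    proof
      fix y assume y: "y \<in> {y \<in> curve. \<not> rv y ?e ((rep ?A \<circ> \<phi>) y)}"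
      show "y \<in> {x \<in> curve. \<phi> x \<in> ?T} \<union> ?E \<union> {p \<in> curve. rv p (PE h (dehom G)) 0}"
      proof (rule ccontr)
        assume n: "\<not> ?thesis"
        have yc: "y \<in> curve" using y by blast
        have rvy: "rv y h (\<eta> y)" and py: "\<phi> y = proj_point (vec3 (\<eta> y) 1 0)" using n yc by blast+
        have "\<phi> y \<in> proj_space 1" unfolding py by (rule line_point_in_space) simp
        then have "rep ?A (\<phi> y) = ?f (\<phi> y)" using n yc by blast
        also have "\<dots> = poly (dehom F) (\<eta> y) / poly (dehom G) (\<eta> y)"
          unfolding py poly_dehom by (rule peval_quotient_proj_point[OF F])
        finally have v: "(rep ?A \<circ> \<phi>) y = poly (dehom F) (\<eta> y) / poly (dehom G) (\<eta> y)" by simp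
        have "poly (dehom G) (\<eta> y) \<noteq> 0"
        proof
          assume "poly (dehom G) (\<eta> y) = 0"
          then have "rv y (PE h (dehom G)) 0" using rv_PE[OF rvy, of "dehom G"] by simp
          then show False using n yc by blast
        qed
        then have "rv y ?e ((rep ?A \<circ> \<phi>) y)" unfolding v by (intro rv_divide rv_PE rvy)
        then show False using y by blast
      qed
    qed
    moreover have "finite ({x \<in> curve. \<phi> x \<in> ?T} \<union> ?E \<union> {p \<in> curve. rv p (PE h (dehom G)) 0})"
      using fib[OF T] \<eta> finite_rv_zeros[OF GK G0] by (intro finite_UnI)
    ultimately have "finite {y \<in> curve. \<not> rv y ?e ((rep ?A \<circ> \<phi>) y)}" by (rule finite_subset)
    then show ?thesis by (rule iffD2[OF gm_germ_iff[OF K], symmetric])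
  qed
  have carr: "carrier (function_field (proj_space 1)) = {quotient_germ (proj_space 1) F G | F G n.
    homogeneous n F \<and> homogeneous n G \<and> (\<exists>x\<in>proj_space 1. \<not> vanishes G x)}"
    by (simp add: function_field_def)
  show ?thesis
  proof (intro equalityI subsetI)
    fix g assume "g \<in> {germ curve (rep A \<circ> \<phi>) | A. A \<in> carrier (function_field (proj_space 1))}"
    then obtain F G n where F: "homogeneous n F" "homogeneous n G" "\<exists>x\<in>proj_space 1. \<not> vanishes G x"
      "g = germ curve (rep (quotient_germ (proj_space 1) F G) \<circ> \<phi>)"
      unfolding carr by blast
    have G: "dehom G \<noteq> 0" using dehom_0_vanishes[OF F(2)] F(3) by blast
    have "PE h (dehom G) \<noteq> 0" using PE_transcendental[OF h(2)] G by blast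
    then show "g \<in> gm ` Ch h" unfolding F(4) pull[OF F(1,2) G] by (intro imageI ChI)
  next
    fix g assume "g \<in> gm ` Ch h"
    then obtain P Q where PQ: "g = gm (PE h P / PE h Q)" "PE h Q \<noteq> 0" unfolding Ch_def by blast
    define n where "n = max (degree P) (degree Q)"
    have dP: "dehom (rehom n P) = P" and dQ: "dehom (rehom n Q) = Q"
      by (rule dehom_rehom; simp add: n_def)+
    have Q: "Q \<noteq> 0" using PQ(2) by auto
    have "\<exists>x\<in>proj_space 1. \<not> vanishes (rehom n Q) x"
    proof -
      obtain t where "poly Q t \<noteq> 0" using Q poly_all_0_iff_0 by blast
      then have "\<not> vanishes (rehom n Q) (proj_point (vec3 t 1 0))"
        unfolding vanishes_proj_point[OF homogeneous_rehom] using poly_dehom[of "rehom n Q" t] dQ by simp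
      moreover have "proj_point (vec3 t 1 0) \<in> proj_space 1" by (rule line_point_in_space) simp
      ultimately show ?thesis by blast
    qed
    then have "quotient_germ (proj_space 1) (rehom n P) (rehom n Q) \<in> carrier (function_field (proj_space 1))"
      unfolding carr by (intro CollectI exI[of _ "rehom n P"] exI[of _ "rehom n Q"] exI[of _ n] conjI refl homogeneous_rehom)
    moreover have "g = germ curve (rep (quotient_germ (proj_space 1) (rehom n P) (rehom n Q)) \<circ> \<phi>)"
      using pull[OF homogeneous_rehom homogeneous_rehom, of n Q P] Q unfolding dP dQ PQ(1) by simp
    ultimately show "g \<in> {germ curve (rep A \<circ> \<phi>) | A. A \<in> carrier (function_field (proj_space 1))}" by blast
  qed
qed

lemma morphism_degree_eq:
  assumes "morphism curve (proj_space 1) \<phi>" "\<not> (\<exists>c. \<forall>x\<in>curve. \<phi> x = c)"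
    and "h \<in> KK" "h \<notin> CC" "finite {y \<in> curve. \<not> (rv y h (\<eta> y) \<and> \<phi> y = proj_point (vec3 (\<eta> y) 1 0))}"
    and "ring.dimension FF e (gm ` Ch h) (gm ` KK)"
  shows "morphism_degree curve (proj_space 1) \<phi> = e"
  unfolding morphism_degree_def pullback_field[OF assms(1-5)] carrier_FF
  by (rule dim_eqI[OF subfld_Ch(1)[OF assms(3)] assms(6)])

lemma morphism_degree_ge:
  assumes "morphism curve (proj_space 1) \<phi>" "\<not> (\<exists>c. \<forall>x\<in>curve. \<phi> x = c)"
  shows "d - 1 \<le> morphism_degree curve (proj_space 1) \<phi>"
proof -
  obtain h \<eta> where h: "h \<in> KK" "h \<notin> CC" "finite {y \<in> curve. \<not> (rv y h (\<eta> y) \<and> \<phi> y = proj_point (vec3 (\<eta> y) 1 0))}"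
    by (rule morphism_to_line[OF assms])
  obtain e where e: "ring.dimension FF e (gm ` Ch h) (gm ` KK)" using finite_dimension_over_Ch[OF h(1,2)] by blast
  show ?thesis using morphism_degree_eq[OF assms h e] dimension_lower_bound[OF h(1,2) e] by simp
qed

section \<open>The projection from the point at infinity\<close>

definition proj_y :: "point \<Rightarrow> point" where
  "proj_y p = (if p = infp then proj_point (vec3 1 0 0) else proj_point (vec3 (rep p 1) (rep p 2) 0))"

lemma rep_pt: obtains c where "c \<noteq> 0" "rep (pt a b) = vec3 (c * a) (c * b) c"
proof -
  obtain c where "c \<noteq> 0" "rep (pt a b) = (\<lambda>i. c * vec3 a b 1 i)"
    unfolding pt_def using rep_proj_point by blast
  then show thesis using that by (simp add: vec3_scale)
qed

lemma rep_infp: obtains c where "c \<noteq> 0" "rep infp = vec3 c 0 0"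
proof -
  obtain c where "c \<noteq> 0" "rep infp = (\<lambda>i. c * vec3 1 0 0 i)"
    unfolding infp_def using rep_proj_point by blast
  then show thesis using that by (simp add: vec3_scale)
qed

lemma proj_y_pt: "proj_y (pt a b) = proj_point (vec3 b 1 0)"
proof -
  obtain c where "c \<noteq> 0" "rep (pt a b) = vec3 (c * a) (c * b) c" by (rule rep_pt)
  then show ?thesis by (simp add: proj_y_def line_point_eq_iff)
qed

text \<open>The chart [x1 : x2] fails at infinity. The curve equation x1^d = (x0^(d-1) - x2^(d-1))
  x2 rewrites it as [x0^(d-1) - x2^(d-1) : x1^(d-1)], which is [1 : 0] there.\<close>

lemma morphism_proj_y: "morphism curve (proj_space 1) proj_y"
  unfolding morphism_def
proof (intro conjI ballI)
  show "proj_y ` curve \<subseteq> proj_space 1"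
  proof
    fix q assume "q \<in> proj_y ` curve"
    then obtain p where p: "p \<in> curve" "q = proj_y p" by blast
    show "q \<in> proj_space 1" using p(1)
    proof (cases rule: curve_cases)
      case 1
      then show ?thesis unfolding p(2) proj_y_def by (simp add: line_point_in_space)
    next
      case (2 a b)
      then show ?thesis unfolding p(2) 2 proj_y_pt by (simp add: line_point_in_space)
    qed
  qed
  have nv: "(\<exists>i. \<not> vanishes (vec3 F G 0 i) y) \<longleftrightarrow> \<not> vanishes F y \<or> \<not> vanishes G y" for F G y
  proof -
    have "vanishes (vec3 F G 0 i) y \<longleftrightarrow> (i = 0 \<longrightarrow> vanishes F y) \<and> (i = 1 \<longrightarrow> vanishes G y)" for i
      by (auto simp: vec3_def vanishes_def peval_gev)
    then show ?thesis by auto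
  qed
  have pv: "(\<lambda>i. peval (vec3 F G 0 i) v) = vec3 (peval F v) (peval G v) 0" for F G v
    by (auto simp: vec3_def peval_gev)
  let ?F = "mvar 0 ^ (d - 1) - mvar 2 ^ (d - 1)" and ?G = "mvar 1 ^ (d - 1)"
  have pe: "peval (mvar i) v = v i" "peval ?F v = v 0 ^ (d - 1) - v 2 ^ (d - 1)" "peval ?G v = v 1 ^ (d - 1)" for i v
    unfolding peval_gev by (simp_all add: gev_simps[OF rhom_id] gev_var[OF rhom_id])
  have z0: "(0 :: complex) ^ (d - 1) = 0" by (rule zero_power) (use d4 in simp)
  fix x assume "x \<in> curve"
  then show "\<exists>n F. (\<forall>i. homogeneous n (F i)) \<and> (\<exists>i. \<not> vanishes (F i) x) \<and>
    (\<forall>y\<in>curve. (\<exists>i. \<not> vanishes (F i) y) \<longrightarrow> proj_y y = proj_point (\<lambda>i. peval (F i) (rep y)))"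
  proof (cases rule: curve_cases)
    case (2 a b)
    show ?thesis
    proof (rule exI[of _ 1], rule exI[of _ "vec3 (mvar 1) (mvar 2) 0"], intro conjI allI ballI impI)
      show "homogeneous 1 (vec3 (mvar 1) (mvar 2) 0 i)" for i by (simp add: vec3_def homogeneous_var)
      obtain c where c: "c \<noteq> 0" "rep (pt a b) = vec3 (c * a) (c * b) c" by (rule rep_pt)
      show "\<exists>i. \<not> vanishes (vec3 (mvar 1) (mvar 2) 0 i) x" unfolding nv unfolding 2 vanishes_def pe c using c(1) by simp
      fix y assume y: "y \<in> curve" "\<exists>i. \<not> vanishes (vec3 (mvar 1) (mvar 2) 0 i) y"
      obtain c' where c': "c' \<noteq> 0" "rep infp = vec3 c' 0 0" by (rule rep_infp)
      have "y \<noteq> infp" using y(2) unfolding nv unfolding vanishes_def pe by (auto simp: c')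
      then show "proj_y y = proj_point (\<lambda>i. peval (vec3 (mvar 1) (mvar 2) 0 i) (rep y))"
        unfolding pv pe by (simp add: proj_y_def)
    qed
  next
    case 1
    show ?thesis
    proof (rule exI[of _ "d - 1"], rule exI[of _ "vec3 ?F ?G 0"], intro conjI allI ballI impI)
      show "homogeneous (d - 1) (vec3 ?F ?G 0 i)" for i
        by (simp add: vec3_def homogeneous_diff homogeneous_var_power)
      obtain c where c: "c \<noteq> 0" "rep infp = vec3 c 0 0" by (rule rep_infp)
      show "\<exists>i. \<not> vanishes (vec3 ?F ?G 0 i) x" unfolding nv unfolding 1 vanishes_def pe c using c(1) by (simp add: z0)
      fix y assume y: "y \<in> curve" "\<exists>i. \<not> vanishes (vec3 ?F ?G 0 i) y"
      show "proj_y y = proj_point (\<lambda>i. peval (vec3 ?F ?G 0 i) (rep y))" using y(1)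
      proof (cases rule: curve_cases)
        case 1
        have "proj_point (vec3 1 0 0) = proj_point (vec3 (c ^ (d - 1)) 0 0)"
          using c(1) by (subst line_point_eq_iff) auto
        then show ?thesis unfolding pv pe 1 c proj_y_def by (simp add: z0)
      next
        case (2 a b)
        obtain c where c: "c \<noteq> 0" "rep (pt a b) = vec3 (c * a) (c * b) c" by (rule rep_pt)
        have ab: "b ^ d = a ^ (d - 1) - 1" using 2(2) by (simp add: Aff_def)
        have p0: "(c * a) ^ (d - 1) - c ^ (d - 1) = c ^ (d - 1) * (b * b ^ (d - 1))"
        proof -
          have "b * b ^ (d - 1) = b ^ d" using power_Suc[of b "d - 1"] d4 by simp
          then have e: "b * b ^ (d - 1) = a ^ (d - 1) - 1" unfolding ab .
          show ?thesis unfolding e power_mult_distrib by (simp add: right_diff_distrib)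
        qed
        have "\<not> vanishes ?F (pt a b) \<or> \<not> vanishes ?G (pt a b)" using y(2) unfolding nv unfolding 2 .
        then have "b ^ (d - 1) \<noteq> 0"
          unfolding vanishes_def pe c vec3_simps unfolding p0 by (auto simp: power_mult_distrib)
        then have "proj_point (vec3 b 1 0) = proj_point (vec3 ((c * a) ^ (d - 1) - c ^ (d - 1)) ((c * b) ^ (d - 1)) 0)"
          unfolding p0 using c(1) by (subst line_point_eq_iff) (auto simp: power_mult_distrib)
        then show ?thesis unfolding 2 proj_y_pt pv pe c vec3_simps .
      qed
    qed
  qed
qed

theorem gonality_curve: "gonality curve = d - 1"
proof -
  obtain a b where ab: "(a, b) \<in> Aff" using infinite_Aff by (metis finite.emptyI ex_in_conv surj_pair)
  have nc: "\<not> (\<exists>c. \<forall>x\<in>curve. proj_y x = c)"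
  proof
    assume "\<exists>c. \<forall>x\<in>curve. proj_y x = c"
    then have "proj_y (pt a b) = proj_y infp" using ab by (metis infp_curve pt_curve)
    then show False unfolding proj_y_pt by (simp add: proj_y_def line_point_eq_iff)
  qed
  have yC: "ys \<notin> CC"
  proof
    assume "ys \<in> CC"
    then have "fls_subdegree ys = 0" by auto
    then show False using subdegree_ys d4 by simp
  qed
  have fin: "finite {y \<in> curve. \<not> (rv y ys (rep y 1 / rep y 2) \<and> proj_y y = proj_point (vec3 (rep y 1 / rep y 2) 1 0))}"
  proof (rule finite_subset)
    show "{y \<in> curve. \<not> (rv y ys (rep y 1 / rep y 2) \<and> proj_y y = proj_point (vec3 (rep y 1 / rep y 2) 1 0))} \<subseteq> {infp}"
    proof
      fix y assume y: "y \<in> {y \<in> curve. \<not> (rv y ys (rep y 1 / rep y 2) \<and> proj_y y = proj_point (vec3 (rep y 1 / rep y 2) 1 0))}"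
      then have "y \<in> curve" by blast
      then show "y \<in> {infp}"
      proof (cases rule: curve_cases)
        case (2 a b)
        obtain c where c: "c \<noteq> 0" "rep (pt a b) = vec3 (c * a) (c * b) c" by (rule rep_pt)
        have "rep y 1 / rep y 2 = b" unfolding 2 c(2) using c(1) by simp
        then have "rv y ys (rep y 1 / rep y 2) \<and> proj_y y = proj_point (vec3 (rep y 1 / rep y 2) 1 0)"
          using rv_ys[OF 2(2)] proj_y_pt[of a b] unfolding 2 by simp
        then show ?thesis using y by blast
      qed simp
    qed
  qed simp
  obtain m where m: "m \<le> d - 1" "ring.dimension FF m (gm ` Ch ys) (gm ` KK)" using dimension_over_Cy by blast
  have "morphism_degree curve (proj_space 1) proj_y = m"
    by (rule morphism_degree_eq[OF morphism_proj_y nc KK_ys yC fin m(2)])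
  then have deg: "morphism_degree curve (proj_space 1) proj_y = d - 1"
    using morphism_degree_ge[OF morphism_proj_y nc] m(1) by simp
  show ?thesis unfolding gonality_def
  proof (rule Least_equality)
    show "\<exists>\<phi>. morphism curve (proj_space 1) \<phi> \<and> \<not> (\<exists>c. \<forall>x\<in>curve. \<phi> x = c) \<and>
      d - 1 = morphism_degree curve (proj_space 1) \<phi>"
      using morphism_proj_y nc deg by metis
    fix n assume "\<exists>\<phi>. morphism curve (proj_space 1) \<phi> \<and> \<not> (\<exists>c. \<forall>x\<in>curve. \<phi> x = c) \<and>
      n = morphism_degree curve (proj_space 1) \<phi>"
    then show "d - 1 \<le> n" using morphism_degree_ge by blast
  qed
qed

end

section \<open>Alternating sums and determinants of functionals\<close>

text \<open>The sum of \<open>(-1)\<^sup>i F v\<^sub>i (v\<^sub>0, \<dots>, v\<^sub>i\<^sub>-\<^sub>1, v\<^sub>i\<^sub>+\<^sub>1, \<dots>)\<close>, by recursion on the list.\<close>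

fun asum :: "'a list \<Rightarrow> ('a \<Rightarrow> 'a list \<Rightarrow> 'v::ab_group_add) \<Rightarrow> 'v" where
  "asum [] F = 0"
| "asum (v # vs) F = F v vs - asum vs (\<lambda>x L. F x (v # L))"

lemma asum_cong:
  "(\<And>x L. mset vs = add_mset x (mset L) \<Longrightarrow> F x L = G x L) \<Longrightarrow> asum vs F = asum vs G"
proof (induction vs arbitrary: F G)
  case (Cons v vs)
  have "asum vs (\<lambda>x L. F x (v # L)) = asum vs (\<lambda>x L. G x (v # L))"
    by (rule Cons.IH) (use Cons.prems in simp)
  then show ?case using Cons.prems[of v vs] by simp
qed simp

lemma asum_0: "asum vs (\<lambda>x L. 0) = 0"
  by (induction vs) auto

lemma asum_eq_0: "(\<And>x L. mset vs = add_mset x (mset L) \<Longrightarrow> F x L = 0) \<Longrightarrow> asum vs F = 0"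
  using asum_cong[of vs F "\<lambda>x L. 0"] asum_0 by metis

lemma asum_hom:
  assumes "\<And>a b. h (a - b) = h a - h b"
  shows "h (asum vs F) = asum vs (\<lambda>x L. h (F x L))"
proof (induction vs arbitrary: F)
  case Nil
  show ?case using assms[of 0 0] by simp
qed (simp add: assms)

lemma asum_diff: "asum vs (\<lambda>x L. F x L - G x L) = asum vs F - asum vs G"
  by (induction vs arbitrary: F G) (auto simp: algebra_simps)

lemma asum_add: "asum vs (\<lambda>x L. F x L + G x L) = asum vs F + asum vs G"
  by (induction vs arbitrary: F G) (auto simp: algebra_simps)

lemma asum_uminus: "asum vs (\<lambda>x L. - F x L) = - asum vs F"
  using asum_diff[of vs "\<lambda>x L. 0" F] by (simp add: asum_0)

lemma asum_cmult: "asum vs (\<lambda>x L. c * F x L) = (c :: complex) * asum vs F"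
  by (induction vs arbitrary: F) (auto simp: algebra_simps)

lemma asum_map: "asum (map f vs) F = asum vs (\<lambda>x L. F (f x) (map f L))"
  by (induction vs arbitrary: F) auto

lemma asum_swap: "asum vs (\<lambda>x L. asum ws (\<lambda>y M. H x L y M)) = asum ws (\<lambda>y M. asum vs (\<lambda>x L. H x L y M))"
  by (induction vs arbitrary: H) (auto simp: asum_0 asum_diff)

lemma asum_closed:
  assumes "0 \<in> S" "\<And>a b. a \<in> S \<Longrightarrow> b \<in> S \<Longrightarrow> a - b \<in> S"
  shows "(\<And>x L. mset vs = add_mset x (mset L) \<Longrightarrow> F x L \<in> S) \<Longrightarrow> asum vs F \<in> S"
proof (induction vs arbitrary: F)
  case (Cons v vs)
  have "asum vs (\<lambda>x L. F x (v # L)) \<in> S"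
    by (rule Cons.IH) (use Cons.prems in simp)
  then show ?case using Cons.prems[of v vs] assms(2) by simp
qed (use assms in simp)

text \<open>Deleting two entries in the two possible orders gives opposite signs. Both the square of
  the Koszul differential and the alternating property of determinants come down to this.\<close>

lemma asum_asum_symmetric:
  "(\<And>M x y. x \<in> set vs \<Longrightarrow> y \<in> set vs \<Longrightarrow> f M x y = f M y x) \<Longrightarrow>
   asum vs (\<lambda>x L. asum L (\<lambda>y M. f M x y)) = 0"
proof (induction vs arbitrary: f)
  case (Cons v vs)
  have "asum vs (\<lambda>x L. asum L (\<lambda>y M. f (v # M) x y)) = 0"
    by (rule Cons.IH) (use Cons.prems in simp)
  moreover have "asum vs (\<lambda>x L. f L v x) = asum vs (\<lambda>x L. f L x v)"
  proof (rule asum_cong)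
    fix x L assume "mset vs = add_mset x (mset L)"
    then have "x \<in> set vs" by (metis set_mset_mset union_single_eq_member)
    then show "f L v x = f L x v" using Cons.prems by simp
  qed
  ultimately show ?case by (simp add: asum_diff)
qed simp

lemma asum_nth: "asum vs F = (\<Sum>j<length vs. (if even j then F (vs ! j) (take j vs @ drop (Suc j) vs)
    else - F (vs ! j) (take j vs @ drop (Suc j) vs)))"
proof (induction vs arbitrary: F)
  case (Cons v vs)
  show ?case unfolding asum.simps Cons.IH length_Cons sum.lessThan_Suc_shift
    by (simp add: sum_negf[symmetric] diff_conv_add_uminus if_distrib[of uminus] cong: if_cong del: add_uminus_conv_diff)
      (rule sum.cong, auto)
qed simp

text \<open>Determinant of the matrix with rows \<open>rs\<close> and columns \<open>vs\<close>,
  expanded along the first column; it is 0 for lists of different lengths.\<close>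

fun detf :: "('a \<Rightarrow> complex) list \<Rightarrow> 'a list \<Rightarrow> complex" where
  "detf rs [] = (if rs = [] then 1 else 0)"
| "detf rs (v # vs) = asum rs (\<lambda>r L. r v * detf L vs)"

lemma mset_removed: "mset rs = add_mset r (mset L) \<Longrightarrow> r \<in> set rs \<and> set L \<subseteq> set rs"
proof -
  assume "mset rs = add_mset r (mset L)"
  then have "set rs = insert r (set L)" by (metis set_mset_add_mset_insert set_mset_mset)
  then show ?thesis by blast
qed

lemma detf_add:
  "(\<And>r. r \<in> set rs \<Longrightarrow> r u = r v + r w) \<Longrightarrow> detf rs (xs @ u # ys) = detf rs (xs @ v # ys) + detf rs (xs @ w # ys)"
proof (induction xs arbitrary: rs)
  case Nil
  show ?case unfolding append.simps detf.simps asum_add[symmetric]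
    by (rule asum_cong) (use Nil mset_removed in \<open>fastforce simp: algebra_simps\<close>)
next
  case (Cons x xs)
  show ?case unfolding append.simps detf.simps asum_add[symmetric]
  proof (rule asum_cong)
    fix r L assume m: "mset rs = add_mset r (mset L)"
    have "detf L (xs @ u # ys) = detf L (xs @ v # ys) + detf L (xs @ w # ys)"
      by (rule Cons.IH) (use Cons.prems mset_removed[OF m] in auto)
    then show "r x * detf L (xs @ u # ys) = r x * detf L (xs @ v # ys) + r x * detf L (xs @ w # ys)"
      by (simp add: algebra_simps)
  qed
qed

lemma detf_scale:
  "(\<And>r. r \<in> set rs \<Longrightarrow> r u = c * r v) \<Longrightarrow> detf rs (xs @ u # ys) = c * detf rs (xs @ v # ys)"
proof (induction xs arbitrary: rs)
  case Nil
  show ?case unfolding append.simps detf.simps asum_cmult[symmetric]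
    by (rule asum_cong) (use Nil mset_removed in \<open>fastforce simp: algebra_simps\<close>)
next
  case (Cons x xs)
  show ?case unfolding append.simps detf.simps asum_cmult[symmetric]
  proof (rule asum_cong)
    fix r L assume m: "mset rs = add_mset r (mset L)"
    have "detf L (xs @ u # ys) = c * detf L (xs @ v # ys)"
      by (rule Cons.IH) (use Cons.prems mset_removed[OF m] in auto)
    then show "r x * detf L (xs @ u # ys) = c * (r x * detf L (xs @ v # ys))"
      by (simp add: algebra_simps)
  qed
qed

lemma detf_swap: "detf rs (xs @ a # b # ys) = - detf rs (xs @ b # a # ys)"
proof (induction xs arbitrary: rs)
  case Nil
  have "detf rs (a # b # ys) + detf rs (b # a # ys)
    = asum rs (\<lambda>r L. asum L (\<lambda>r' M. (r a * r' b + r b * r' a) * detf M ys))"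
    by (simp add: asum_cmult[symmetric] asum_add[symmetric] algebra_simps)
  also have "\<dots> = 0" by (rule asum_asum_symmetric) (simp add: algebra_simps)
  finally show ?case by (simp add: eq_neg_iff_add_eq_0)
next
  case (Cons x xs)
  show ?case by (simp add: Cons asum_uminus)
qed

lemma detf_repeated_entry: "detf rs (xs @ a # ys @ a # zs) = 0"
proof (induction ys arbitrary: xs)
  case Nil
  show ?case using detf_swap[of rs xs a a zs] by simp
next
  case (Cons b ys)
  show ?case using detf_swap[of rs xs a b "ys @ a # zs"] Cons[of "xs @ [b]"] by simp
qed

text \<open>Expansion along the first row agrees with the definition by columns because the two
  deletions commute (\<open>asum_swap\<close>). The Koszul differential deletes columns, so it has
  to be matched with a row expansion.\<close>

lemma detf_row_expansion: "asum vs (\<lambda>v L. r v * detf rs L) = detf (r # rs) vs"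
proof (induction vs arbitrary: rs)
  case (Cons v vs)
  have "asum vs (\<lambda>x L. r x * detf rs (v # L)) = asum vs (\<lambda>x L. asum rs (\<lambda>r' M. r x * (r' v * detf M L)))"
    by (simp add: asum_cmult)
  also have "\<dots> = asum rs (\<lambda>r' M. asum vs (\<lambda>x L. r x * (r' v * detf M L)))" by (rule asum_swap)
  also have "\<dots> = asum rs (\<lambda>r' M. r' v * detf (r # M) vs)"
    by (simp add: Cons[symmetric] asum_cmult[symmetric] mult_ac)
  finally show ?case by simp
qed simp

lemma detf_repeated_functional: "r \<in> set rs \<Longrightarrow> detf (r # rs) vs = 0"
proof (induction rs arbitrary: vs)
  case (Cons r' rs)
  have "detf (r # r' # rs) vs + detf (r' # r # rs) vs
    = asum vs (\<lambda>x L. asum L (\<lambda>y M. (r x * r' y + r' x * r y) * detf rs M))"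
    unfolding detf_row_expansion[symmetric] by (simp add: asum_cmult[symmetric] asum_add[symmetric] algebra_simps)
  also have "\<dots> = 0" by (rule asum_asum_symmetric) (simp add: algebra_simps)
  finally have sw: "detf (r # r' # rs) vs = - detf (r' # r # rs) vs" by (simp add: eq_neg_iff_add_eq_0)
  show ?case
  proof (cases "r = r'")
    case True
    then show ?thesis using sw by simp
  next
    case False
    then have "detf (r # rs) L = 0" for L using Cons by simp
    then have "detf (r' # r # rs) vs = 0" unfolding detf_row_expansion[of vs r' "r # rs", symmetric] by (simp add: asum_0)
    then show ?thesis using sw by simp
  qed
qed simp

lemma detf_vanishing_functional: "r \<in> set rs \<Longrightarrow> (\<And>v. v \<in> set vs \<Longrightarrow> r v = 0) \<Longrightarrow> detf rs vs = 0"
proof (induction vs arbitrary: rs)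
  case (Cons v vs)
  show ?case unfolding detf.simps
  proof (rule asum_eq_0)
    fix r' L assume m: "mset rs = add_mset r' (mset L)"
    then have "set rs = insert r' (set L)" by (metis set_mset_add_mset_insert set_mset_mset)
    then have "r' = r \<or> r \<in> set L" using Cons.prems(1) by auto
    then show "r' v * detf L vs = 0"
    proof
      assume "r \<in> set L"
      then have "detf L vs = 0" by (rule Cons.IH) (use Cons.prems in simp)
      then show ?thesis by simp
    qed (use Cons.prems in simp)
  qed
qed auto

lemma detf_dual:
  assumes "distinct ws" "\<And>x y. x \<in> set ws \<Longrightarrow> y \<in> set ws \<Longrightarrow> \<delta> x (E y) = (if x = y then 1 else 0)"
  shows "detf (map \<delta> ws) (map E ws) = 1"
  using assms
proof (induction ws)
  case (Cons w ws)
  have "asum (map \<delta> ws) (\<lambda>r L. r (E w) * detf (\<delta> w # L) (map E ws)) = 0"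
    unfolding asum_map
  proof (rule asum_eq_0)
    fix x L assume m: "mset ws = add_mset x (mset L)"
    have "x \<in> set ws" using mset_removed[OF m] by simp
    then show "\<delta> x (E w) * detf (\<delta> w # map \<delta> L) (map E ws) = 0" using Cons.prems by auto
  qed
  then show ?case using Cons by simp
qed simp


section \<open>Koszul chains\<close>

lemma lookup_chain_scale: "Poly_Mapping.lookup (chain_scale c z) g = c * Poly_Mapping.lookup z g"
  by (simp add: Poly_Mapping.map.rep_eq when_def)

lemma module_chain_scale: "Modules.module chain_scale"
  by unfold_locales (auto intro!: poly_mapping_eqI simp: lookup_chain_scale lookup_add algebra_simps)

lemma chain_scale_sign: "chain_scale ((- 1) ^ j) z = (if even j then z else - z)"
  by (auto intro!: poly_mapping_eqI simp: lookup_chain_scale)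

lemma keys_chain_scale: "Poly_Mapping.keys (chain_scale c z) \<subseteq> Poly_Mapping.keys z"
  by (auto simp: in_keys_iff lookup_chain_scale)

definition pairing :: "(ratfun list \<times> ratfun \<Rightarrow> complex) \<Rightarrow> koszul_chain \<Rightarrow> complex" where
  "pairing \<psi> z = (\<Sum>g\<in>Poly_Mapping.keys z. Poly_Mapping.lookup z g * \<psi> g)"

lemma pairing_superset:
  "finite S \<Longrightarrow> Poly_Mapping.keys z \<subseteq> S \<Longrightarrow> pairing \<psi> z = (\<Sum>g\<in>S. Poly_Mapping.lookup z g * \<psi> g)"
  unfolding pairing_def by (rule sum.mono_neutral_left) (auto simp: in_keys_iff)

lemma pairing_add: "pairing \<psi> (z + w) = pairing \<psi> z + pairing \<psi> w"
proof -
  let ?S = "Poly_Mapping.keys z \<union> Poly_Mapping.keys w"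
  have "pairing \<psi> (z + w) = (\<Sum>g\<in>?S. Poly_Mapping.lookup (z + w) g * \<psi> g)"
    by (rule pairing_superset) (auto simp: Poly_Mapping.keys_add)
  then show ?thesis
    using pairing_superset[of ?S z \<psi>] pairing_superset[of ?S w \<psi>]
    by (simp add: lookup_add algebra_simps sum.distrib)
qed

lemma pairing_scale: "pairing \<psi> (chain_scale c z) = c * pairing \<psi> z"
  using pairing_superset[OF _ keys_chain_scale, of z \<psi> c]
  by (simp add: lookup_chain_scale pairing_def sum_distrib_left mult_ac)

lemma pairing_diff: "pairing \<psi> (z - w) = pairing \<psi> z - pairing \<psi> w"
  using pairing_add[of \<psi> "z - w" w] by simp

lemma pairing_0 [simp]: "pairing \<psi> 0 = 0"
  by (simp add: pairing_def)

lemma pairing_symbol [simp]: "pairing \<psi> (symbol vs s) = \<psi> (vs, s)"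
  by (simp add: pairing_def)

lemma pairing_sum: "pairing \<psi> (sum f S) = (\<Sum>x\<in>S. pairing \<psi> (f x))"
  by (induction S rule: infinite_finite_induct) (auto simp: pairing_add)

lemma pairing_span:
  assumes "\<And>z. z \<in> S \<Longrightarrow> pairing \<psi> z = 0" "z \<in> Modules.module.span chain_scale S"
  shows "pairing \<psi> z = 0"
proof -
  interpret Modules.module chain_scale by (rule module_chain_scale)
  have "subspace {z. pairing \<psi> z = 0}" by (rule subspaceI) (auto simp: pairing_add pairing_scale)
  then have "span S \<subseteq> {z. pairing \<psi> z = 0}" using assms(1) by (intro span_minimal) auto
  then show ?thesis using assms(2) by blast
qed

lemma koszul_diff_superset:
  "finite S \<Longrightarrow> Poly_Mapping.keys z \<subseteq> S \<Longrightarrow>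
   koszul_diff X z = (\<Sum>g\<in>S. chain_scale (Poly_Mapping.lookup z g) (koszul_symbol_diff X g))"
  unfolding koszul_diff_def
  by (rule sum.mono_neutral_left) (auto simp: in_keys_iff intro!: poly_mapping_eqI simp: lookup_chain_scale)

lemma koszul_diff_diff: "koszul_diff X (z - w) = koszul_diff X z - koszul_diff X w"
proof -
  interpret Modules.module chain_scale by (rule module_chain_scale)
  let ?S = "Poly_Mapping.keys z \<union> Poly_Mapping.keys w"
  have "koszul_diff X (z - w) = (\<Sum>g\<in>?S. chain_scale (Poly_Mapping.lookup (z - w) g) (koszul_symbol_diff X g))"
    by (rule koszul_diff_superset) (auto simp: in_keys_iff lookup_minus)
  then show ?thesis
    using koszul_diff_superset[of ?S z X] koszul_diff_superset[of ?S w X]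
    by (simp add: lookup_minus scale_left_diff_distrib sum_subtractf)
qed

lemma koszul_diff_symbol: "koszul_diff X (symbol vs s) = koszul_symbol_diff X (vs, s)"
  unfolding koszul_diff_def by (simp add: chain_scale_sign[of 0, simplified])

lemma koszul_symbol_diff_asum:
  "koszul_symbol_diff X (vs, s) = - asum vs (\<lambda>v L. symbol L (v \<otimes>\<^bsub>function_field X\<^esub> s))"
  unfolding koszul_symbol_diff_def asum_nth chain_scale_sign sum_negf[symmetric]
  by (simp add: if_distrib[of uminus] cong: if_cong) (rule sum.cong, auto)

text \<open>The two orders of deleting v and w leave the same symbol by commutativity, so the square
  vanishes already on free chains. The coefficient s may be any rational function, which is
  essential for \<open>scroll_chain_cycle\<close>.\<close>

lemma koszul_diff_square:
  assumes "Ring.cring (function_field X)" "set vs \<subseteq> carrier (function_field X)" "s \<in> carrier (function_field X)"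
  shows "koszul_diff X (koszul_symbol_diff X (vs, s)) = 0"
proof -
  interpret cring "function_field X" by (rule assms(1))
  have u: "koszul_diff X (- z) = - koszul_diff X z" for z
    using koszul_diff_diff[of X 0 z] by (simp add: koszul_diff_def)
  have "koszul_diff X (koszul_symbol_diff X (vs, s))
    = asum vs (\<lambda>v L. asum L (\<lambda>w M. symbol M (w \<otimes>\<^bsub>function_field X\<^esub> (v \<otimes>\<^bsub>function_field X\<^esub> s))))"
    unfolding koszul_symbol_diff_asum u asum_hom[of "koszul_diff X", OF koszul_diff_diff] koszul_diff_symbol
    by (simp add: asum_uminus)
  also have "\<dots> = 0"
  proof (rule asum_asum_symmetric)
    fix M v w assume "v \<in> set vs" "w \<in> set vs"
    then have "v \<in> carrier (function_field X)" "w \<in> carrier (function_field X)" using assms(2) by auto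
    then show "symbol M (w \<otimes>\<^bsub>function_field X\<^esub> (v \<otimes>\<^bsub>function_field X\<^esub> s)) = symbol M (v \<otimes>\<^bsub>function_field X\<^esub> (w \<otimes>\<^bsub>function_field X\<^esub> s))"
      using m_lcomm[of w v s] assms(3) by simp
  qed
  finally show ?thesis .
qed

context plane_curve
begin

section \<open>Functionals on Koszul chains and the nonzero class\<close>

definition un :: "ratfun \<Rightarrow> complex fls" where "un A = inv_into KK gm A"

lemma un_gm: "e \<in> KK \<Longrightarrow> un (gm e) = e"
  unfolding un_def by (rule inv_into_f_f[OF inj_gm])

definition dual :: "nat \<times> nat \<Rightarrow> ratfun \<Rightarrow> complex" where
  "dual x A = un A $$ (- int (wt x))"

lemma dual_gm: "e \<in> KK \<Longrightarrow> dual x (gm e) = e $$ (- int (wt x))"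
  by (simp add: dual_def un_gm)

lemma dual_mn: "x \<in> Tn (d - 2) \<Longrightarrow> y \<in> Tn (d - 2) \<Longrightarrow> dual x (gm (mn y)) = (if x = y then 1 else 0)"
  using mn_nth[of y x] by (auto simp: dual_gm mn_KK)

lemma dual_add: "A \<in> carrier FF \<Longrightarrow> B \<in> carrier FF \<Longrightarrow> dual x (A \<oplus>\<^bsub>FF\<^esub> B) = dual x A + dual x B"
  unfolding carrier_FF by (auto simp: gm_add[symmetric] dual_gm KK_add)

lemma dual_scale: "A \<in> carrier FF \<Longrightarrow> dual x (const_fun curve c \<otimes>\<^bsub>FF\<^esub> A) = c * dual x A"
  unfolding carrier_FF gm_const[symmetric] by (auto simp: gm_mult[symmetric] dual_gm KK_mult KK_const)

text \<open>Evaluated on the boundary of \<open>v\<^sub>0 \<and> \<dots> \<and> v\<^sub>p \<otimes> 1\<close>, this is a determinant with the row \<open>r\<close> repeated.\<close>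

definition kfun :: "(nat \<times> nat) list \<Rightarrow> nat \<times> nat \<Rightarrow> ratfun list \<times> ratfun \<Rightarrow> complex" where
  "kfun R r = (\<lambda>(vs, s). detf (map dual R) vs * dual r s)"

lemma sections_carrier: "sections curve D \<subseteq> carrier FF"
  by (auto simp: sections_def)

lemma kfun_relations:
  assumes "z \<in> relations curve L p q"
  shows "pairing (kfun R r) z = 0"
proof (rule pairing_span[OF _ assms[unfolded relations_def]])
  fix z assume "z \<in> relators curve L p q"
  note sc = subsetD[OF sections_carrier]
  have up: "vs[i := v] = take i vs @ v # drop (Suc i) vs" if "i < length vs" for vs :: "ratfun list" and i v
    using that by (rule upd_conv_take_nth_drop)
  from \<open>z \<in> relators curve L p q\<close>[unfolded relators_def Un_iff mem_Collect_eq]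
  show "pairing (kfun R r) z = 0"
  proof (elim disjE exE conjE, goal_cases)
    case (1 vs s i v w)
    have "detf (map dual R) (vs[i := v \<oplus>\<^bsub>FF\<^esub> w]) = detf (map dual R) (vs[i := v]) + detf (map dual R) (vs[i := w])"
      unfolding up[OF 1(3)] by (rule detf_add) (use dual_add sc 1 in auto)
    then show ?thesis unfolding 1(1) pairing_diff pairing_symbol by (simp add: kfun_def algebra_simps)
  next
    case (2 vs s i v c)
    have "detf (map dual R) (vs[i := const_fun curve c \<otimes>\<^bsub>FF\<^esub> v]) = c * detf (map dual R) (vs[i := v])"
      unfolding up[OF 2(3)] by (rule detf_scale) (use dual_scale sc 2 in auto)
    then show ?thesis unfolding 2(1) pairing_diff pairing_scale pairing_symbol by (simp add: kfun_def algebra_simps)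
  next
    case (3 vs s s')
    then have "s \<in> carrier FF" "s' \<in> carrier FF" using sc unfolding symbols_def by auto
    then show ?thesis unfolding 3(1) pairing_diff pairing_symbol by (simp add: kfun_def dual_add algebra_simps)
  next
    case (4 vs s c)
    then have "s \<in> carrier FF" using sc unfolding symbols_def by auto
    then show ?thesis unfolding 4(1) pairing_diff pairing_scale pairing_symbol by (simp add: kfun_def dual_scale algebra_simps)
  next
    case (5 vs s i j)
    have "vs = take j vs @ vs ! j # drop (Suc j) vs" using 5(4) by (rule id_take_nth_drop)
    moreover have "take j vs = take i (take j vs) @ take j vs ! i # drop (Suc i) (take j vs)"
      using 5 by (intro id_take_nth_drop) simp
    ultimately obtain xs ys zs where "vs = xs @ vs ! j # ys @ vs ! j # zs"
      using 5 by (metis append.assoc append_Cons nth_take)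
    then have "detf (map dual R) vs = 0" using detf_repeated_entry by metis
    then show ?thesis unfolding 5(1) by (simp add: kfun_def)
  qed
qed

lemma kfun_boundary:
  assumes y: "y \<in> free_space curve LL p 0" and r: "r \<in> set R"
  shows "pairing (kfun R r) (koszul_diff curve y) = 0"
proof -
  have "pairing (kfun R r) (koszul_symbol_diff curve g) = 0" if g: "g \<in> Poly_Mapping.keys y" for g
  proof -
    obtain vs s where gs: "g = (vs, s)" by (cases g)
    have sym: "set vs \<subseteq> sections curve LL" "s \<in> sections curve (\<lambda>x. 0 * LL x)"
      using y g unfolding gs free_space_def symbols_def by auto
    have vs: "set vs \<subseteq> carrier FF" using sym(1) sections_carrier by blast
    \<comment> \<open>The sections of the trivial bundle are the constants, so s only scales the
      expansion.\<close>
    have "(\<lambda>x. 0 * LL x) = Linf (int (0 * d))" by (auto simp: Linf_def fun_eq_iff)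
    then have "s \<in> gm ` Mn 0" using sym(2) sections_Linf[of 0] d4 by simp
    then obtain c where s: "s = const_fun curve c" by (auto simp: Mn_def Tn_def mn_def gm_const)
    have "asum vs (\<lambda>v L. pairing (kfun R r) (symbol L (v \<otimes>\<^bsub>FF\<^esub> s))) = asum vs (\<lambda>v L. c * (dual r v * detf (map dual R) L))"
    proof (rule asum_cong)
      fix v L assume m: "mset vs = add_mset v (mset L)"
      have v: "v \<in> carrier FF" using mset_removed[OF m] vs by auto
      have "v \<otimes>\<^bsub>FF\<^esub> s = s \<otimes>\<^bsub>FF\<^esub> v" unfolding s
      proof -
        interpret field FF by (rule field_FF)
        show "v \<otimes>\<^bsub>FF\<^esub> const_fun curve c = const_fun curve c \<otimes>\<^bsub>FF\<^esub> v"
          using gm_carrier[OF KK_const, of c] v unfolding gm_const by (simp add: m_comm)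
      qed
      then show "pairing (kfun R r) (symbol L (v \<otimes>\<^bsub>FF\<^esub> s)) = c * (dual r v * detf (map dual R) L)"
        using v by (simp add: kfun_def s dual_scale)
    qed
    also have "\<dots> = c * detf (dual r # map dual R) vs" by (simp add: asum_cmult detf_row_expansion)
    also have "\<dots> = 0" using detf_repeated_functional[of "dual r" "map dual R"] r by simp
    finally have z: "pairing (kfun R r) (asum vs (\<lambda>v L. symbol L (v \<otimes>\<^bsub>FF\<^esub> s))) = 0"
      unfolding asum_hom[of "pairing (kfun R r)", OF pairing_diff] .
    show ?thesis unfolding gs koszul_symbol_diff_asum
      using pairing_diff[of "kfun R r" 0 "asum vs (\<lambda>v L. symbol L (v \<otimes>\<^bsub>FF\<^esub> s))"] z by simp
  qed
  then show ?thesis unfolding koszul_diff_def pairing_sum pairing_scale by simp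
qed

text \<open>With m = d - 2: deleting \<beta> and x^(m-1) y leaves x^m in the wedge with coefficient
  y \<beta>; deleting \<beta> and x^m leaves x^(m-1) y with coefficient x \<beta> and the opposite
  sign. When B consists of monomials of degree less than m, the coefficients are sections of
  L.\<close>

definition scroll_chain :: "(nat \<times> nat) list \<Rightarrow> koszul_chain" where
  "scroll_chain B = asum B (\<lambda>x L.
     symbol (gm (mn (0, d - 2)) # map (gm \<circ> mn) L) (gm (ys * mn x)) -
     symbol (gm (mn (1, d - 3)) # map (gm \<circ> mn) L) (gm (xs * mn x)))"

text \<open>The cycle is the boundary of a chain with coefficients \<open>mn x / xs\<^bsup>d-3\<^esup>\<close>, whose values are not
  regular; all terms of this boundary except those removing \<open>xs\<^bsup>d-2\<^esup>\<close> or \<open>xs\<^bsup>d-3\<^esup> ys\<close> cancel.\<close>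

lemma scroll_chain_cycle: "koszul_diff curve (scroll_chain B) = 0"
proof -
  let ?E = "gm \<circ> mn" and ?t = "\<lambda>x. mn x / xs ^ (d - 3)"
  let ?a = "gm (mn (0, d - 2))" and ?b = "gm (mn (1, d - 3))"
  have tK: "?t x \<in> KK" for x by (intro KK_divide KK_power KK_xs mn_KK)
  have s: "d - 2 = Suc (d - 3)" using d4 by simp
  have m1: "?a \<otimes>\<^bsub>FF\<^esub> gm (?t x) = gm (xs * mn x)" and m2: "?b \<otimes>\<^bsub>FF\<^esub> gm (?t x) = gm (ys * mn x)" for x
    unfolding gm_mult[OF mn_KK tK, symmetric] by (simp_all add: mn_def s case_prod_beta)
  define \<eta> where "\<eta> x L = koszul_symbol_diff curve (?a # ?b # map ?E L, gm (?t x))" for x L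
  have eta: "\<eta> x L = (symbol (?a # map ?E L) (gm (ys * mn x)) - symbol (?b # map ?E L) (gm (xs * mn x)))
    - asum L (\<lambda>y M. symbol (?a # ?b # map ?E M) (gm (mn y * ?t x)))" for x L
    unfolding \<eta>_def koszul_symbol_diff_asum asum.simps m1 m2 asum_map
    by (simp add: gm_mult[OF mn_KK tK, symmetric])
  \<comment> \<open>The terms that keep both x^(d-2) and x^(d-3) y delete two elements of B and
    carry a coefficient symmetric in them.\<close>
  have "asum B (\<lambda>x L. asum L (\<lambda>y M. symbol (?a # ?b # map ?E M) (gm (mn y * ?t x)))) = 0"
    by (rule asum_asum_symmetric) (simp add: mult.commute)
  then have "scroll_chain B = asum B \<eta>"
    unfolding scroll_chain_def eta asum_diff[of B "\<lambda>x L. _ x L - _ x L"] by simp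
  then have "koszul_diff curve (scroll_chain B) = asum B (\<lambda>x L. koszul_diff curve (\<eta> x L))"
    using asum_hom[of "koszul_diff curve", OF koszul_diff_diff] by simp
  also have "\<dots> = 0"
  proof (rule asum_eq_0)
    fix x L
    have "Ring.cring FF" using field_FF by (simp add: field_def domain_def)
    then show "koszul_diff curve (\<eta> x L) = 0" unfolding \<eta>_def
      by (rule koszul_diff_square) (auto intro!: gm_carrier mn_KK tK)
  qed
  finally show ?thesis .
qed

lemma scroll_chain_free:
  assumes B: "set B = Tn (d - 3)"
  shows "scroll_chain B \<in> free_space curve LL (int (length B)) 1"
proof -
  have sec: "sections curve LL = gm ` Mn (d - 2)" unfolding LL_def by (rule sections_Linf) (use d4 in simp)
  have E: "gm (mn x) \<in> sections curve LL" if "x \<in> Tn (d - 2)" for x unfolding sec by (intro imageI mn_Mn that)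
  have key: "symbol (gm (mn a) # map (gm \<circ> mn) L) (gm (mn z)) \<in> free_space curve LL (int (length B)) 1"
    if m: "mset B = add_mset x (mset L)" and a: "a \<in> Tn (d - 2)" "z \<in> Tn (d - 2)" for a z x L
  proof -
    have "length B = Suc (length L)" using m by (metis size_add_mset size_mset)
    moreover have "set L \<subseteq> Tn (d - 2)"
      by (rule order_trans[OF conjunct2[OF mset_removed[OF m], unfolded B]]) (auto simp: Tn_def)
    then have "set (gm (mn a) # map (gm \<circ> mn) L) \<subseteq> sections curve LL" using E a(1) by auto
    moreover have "gm (mn z) \<in> sections curve (\<lambda>x. 1 * LL x)" using E[OF a(2)] by simp
    ultimately show ?thesis unfolding free_space_def symbols_def by simp
  qed
  have diff: "a - b \<in> free_space curve LL p q" if "a \<in> free_space curve LL p q" "b \<in> free_space curve LL p q" for a b p q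
  proof -
    have "Poly_Mapping.keys (a - b) \<subseteq> Poly_Mapping.keys a \<union> Poly_Mapping.keys b"
      by (auto simp: in_keys_iff lookup_minus)
    then show ?thesis using that unfolding free_space_def by blast
  qed
  have T: "(0, d - 2) \<in> Tn (d - 2)" "(1, d - 3) \<in> Tn (d - 2)" using d4 by (auto simp: Tn_iff)
  show ?thesis unfolding scroll_chain_def
  proof (rule asum_closed)
    show "0 \<in> free_space curve LL (int (length B)) 1" by (simp add: free_space_def)
    fix x L assume m: "mset B = add_mset x (mset L)"
    have x: "x \<in> Tn (d - 3)" using mset_removed[OF m] B by auto
    obtain j i where ji: "x = (j, i)" by (cases x)
    have y: "ys * mn x = mn (Suc j, i)" "xs * mn x = mn (j, Suc i)" unfolding ji by (simp_all add: mn_def)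
    have "(Suc j, i) \<in> Tn (d - 2)" "(j, Suc i) \<in> Tn (d - 2)" using x d4 unfolding ji Tn_iff by auto
    then show "symbol (gm (mn (0, d - 2)) # map (gm \<circ> mn) L) (gm (ys * mn x)) -
        symbol (gm (mn (1, d - 3)) # map (gm \<circ> mn) L) (gm (xs * mn x)) \<in> free_space curve LL (int (length B)) 1"
      unfolding y by (intro diff key[OF m] T)
  qed (rule diff)
qed

text \<open>The rows are dual to x^(d-3) y and to the elements of C, the monomials of degree at most
  d - 3 other than 1; the last factor reads off the coefficient of x. Only the term that deletes 1
  and x^(d-2) survives, since every other term lacks the vector dual to some row.\<close>

lemma scroll_chain_pairing:
  assumes C: "distinct C" "set C = Tn (d - 3) - {(0, 0)}"
  shows "pairing (kfun ((1, d - 3) # C) (0, 1)) (scroll_chain ((0, 0) # C)) = - 1"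
proof -
  let ?R = "(1, d - 3) # C" and ?E = "gm \<circ> mn"
  let ?D = "detf (map dual ?R)"
  have T: "(0, d - 2) \<in> Tn (d - 2)" "(1, d - 3) \<in> Tn (d - 2)" "(0, 0) \<in> Tn (d - 2)" "(0, 1) \<in> Tn (d - 2)"
    using d4 by (auto simp: Tn_iff)
  have CT: "x \<in> Tn (d - 2)" "x \<noteq> (0, 0)" "x \<noteq> (1, d - 3)" "x \<noteq> (0, d - 2)" if "x \<in> set C" for x
  proof -
    obtain j i where x: "x = (j, i)" by (cases x)
    have "x \<in> Tn (d - 3) - {(0, 0)}" using that unfolding C(2) .
    then have "i + j \<le> d - 3" and "x \<noteq> (0, 0)" unfolding x by (simp_all only: Diff_iff Tn_iff singleton_iff not_False_eq_True)
    moreover have "\<not> d - 3 + 1 \<le> d - 3" "\<not> d - 2 + 0 \<le> d - 3" "d - 3 \<le> d - 2" using d4 by simp_all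
    ultimately show "x \<in> Tn (d - 2)" "x \<noteq> (0, 0)" "x \<noteq> (1, d - 3)" "x \<noteq> (0, d - 2)"
      unfolding x Tn_iff prod.inject by (linarith, blast, blast, blast)
  qed
  have da: "dual x (?E y) = (if x = y then 1 else 0)" if "x \<in> Tn (d - 2)" "y \<in> Tn (d - 2)" for x y
    using dual_mn[OF that] by simp
  have CS: "set C \<subseteq> Tn (d - 2)" "(0, 0) \<notin> set C" "(1, d - 3) \<notin> set C" using CT by blast+
  have RS: "set ?R \<subseteq> Tn (d - 2)" using CS(1) T(2) by simp
  have n1: "(1::nat, d - 3) \<noteq> (0, d - 2)" "(1::nat, d - 3) \<noteq> (0, 0)" by auto
  have van: "?D (map ?E W) = 0" if "r \<in> set ?R" "set W \<subseteq> Tn (d - 2)" "r \<notin> set W" for r W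
  proof (rule detf_vanishing_functional)
    show "dual r \<in> set (map dual ?R)" using that(1) by auto
    fix v assume "v \<in> set (map ?E W)"
    then obtain y where "v = ?E y" "y \<in> set W" by auto
    moreover have "r \<in> Tn (d - 2)" by (rule subsetD[OF RS that(1)])
    ultimately show "dual r v = 0" using da[of r y] subsetD[OF that(2)] that(3) by metis
  qed
  have D1: "?D (map ?E ?R) = 1"
  proof (rule detf_dual)
    show "distinct ?R" using C(1) CS(3) by simp
    show "dual x (?E y) = (if x = y then 1 else 0)" if "x \<in> set ?R" "y \<in> set ?R" for x y
      by (rule da[OF subsetD[OF RS that(1)] subsetD[OF RS that(2)]])
  qed
  have A: "?D (gm (mn (0, d - 2)) # map ?E L) = 0" if "set L \<subseteq> insert (0, 0) (set C)" for L
  proof -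
    have "set ((0, d - 2) # L) \<subseteq> Tn (d - 2)" using order_trans[OF that] T(1,3) CS(1) by simp
    moreover have "(1, d - 3) \<notin> set ((0, d - 2) # L)"
    proof -
      have "(1, d - 3) \<notin> insert (0, 0) (set C)" using CS(3) n1(2) by blast
      then have "(1, d - 3) \<notin> set L" using that by blast
      then show ?thesis using n1(1) by simp
    qed
    ultimately show ?thesis using van[of "(1, d - 3)" "(0, d - 2) # L"] by simp
  qed
  define F where "F x L = pairing (kfun ?R (0, 1))
    (symbol (gm (mn (0, d - 2)) # map ?E L) (gm (ys * mn x)) - symbol (gm (mn (1, d - 3)) # map ?E L) (gm (xs * mn x)))" for x L
  have F: "F x L = - (?D (map ?E ((1, d - 3) # L)) * dual (0, 1) (gm (xs * mn x)))" if "set L \<subseteq> insert (0, 0) (set C)" for x L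
    unfolding F_def pairing_diff pairing_symbol kfun_def using A[OF that] by simp
  have "pairing (kfun ?R (0, 1)) (scroll_chain ((0, 0) # C)) = asum ((0, 0) # C) F"
    unfolding scroll_chain_def F_def by (rule asum_hom) (rule pairing_diff)
  also have "\<dots> = F (0, 0) C - asum C (\<lambda>x L. F x ((0, 0) # L))" by simp
  also have "asum C (\<lambda>x L. F x ((0, 0) # L)) = 0"
  proof (rule asum_eq_0)
    fix x L assume m: "mset C = add_mset x (mset L)"
    note sub = mset_removed[OF m]
    have "x \<notin> set L"
    proof -
      have "distinct (x # L)" using C(1) m by (metis mset.simps(2) mset_eq_imp_distinct_iff)
      then show ?thesis by simp
    qed
    have "?D (map ?E ((1, d - 3) # (0, 0) # L)) = 0"
    proof (intro van)
      show "x \<in> set ?R" using sub by simp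
      show "set ((1, d - 3) # (0, 0) # L) \<subseteq> Tn (d - 2)" using order_trans[OF conjunct2[OF sub] CS(1)] T by simp
      have "x \<noteq> (0, 0)" "x \<noteq> (1, d - 3)" using sub CS(2,3) by blast+
      then show "x \<notin> set ((1, d - 3) # (0, 0) # L)" using \<open>x \<notin> set L\<close> by simp
    qed
    moreover have "set ((0, 0) # L) \<subseteq> insert (0, 0) (set C)" using sub by (simp add: subset_insertI2)
    ultimately show "F x ((0, 0) # L) = 0" using F[of "(0, 0) # L" x] by simp
  qed
  also have "F (0, 0) C = - 1"
  proof -
    have "xs * mn (0, 0) = mn (0, 1)" by (simp add: mn_def)
    then have "dual (0, 1) (gm (xs * mn (0, 0))) = 1" using dual_mn[OF T(4) T(4)] by simp
    then show ?thesis unfolding F[OF subset_insertI, of "(0, 0)"] D1 by simp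
  qed
  finally show ?thesis by simp
qed

lemma koszul_nonzero_LL: "koszul_nonzero curve LL (int (h0 curve LL) - int (d - 1)) 1"
proof -
  have f: "finite (Tn (d - 3) - {(0, 0)})" by simp
  obtain C where C: "set C = Tn (d - 3) - {(0, 0)}" "distinct C" using finite_distinct_list[OF f] by blast
  let ?B = "(0, 0) # C" and ?z = "scroll_chain ((0, 0) # C)"
  have B: "set ?B = Tn (d - 3)" using C(1) by (auto simp: Tn_def)
  have a: "d - 3 + 1 = d - 2" "d - 3 + 2 = d - 1" using d4 by arith+
  have "length ?B = card (Tn (d - 3))" using B C by (metis Diff_iff distinct.simps(2) distinct_card insertI1)
  also have "\<dots> = (d - 3 + 1) * (d - 3 + 2) div 2" by (rule card_Tn)
  finally have len: "length ?B = (d - 2) * (d - 1) div 2" by (simp only: a)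
  \<comment> \<open>The index is d (d - 1)/2 - (d - 1) = (d - 1) (d - 2)/2, which is the number of
    monomials of degree at most d - 3.\<close>
  have hp: "int (h0 curve LL) - int (d - 1) = int (length ?B)"
  proof -
    have "d - 2 + 2 = d" using d4 by arith
    then have "(d - 1) * d = (d - 1) * ((d - 2) + 2)" by (simp only:)
    then have b: "(d - 1) * d = (d - 2) * (d - 1) + 2 * (d - 1)" by (simp only: distrib_left mult.commute)
    have "(d - 1) * d div 2 = (d - 1) + (d - 2) * (d - 1) div 2" unfolding b by (rule div_mult_self2) simp
    then show ?thesis unfolding h0_LL len by (simp only: of_nat_add add_diff_cancel_left')
  qed
  have cyc: "?z \<in> koszul_cycles curve LL (int (length ?B)) 1"
  proof -
    interpret Modules.module chain_scale by (rule module_chain_scale)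
    show ?thesis unfolding koszul_cycles_def relations_def scroll_chain_cycle
      using scroll_chain_free[OF B] span_zero scroll_chain_cycle[of ?B] by simp
  qed
  have nb: "?z \<notin> koszul_boundaries curve LL (int (length ?B)) 1"
  proof
    assume "?z \<in> koszul_boundaries curve LL (int (length ?B)) 1"
    then obtain y r where yr: "?z = koszul_diff curve y + r" "y \<in> free_space curve LL (int (length ?B) + 1) 0"
      "r \<in> relations curve LL (int (length ?B)) 1"
      unfolding koszul_boundaries_def by auto
    \<comment> \<open>Boundaries are killed only if the functional r is one of the rows. The
      monomial x qualifies as a non-constant monomial of degree at most d - 3, and this is where d
      >= 4 enters.\<close>
    have "(0, 1) \<in> set ((1, d - 3) # C)" using C(1) d4 by (auto simp: Tn_iff)
    then have "pairing (kfun ((1, d - 3) # C) (0, 1)) ?z = 0"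
      unfolding yr(1) pairing_add using kfun_boundary[OF yr(2)] kfun_relations[OF yr(3)] by simp
    then show False using scroll_chain_pairing[OF C(2,1)] by simp
  qed
  have zero: "0 \<in> koszul_boundaries curve LL (int (length ?B)) 1"
  proof -
    interpret Modules.module chain_scale by (rule module_chain_scale)
    have "0 \<in> free_space curve LL (int (length ?B) + 1) (1 - 1)" by (simp add: free_space_def)
    moreover have "0 \<in> relations curve LL (int (length ?B)) 1" unfolding relations_def by (rule span_zero)
    moreover have "0 = koszul_diff curve 0 + 0" by (simp add: koszul_diff_def)
    ultimately show ?thesis unfolding koszul_boundaries_def by blast
  qed
  show ?thesis unfolding hp koszul_nonzero_def
  proof
    assume eq: "koszul_cohomology curve LL (int (length ?B)) 1 = {koszul_boundaries curve LL (int (length ?B)) 1}"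
    have "{?z + b | b. b \<in> koszul_boundaries curve LL (int (length ?B)) 1} \<in> koszul_cohomology curve LL (int (length ?B)) 1"
      unfolding koszul_cohomology_def using cyc by blast
    then have "{?z + b | b. b \<in> koszul_boundaries curve LL (int (length ?B)) 1} = koszul_boundaries curve LL (int (length ?B)) 1"
      unfolding eq by blast
    moreover have "?z + 0 \<in> {?z + b | b. b \<in> koszul_boundaries curve LL (int (length ?B)) 1}" using zero by blast
    ultimately show False using nb by simp
  qed
qed

end

theorem mainTheorem1:
  fixes k :: nat
  assumes "k \<ge> 3"
  shows "(\<exists>C L. smooth_projective_curve C \<and> gonality C = k \<and> genus C = k * (k - 1) div 2 \<and>
            divisor C L \<and> very_ample C L \<and>
            divisor_degree L = 2 * int (genus C) + int k - 1 \<and>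
            koszul_nonzero C L (int (h0 C L) - int k) 1) \<and>
         \<not> (\<forall>C L. smooth_projective_curve C \<longrightarrow> genus C \<ge> 1 \<longrightarrow> gonality C = k \<longrightarrow>
               divisor C L \<longrightarrow> globally_generated C L \<longrightarrow>
               divisor_degree L \<ge> 2 * int (genus C) + int k - 1 \<longrightarrow>
               (\<forall>i :: int. koszul_nonzero C L i 1 \<longleftrightarrow>
                  1 \<le> i \<and> i \<le> int (h0 C L) - int k - 1))"
proof -
  interpret plane_curve "k + 1" by unfold_locales (use assms in simp)
  have gon: "gonality curve = k" using gonality_curve by simp
  have gen: "genus curve = k * (k - 1) div 2" using genus_curve by (simp add: mult.commute One_nat_def)
  have "even (k * (k - 1))" by (cases "even k") auto
  then have g2: "2 * int (genus curve) = int (k * (k - 1))"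
    unfolding gen by (metis dvd_mult_div_cancel of_nat_mult of_nat_numeral)
  have deg: "divisor_degree LL = 2 * int (genus curve) + int k - 1"
  proof -
    have "(k + 1 - 2) * (k + 1) + 1 = k * (k - 1) + k" using assms by (cases k) (auto simp: algebra_simps)
    from arg_cong[OF this, of int]
    have "int ((k + 1 - 2) * (k + 1)) + 1 = int (k * (k - 1)) + int k" by (simp only: of_nat_add of_nat_1)
    then show ?thesis unfolding degree_LL g2 by (rule eq_diff_eq[THEN iffD2])
  qed
  have kos: "koszul_nonzero curve LL (int (h0 curve LL) - int k) 1" using koszul_nonzero_LL by simp
  have "6 \<le> k * (k - 1)" using assms mult_le_mono[of 3 k 2 "k - 1"] by simp
  then have pos: "genus curve \<ge> 1" unfolding gen by simp
  show ?thesis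
  proof (intro conjI notI)
    show "\<exists>C L. smooth_projective_curve C \<and> gonality C = k \<and> genus C = k * (k - 1) div 2 \<and>
            divisor C L \<and> very_ample C L \<and> divisor_degree L = 2 * int (genus C) + int k - 1 \<and>
            koszul_nonzero C L (int (h0 C L) - int k) 1"
      by (rule exI[of _ curve], rule exI[of _ LL]) (intro conjI smooth_curve gon gen divisor_LL very_ample_LL deg kos)
    assume "\<forall>C L. smooth_projective_curve C \<longrightarrow> genus C \<ge> 1 \<longrightarrow> gonality C = k \<longrightarrow>
               divisor C L \<longrightarrow> globally_generated C L \<longrightarrow>
               divisor_degree L \<ge> 2 * int (genus C) + int k - 1 \<longrightarrow>
               (\<forall>i :: int. koszul_nonzero C L i 1 \<longleftrightarrow>
                  1 \<le> i \<and> i \<le> int (h0 C L) - int k - 1)"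
    \<comment> \<open>The index h0(L) - k exceeds the last admissible one by exactly 1, so
      nonvanishing there refutes the equivalence.\<close>
    then have "koszul_nonzero curve LL (int (h0 curve LL) - int k) 1 \<longleftrightarrow>
        1 \<le> int (h0 curve LL) - int k \<and> int (h0 curve LL) - int k \<le> int (h0 curve LL) - int k - 1"
      using smooth_curve pos gon divisor_LL globally_generated_LL deg by simp
    then show False using kos by simp
  qed
qed

end
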